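(* Let $E\to M$ be a Lie algebroid with anchor $\rho:E\to TM$. Then its modular class $\mathrm{Mod}(E):=\mathrm{Mod}(\rho)\in H^1(E,d_E)$ equals the modular class $\Theta_E\in H^1(E,d_E)$ in the sense of Evens, Lu and Weinstein.
   Context: All objects are smooth. For a Lie algebroid $E\to M$ with anchor $\rho$, $d_E$ is the Lie algebroid de Rham differential on $\bigoplus_i\mathrm{Sec}(\bigwedge^iE^* )$, $H^*(E,d_E)$ its cohomology, and for $X\in\mathrm{Sec}(E)$, $\mathcal L_X=d_E\,i_X+i_X\,d_E$ on forms; on multisections of $E$, $\mathcal L_X=[X,\cdot]$ is the derivation of the wedge product extending the Lie algebroid bracket. $|\mathrm{Vol}|_E=(\bigwedge^{\mathrm{top}}E^*\setminus 0)/\mathbb Z_2$, with $\mathbb Z_2$ acting by $\mu\mapsto-\mu$ on the line bundle with zero section removed. A section $|\mu|$ is given locally by unordered pairs $\{\mu_U,-\mu_U\}$ of nowhere-vanishing local sections of $\bigwedge^{\mathrm{top}}E^*$ agreeing on overlaps; global sections always exist. Each $|\mu|$ defines $\mathrm{div}_{|\mu|}:\mathrm{Sec}(E)\to C^\infty(M)$ by $\mathcal L_X\mu=\mathrm{div}_{|\mu|}(X)\,\mu$ for local representatives $\mu$ of $|\mu|$. $\mathrm{Div}_0(E)$ is the set of all such $\mathrm{div}_{|\mu|}$. All this applies in particular to the Lie algebroid $TM$ (with identity anchor). The modular class of a Lie algebroid morphism $\kappa:E_1\to E_2$ over $\mathrm{id}_M$ is $\mathrm{Mod}(\kappa)=[\phi]\in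 H^1(E_1,d_{E_1})$, where $\phi\in\mathrm{Sec}(E_1^* )$ is determined by $\mathrm{div}_{E_2}(\kappa(X))-\mathrm{div}_{E_1}(X)=\langle X,\phi\rangle$ for all $X\in\mathrm{Sec}(E_1)$, with $\mathrm{div}_{E_i}\in\mathrm{Div}_0(E_i)$; the class does not depend on these choices. $\mathrm{Mod}(\rho)$ is this class for $\kappa=\rho:E\to TM$. The Evens–Lu–Weinstein class: the line bundle $L=\bigwedge^{\mathrm{top}}E\otimes\bigwedge^{\mathrm{top}}T^*M$ carries the representation of $E$ $$D_X(a\otimes\mu)=\mathcal L_X(a)\otimes\mu+a\otimes\mathcal L_{\rho(X)}\mu .$$ If $L$ is trivializable and $s$ is a nowhere-vanishing section, $\Theta_E=[\phi]$ where $D_Xs=\langle X,\phi\rangle s$. In general, $L\otimes L$ is trivializable and carries the induced representation; for a nowhere-vanishing section $s$ of $L\otimes L$, $\Theta_E=[\phi]$ where $D_Xs=2\langle X,\phi\rangle s$. The class does not depend on the choice of $s$. *)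

theory Defs
  imports "HOL-Analysis.Analysis" "HOL-Library.Function_Algebras"
begin

text \<open>Functions into a real vector space form a real vector space. Tangent vectors, alternating
  forms, multivectors and tensors below are all functions, so their bundles have fibres that are
  linear subspaces of such function spaces.\<close>

instantiation "fun" :: (type, real_vector) real_vector
begin

definition scaleR_fun_def: "c *\<^sub>R f = (\<lambda>x. c *\<^sub>R f x)"

instance
  by standard (auto simp: scaleR_fun_def plus_fun_def scaleR_add_right scaleR_add_left)

end

lemma scaleR_fun_apply [simp]: "(c *\<^sub>R f) x = c *\<^sub>R f x"
  by (simp add: scaleR_fun_def)

primrec Ck_on :: "nat \<Rightarrow> 'a::real_normed_vector set \<Rightarrow> ('a \<Rightarrow> 'b::real_normed_vector) \<Rightarrow> bool" where
  "Ck_on 0 W f \<longleftrightarrow> continuous_on W f"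
| "Ck_on (Suc k) W f \<longleftrightarrow> (\<forall>x\<in>W. f differentiable (at x)) \<and>
     (\<forall>v. Ck_on k W (\<lambda>x. frechet_derivative f (at x) v))"

text \<open>Smoothness on a set that need not be open: \<open>f\<close> has smooth local extensions. On an open set
  this is ordinary \<open>C\<^sup>\<infinity>\<close> smoothness.\<close>

definition smooth_on :: "'a::real_normed_vector set \<Rightarrow> ('a \<Rightarrow> 'b::real_normed_vector) \<Rightarrow> bool" where
  "smooth_on A f \<longleftrightarrow> (\<forall>x\<in>A. \<exists>W F. open W \<and> x \<in> W \<and> (\<forall>k. Ck_on k W F) \<and> (\<forall>y\<in>A \<inter> W. F y = f y))"

text \<open>The points of the manifold are the elements of a type. The model space \<open>\<real>\<^sup>n\<close> is the span
  of a list \<open>model\<close> of \<open>n\<close> distinct basis vectors of a Euclidean space; unlike the Euclidean space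
  itself, which has positive dimension, this also permits \<open>n = 0\<close>.\<close>

record ('m, 'b) manifold =
  model :: "'b list"
  charts :: "('m set \<times> ('m \<Rightarrow> 'b)) set"

definition smooth_manifold ::
  "('m::{t2_space,second_countable_topology}, 'b::euclidean_space) manifold \<Rightarrow> bool" where
  "smooth_manifold M \<longleftrightarrow>
     distinct (model M) \<and> set (model M) \<subseteq> Basis \<and>
     (\<Union>(U, \<phi>)\<in>charts M. U) = UNIV \<and>
     (\<forall>(U, \<phi>)\<in>charts M. open U \<and>
        openin (top_of_set (span (set (model M)))) (\<phi> ` U) \<and>
        (\<exists>g. homeomorphism U (\<phi> ` U) \<phi> g)) \<and>
     (\<forall>(U, \<phi>)\<in>charts M. \<forall>(V, \<psi>)\<in>charts M. smooth_on (\<phi> ` (U \<inter> V)) (\<psi> \<circ> inv_into U \<phi>))"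

definition smooth_fun ::
  "('m::topological_space, 'b::euclidean_space) manifold \<Rightarrow> 'm set \<Rightarrow> ('m \<Rightarrow> real) \<Rightarrow> bool" where
  "smooth_fun M W f \<longleftrightarrow> (\<forall>(U, \<phi>)\<in>charts M. smooth_on (\<phi> ` (U \<inter> W)) (f \<circ> inv_into U \<phi>))"

definition smooth_near ::
  "('m::topological_space, 'b::euclidean_space) manifold \<Rightarrow> 'm \<Rightarrow> ('m \<Rightarrow> real) \<Rightarrow> bool" where
  "smooth_near M x f \<longleftrightarrow> (\<exists>W. open W \<and> x \<in> W \<and> smooth_fun M W f)"

text \<open>The fibres are subspaces of one ambient vector space \<open>'v\<close> (always possible: take, for example,
  the direct sum of all fibres). A local trivialization over \<open>U\<close> is given by its local frame
  \<open>e 0, \<dots>, e (brank - 1)\<close>.\<close>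

record ('m, 'v) vbundle =
  fiber :: "'m \<Rightarrow> 'v set"
  brank :: nat
  frames :: "('m set \<times> (nat \<Rightarrow> 'm \<Rightarrow> 'v)) set"

definition smooth_section ::
  "('m::topological_space, 'b::euclidean_space) manifold \<Rightarrow> ('m, 'v::real_vector, 'z) vbundle_scheme \<Rightarrow>
   'm set \<Rightarrow> ('m \<Rightarrow> 'v) \<Rightarrow> bool" where
  "smooth_section M E W s \<longleftrightarrow> (\<forall>x\<in>W. s x \<in> fiber E x) \<and>
     (\<forall>(U, e)\<in>frames E. \<exists>c. (\<forall>i<brank E. smooth_fun M (U \<inter> W) (c i)) \<and>
        (\<forall>x\<in>U \<inter> W. s x = (\<Sum>i<brank E. c i x *\<^sub>R e i x)))"

abbreviation Sec ::
  "('m::topological_space, 'b::euclidean_space) manifold \<Rightarrow> ('m, 'v::real_vector, 'z) vbundle_scheme \<Rightarrow>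
   ('m \<Rightarrow> 'v) set" where
  "Sec M E \<equiv> {s. smooth_section M E UNIV s}"

definition vector_bundle ::
  "('m::topological_space, 'b::euclidean_space) manifold \<Rightarrow> ('m, 'v::real_vector, 'z) vbundle_scheme \<Rightarrow>
   bool" where
  "vector_bundle M E \<longleftrightarrow>
     (\<Union>(U, e)\<in>frames E. U) = UNIV \<and>
     (\<forall>(U, e)\<in>frames E. open U \<and>
        (\<forall>x\<in>U. inj_on (\<lambda>i. e i x) {..<brank E} \<and>
               independent ((\<lambda>i. e i x) ` {..<brank E}) \<and>
               span ((\<lambda>i. e i x) ` {..<brank E}) = fiber E x)) \<and>
     (\<forall>(U, e)\<in>frames E. \<forall>i<brank E. smooth_section M E U (e i))"

text \<open>Tangent vectors at \<open>x\<close> are derivations of germs at \<open>x\<close> of smooth functions; they are given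
  the value \<open>0\<close> on functions that are not smooth near \<open>x\<close>.\<close>

type_synonym 'm tvec = "('m \<Rightarrow> real) \<Rightarrow> real"

definition tangent_space ::
  "('m::topological_space, 'b::euclidean_space) manifold \<Rightarrow> 'm \<Rightarrow> 'm tvec set" where
  "tangent_space M x = {v.
     (\<forall>f. \<not> smooth_near M x f \<longrightarrow> v f = 0) \<and>
     (\<forall>f g. smooth_near M x f \<and> smooth_near M x g \<longrightarrow>
        (eventually (\<lambda>y. f y = g y) (nhds x) \<longrightarrow> v f = v g) \<and>
        v (\<lambda>y. f y + g y) = v f + v g \<and>
        v (\<lambda>y. f y * g y) = f x * v g + g x * v f) \<and>
     (\<forall>c f. smooth_near M x f \<longrightarrow> v (\<lambda>y. c * f y) = c * v f)}"

definition coord_vec ::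
  "('m::topological_space, 'b::euclidean_space) manifold \<Rightarrow> 'm set \<Rightarrow> ('m \<Rightarrow> 'b) \<Rightarrow> 'b \<Rightarrow> 'm \<Rightarrow> 'm tvec"
  where
  "coord_vec M U \<phi> b x = (\<lambda>f. if smooth_near M x f
     then deriv (\<lambda>t. f (inv_into U \<phi> (\<phi> x + t *\<^sub>R b))) 0 else 0)"

record ('m, 'v) algebroid = "('m, 'v) vbundle" +
  bracket :: "('m \<Rightarrow> 'v) \<Rightarrow> ('m \<Rightarrow> 'v) \<Rightarrow> ('m \<Rightarrow> 'v)"
  anchor :: "'m \<Rightarrow> 'v \<Rightarrow> 'm tvec"

definition tangent_algebroid ::
  "('m::topological_space, 'b::euclidean_space) manifold \<Rightarrow> ('m, 'm tvec) algebroid" where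
  "tangent_algebroid M = \<lparr>
     fiber = tangent_space M,
     brank = length (model M),
     frames = {(U, \<lambda>i. coord_vec M U \<phi> (model M ! i)) | U \<phi>. (U, \<phi>) \<in> charts M},
     bracket = (\<lambda>X Y x f. if smooth_near M x f
                  then X x (\<lambda>y. Y y f) - Y x (\<lambda>y. X y f) else 0),
     anchor = (\<lambda>x v. v) \<rparr>"

definition lie_algebroid ::
  "('m::topological_space, 'b::euclidean_space) manifold \<Rightarrow> ('m, 'v::real_vector) algebroid \<Rightarrow> bool"
  where
  "lie_algebroid M E \<longleftrightarrow>
     vector_bundle M E \<and>
     (\<forall>x. \<forall>v\<in>fiber E x. anchor E x v \<in> tangent_space M x \<and>
        (\<forall>w\<in>fiber E x. anchor E x (v + w) = anchor E x v + anchor E x w) \<and>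
        (\<forall>c. anchor E x (c *\<^sub>R v) = c *\<^sub>R anchor E x v)) \<and>
     (\<forall>X\<in>Sec M E. (\<lambda>x. anchor E x (X x)) \<in> Sec M (tangent_algebroid M)) \<and>
     (\<forall>X\<in>Sec M E. \<forall>Y\<in>Sec M E.
        bracket E X Y \<in> Sec M E \<and>
        bracket E Y X = - bracket E X Y \<and>
        (\<forall>Z\<in>Sec M E. bracket E X (Y + Z) = bracket E X Y + bracket E X Z) \<and>
        (\<forall>c. bracket E X (c *\<^sub>R Y) = c *\<^sub>R bracket E X Y) \<and>
        (\<forall>Z\<in>Sec M E. bracket E X (bracket E Y Z) =
           bracket E (bracket E X Y) Z + bracket E Y (bracket E X Z)) \<and>
        (\<forall>f. smooth_fun M UNIV f \<longrightarrow> bracket E X (\<lambda>x. f x *\<^sub>R Y x) =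
           (\<lambda>x. f x *\<^sub>R bracket E X Y x + anchor E x (X x) f *\<^sub>R Y x)) \<and>
        (\<lambda>x. anchor E x (bracket E X Y x)) =
           bracket (tangent_algebroid M) (\<lambda>x. anchor E x (X x)) (\<lambda>x. anchor E x (Y x)))"

text \<open>Elements of \<open>\<And>\<^sup>k V\<^sup>*\<close> are alternating \<open>k\<close>-linear forms on \<open>V\<close>, as functions of argument lists,
  with value \<open>0\<close> on lists of the wrong length or not in \<open>V\<close>.\<close>

definition alt_forms :: "'v::real_vector set \<Rightarrow> nat \<Rightarrow> ('v list \<Rightarrow> real) set" where
  "alt_forms V k = {\<omega>.
     (\<forall>vs. \<not> (length vs = k \<and> set vs \<subseteq> V) \<longrightarrow> \<omega> vs = 0) \<and>
     (\<forall>vs. length vs = k \<and> set vs \<subseteq> V \<longrightarrow>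
        (\<forall>i<k. \<forall>u\<in>V. (\<forall>w\<in>V. \<omega> (vs[i := u + w]) = \<omega> (vs[i := u]) + \<omega> (vs[i := w])) \<and>
                    (\<forall>c. \<omega> (vs[i := c *\<^sub>R u]) = c * \<omega> (vs[i := u]))) \<and>
        (\<forall>i<k. \<forall>j<k. i \<noteq> j \<and> vs ! i = vs ! j \<longrightarrow> \<omega> vs = 0))}"

text \<open>Smooth \<open>k\<close>-forms on \<open>E\<close> over the open set \<open>W\<close>, that is, sections of \<open>\<And>\<^sup>k E\<^sup>*\<close> over \<open>W\<close>.\<close>

definition is_form ::
  "('m::topological_space, 'b::euclidean_space) manifold \<Rightarrow> ('m, 'v::real_vector, 'z) vbundle_scheme \<Rightarrow>
   nat \<Rightarrow> 'm set \<Rightarrow> ('m \<Rightarrow> 'v list \<Rightarrow> real) \<Rightarrow> bool" where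
  "is_form M E k W \<omega> \<longleftrightarrow> (\<forall>x\<in>W. \<omega> x \<in> alt_forms (fiber E x) k) \<and>
     (\<forall>(U, e)\<in>frames E. \<forall>I. length I = k \<and> set I \<subseteq> {..<brank E} \<longrightarrow>
        smooth_fun M (U \<inter> W) (\<lambda>x. \<omega> x (map (\<lambda>i. e i x) I)))"

definition drop_nth :: "nat \<Rightarrow> 'a list \<Rightarrow> 'a list" where
  "drop_nth i xs = take i xs @ drop (Suc i) xs"

abbreviation eval_at :: "'m \<Rightarrow> ('m \<Rightarrow> 'v) list \<Rightarrow> 'v list" where
  "eval_at x Xs \<equiv> map (\<lambda>X. X x) Xs"

definition koszul ::
  "('m, 'v) algebroid \<Rightarrow> ('m \<Rightarrow> 'v list \<Rightarrow> real) \<Rightarrow> ('m \<Rightarrow> 'v) list \<Rightarrow> 'm \<Rightarrow> real" where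
  "koszul E \<omega> Xs x =
     (\<Sum>i<length Xs. (-1) ^ i * anchor E x ((Xs ! i) x) (\<lambda>y. \<omega> y (eval_at y (drop_nth i Xs)))) +
     (\<Sum>j<length Xs. \<Sum>i<j. (-1) ^ (i + j) *
        \<omega> x (eval_at x (bracket E (Xs ! i) (Xs ! j) # drop_nth i (drop_nth j Xs))))"

text \<open>\<open>(d\<omega>)\<^sub>x(v\<^sub>0, \<dots>, v\<^sub>k)\<close> is given by the Koszul formula on any global sections extending the \<open>v\<^sub>i\<close>.
  Since anchors act on germs, this applies equally to forms that are only defined near \<open>x\<close>.\<close>

definition ext_d ::
  "('m::topological_space, 'b::euclidean_space) manifold \<Rightarrow> ('m, 'v::real_vector) algebroid \<Rightarrow>
   ('m \<Rightarrow> 'v list \<Rightarrow> real) \<Rightarrow> ('m \<Rightarrow> 'v list \<Rightarrow> real)" where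
  "ext_d M E \<omega> = (\<lambda>x vs. if set vs \<subseteq> fiber E x
     then (THE c. \<exists>Xs. set Xs \<subseteq> Sec M E \<and> eval_at x Xs = vs \<and> c = koszul E \<omega> Xs x) else 0)"

definition contract :: "('m \<Rightarrow> 'v) \<Rightarrow> ('m \<Rightarrow> 'v list \<Rightarrow> real) \<Rightarrow> ('m \<Rightarrow> 'v list \<Rightarrow> real)" where
  "contract X \<omega> = (\<lambda>x vs. \<omega> x (X x # vs))"

definition lie_form ::
  "('m::topological_space, 'b::euclidean_space) manifold \<Rightarrow> ('m, 'v::real_vector) algebroid \<Rightarrow>
   ('m \<Rightarrow> 'v) \<Rightarrow> ('m \<Rightarrow> 'v list \<Rightarrow> real) \<Rightarrow> ('m \<Rightarrow> 'v list \<Rightarrow> real)" where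
  "lie_form M E X \<omega> = ext_d M E (contract X \<omega>) + contract X (ext_d M E \<omega>)"

definition closed_forms ::
  "('m::topological_space, 'b::euclidean_space) manifold \<Rightarrow> ('m, 'v::real_vector) algebroid \<Rightarrow>
   nat \<Rightarrow> ('m \<Rightarrow> 'v list \<Rightarrow> real) set" where
  "closed_forms M E k = {\<omega>. is_form M E k UNIV \<omega> \<and> ext_d M E \<omega> = 0}"

primrec exact_forms ::
  "('m::topological_space, 'b::euclidean_space) manifold \<Rightarrow> ('m, 'v::real_vector) algebroid \<Rightarrow>
   nat \<Rightarrow> ('m \<Rightarrow> 'v list \<Rightarrow> real) set" where
  "exact_forms M E 0 = {0}"
| "exact_forms M E (Suc k) = ext_d M E ` {\<eta>. is_form M E k UNIV \<eta>}"

definition cohomologous ::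
  "('m::topological_space, 'b::euclidean_space) manifold \<Rightarrow> ('m, 'v::real_vector) algebroid \<Rightarrow>
   nat \<Rightarrow> ('m \<Rightarrow> 'v list \<Rightarrow> real) rel" where
  "cohomologous M E k = {(\<alpha>, \<beta>). \<alpha> \<in> closed_forms M E k \<and> \<beta> \<in> closed_forms M E k \<and>
     \<beta> - \<alpha> \<in> exact_forms M E k}"

definition cohomology ::
  "('m::topological_space, 'b::euclidean_space) manifold \<Rightarrow> ('m, 'v::real_vector) algebroid \<Rightarrow>
   nat \<Rightarrow> ('m \<Rightarrow> 'v list \<Rightarrow> real) set set" where
  "cohomology M E k = closed_forms M E k // cohomologous M E k"

definition coh_class ::
  "('m::topological_space, 'b::euclidean_space) manifold \<Rightarrow> ('m, 'v::real_vector) algebroid \<Rightarrow>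
   nat \<Rightarrow> ('m \<Rightarrow> 'v list \<Rightarrow> real) \<Rightarrow> ('m \<Rightarrow> 'v list \<Rightarrow> real) set" where
  "coh_class M E k \<phi> = cohomologous M E k `` {\<phi>}"

text \<open>A section \<open>|\<mu>|\<close> of \<open>|Vol|\<^sub>E\<close> assigns to each point the unordered pair \<open>{\<mu> x, - \<mu> x}\<close>.\<close>

definition local_rep ::
  "('m::topological_space, 'b::euclidean_space) manifold \<Rightarrow> ('m, 'v::real_vector, 'z) vbundle_scheme \<Rightarrow>
   ('m \<Rightarrow> ('v list \<Rightarrow> real) set) \<Rightarrow> 'm set \<Rightarrow> ('m \<Rightarrow> 'v list \<Rightarrow> real) \<Rightarrow> bool" where
  "local_rep M E m U \<mu> \<longleftrightarrow> open U \<and> is_form M E (brank E) U \<mu> \<and>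
     (\<forall>x\<in>U. \<mu> x \<noteq> 0 \<and> m x = {\<mu> x, - \<mu> x})"

definition vol_section ::
  "('m::topological_space, 'b::euclidean_space) manifold \<Rightarrow> ('m, 'v::real_vector, 'z) vbundle_scheme \<Rightarrow>
   ('m \<Rightarrow> ('v list \<Rightarrow> real) set) \<Rightarrow> bool" where
  "vol_section M E m \<longleftrightarrow> (\<forall>x. \<exists>U \<mu>. x \<in> U \<and> local_rep M E m U \<mu>)"

definition divergence ::
  "('m::topological_space, 'b::euclidean_space) manifold \<Rightarrow> ('m, 'v::real_vector) algebroid \<Rightarrow>
   ('m \<Rightarrow> ('v list \<Rightarrow> real) set) \<Rightarrow> ('m \<Rightarrow> 'v) \<Rightarrow> ('m \<Rightarrow> real)" where
  "divergence M E m X = (THE f. \<forall>U \<mu>. local_rep M E m U \<mu> \<longrightarrow>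
     (\<forall>x\<in>U. lie_form M E X \<mu> x = f x *\<^sub>R \<mu> x))"

definition Div0 ::
  "('m::topological_space, 'b::euclidean_space) manifold \<Rightarrow> ('m, 'v::real_vector) algebroid \<Rightarrow>
   (('m \<Rightarrow> 'v) \<Rightarrow> ('m \<Rightarrow> real)) set" where
  "Div0 M E = divergence M E ` {m. vol_section M E m}"

definition modular_class ::
  "('m::topological_space, 'b::euclidean_space) manifold \<Rightarrow> ('m, 'v::real_vector) algebroid \<Rightarrow>
   ('m, 'w::real_vector) algebroid \<Rightarrow> ('m \<Rightarrow> 'v \<Rightarrow> 'w) \<Rightarrow> ('m \<Rightarrow> 'v list \<Rightarrow> real) set" where
  "modular_class M E1 E2 \<kappa> = (THE c. \<exists>\<delta>1\<in>Div0 M E1. \<exists>\<delta>2\<in>Div0 M E2. \<exists>\<phi>.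
     is_form M E1 1 UNIV \<phi> \<and>
     (\<forall>X\<in>Sec M E1. \<forall>x. \<delta>2 (\<lambda>y. \<kappa> y (X y)) x - \<delta>1 X x = \<phi> x [X x]) \<and>
     c = coh_class M E1 1 \<phi>)"

text \<open>\<open>v\<^sub>1 \<and> \<dots> \<and> v\<^sub>k\<close> and \<open>v \<otimes> w\<close> are the evaluation functionals on alternating \<open>k\<close>-linear forms and
  on bilinear forms of the ambient spaces. Their spans are models of the exterior power and of the
  tensor product (of the ambient spaces, hence also of subspaces).\<close>

definition wedge :: "'v::real_vector list \<Rightarrow> (('v list \<Rightarrow> real) \<Rightarrow> real)" where
  "wedge vs = (\<lambda>\<omega>. if \<omega> \<in> alt_forms UNIV (length vs) then \<omega> vs else 0)"

definition tensor :: "'v::real_vector \<Rightarrow> 'w::real_vector \<Rightarrow> (('v \<Rightarrow> 'w \<Rightarrow> real) \<Rightarrow> real)"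
    (infixr "\<otimes>\<^sub>t" 70) where
  "v \<otimes>\<^sub>t w = (\<lambda>\<beta>. if bilinear \<beta> then \<beta> v w else 0)"

definition top_multivector_bundle ::
  "('m, 'v::real_vector, 'z) vbundle_scheme \<Rightarrow> ('m, ('v list \<Rightarrow> real) \<Rightarrow> real) vbundle" where
  "top_multivector_bundle E = \<lparr>
     fiber = (\<lambda>x. span {wedge vs | vs. length vs = brank E \<and> set vs \<subseteq> fiber E x}),
     brank = 1,
     frames = {(U, \<lambda>_ x. wedge (map (\<lambda>i. e i x) [0..<brank E])) | U e. (U, e) \<in> frames E} \<rparr>"

definition top_form_bundle ::
  "('m, 'v::real_vector, 'z) vbundle_scheme \<Rightarrow> ('m, 'v list \<Rightarrow> real) vbundle" where
  "top_form_bundle E = \<lparr>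
     fiber = (\<lambda>x. alt_forms (fiber E x) (brank E)),
     brank = 1,
     frames = {(U, \<lambda>_. \<mu>) | U \<mu>. \<exists>e. (U, e) \<in> frames E \<and>
       (\<forall>x\<in>U. \<mu> x \<in> alt_forms (fiber E x) (brank E) \<and>
              \<mu> x (map (\<lambda>i. e i x) [0..<brank E]) = 1)} \<rparr>"

definition tensor_bundle ::
  "('m, 'v::real_vector, 'z) vbundle_scheme \<Rightarrow> ('m, 'w::real_vector, 'y) vbundle_scheme \<Rightarrow>
   ('m, ('v \<Rightarrow> 'w \<Rightarrow> real) \<Rightarrow> real) vbundle" where
  "tensor_bundle E F = \<lparr>
     fiber = (\<lambda>x. span {v \<otimes>\<^sub>t w | v w. v \<in> fiber E x \<and> w \<in> fiber F x}),
     brank = brank E * brank F,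
     frames = {(U \<inter> V, \<lambda>i x. e (i div brank F) x \<otimes>\<^sub>t f (i mod brank F) x) | U e V f.
       (U, e) \<in> frames E \<and> (V, f) \<in> frames F} \<rparr>"

text \<open>The Lie derivative of a section \<open>a\<close> of \<open>\<And>\<^sup>k E\<close>, defined near \<open>x\<close>: write \<open>a\<close> near \<open>x\<close> as a finite sum
  of terms \<open>f Y\<^sub>1 \<and> \<dots> \<and> Y\<^sub>k\<close> and apply the derivation that acts on functions through the anchor
  and on sections of \<open>E\<close> by the bracket.\<close>

definition lie_multi ::
  "('m::topological_space, 'b::euclidean_space) manifold \<Rightarrow> ('m, 'v::real_vector) algebroid \<Rightarrow> nat \<Rightarrow>
   ('m \<Rightarrow> 'v) \<Rightarrow> ('m \<Rightarrow> ('v list \<Rightarrow> real) \<Rightarrow> real) \<Rightarrow> ('m \<Rightarrow> ('v list \<Rightarrow> real) \<Rightarrow> real)" where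
  "lie_multi M E k X a x = (THE w. \<exists>V T. open V \<and> x \<in> V \<and>
     (\<forall>(f, Ys)\<in>set T. smooth_fun M V f \<and> length Ys = k \<and> set Ys \<subseteq> Sec M E) \<and>
     (\<forall>y\<in>V. a y = (\<Sum>(f, Ys)\<leftarrow>T. f y *\<^sub>R wedge (eval_at y Ys))) \<and>
     w = (\<Sum>(f, Ys)\<leftarrow>T. anchor E x (X x) f *\<^sub>R wedge (eval_at x Ys) +
            f x *\<^sub>R (\<Sum>i<k. wedge (eval_at x (Ys[i := bracket E X (Ys ! i)])))))"

type_synonym ('m, 'v) elw_fib =
  "((('v list \<Rightarrow> real) \<Rightarrow> real) \<Rightarrow> ('m tvec list \<Rightarrow> real) \<Rightarrow> real) \<Rightarrow> real"

type_synonym ('m, 'v) elw_fib2 = "(('m, 'v) elw_fib \<Rightarrow> ('m, 'v) elw_fib \<Rightarrow> real) \<Rightarrow> real"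

definition elw_bundle ::
  "('m::topological_space, 'b::euclidean_space) manifold \<Rightarrow> ('m, 'v::real_vector) algebroid \<Rightarrow>
   ('m, ('m, 'v) elw_fib) vbundle" where
  "elw_bundle M E =
     tensor_bundle (top_multivector_bundle E) (top_form_bundle (tangent_algebroid M))"

text \<open>Sections of a tensor product of line bundles are locally of the form \<open>a \<otimes> \<mu>\<close>, so the following
  two formulas determine the representations on \<open>L = elw_bundle M E\<close> and on \<open>L \<otimes> L\<close>.\<close>

definition elw_rep ::
  "('m::topological_space, 'b::euclidean_space) manifold \<Rightarrow> ('m, 'v::real_vector) algebroid \<Rightarrow>
   ('m \<Rightarrow> 'v) \<Rightarrow> ('m \<Rightarrow> ('m, 'v) elw_fib) \<Rightarrow> ('m \<Rightarrow> ('m, 'v) elw_fib)" where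
  "elw_rep M E X s x = (THE w. \<exists>V a \<mu>. open V \<and> x \<in> V \<and>
     smooth_section M (top_multivector_bundle E) V a \<and>
     smooth_section M (top_form_bundle (tangent_algebroid M)) V \<mu> \<and>
     (\<forall>y\<in>V. s y = a y \<otimes>\<^sub>t \<mu> y) \<and>
     w = lie_multi M E (brank E) X a x \<otimes>\<^sub>t \<mu> x +
         a x \<otimes>\<^sub>t lie_form M (tangent_algebroid M) (\<lambda>y. anchor E y (X y)) \<mu> x)"

definition elw_rep2 ::
  "('m::topological_space, 'b::euclidean_space) manifold \<Rightarrow> ('m, 'v::real_vector) algebroid \<Rightarrow>
   ('m \<Rightarrow> 'v) \<Rightarrow> ('m \<Rightarrow> ('m, 'v) elw_fib2) \<Rightarrow> ('m \<Rightarrow> ('m, 'v) elw_fib2)" where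
  "elw_rep2 M E X s x = (THE w. \<exists>V t u. open V \<and> x \<in> V \<and>
     smooth_section M (elw_bundle M E) V t \<and> smooth_section M (elw_bundle M E) V u \<and>
     (\<forall>y\<in>V. s y = t y \<otimes>\<^sub>t u y) \<and>
     w = elw_rep M E X t x \<otimes>\<^sub>t u x + t x \<otimes>\<^sub>t elw_rep M E X u x)"

text \<open>\<open>L\<close> is \<open>elw_bundle M E\<close>. All nowhere-vanishing sections of \<open>L\<close> (if there are any) and of \<open>L \<otimes> L\<close>
  yield the same class.\<close>

definition elw_class ::
  "('m::topological_space, 'b::euclidean_space) manifold \<Rightarrow> ('m, 'v::real_vector) algebroid \<Rightarrow>
   ('m \<Rightarrow> 'v list \<Rightarrow> real) set" where
  "elw_class M E = (THE c. \<exists>\<phi>. is_form M E 1 UNIV \<phi> \<and> c = coh_class M E 1 \<phi> \<and>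
     ((\<exists>s\<in>Sec M (elw_bundle M E). (\<forall>x. s x \<noteq> 0) \<and>
         (\<forall>X\<in>Sec M E. \<forall>x. elw_rep M E X s x = \<phi> x [X x] *\<^sub>R s x)) \<or>
      (\<exists>s\<in>Sec M (tensor_bundle (elw_bundle M E) (elw_bundle M E)). (\<forall>x. s x \<noteq> 0) \<and>
         (\<forall>X\<in>Sec M E. \<forall>x. elw_rep2 M E X s x = (2 * \<phi> x [X x]) *\<^sub>R s x))))"

end

theory Submission
  imports Defs "HOL-Computational_Algebra.Polynomial" "HOL-Combinatorics.Permutations"
begin

text \<open>Fix sections of \<open>|Vol|\<close> of \<open>E\<close> and of \<open>TM\<close>, with local representatives \<open>\<mu>\<close> and \<open>\<nu>\<close>. Lie derivatives
  are compatible with the pairing of top multivectors and top forms. Hence the local generator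
  \<open>\<sigma> = \<mu>' \<otimes> \<nu>\<close> of the Evens--Lu--Weinstein line bundle \<open>L\<close>, where \<open>\<mu>'\<close> is dual to \<open>\<mu>\<close>, satisfies
  \<open>D X \<sigma> = (div \<nu> (\<rho> X) - div \<mu> X) \<sigma>\<close>, and the coefficient is the 1-form representing the modular class
  of the anchor. It is tensorial since \<open>div (f X) = f div X + \<rho> X f\<close> for both divergences, and closed
  since \<open>div [X, Y] = \<rho> X (div Y) - \<rho> Y (div X)\<close>. Signs of \<open>\<mu>\<close> and \<open>\<nu>\<close> do not affect \<open>\<sigma> \<otimes> \<sigma>\<close>, which is
  therefore a global section of \<open>L \<otimes> L\<close> producing this very 1-form. Any other admissible choice (of the
  two densities, of a section of \<open>L\<close>, or of a section of \<open>L \<otimes> L\<close>) differs by local nowhere vanishing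
  functions that are unique up to sign; the logarithm of their absolute value (or half of it) is a
  global function whose differential is the difference of the two 1-forms.\<close>

section \<open>Smooth functions on open subsets of a Euclidean space\<close>

text \<open>Most notions involved are descriptions (\<open>THE\<close>) over local data: a
  divergence quantifies over local representatives, the differential over global extensions of
  vectors, \<open>lie_multi\<close> over local decompositions and \<open>elw_rep\<close> over local
  factorizations. Nothing can be computed before each description is shown to be independent of its
  choices, and this shapes the proof. Everything is therefore stated for germs, by
  \<open>smooth_near\<close>, \<open>sec_near\<close>, \<open>form_near\<close> and
  \<open>vol_near\<close> at a point, and tested in a single chart or frame. Brackets, on the other
  hand, are controlled for global sections only, so local frames have to be extended by bump
  functions; the same functions show that additive operators that are linear over functions depend
  on values at a point only. Tangent vectors are abstract derivations; Hadamard's lemma makes them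
  combinations of coordinate vectors, so that the tangent bundle is a Lie algebroid and the theory
  of divergences applies to it as well as to \<open>E\<close>.\<close>

definition Cinf :: "'a::real_normed_vector set \<Rightarrow> ('a \<Rightarrow> 'b::real_normed_vector) \<Rightarrow> bool" where
  "Cinf W f \<longleftrightarrow> open W \<and> (\<forall>k. Ck_on k W f)"

text \<open>\<open>frechet_derivative\<close> at a point sees a full neighbourhood, so on an open
  set agreement of two functions passes to their directional derivatives, to which the induction
  hypothesis applies.\<close>

lemma Ck_on_cong:
  assumes "open W" "\<And>x. x \<in> W \<Longrightarrow> f x = g x" "Ck_on k W f"
  shows "Ck_on k W g"
  using assms(2,3)
proof (induction k arbitrary: f g)
  case 0
  then show ?case using continuous_on_cong by (metis Ck_on.simps(1))
next
  case (Suc k)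
  have d: "f differentiable at x" if "x \<in> W" for x
    using Suc.prems that by simp
  have g: "g differentiable at x \<and> frechet_derivative f (at x) = frechet_derivative g (at x)"
    if "x \<in> W" for x
    using d[OF that] assms(1) that Suc.prems(1)
    by (metis differentiable_def has_derivative_transform_within_open
        frechet_derivative_transform_within_open)
  have "Ck_on k W (\<lambda>x. frechet_derivative g (at x) v)" for v
    by (rule Suc.IH[of "\<lambda>x. frechet_derivative f (at x) v"]) (use g Suc.prems in auto)
  then show ?case using g by auto
qed

lemma Ck_on_mono: "Ck_on k W f \<Longrightarrow> V \<subseteq> W \<Longrightarrow> Ck_on k V f"
  by (induction k arbitrary: f) (auto intro: continuous_on_subset)

lemma Cinf_subset: "Cinf W f \<Longrightarrow> V \<subseteq> W \<Longrightarrow> open V \<Longrightarrow> Cinf V f"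
  unfolding Cinf_def using Ck_on_mono by blast

text \<open>Smoothness as a greatest fixed point: any class of functions differentiable on
  \<open>W\<close> and stable under directional derivatives consists of smooth functions. Closure
  proofs then reduce to one differentiation within a suitable class, without induction on the
  order.\<close>

lemma Cinf_coinduct:
  assumes W: "open W" and "P f"
    and step: "\<And>f. P f \<Longrightarrow> \<exists>D. (\<forall>x\<in>W. (f has_derivative D x) (at x)) \<and> (\<forall>v. P (\<lambda>x. D x v))"
  shows "Cinf W f"
proof -
  have "Ck_on k W f" for k
    using \<open>P f\<close>
  proof (induction k arbitrary: f)
    case 0
    then show ?case
      using step by (metis Ck_on.simps(1) continuous_at_imp_continuous_on has_derivative_continuous)
  next
    case (Suc k)
    obtain D where D: "\<And>x. x \<in> W \<Longrightarrow> (f has_derivative D x) (at x)" "\<And>v. P (\<lambda>x. D x v)"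
      using step[OF Suc.prems] by blast
    have "Ck_on k W (\<lambda>x. frechet_derivative f (at x) v)" for v
      by (rule Ck_on_cong[OF W _ Suc.IH[OF D(2)[of v]]]) (metis D(1) frechet_derivative_at)
    then show ?case using D(1) by (auto simp: differentiable_def)
  qed
  then show ?thesis using W by (simp add: Cinf_def)
qed

lemma Cinf_has_derivative:
  "Cinf W f \<Longrightarrow> x \<in> W \<Longrightarrow> (f has_derivative frechet_derivative f (at x)) (at x)"
  unfolding Cinf_def using frechet_derivative_works by (metis Ck_on.simps(2))

lemma Cinf_derivative: "Cinf W f \<Longrightarrow> Cinf W (\<lambda>x. frechet_derivative f (at x) v)"
  unfolding Cinf_def by (metis Ck_on.simps(2))

lemma Cinf_open: "Cinf W f \<Longrightarrow> open W"
  by (simp add: Cinf_def)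

lemma Cinf_continuous: "Cinf W f \<Longrightarrow> continuous_on W f"
  unfolding Cinf_def by (metis Ck_on.simps(1))

lemma Cinf_affine:
  assumes "open W" "bounded_linear f"
  shows "Cinf W (\<lambda>x. f x + c)"
proof (rule Cinf_coinduct[where P = "\<lambda>h. \<exists>f c. bounded_linear f \<and> h = (\<lambda>x. f x + c)"])
  fix h :: "'a \<Rightarrow> 'b"
  assume "\<exists>f c. bounded_linear f \<and> h = (\<lambda>x. f x + c)"
  then obtain f c where f: "bounded_linear f" "h = (\<lambda>x. f x + c)" by blast
  have "\<exists>g d. bounded_linear g \<and> (\<lambda>x::'a. f v) = (\<lambda>x. g x + d)" for v
    by (rule exI[of _ "\<lambda>x. 0"]) auto
  then show "\<exists>D. (\<forall>x\<in>W. (h has_derivative D x) (at x)) \<and>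
      (\<forall>v. \<exists>f c. bounded_linear f \<and> (\<lambda>x. D x v) = (\<lambda>x. f x + c))"
    using f bounded_linear_imp_has_derivative[OF f(1)]
    by (intro exI[of _ "\<lambda>x. f"] conjI allI ballI) (simp_all add: has_derivative_add_const)
next
  show "\<exists>g d. bounded_linear g \<and> (\<lambda>x. f x + c) = (\<lambda>x. g x + d)"
    using assms(2) by blast
qed (rule assms(1))

lemma Cinf_const: "open W \<Longrightarrow> Cinf W (\<lambda>x. c)"
  using Cinf_affine[of W "\<lambda>x. 0" c] by simp

lemma Cinf_inner: "open W \<Longrightarrow> Cinf W (\<lambda>x. x \<bullet> b)"
  using Cinf_affine[of W "\<lambda>x. x \<bullet> b" 0] by (simp add: bounded_linear_inner_left)

lemma Cinf_component:
  assumes "Cinf W g"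
  shows "Cinf W (\<lambda>x. g x \<bullet> b)"
proof (rule Cinf_coinduct[where P = "\<lambda>h. \<exists>g. Cinf W g \<and> h = (\<lambda>x. g x \<bullet> b)"])
  fix h assume "\<exists>g. Cinf W g \<and> h = (\<lambda>x. g x \<bullet> b)"
  then obtain g where g: "Cinf W g" "h = (\<lambda>x. g x \<bullet> b)" by blast
  then show "\<exists>D. (\<forall>x\<in>W. (h has_derivative D x) (at x)) \<and>
      (\<forall>v. \<exists>g. Cinf W g \<and> (\<lambda>x. D x v) = (\<lambda>x. g x \<bullet> b))"
    using Cinf_derivative[OF g(1)] has_derivative_inner_left[OF Cinf_has_derivative[OF g(1)], of _ b]
    by (intro exI[of _ "\<lambda>x v. frechet_derivative g (at x) v \<bullet> b"]) blast
next
  show "\<exists>g'. Cinf W g' \<and> (\<lambda>x. g x \<bullet> b) = (\<lambda>x. g' x \<bullet> b)"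
    using assms by blast
qed (rule Cinf_open[OF assms])

lemma linear_sum_Basis:
  fixes f :: "'a::euclidean_space \<Rightarrow> real"
  assumes "linear f"
  shows "f v = (\<Sum>b\<in>Basis. (v \<bullet> b) * f b)"
proof -
  have "f v = f (\<Sum>b\<in>Basis. (v \<bullet> b) *\<^sub>R b)" by (simp add: euclidean_representation)
  also have "\<dots> = (\<Sum>b\<in>Basis. (v \<bullet> b) * f b)"
    by (simp only: linear_sum[OF assms] linear_scale[OF assms] real_scaleR_def)
  finally show ?thesis .
qed

text \<open>This class of functions is closed under directional derivatives, so coinduction yields the
  closure of smooth functions under sums, products and composition simultaneously.\<close>

inductive smooth_closure ::
  "'a::real_normed_vector set \<Rightarrow> 'c::real_normed_vector set \<Rightarrow> ('a \<Rightarrow> 'c) \<Rightarrow> ('a \<Rightarrow> real) \<Rightarrow> bool"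
  for W N g where
  base: "Cinf W f \<Longrightarrow> smooth_closure W N g f"
| comp: "Cinf N f \<Longrightarrow> smooth_closure W N g (\<lambda>x. f (g x))"
| add: "smooth_closure W N g f1 \<Longrightarrow> smooth_closure W N g f2 \<Longrightarrow>
    smooth_closure W N g (\<lambda>x. f1 x + f2 x)"
| mult: "smooth_closure W N g f1 \<Longrightarrow> smooth_closure W N g f2 \<Longrightarrow>
    smooth_closure W N g (\<lambda>x. f1 x * f2 x)"

lemma smooth_closure_sum:
  assumes "finite S" "open W" "\<And>b. b \<in> S \<Longrightarrow> smooth_closure W N g (F b)"
  shows "smooth_closure W N g (\<lambda>x. \<Sum>b\<in>S. F b x)"
  using assms(1,3)
proof (induction S rule: finite_induct)
  case empty
  then show ?case using Cinf_const[OF assms(2), of 0] smooth_closure.base by auto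
next
  case (insert b S)
  then show ?case using smooth_closure.add[of W N g "F b"] by auto
qed

text \<open>By the chain rule the derivative of \<open>f (g x)\<close> in direction \<open>v\<close>
  is a sum over \<open>Basis\<close> of components of the derivative of \<open>g\<close> times
  partial derivatives of \<open>f\<close> at \<open>g x\<close>. This finite sum of products stays
  in the closure; the expansion uses that the target of \<open>g\<close> is Euclidean.\<close>

lemma smooth_closure_imp_Cinf:
  fixes g :: "'a::real_normed_vector \<Rightarrow> 'c::euclidean_space"
  assumes g: "Cinf W g" and gN: "g ` W \<subseteq> N" and f: "smooth_closure W N g f"
  shows "Cinf W f"
proof (rule Cinf_coinduct[where P = "smooth_closure W N g"])
  have W: "open W" using g by (rule Cinf_open)
  show "open W" by fact
  show "smooth_closure W N g f" by fact
  fix f assume "smooth_closure W N g f"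
  then show "\<exists>D. (\<forall>x\<in>W. (f has_derivative D x) (at x)) \<and> (\<forall>v. smooth_closure W N g (\<lambda>x. D x v))"
  proof induction
    case (base f)
    then show ?case
      by (intro exI[of _ "\<lambda>x. frechet_derivative f (at x)"] conjI ballI allI smooth_closure.base
          Cinf_has_derivative[OF base] Cinf_derivative[OF base])
  next
    case (comp f)
    let ?D = "\<lambda>x v. frechet_derivative f (at (g x)) (frechet_derivative g (at x) v)"
    have "((\<lambda>x. f (g x)) has_derivative ?D x) (at x)" if "x \<in> W" for x
    proof -
      have "((f \<circ> g) has_derivative frechet_derivative f (at (g x)) \<circ> frechet_derivative g (at x)) (at x)"
        using that gN comp g by (intro diff_chain_at Cinf_has_derivative) auto
      then show ?thesis by (simp add: o_def)
    qed
    moreover have "smooth_closure W N g (\<lambda>x. \<Sum>b\<in>Basis. (frechet_derivative g (at x) v \<bullet> b) *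
        frechet_derivative f (at (g x)) b)" for v
      by (intro smooth_closure_sum smooth_closure.mult W smooth_closure.base
          smooth_closure.comp[of N "\<lambda>y. frechet_derivative f (at y) _"]
          Cinf_component Cinf_derivative g comp) simp
    moreover have "?D x v = (\<Sum>b\<in>Basis. (frechet_derivative g (at x) v \<bullet> b) *
        frechet_derivative f (at (g x)) b)" if "x \<in> W" for x v
    proof -
      have "linear (frechet_derivative f (at (g x)))"
        using Cinf_has_derivative[OF comp] gN that
        by (metis has_derivative_linear image_subset_iff)
      then show ?thesis by (rule linear_sum_Basis)
    qed
    ultimately show ?case
      by (intro exI[of _ "\<lambda>x v. \<Sum>b\<in>Basis. (frechet_derivative g (at x) v \<bullet> b) *
        frechet_derivative f (at (g x)) b"]) simp
  next
    case (add f1 f2)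
    then obtain D1 D2 where "\<forall>x\<in>W. (f1 has_derivative D1 x) (at x)"
      "\<forall>v. smooth_closure W N g (\<lambda>x. D1 x v)" "\<forall>x\<in>W. (f2 has_derivative D2 x) (at x)"
      "\<forall>v. smooth_closure W N g (\<lambda>x. D2 x v)" by blast
    then show ?case
      by (intro exI[of _ "\<lambda>x v. D1 x v + D2 x v"] conjI allI)
        (use has_derivative_add in blast, intro smooth_closure.add, auto)
  next
    case (mult f1 f2)
    then obtain D1 D2 where "\<forall>x\<in>W. (f1 has_derivative D1 x) (at x)"
      "\<forall>v. smooth_closure W N g (\<lambda>x. D1 x v)" "\<forall>x\<in>W. (f2 has_derivative D2 x) (at x)"
      "\<forall>v. smooth_closure W N g (\<lambda>x. D2 x v)" by blast
    then show ?case using mult.hyps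
      by (intro exI[of _ "\<lambda>x v. f1 x * D2 x v + D1 x v * f2 x"] conjI allI)
        (use has_derivative_mult in blast, intro smooth_closure.add smooth_closure.mult, auto)
  qed
qed

lemma Cinf_compose:
  fixes g :: "'a::real_normed_vector \<Rightarrow> 'c::euclidean_space" and f :: "'c \<Rightarrow> real"
  assumes "Cinf N f" "Cinf W g" "g ` W \<subseteq> N"
  shows "Cinf W (\<lambda>x. f (g x))"
  using smooth_closure_imp_Cinf[OF assms(2,3)] smooth_closure.comp[OF assms(1)] by blast

text \<open>Sums and products come from the closure for any smooth inner map; \<open>f\<close>
  itself serves as one.\<close>

lemma Cinf_add:
  fixes f g :: "'a::real_normed_vector \<Rightarrow> real"
  assumes "Cinf W f" "Cinf W g"
  shows "Cinf W (\<lambda>x. f x + g x)"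
  by (rule smooth_closure_imp_Cinf[where g = f and N = UNIV])
    (use assms in \<open>auto intro: smooth_closure.add smooth_closure.base\<close>)

lemma Cinf_mult:
  fixes f g :: "'a::real_normed_vector \<Rightarrow> real"
  assumes "Cinf W f" "Cinf W g"
  shows "Cinf W (\<lambda>x. f x * g x)"
  by (rule smooth_closure_imp_Cinf[where g = f and N = UNIV])
    (use assms in \<open>auto intro: smooth_closure.mult smooth_closure.base\<close>)

text \<open>On the line a directional derivative is \<open>v\<close> times the ordinary one, which
  is why the invariant passed to \<open>Cinf_coinduct\<close> consists of all scalar multiples of
  members of \<open>P\<close>.\<close>

lemma Cinf_real_coinduct:
  fixes f :: "real \<Rightarrow> real"
  assumes W: "open W" and f: "P f"
    and step: "\<And>f. P f \<Longrightarrow> \<exists>f'. (\<forall>x\<in>W. (f has_real_derivative f' x) (at x)) \<and> P f'"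
  shows "Cinf W f"
proof (rule Cinf_coinduct[where P = "\<lambda>h. \<exists>c f. P f \<and> h = (\<lambda>x. c * f x)"])
  show "\<exists>c g. P g \<and> f = (\<lambda>x. c * g x)"
    using f by (intro exI[of _ 1] exI[of _ f]) auto
  fix h assume "\<exists>c f. P f \<and> h = (\<lambda>x. c * f x)"
  then obtain c f where h: "P f" "h = (\<lambda>x. c * f x)" by blast
  then obtain f' where f': "\<And>x. x \<in> W \<Longrightarrow> (f has_real_derivative f' x) (at x)" "P f'"
    using step by blast
  have "(h has_derivative (\<lambda>v. v * c * f' x)) (at x)" if "x \<in> W" for x
    using has_derivative_mult_right[OF f'(1)[OF that, unfolded has_field_derivative_def], of c] h(2)
    by (simp add: mult_ac)
  then show "\<exists>D. (\<forall>x\<in>W. (h has_derivative D x) (at x)) \<and>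
      (\<forall>v. \<exists>c f. P f \<and> (\<lambda>x. D x v) = (\<lambda>x. c * f x))"
    using f'(2) by (intro exI[of _ "\<lambda>x v. v * c * f' x"] conjI allI exI[of _ "_ * c"] exI[of _ f']) auto
qed fact

text \<open>The multiples of powers of \<open>inverse\<close> form a class stable under
  differentiation.\<close>

lemma Cinf_inverse: "Cinf (- {0}) (inverse :: real \<Rightarrow> real)"
proof (rule Cinf_real_coinduct[where P = "\<lambda>h. \<exists>c n. h = (\<lambda>x. c * inverse x ^ n)"])
  fix h assume "\<exists>c n. h = (\<lambda>x::real. c * inverse x ^ n)"
  then obtain c n where h: "h = (\<lambda>x::real. c * inverse x ^ n)" by blast
  have "(h has_real_derivative (- (c * real n)) * inverse x ^ (n + 1)) (at x)" if "x \<noteq> 0" for x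
  proof (cases n)
    case 0
    then show ?thesis by (simp add: h)
  next
    case (Suc k)
    show ?thesis
      using DERIV_cmult[OF DERIV_power[OF DERIV_inverse[OF that], of n], of c] Suc
      by (simp add: h numeral_2_eq_2 mult_ac)
  qed
  then show "\<exists>h'. (\<forall>x\<in>-{0}. (h has_real_derivative h' x) (at x)) \<and>
      (\<exists>c n. h' = (\<lambda>x. c * inverse x ^ n))"
    by (intro exI[of _ "\<lambda>x. (- (c * real n)) * inverse x ^ (n + 1)"] conjI ballI
        exI[of _ "- (c * real n)"] exI[of _ "n + 1"] refl) simp
qed (auto intro!: exI[of _ 1])

text \<open>One differentiation leads from \<open>ln\<close> to \<open>inverse\<close>; the second
  disjunct of the invariant holds everything that is already known to be smooth.\<close>

lemma Cinf_ln: "Cinf {0<..} (ln :: real \<Rightarrow> real)"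
proof (rule Cinf_real_coinduct[where P = "\<lambda>h. h = ln \<or> Cinf (- {0}) h"])
  fix h :: "real \<Rightarrow> real" assume "h = ln \<or> Cinf (- {0}) h"
  then show "\<exists>h'. (\<forall>x\<in>{0<..}. (h has_real_derivative h' x) (at x)) \<and> (h' = ln \<or> Cinf (- {0}) h')"
  proof
    assume "h = ln"
    then show ?thesis
      using Cinf_inverse DERIV_ln by (metis greaterThan_iff)
  next
    assume h: "Cinf (- {0}) h"
    show ?thesis
    proof (intro exI[of _ "\<lambda>x. frechet_derivative h (at x) 1"] conjI ballI disjI2)
      fix x :: real assume "x \<in> {0<..}"
      then have D: "(h has_derivative frechet_derivative h (at x)) (at x)"
        using Cinf_has_derivative[OF h] by auto
      have "frechet_derivative h (at x) v = frechet_derivative h (at x) 1 * v" for v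
        using linear_scale[OF has_derivative_linear[OF D], of v 1] by simp
      then show "(h has_real_derivative frechet_derivative h (at x) 1) (at x)"
        using D by (metis (no_types, lifting) ext has_field_derivative_def)
    qed (rule Cinf_derivative[OF h])
  qed
qed simp_all

section \<open>A smooth cutoff on the real line\<close>

definition flat_fun :: "real poly \<Rightarrow> real \<Rightarrow> real" where
  "flat_fun p t = (if t > 0 then poly p (inverse t) * exp (- inverse t) else 0)"

text \<open>Substituting \<open>x = inverse t\<close> turns the limit into the domination of powers
  by \<open>exp\<close> at infinity.\<close>

lemma flat_fun_tendsto: "(flat_fun p \<longlongrightarrow> 0) (at_right 0)"
proof -
  have "((\<lambda>x. \<Sum>i\<le>degree p. coeff p i * (x ^ i / exp x)) \<longlongrightarrow> (\<Sum>i\<le>degree p. coeff p i * 0)) at_top"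
    by (intro tendsto_sum tendsto_mult tendsto_const tendsto_power_div_exp_0)
  then have "((\<lambda>x. poly p x * exp (- x)) \<longlongrightarrow> 0) at_top"
    by (simp add: poly_altdef sum_distrib_right exp_minus divide_inverse mult.assoc)
  then have "((\<lambda>t. poly p (inverse t) * exp (- inverse t)) \<longlongrightarrow> 0) (at_right (0::real))"
    by (rule filterlim_compose[OF _ filterlim_inverse_at_top_right])
  then show ?thesis
    by (rule Lim_transform_eventually) (auto simp: eventually_at_filter flat_fun_def)
qed

text \<open>With \<open>x = inverse t\<close> the derivative of p(x) exp(-x) in t is x^2 (p(x) -
  p'(x)) exp(-x), and \<open>[:0, 0, 1:]\<close> is the polynomial x^2. The family indexed by
  polynomials thus reproduces itself under differentiation.\<close>

lemma flat_fun_derivative: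
  "(flat_fun p has_real_derivative flat_fun ([:0, 0, 1:] * (p - pderiv p)) t) (at t)"
proof -
  consider "t > 0" | "t < 0" | "t = 0" by linarith
  then show ?thesis
  proof cases
    case 1
    have "((\<lambda>t. poly p (inverse t) * exp (- inverse t)) has_real_derivative
        flat_fun ([:0, 0, 1:] * (p - pderiv p)) t) (at t)"
      using 1 unfolding flat_fun_def
      by (auto intro!: derivative_eq_intros simp: field_simps)
    then show ?thesis
      by (rule has_field_derivative_transform_within_open[where S = "{0<..}"])
        (use 1 in \<open>auto simp: flat_fun_def\<close>)
  next
    case 2
    have "((\<lambda>t. 0) has_real_derivative flat_fun ([:0, 0, 1:] * (p - pderiv p)) t) (at t)"
      using 2 by (simp add: flat_fun_def)
    then show ?thesis
      by (rule has_field_derivative_transform_within_open[where S = "{..<0}"])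
        (use 2 in \<open>auto simp: flat_fun_def\<close>)
  next
    case 3
    have "((\<lambda>h. (flat_fun p (0 + h) - flat_fun p 0) / h) \<longlongrightarrow> 0) (at 0)"
      unfolding at_eq_sup_left_right
    proof (rule filterlim_sup)
      show "((\<lambda>h. (flat_fun p (0 + h) - flat_fun p 0) / h) \<longlongrightarrow> 0) (at_left 0)"
        by (rule tendsto_eventually) (auto simp: eventually_at_filter flat_fun_def)
      \<comment> \<open>Dividing by \<open>h\<close> multiplies by \<open>inverse h\<close>, so the
        quotient is the member of the family for the polynomial x p(x), written
        \<open>pCons 0 p\<close>.\<close>
      show "((\<lambda>h. (flat_fun p (0 + h) - flat_fun p 0) / h) \<longlongrightarrow> 0) (at_right 0)"
        by (rule Lim_transform_eventually[OF flat_fun_tendsto[of "pCons 0 p"]])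
          (auto simp: eventually_at_filter flat_fun_def field_simps)
    qed
    then show ?thesis
      using 3 by (simp add: DERIV_def flat_fun_def)
  qed
qed

lemma Cinf_flat_fun: "Cinf UNIV (flat_fun p)"
proof (rule Cinf_real_coinduct[where P = "\<lambda>h. \<exists>p. h = flat_fun p"])
  fix h assume "\<exists>p. h = flat_fun p"
  then obtain p where h: "h = flat_fun p" ..
  show "\<exists>h'. (\<forall>t\<in>UNIV. (h has_real_derivative h' t) (at t)) \<and> (\<exists>p. h' = flat_fun p)"
    unfolding h
    by (intro exI[of _ "flat_fun ([:0, 0, 1:] * (p - pderiv p))"] conjI ballI flat_fun_derivative)
      (rule exI, rule refl)
qed (simp, rule exI, rule refl)

text \<open>Equal to 1 up to 1/2 and to 0 from 1 on. The arguments \<open>1 - t\<close> and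
  \<open>t - 1 / 2\<close> add up to 1/2, so at least one of them is positive and the denominator
  never vanishes.\<close>

definition bump :: "real \<Rightarrow> real" where
  "bump t = flat_fun 1 (1 - t) / (flat_fun 1 (1 - t) + flat_fun 1 (t - 1 / 2))"

lemma flat_fun_1: "flat_fun 1 t \<ge> 0" "flat_fun 1 t = 0 \<longleftrightarrow> t \<le> 0"
  by (auto simp: flat_fun_def)

lemma bump_denominator: "flat_fun 1 (1 - t) + flat_fun 1 (t - 1 / 2) > 0"
  using flat_fun_1(1)[of "1 - t"] flat_fun_1(1)[of "t - 1/2"] flat_fun_1(2)[of "1 - t"]
    flat_fun_1(2)[of "t - 1/2"] by fastforce

lemma bump_simps:
  "0 \<le> bump t" "bump t \<le> 1" "t \<le> 1 / 2 \<Longrightarrow> bump t = 1" "t \<ge> 1 \<Longrightarrow> bump t = 0"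
proof -
  show "0 \<le> bump t" "bump t \<le> 1"
    using bump_denominator[of t] flat_fun_1(1)[of "1 - t"] flat_fun_1(1)[of "t - 1/2"]
    by (auto simp: bump_def field_simps)
  show "bump t = 1" if "t \<le> 1 / 2"
    using bump_denominator[of t] flat_fun_1(2)[of "t - 1/2"] that by (simp add: bump_def)
  show "bump t = 0" if "t \<ge> 1"
    using flat_fun_1(2)[of "1 - t"] that by (simp add: bump_def)
qed

lemma Cinf_bump: "Cinf UNIV bump"
proof -
  have a: "Cinf UNIV (\<lambda>t::real. 1 - t)" "Cinf UNIV (\<lambda>t::real. t - 1 / 2)"
    using Cinf_affine[of UNIV "\<lambda>t::real. - t" 1] Cinf_affine[of UNIV "\<lambda>t::real. t" "- 1/2"]
    by (simp_all add: bounded_linear_minus bounded_linear_ident)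
  have f: "Cinf UNIV (\<lambda>t. flat_fun 1 (1 - t))" "Cinf UNIV (\<lambda>t. flat_fun 1 (t - 1 / 2))"
    using Cinf_compose[OF Cinf_flat_fun a(1)] Cinf_compose[OF Cinf_flat_fun a(2)] by auto
  have "Cinf UNIV (\<lambda>t. flat_fun 1 (1 - t) * inverse (flat_fun 1 (1 - t) + flat_fun 1 (t - 1 / 2)))"
    by (intro Cinf_mult f Cinf_compose[OF Cinf_inverse] Cinf_add)
      (use bump_denominator in \<open>auto simp: less_le\<close>)
  then show ?thesis unfolding bump_def[abs_def] divide_inverse .
qed

section \<open>Integration along rays and Hadamard's lemma\<close>

lemma Cinf_ray_integral:
  fixes F :: "'a::euclidean_space \<Rightarrow> real"
  assumes F: "Cinf (ball p r) F"
  shows "Cinf (ball p r) (\<lambda>z. integral {0..1} (\<lambda>t. t ^ m * F (p + t *\<^sub>R (z - p))))"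
\<comment> \<open>Differentiation under the integral sign brings out one more factor
  \<open>t\<close> from the inner map. Carrying an arbitrary power \<open>t ^ m\<close> makes the
  class stable under directional derivatives.\<close>
proof (rule Cinf_coinduct[where P = "\<lambda>h. \<exists>m F. Cinf (ball p r) F \<and>
    h = (\<lambda>z. integral {0..1} (\<lambda>t. t ^ m * F (p + t *\<^sub>R (z - p))))"])
  fix h :: "'a \<Rightarrow> real"
  assume "\<exists>m F. Cinf (ball p r) F \<and> h = (\<lambda>z. integral {0..1} (\<lambda>t. t ^ m * F (p + t *\<^sub>R (z - p))))"
  then obtain m and F :: "'a \<Rightarrow> real" where F: "Cinf (ball p r) F"
    and h: "h = (\<lambda>z. integral (cbox 0 1) (\<lambda>t. t ^ m * F (p + t *\<^sub>R (z - p))))" by auto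
  let ?DF = "\<lambda>z. frechet_derivative F (at z)"
  have ray: "p + t *\<^sub>R (z - p) \<in> ball p r" if "z \<in> ball p r" "t \<in> cbox 0 1" for z t
  proof -
    have "\<bar>t\<bar> * norm (z - p) \<le> 1 * norm (z - p)" using that by (intro mult_right_mono) auto
    then show ?thesis using that by (auto simp: dist_norm norm_minus_commute)
  qed
  \<comment> \<open>The integrand of the derivative as a bounded linear map, the type on which
    \<open>leibniz_rule\<close> works. It is assembled from partial derivatives so that joint
    continuity in \<open>z\<close> and \<open>t\<close> is inherited from theirs.\<close>
  define fx :: "'a \<Rightarrow> real \<Rightarrow> 'a \<Rightarrow>\<^sub>L real" where
    "fx z t = (\<Sum>b\<in>Basis. (t ^ Suc m * ?DF (p + t *\<^sub>R (z - p)) b) *\<^sub>R blinfun_inner_left b)" for z t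
  have lin: "linear (?DF y)" if "y \<in> ball p r" for y
    using Cinf_has_derivative[OF F that] has_derivative_linear by blast
  have fx: "blinfun_apply (fx z t) v = t ^ Suc m * ?DF (p + t *\<^sub>R (z - p)) v"
    if "z \<in> ball p r" "t \<in> cbox 0 1" for z t v
  proof -
    have "?DF (p + t *\<^sub>R (z - p)) v = (\<Sum>b\<in>Basis. (v \<bullet> b) * ?DF (p + t *\<^sub>R (z - p)) b)"
      by (rule linear_sum_Basis[OF lin[OF ray[OF that]]])
    then show ?thesis
      unfolding fx_def
      by (simp only: blinfun.sum_left blinfun.scaleR_left blinfun_inner_left.rep_eq sum_distrib_left
          real_scaleR_def mult_ac)
  qed
  have cont: "continuous_on (ball p r \<times> cbox 0 1) (\<lambda>(z, t). G (p + t *\<^sub>R (z - p)))"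
    if "Cinf (ball p r) G" for G :: "'a \<Rightarrow> real"
    unfolding split_beta
    by (rule continuous_on_compose2[OF Cinf_continuous[OF that]])
      (use ray in \<open>auto intro!: continuous_intros\<close>)
  have cont': "continuous_on (cbox 0 1) (\<lambda>t. G (p + t *\<^sub>R (z - p)))"
    if "Cinf (ball p r) G" "z \<in> ball p r" for G :: "'a \<Rightarrow> real" and z
    by (rule continuous_on_compose2[OF Cinf_continuous[OF that(1)]])
      (use ray that in \<open>auto intro!: continuous_intros\<close>)
  have cfx: "continuous_on (ball p r \<times> cbox 0 1) (\<lambda>(z, t). fx z t)"
    unfolding fx_def split_beta
    using cont[OF Cinf_derivative[OF F]] unfolding split_beta
    by (intro continuous_intros) auto
  have der: "(h has_derivative integral (cbox 0 1) (fx z)) (at z)" if z: "z \<in> ball p r" for z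
  proof -
    have "(h has_derivative integral (cbox 0 1) (fx z)) (at z within ball p r)"
      unfolding h
    proof (rule leibniz_rule)
      fix y t assume y: "y \<in> ball p r" and t: "t \<in> cbox (0::real) 1"
      have "((\<lambda>z. p + t *\<^sub>R (z - p)) has_derivative (\<lambda>v. t *\<^sub>R v)) (at y)"
        by (auto intro!: derivative_eq_intros)
      then have "((\<lambda>z. F (p + t *\<^sub>R (z - p))) has_derivative (\<lambda>v. ?DF (p + t *\<^sub>R (y - p)) (t *\<^sub>R v))) (at y)"
        by (rule has_derivative_compose[where g = F and f = "\<lambda>z. p + t *\<^sub>R (z - p)"])
          (rule Cinf_has_derivative[OF F ray[OF y t]])
      then have "((\<lambda>z. t ^ m * F (p + t *\<^sub>R (z - p))) has_derivative
          (\<lambda>v. t ^ m * ?DF (p + t *\<^sub>R (y - p)) (t *\<^sub>R v))) (at y)"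
        by (rule has_derivative_mult_right)
      then have "((\<lambda>z. t ^ m * F (p + t *\<^sub>R (z - p))) has_derivative blinfun_apply (fx y t)) (at y)"
        by (rule has_derivative_eq_rhs)
          (auto simp: fx[OF y t] linear_scale[OF lin[OF ray[OF y t]]] fun_eq_iff)
      then show "((\<lambda>z. t ^ m * F (p + t *\<^sub>R (z - p))) has_derivative blinfun_apply (fx y t)) (at y within ball p r)"
        by (rule has_derivative_at_withinI)
    next
      fix y assume "y \<in> ball p r"
      then show "(\<lambda>t. t ^ m * F (p + t *\<^sub>R (y - p))) integrable_on cbox 0 1"
        by (intro integrable_continuous continuous_intros cont' F)
    qed (use cfx z in auto)
    then show ?thesis using z by (simp add: at_within_open[OF _ open_ball])
  qed
  have ifx: "blinfun_apply (integral (cbox 0 1) (fx z)) v =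
      integral {0..1} (\<lambda>t. t ^ Suc m * ?DF (p + t *\<^sub>R (z - p)) v)" if z: "z \<in> ball p r" for z v
  proof -
    have "continuous_on (cbox 0 1) (fx z)"
      using continuous_on_compose2[OF cfx, where s = "cbox 0 1" and f = "\<lambda>t. (z, t)"] z
      by (simp add: continuous_on_Pair image_subset_iff)
    then have "blinfun_apply (integral (cbox 0 1) (fx z)) v = integral (cbox 0 1) (\<lambda>t. blinfun_apply (fx z t) v)"
      using blinfun_apply_integral integrable_continuous by blast
    also have "\<dots> = integral (cbox 0 1) (\<lambda>t. t ^ Suc m * ?DF (p + t *\<^sub>R (z - p)) v)"
      by (rule integral_cong) (use fx[OF z] in auto)
    finally show ?thesis by simp
  qed
  show "\<exists>D. (\<forall>z\<in>ball p r. (h has_derivative D z) (at z)) \<and> (\<forall>v. \<exists>m F. Cinf (ball p r) F \<and>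
      (\<lambda>z. D z v) = (\<lambda>z. integral {0..1} (\<lambda>t. t ^ m * F (p + t *\<^sub>R (z - p)))))"
  proof (intro exI conjI ballI allI)
    fix z assume z: "z \<in> ball p r"
    show "(h has_derivative (\<lambda>v. integral {0..1} (\<lambda>t. t ^ Suc m * ?DF (p + t *\<^sub>R (z - p)) v))) (at z)"
      using der[OF z] by (rule has_derivative_eq_rhs) (use ifx[OF z] in auto)
  next
    fix v
    show "Cinf (ball p r) (\<lambda>y. ?DF y v)" by (rule Cinf_derivative[OF F])
    show "(\<lambda>z. integral {0..1} (\<lambda>t. t ^ Suc m * ?DF (p + t *\<^sub>R (z - p)) v)) =
        (\<lambda>z. integral {0..1} (\<lambda>t. t ^ Suc m * ?DF (p + t *\<^sub>R (z - p)) v))" ..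
  qed
qed (use F in auto)

text \<open>\<open>G b\<close> is the average of the partial derivative in direction
  \<open>b\<close> over the segment from \<open>p\<close> to \<open>z\<close>; the identity is the
  fundamental theorem of calculus along that segment. It will show that a derivation of germs
  depends on first derivatives only.\<close>

lemma Hadamard:
  fixes F :: "'a::euclidean_space \<Rightarrow> real"
  assumes F: "Cinf (ball p r) F"
  obtains G where "\<And>b. Cinf (ball p r) (G b)"
    and "\<And>z. z \<in> ball p r \<Longrightarrow> F z = F p + (\<Sum>b\<in>Basis. ((z - p) \<bullet> b) * G b z)"
    and "\<And>b. G b p = frechet_derivative F (at p) b"
proof
  let ?DF = "\<lambda>z. frechet_derivative F (at z)"
  define G where "G b z = integral {0..1} (\<lambda>t. ?DF (p + t *\<^sub>R (z - p)) b)" for b z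
  show "Cinf (ball p r) (G b)" for b
    using Cinf_ray_integral[OF Cinf_derivative[OF F], where m = 0] unfolding G_def[abs_def] by simp
  show "G b p = ?DF p b" for b by (simp add: G_def)
  fix z assume z: "z \<in> ball p r"
  have ray: "p + t *\<^sub>R (z - p) \<in> ball p r" if "t \<in> {0..1}" for t
  proof -
    have "\<bar>t\<bar> * norm (z - p) \<le> 1 * norm (z - p)" using that by (intro mult_right_mono) auto
    then show ?thesis using that z by (auto simp: dist_norm norm_minus_commute)
  qed
  have "((\<lambda>t. ?DF (p + t *\<^sub>R (z - p)) (z - p)) has_integral
      F (p + 1 *\<^sub>R (z - p)) - F (p + 0 *\<^sub>R (z - p))) {0..1}"
  proof (rule fundamental_theorem_of_calculus)
    fix t :: real assume t: "t \<in> {0..1}"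
    have "((\<lambda>t. p + t *\<^sub>R (z - p)) has_derivative (\<lambda>s. s *\<^sub>R (z - p))) (at t)"
      by (auto intro!: derivative_eq_intros)
    then have "((\<lambda>t. F (p + t *\<^sub>R (z - p))) has_derivative (\<lambda>s. ?DF (p + t *\<^sub>R (z - p)) (s *\<^sub>R (z - p)))) (at t)"
      by (rule has_derivative_compose[where g = F and f = "\<lambda>t. p + t *\<^sub>R (z - p)"])
        (rule Cinf_has_derivative[OF F ray[OF t]])
    moreover have "linear (?DF (p + t *\<^sub>R (z - p)))"
      using Cinf_has_derivative[OF F ray[OF t]] has_derivative_linear by blast
    ultimately show "((\<lambda>t. F (p + t *\<^sub>R (z - p))) has_vector_derivative ?DF (p + t *\<^sub>R (z - p)) (z - p)) (at t within {0..1})"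
      by (simp add: has_vector_derivative_def linear_scale has_derivative_at_withinI)
  qed simp
  then have "F z - F p = integral {0..1} (\<lambda>t. ?DF (p + t *\<^sub>R (z - p)) (z - p))"
    by (simp add: integral_unique)
  also have "\<dots> = integral {0..1} (\<lambda>t. \<Sum>b\<in>Basis. ((z - p) \<bullet> b) * ?DF (p + t *\<^sub>R (z - p)) b)"
  proof (rule integral_cong)
    fix t :: real assume t: "t \<in> {0..1}"
    have l: "linear (?DF (p + t *\<^sub>R (z - p)))"
      using Cinf_has_derivative[OF F ray[OF t]] has_derivative_linear by blast
    show "?DF (p + t *\<^sub>R (z - p)) (z - p) = (\<Sum>b\<in>Basis. ((z - p) \<bullet> b) * ?DF (p + t *\<^sub>R (z - p)) b)"
      by (rule linear_sum_Basis[OF l])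
  qed
  also have "\<dots> = (\<Sum>b\<in>Basis. ((z - p) \<bullet> b) * G b z)"
  proof -
    have "continuous_on {0..1} (\<lambda>t. ?DF (p + t *\<^sub>R (z - p)) b)" for b
      by (rule continuous_on_compose2[OF Cinf_continuous[OF Cinf_derivative[OF F]]])
        (use ray in \<open>auto intro!: continuous_intros\<close>)
    then have "(\<lambda>t. ((z - p) \<bullet> b) * ?DF (p + t *\<^sub>R (z - p)) b) integrable_on {0..1}" for b
      by (intro integrable_continuous_interval continuous_intros)
    then show ?thesis
      by (subst integral_sum) (auto simp: G_def)
  qed
  finally show "F z = F p + (\<Sum>b\<in>Basis. ((z - p) \<bullet> b) * G b z)" by simp
qed

section \<open>Smooth functions on a manifold\<close>

lemma smooth_onE:
  assumes "smooth_on A f" "x \<in> A"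
  obtains N F where "x \<in> N" "Cinf N F" "\<And>y. y \<in> A \<Longrightarrow> y \<in> N \<Longrightarrow> F y = f y"
proof -
  from assms obtain N F where "open N" "x \<in> N" "\<forall>k. Ck_on k N F" "\<forall>y\<in>A \<inter> N. F y = f y"
    unfolding smooth_on_def by meson
  then show thesis using that[of N F] by (simp add: Cinf_def)
qed

locale smooth_mfd =
  fixes M :: "('m::{t2_space,second_countable_topology}, 'b::euclidean_space) manifold"
  assumes smooth_manifold: "smooth_manifold M"
begin

abbreviation "model_space \<equiv> span (set (model M))"

lemma chart_cover: obtains U \<phi> where "(U, \<phi>) \<in> charts M" "x \<in> U"
proof -
  have "x \<in> (\<Union>(U, \<phi>)\<in>charts M. U)"
    using smooth_manifold unfolding smooth_manifold_def by simp
  then show thesis using that by auto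
qed

context
  fixes U \<phi>
  assumes chart: "(U, \<phi>) \<in> charts M"
begin

lemma chart_open: "open U"
  using smooth_manifold chart unfolding smooth_manifold_def by fast

lemma chart_image_open: "openin (top_of_set model_space) (\<phi> ` U)"
  using smooth_manifold chart unfolding smooth_manifold_def by fast

lemma chart_homeo: obtains g where "homeomorphism U (\<phi> ` U) \<phi> g"
  using smooth_manifold chart unfolding smooth_manifold_def by fast

lemma chart_inj: "inj_on \<phi> U"
  using chart_homeo by (metis homeomorphism_apply1 inj_on_inverseI)

lemma chart_inv [simp]: "y \<in> U \<Longrightarrow> inv_into U \<phi> (\<phi> y) = y"
  using chart_inj by simp

lemma chart_continuous: "continuous_on U \<phi>"
  using chart_homeo homeomorphism_cont1 by metis

lemma chart_in_model: "y \<in> U \<Longrightarrow> \<phi> y \<in> model_space"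
  using chart_image_open openin_imp_subset by fastforce

lemma chart_preimage_open: "open N \<Longrightarrow> open (U \<inter> \<phi> -` N)"
  using continuous_open_preimage[OF chart_continuous chart_open] .

lemma chart_tendsto: "x \<in> U \<Longrightarrow> (\<phi> \<longlongrightarrow> \<phi> x) (nhds x)"
  using chart_continuous chart_open
  by (metis at_within_open continuous_on_def tendsto_at_iff_tendsto_nhds)

lemma chart_eventually: "x \<in> U \<Longrightarrow> open N \<Longrightarrow> \<phi> x \<in> N \<Longrightarrow> \<forall>\<^sub>F y in nhds x. \<phi> y \<in> N"
  using chart_tendsto topological_tendstoD by blast

text \<open>A chart image is open only relative to the model space, which may be a proper subspace
  of \<open>'b\<close>. Open sets of the manifold correspond to traces of ambient open sets
  \<open>N\<close>.\<close>

lemma chart_image: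
  assumes "open Q"
  obtains N where "open N" "\<phi> ` (U \<inter> Q) = model_space \<inter> N"
proof -
  obtain g where "homeomorphism U (\<phi> ` U) \<phi> g" using chart_homeo .
  then have "openin (top_of_set (\<phi> ` U)) (\<phi> ` (U \<inter> Q))"
    using homeomorphism_imp_open_map openin_open_Int assms by blast
  then have "openin (top_of_set model_space) (\<phi> ` (U \<inter> Q))"
    using chart_image_open openin_trans by blast
  then show thesis using that by (auto simp: openin_open)
qed

text \<open>One chart decides smoothness near a point: the change to another chart has a smooth
  local extension \<open>G\<close>, and the composite of \<open>F\<close> with \<open>G\<close>
  represents \<open>f\<close> there. The function \<open>F\<close> lives on a ball of the ambient
  space; only its values on the chart image are tied to \<open>f\<close>.\<close>

lemma smooth_near_chart:
  assumes x: "x \<in> U"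
  shows "smooth_near M x f \<longleftrightarrow>
    (\<exists>r>0. \<exists>F. Cinf (ball (\<phi> x) r) F \<and> (\<forall>\<^sub>F y in nhds x. f y = F (\<phi> y)))"
proof
  assume "smooth_near M x f"
  then obtain W where W: "open W" "x \<in> W" "smooth_on (\<phi> ` (U \<inter> W)) (f \<circ> inv_into U \<phi>)"
    using chart unfolding smooth_near_def smooth_fun_def by fast
  moreover have "\<phi> x \<in> \<phi> ` (U \<inter> W)" using x W by blast
  ultimately obtain N F where N: "\<phi> x \<in> N" "Cinf N F"
    and F: "\<And>z. z \<in> \<phi> ` (U \<inter> W) \<Longrightarrow> z \<in> N \<Longrightarrow> F z = (f \<circ> inv_into U \<phi>) z"
    using smooth_onE by blast
  obtain r where r: "r > 0" "ball (\<phi> x) r \<subseteq> N"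
    using openE[OF Cinf_open[OF N(2)] N(1)] by blast
  have "Cinf (ball (\<phi> x) r) F"
    using Cinf_subset[OF N(2) r(2)] by simp
  moreover have "\<forall>\<^sub>F y in nhds x. y \<in> U \<inter> W \<and> \<phi> y \<in> N"
    using W x chart_open N Cinf_open
    by (intro eventually_conj eventually_nhds_in_open chart_eventually) auto
  then have "\<forall>\<^sub>F y in nhds x. f y = F (\<phi> y)"
    by eventually_elim (use F in auto)
  ultimately show "\<exists>r>0. \<exists>F. Cinf (ball (\<phi> x) r) F \<and> (\<forall>\<^sub>F y in nhds x. f y = F (\<phi> y))"
    using r by blast
next
  assume "\<exists>r>0. \<exists>F. Cinf (ball (\<phi> x) r) F \<and> (\<forall>\<^sub>F y in nhds x. f y = F (\<phi> y))"
  then obtain r F where r: "r > 0" and F: "Cinf (ball (\<phi> x) r) F"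
    and "\<forall>\<^sub>F y in nhds x. f y = F (\<phi> y)" by blast
  then obtain Q where Q: "open Q" "x \<in> Q" "\<And>y. y \<in> Q \<Longrightarrow> f y = F (\<phi> y)"
    unfolding eventually_nhds by blast
  define W where "W = (U \<inter> \<phi> -` ball (\<phi> x) r) \<inter> Q"
  have W: "open W" "x \<in> W" "W \<subseteq> U"
    using Q x r chart_preimage_open by (auto simp: W_def)
  have "smooth_on (\<psi> ` (V \<inter> W)) (f \<circ> inv_into V \<psi>)" if V: "(V, \<psi>) \<in> charts M" for V \<psi>
    unfolding smooth_on_def
  proof
    fix z assume "z \<in> \<psi> ` (V \<inter> W)"
    then obtain y where y: "y \<in> V" "y \<in> W" "z = \<psi> y" by blast
    have inv: "inv_into V \<psi> (\<psi> y) = y" if "y \<in> V" for y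
    proof -
      obtain g where "homeomorphism V (\<psi> ` V) \<psi> g"
        using smooth_manifold V unfolding smooth_manifold_def by fast
      then have "inj_on \<psi> V" by (metis homeomorphism_apply1 inj_on_inverseI)
      then show ?thesis using that by simp
    qed
    have "smooth_on (\<psi> ` (V \<inter> U)) (\<phi> \<circ> inv_into V \<psi>)"
      using smooth_manifold V chart unfolding smooth_manifold_def by fast
    moreover have "z \<in> \<psi> ` (V \<inter> U)" using y W by blast
    ultimately obtain N G where N: "z \<in> N" and NG: "Cinf N G"
      and G: "\<And>z. z \<in> \<psi> ` (V \<inter> U) \<Longrightarrow> z \<in> N \<Longrightarrow> G z = (\<phi> \<circ> inv_into V \<psi>) z"
      using smooth_onE by blast
    \<comment> \<open>The extension \<open>G\<close> may leave the ball on which \<open>F\<close> is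
      smooth, so its domain is cut down to the preimage of that ball.\<close>
    define N' where "N' = N \<inter> G -` ball (\<phi> x) r"
    have oN': "open N'"
      unfolding N'_def using continuous_open_preimage[OF Cinf_continuous[OF NG] Cinf_open[OF NG]] by simp
    have "z \<in> N'"
      using y N G[of z] inv W by (auto simp: N'_def W_def)
    moreover have "Cinf N' (\<lambda>z. F (G z))"
      by (rule Cinf_compose[OF F Cinf_subset[OF NG]]) (use oN' in \<open>auto simp: N'_def\<close>)
    moreover have "F (G z) = (f \<circ> inv_into V \<psi>) z" if z: "z \<in> \<psi> ` (V \<inter> W) \<inter> N'" for z
    proof -
      obtain y' where "y' \<in> V" "y' \<in> W" "z = \<psi> y'" using z by blast
      then show ?thesis using G[of z] z inv Q(3)[of y'] by (auto simp: N'_def W_def)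
    qed
    ultimately show "\<exists>W' F'. open W' \<and> z \<in> W' \<and> (\<forall>k. Ck_on k W' F') \<and>
        (\<forall>y\<in>\<psi> ` (V \<inter> W) \<inter> W'. F' y = (f \<circ> inv_into V \<psi>) y)"
      unfolding Cinf_def using oN' by (intro exI[of _ N'] exI[of _ "\<lambda>z. F (G z)"]) simp
  qed
  then show "smooth_near M x f"
    unfolding smooth_near_def smooth_fun_def using W by blast
qed

end

text \<open>On open sets smoothness is a condition on germs; most later arguments work with
  \<open>smooth_near\<close> and return to \<open>smooth_fun\<close> through this
  equivalence.\<close>

lemma smooth_fun_iff:
  assumes "open W"
  shows "smooth_fun M W f \<longleftrightarrow> (\<forall>x\<in>W. smooth_near M x f)"
proof
  assume "smooth_fun M W f"
  then show "\<forall>x\<in>W. smooth_near M x f"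
    using assms unfolding smooth_near_def by blast
next
  assume *: "\<forall>x\<in>W. smooth_near M x f"
  have "smooth_on (\<phi> ` (U \<inter> W)) (f \<circ> inv_into U \<phi>)" if chart: "(U, \<phi>) \<in> charts M" for U \<phi>
    unfolding smooth_on_def
  proof
    fix z assume "z \<in> \<phi> ` (U \<inter> W)"
    then obtain x where x: "x \<in> U" "x \<in> W" "z = \<phi> x" by blast
    then obtain r F where r: "r > 0" and F: "Cinf (ball z r) F"
      and "\<forall>\<^sub>F y in nhds x. f y = F (\<phi> y)"
      using * smooth_near_chart[OF chart] by blast
    then obtain Q where Q: "open Q" "x \<in> Q" "\<And>y. y \<in> Q \<Longrightarrow> f y = F (\<phi> y)"
      unfolding eventually_nhds by blast
    \<comment> \<open>Intersecting the ball with \<open>N\<close> ensures that the points of the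
      chart image in it come from \<open>Q\<close>, where \<open>F\<close> represents
      \<open>f\<close>.\<close>
    obtain N where N: "open N" "\<phi> ` (U \<inter> Q) = model_space \<inter> N"
      using chart_image[OF chart Q(1)] .
    have "F z' = (f \<circ> inv_into U \<phi>) z'" if z': "z' \<in> \<phi> ` (U \<inter> W) \<inter> (ball z r \<inter> N)" for z'
    proof -
      obtain y where y: "y \<in> U" "z' = \<phi> y" using z' by blast
      then have "z' \<in> \<phi> ` (U \<inter> Q)" using N(2) z' chart_in_model[OF chart] by blast
      then have "y \<in> Q" using chart_inj[OF chart] y by (auto dest: inj_onD)
      then show ?thesis using y Q chart_inv[OF chart] by simp
    qed
    moreover have "z \<in> N" using N(2) x Q by blast
    ultimately show "\<exists>W' F. open W' \<and> z \<in> W' \<and> (\<forall>k. Ck_on k W' F) \<and>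
        (\<forall>y\<in>\<phi> ` (U \<inter> W) \<inter> W'. F y = (f \<circ> inv_into U \<phi>) y)"
      using F r N Ck_on_mono[of _ "ball z r" F "ball z r \<inter> N"] unfolding Cinf_def
      by (intro exI[of _ "ball z r \<inter> N"] exI[of _ F]) auto
  qed
  then show "smooth_fun M W f" unfolding smooth_fun_def by blast
qed

lemma smooth_fun_UNIV: "smooth_fun M UNIV f \<longleftrightarrow> (\<forall>x. smooth_near M x f)"
  by (simp add: smooth_fun_iff)

lemma smooth_near_cong:
  assumes "\<forall>\<^sub>F y in nhds x. f y = g y" "smooth_near M x f"
  shows "smooth_near M x g"
proof -
  obtain U \<phi> where c: "(U, \<phi>) \<in> charts M" "x \<in> U" using chart_cover .
  then obtain r F where r: "r > 0" "Cinf (ball (\<phi> x) r) F" and F: "\<forall>\<^sub>F y in nhds x. f y = F (\<phi> y)"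
    using assms(2) smooth_near_chart by blast
  have "\<forall>\<^sub>F y in nhds x. g y = F (\<phi> y)"
    using F assms(1) by eventually_elim simp
  then show ?thesis using r c smooth_near_chart by blast
qed

lemmas smooth_near_transform = smooth_near_cong[rotated]

lemma smooth_near_cong_iff:
  "\<forall>\<^sub>F y in nhds x. f y = g y \<Longrightarrow> smooth_near M x f \<longleftrightarrow> smooth_near M x g"
  using smooth_near_cong[of f g x] smooth_near_cong[of g f x] by (auto simp: eq_commute)

lemma smooth_near_eventually: "smooth_near M x f \<Longrightarrow> \<forall>\<^sub>F y in nhds x. smooth_near M y f"
  unfolding smooth_near_def eventually_nhds by blast

section \<open>Algebra of smooth germs\<close>

lemma smooth_near_const [simp, intro]: "smooth_near M x (\<lambda>y. c)"
proof -
  obtain U \<phi> where c: "(U, \<phi>) \<in> charts M" "x \<in> U" using chart_cover .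
  show ?thesis
    unfolding smooth_near_chart[OF c]
    by (intro exI[of _ 1] conjI exI[of _ "\<lambda>y. c"]) (auto intro: Cinf_const)
qed

lemma smooth_near_compose2:
  assumes "smooth_near M x f" "smooth_near M x g"
    and H: "\<And>(p::'b) r F G. Cinf (ball p r) F \<Longrightarrow> Cinf (ball p r) G \<Longrightarrow> Cinf (ball p r) (\<lambda>z. H (F z) (G z))"
  shows "smooth_near M x (\<lambda>y. H (f y) (g y))"
proof -
  obtain U \<phi> where c: "(U, \<phi>) \<in> charts M" "x \<in> U" using chart_cover .
  obtain r F where F: "r > 0" "Cinf (ball (\<phi> x) r) F" "\<forall>\<^sub>F y in nhds x. f y = F (\<phi> y)"
    using assms(1) smooth_near_chart[OF c] by blast
  obtain s G where G: "s > 0" "Cinf (ball (\<phi> x) s) G" "\<forall>\<^sub>F y in nhds x. g y = G (\<phi> y)"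
    using assms(2) smooth_near_chart[OF c] by blast
  have "Cinf (ball (\<phi> x) (min r s)) (\<lambda>z. H (F z) (G z))"
    by (rule H) (use F G in \<open>auto intro: Cinf_subset\<close>)
  moreover have "\<forall>\<^sub>F y in nhds x. H (f y) (g y) = H (F (\<phi> y)) (G (\<phi> y))"
    using F(3) G(3) by eventually_elim simp
  ultimately show ?thesis
    unfolding smooth_near_chart[OF c] using F(1) G(1)
    by (intro exI[of _ "min r s"] conjI exI[of _ "\<lambda>z. H (F z) (G z)"]) auto
qed

lemma smooth_near_add [intro]:
  "smooth_near M x f \<Longrightarrow> smooth_near M x g \<Longrightarrow> smooth_near M x (\<lambda>y. f y + g y)"
  using smooth_near_compose2[where H = "(+)"] Cinf_add by blast

lemma smooth_near_mult [intro]: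
  "smooth_near M x f \<Longrightarrow> smooth_near M x g \<Longrightarrow> smooth_near M x (\<lambda>y. f y * g y)"
  using smooth_near_compose2[where H = "(*)"] Cinf_mult by blast

lemma smooth_near_minus [intro]: "smooth_near M x f \<Longrightarrow> smooth_near M x (\<lambda>y. - f y)"
  using smooth_near_mult[of x "\<lambda>y. - 1" f] by simp

lemma smooth_near_diff [intro]:
  "smooth_near M x f \<Longrightarrow> smooth_near M x g \<Longrightarrow> smooth_near M x (\<lambda>y. f y - g y)"
  using smooth_near_add[of x f "\<lambda>y. - g y"] by auto

lemma smooth_near_sum [intro]:
  "(\<And>i. i \<in> I \<Longrightarrow> smooth_near M x (f i)) \<Longrightarrow> smooth_near M x (\<lambda>y. \<Sum>i\<in>I. f i y)"
  by (induction I rule: infinite_finite_induct) auto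

lemma smooth_near_prod:
  "(\<And>i. i \<in> I \<Longrightarrow> smooth_near M x (f i)) \<Longrightarrow> smooth_near M x (\<lambda>y. \<Prod>i\<in>I. f i y)"
  by (induction I rule: infinite_finite_induct) auto

lemma chart_coord_smooth:
  assumes "(U, \<phi>) \<in> charts M" "x \<in> U"
  shows "smooth_near M x (\<lambda>y. \<phi> y \<bullet> b)"
  unfolding smooth_near_chart[OF assms]
  by (rule exI[of _ 1], rule conjI, simp, rule exI[of _ "\<lambda>z. z \<bullet> b"])
    (simp add: Cinf_inner)

lemma smooth_near_tendsto:
  assumes "smooth_near M x f"
  shows "(f \<longlongrightarrow> f x) (nhds x)"
proof -
  obtain U \<phi> where c: "(U, \<phi>) \<in> charts M" "x \<in> U" using chart_cover .
  then obtain r F where r: "r > 0" "Cinf (ball (\<phi> x) r) F" and F: "\<forall>\<^sub>F y in nhds x. f y = F (\<phi> y)"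
    using assms smooth_near_chart by blast
  have "isCont F (\<phi> x)"
    using Cinf_continuous[OF r(2)] r(1) by (simp add: continuous_on_interior)
  then have "((\<lambda>y. F (\<phi> y)) \<longlongrightarrow> F (\<phi> x)) (nhds x)"
    using isCont_tendsto_compose[OF _ chart_tendsto[OF c]] by blast
  then show ?thesis
    using F Lim_transform_eventually[of "\<lambda>y. F (\<phi> y)" _ "nhds x" f] eventually_nhds_x_imp_x[OF F]
    by (simp add: eq_commute)
qed

lemma smooth_near_eventually_nonzero:
  "smooth_near M x f \<Longrightarrow> f x \<noteq> 0 \<Longrightarrow> \<forall>\<^sub>F y in nhds x. f y \<noteq> 0"
  using smooth_near_tendsto tendsto_imp_eventually_ne by blast

lemma smooth_near_compose:
  assumes f: "smooth_near M x f" and H: "Cinf N H" "f x \<in> N"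
  shows "smooth_near M x (\<lambda>y. H (f y))"
proof -
  obtain U \<phi> where c: "(U, \<phi>) \<in> charts M" "x \<in> U" using chart_cover .
  obtain r F where F: "r > 0" "Cinf (ball (\<phi> x) r) F" "\<forall>\<^sub>F y in nhds x. f y = F (\<phi> y)"
    using f smooth_near_chart[OF c] by blast
  have "open (ball (\<phi> x) r \<inter> F -` N)"
    using continuous_open_preimage[OF Cinf_continuous[OF F(2)]] Cinf_open[OF H(1)] by simp
  moreover have "\<phi> x \<in> ball (\<phi> x) r \<inter> F -` N"
    using F(1) H(2) eventually_nhds_x_imp_x[OF F(3)] by simp
  ultimately obtain s where s: "s > 0" "ball (\<phi> x) s \<subseteq> ball (\<phi> x) r \<inter> F -` N"
    using openE by blast
  have "Cinf (ball (\<phi> x) s) (\<lambda>z. H (F z))"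
    by (rule Cinf_compose[OF H(1) Cinf_subset[OF F(2)]]) (use s in auto)
  moreover have "\<forall>\<^sub>F y in nhds x. H (f y) = H (F (\<phi> y))"
    using F(3) by eventually_elim simp
  ultimately show ?thesis
    unfolding smooth_near_chart[OF c] using s by blast
qed

lemma smooth_near_inverse: "smooth_near M x f \<Longrightarrow> f x \<noteq> 0 \<Longrightarrow> smooth_near M x (\<lambda>y. inverse (f y))"
  by (rule smooth_near_compose[OF _ Cinf_inverse]) auto

lemma smooth_near_divide:
  "smooth_near M x f \<Longrightarrow> smooth_near M x g \<Longrightarrow> g x \<noteq> 0 \<Longrightarrow> smooth_near M x (\<lambda>y. f y / g y)"
  unfolding divide_inverse by (intro smooth_near_mult smooth_near_inverse)

text \<open>Away from zeros the sign is locally constant by continuity, so the absolute value is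
  \<open>f\<close> or \<open>- f\<close> near \<open>x\<close>.\<close>

lemma smooth_near_abs:
  assumes "smooth_near M x f" "f x \<noteq> 0"
  shows "smooth_near M x (\<lambda>y. \<bar>f y\<bar>)"
proof (cases "f x > 0")
  case True
  then have "\<forall>\<^sub>F y in nhds x. f y > 0"
    using order_tendstoD(1)[OF smooth_near_tendsto[OF assms(1)]] by blast
  then have "\<forall>\<^sub>F y in nhds x. f y = \<bar>f y\<bar>" by eventually_elim simp
  with assms(1) show ?thesis by (rule smooth_near_transform)
next
  case False
  then have "\<forall>\<^sub>F y in nhds x. f y < 0"
    using order_tendstoD(2)[OF smooth_near_tendsto[OF assms(1)], of 0] assms(2) by simp
  then have "\<forall>\<^sub>F y in nhds x. - f y = \<bar>f y\<bar>" by eventually_elim simp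
  with smooth_near_minus[OF assms(1)] show ?thesis by (rule smooth_near_transform)
qed

lemma smooth_near_ln_abs:
  assumes "smooth_near M x f" "f x \<noteq> 0"
  shows "smooth_near M x (\<lambda>y. ln \<bar>f y\<bar>)"
  by (rule smooth_near_compose[OF smooth_near_abs[OF assms] Cinf_ln]) (use assms in auto)

text \<open>A cutoff in a chart extends smoothly by 0 if its support is closed in the whole
  manifold. The support lies in the preimage of a compact piece of a closed ball; this preimage is
  compact and hence closed, because the space is Hausdorff.\<close>

lemma bump_function:
  assumes W: "open W" "x \<in> W"
  obtains \<beta> C where "\<And>y. smooth_near M y \<beta>" "closed C" "C \<subseteq> W" "\<And>y. y \<notin> C \<Longrightarrow> \<beta> y = 0"
    "\<And>y. 0 \<le> \<beta> y" "\<And>y. \<beta> y \<le> 1" "\<forall>\<^sub>F y in nhds x. \<beta> y = 1"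
proof -
  obtain U \<phi> where c: "(U, \<phi>) \<in> charts M" "x \<in> U" using chart_cover .
  obtain N where N: "open N" "\<phi> ` (U \<inter> W) = model_space \<inter> N"
    using chart_image[OF c(1) W(1)] .
  have "\<phi> x \<in> N" using N(2) c(2) W(2) by blast
  then obtain r where r: "r > 0" "cball (\<phi> x) r \<subseteq> N"
    using N(1) open_contains_cball by blast
  define K where "K = model_space \<inter> cball (\<phi> x) r"
  have K: "compact K" "K \<subseteq> \<phi> ` (U \<inter> W)"
    unfolding K_def N(2) using r by (auto intro!: closed_Int_compact closed_subspace)
  obtain g where g: "homeomorphism U (\<phi> ` U) \<phi> g" using chart_homeo[OF c(1)] .
  define C where "C = g ` K"
  have "compact C"
    unfolding C_def using K continuous_on_subset[OF homeomorphism_cont2[OF g], of K]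
    by (intro compact_continuous_image) auto
  then have C: "closed C" by (rule compact_imp_closed)
  have CW: "C \<subseteq> U \<inter> W"
    using K(2) homeomorphism_apply1[OF g] unfolding C_def by fastforce
  \<comment> \<open>The squared distance to \<open>\<phi> x\<close> in units of \<open>r\<close>,
    spelled out in coordinates to make its smoothness visible. A distance beyond \<open>r\<close>
    gives \<open>q\<close> at least 1, where \<open>bump\<close> vanishes.\<close>
  define q where "q y = (\<Sum>b\<in>Basis. (\<phi> y \<bullet> b - \<phi> x \<bullet> b) * (\<phi> y \<bullet> b - \<phi> x \<bullet> b)) / r\<^sup>2" for y
  have q: "q y = (norm (\<phi> y - \<phi> x) / r)\<^sup>2" for y
    unfolding q_def power_divide power2_norm_eq_inner
    by (subst euclidean_inner) (simp add: inner_diff_left)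
  define \<beta> where "\<beta> y = (if y \<in> U then bump (q y) else 0)" for y
  have zero: "\<beta> y = 0" if "y \<notin> C" for y
  proof (cases "y \<in> U")
    case True
    have "\<phi> y \<notin> K"
      using that homeomorphism_apply1[OF g True] unfolding C_def by (metis image_eqI)
    then have "norm (\<phi> y - \<phi> x) > r"
      using chart_in_model[OF c(1) True] by (auto simp: K_def dist_norm norm_minus_commute)
    then have "q y \<ge> 1" unfolding q using r(1) by (simp add: one_le_power)
    then show ?thesis by (simp add: \<beta>_def bump_simps)
  qed (simp add: \<beta>_def)
  have smooth: "smooth_near M y \<beta>" for y
  proof (cases "y \<in> U")
    case True
    have "smooth_near M y q"
      unfolding q_def divide_inverse
      by (intro smooth_near_mult smooth_near_sum smooth_near_diff smooth_near_const
          chart_coord_smooth[OF c(1) True])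
    then have "smooth_near M y (\<lambda>y. bump (q y))"
      using smooth_near_compose[OF _ Cinf_bump] by simp
    moreover have "\<forall>\<^sub>F z in nhds y. bump (q z) = \<beta> z"
      using eventually_nhds_in_open[OF chart_open[OF c(1)] True] by eventually_elim (simp add: \<beta>_def)
    ultimately show ?thesis by (rule smooth_near_transform)
  next
    case False
    \<comment> \<open>Here closedness of \<open>C\<close> enters: a point outside the chart domain
      has a neighbourhood on which \<open>\<beta>\<close> is 0.\<close>
    then have "y \<in> - C" using CW by blast
    then have "\<forall>\<^sub>F z in nhds y. z \<in> - C" using C by (intro eventually_nhds_in_open) auto
    then have "\<forall>\<^sub>F z in nhds y. 0 = \<beta> z" by eventually_elim (simp add: zero)
    with smooth_near_const show ?thesis by (rule smooth_near_transform)
  qed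
  have "(q \<longlongrightarrow> (norm (\<phi> x - \<phi> x) / r)\<^sup>2) (nhds x)"
    unfolding q using r(1) by (intro tendsto_intros chart_tendsto[OF c]) auto
  then have "\<forall>\<^sub>F y in nhds x. q y < 1 / 2" by (rule order_tendstoD) simp
  moreover have "\<forall>\<^sub>F y in nhds x. y \<in> U"
    using eventually_nhds_in_open[OF chart_open[OF c(1)] c(2)] .
  ultimately have "\<forall>\<^sub>F y in nhds x. \<beta> y = 1"
    by eventually_elim (simp add: \<beta>_def bump_simps)
  moreover have "0 \<le> \<beta> y" "\<beta> y \<le> 1" for y
    by (simp_all add: \<beta>_def bump_simps)
  moreover have "C \<subseteq> W" using CW by blast
  ultimately show thesis
    using that[OF smooth C _ zero] by blast
qed

text \<open>Multiplying the \<open>n\<close>-th bump function by \<open>1 - \<beta>\<close> for all preceding ones makes a countable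
  family locally finite without any compactness argument.\<close>

lemma locally_finite_bumps:
  assumes A: "\<And>x. open (A x)" "\<And>x. x \<in> A x"
  obtains \<psi> :: "nat \<Rightarrow> 'm \<Rightarrow> real" and c :: "nat \<Rightarrow> 'm"
  where "\<And>n y. smooth_near M y (\<psi> n)" "\<And>n y. 0 \<le> \<psi> n y"
    "\<And>n y. y \<notin> A (c n) \<Longrightarrow> \<forall>\<^sub>F z in nhds y. \<psi> n z = 0"
    "\<And>n y. \<psi> n y \<noteq> 0 \<Longrightarrow> y \<in> A (c n)"
    "\<And>x. \<exists>k. \<forall>\<^sub>F y in nhds x. \<forall>n\<ge>k. \<psi> n y = 0" "\<And>x. \<exists>n. \<psi> n x > 0"
proof -
  have "\<exists>\<beta> C Q. (\<forall>y. smooth_near M y \<beta>) \<and> closed C \<and> C \<subseteq> A x \<and> (\<forall>y. y \<notin> C \<longrightarrow> \<beta> y = 0) \<and>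
      (\<forall>y. 0 \<le> \<beta> y \<and> \<beta> y \<le> 1) \<and> open Q \<and> x \<in> Q \<and> (\<forall>y\<in>Q. \<beta> y = 1)" for x
    using bump_function[OF A[of x]] unfolding eventually_nhds by metis
  then obtain \<beta> C Q where sm: "\<And>x y. smooth_near M y (\<beta> x)" and C: "\<And>x. closed (C x)" "\<And>x. C x \<subseteq> A x"
    "\<And>x y. y \<notin> C x \<Longrightarrow> \<beta> x y = 0" and b: "\<And>x y. 0 \<le> \<beta> x y" "\<And>x y. \<beta> x y \<le> 1"
    and Q: "\<And>x. open (Q x)" "\<And>x. x \<in> Q x" "\<And>x y. y \<in> Q x \<Longrightarrow> \<beta> x y = 1"
    by metis
  \<comment> \<open>Second countability enters through Lindelof: countably many of the sets on which
    a bump function equals 1 cover the manifold.\<close>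
  obtain F' where F': "F' \<subseteq> range Q" "countable F'" "\<Union>F' = \<Union>(range Q)"
    using Lindelof[of "range Q"] Q(1) by blast
  then obtain P where P: "countable P" "Q ` P = F'"
    by (metis countable_subset_image order_refl)
  have U: "(\<Union>x\<in>P. Q x) = UNIV"
    unfolding P(2) F'(3) using Q(2) by auto
  then have "P \<noteq> {}" by auto
  then have ran: "range (from_nat_into P) = P" by (rule range_from_nat_into[OF _ P(1)])
  define c where "c = from_nat_into P"
  define \<psi> where "\<psi> n y = \<beta> (c n) y * (\<Prod>k<n. 1 - \<beta> (c k) y)" for n y
  have cov: "\<exists>k. x \<in> Q (c k)" for x
  proof -
    have "x \<in> (\<Union>p\<in>range c. Q p)" using U ran by (simp add: c_def)
    then show ?thesis by auto
  qed
  show thesis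
  proof (rule that[of \<psi> c])
    show "smooth_near M y (\<psi> n)" for n y
      unfolding \<psi>_def[abs_def] by (intro smooth_near_mult smooth_near_prod smooth_near_diff sm smooth_near_const)
    show "0 \<le> \<psi> n y" for n y
      unfolding \<psi>_def using b by (intro mult_nonneg_nonneg prod_nonneg) auto
    show "\<forall>\<^sub>F z in nhds y. \<psi> n z = 0" if "y \<notin> A (c n)" for n y
    proof -
      have "\<forall>\<^sub>F z in nhds y. z \<in> - C (c n)"
        using C that by (intro eventually_nhds_in_open) auto
      then show ?thesis by eventually_elim (simp add: \<psi>_def C)
    qed
    show "y \<in> A (c n)" if "\<psi> n y \<noteq> 0" for n y
    proof -
      have "\<beta> (c n) y \<noteq> 0" using that by (auto simp: \<psi>_def)
      then have "y \<in> C (c n)" using C(3)[of y "c n"] by blast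
      then show ?thesis using C(2) by blast
    qed
    show "\<exists>k. \<forall>\<^sub>F y in nhds x. \<forall>n\<ge>k. \<psi> n y = 0" for x
    proof -
      obtain k where k: "x \<in> Q (c k)" using cov by blast
      have "\<forall>\<^sub>F y in nhds x. y \<in> Q (c k)" using k Q by (intro eventually_nhds_in_open)
      then have "\<forall>\<^sub>F y in nhds x. \<forall>n\<ge>Suc k. \<psi> n y = 0"
      proof eventually_elim
        case (elim y)
        have "(\<Prod>j<n. 1 - \<beta> (c j) y) = 0" if "n \<ge> Suc k" for n
          using that Q(3)[OF elim] by (intro prod_zero) (auto intro!: bexI[of _ k])
        then show ?case by (simp add: \<psi>_def)
      qed
      then show ?thesis by blast
    qed
    show "\<exists>n. \<psi> n x > 0" for x
    proof -
      have ex: "\<exists>n. \<beta> (c n) x > 0" using cov Q(3) by (metis zero_less_one)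
      \<comment> \<open>At the first index whose bump function is positive at \<open>x\<close>, all
        earlier factors equal 1.\<close>
      define n where "n = (LEAST n. \<beta> (c n) x > 0)"
      have "\<beta> (c n) x > 0" using LeastI_ex[OF ex] by (simp add: n_def)
      moreover have "\<beta> (c k) x = 0" if "k < n" for k
        using not_less_Least[of k "\<lambda>n. \<beta> (c n) x > 0"] that b(1)[of "c k" x] by (simp add: n_def)
      ultimately have "\<psi> n x > 0" by (simp add: \<psi>_def)
      then show ?thesis ..
    qed
  qed
qed

end

section \<open>Sections of vector bundles\<close>

text \<open>A basis indexed by numbers, in the shape of the frame condition of
  \<open>vector_bundle\<close>; the order of the vectors matters for top forms and wedges.\<close>

definition basis_of :: "'v::real_vector set \<Rightarrow> nat \<Rightarrow> (nat \<Rightarrow> 'v) \<Rightarrow> bool" where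
  "basis_of V n b \<longleftrightarrow> inj_on b {..<n} \<and> independent (b ` {..<n}) \<and> span (b ` {..<n}) = V"

lemma basis_of_subspace: "basis_of V n b \<Longrightarrow> subspace V"
  unfolding basis_of_def by (metis subspace_span)

lemma basis_of_in: "basis_of V n b \<Longrightarrow> i < n \<Longrightarrow> b i \<in> V"
  unfolding basis_of_def by (metis imageI lessThan_iff span_base)

lemma basis_of_expand:
  assumes "basis_of V n b" "v \<in> V"
  obtains c where "v = (\<Sum>i<n. c i *\<^sub>R b i)"
proof -
  have "v \<in> range (\<lambda>u. \<Sum>w\<in>b ` {..<n}. u w *\<^sub>R w)"
    using assms span_finite[of "b ` {..<n}"] by (simp add: basis_of_def)
  then obtain u where "v = (\<Sum>w\<in>b ` {..<n}. u w *\<^sub>R w)" by blast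
  also have "\<dots> = (\<Sum>i<n. u (b i) *\<^sub>R b i)"
    using assms(1) by (simp add: basis_of_def sum.reindex)
  finally show thesis using that[of "\<lambda>i. u (b i)"] by simp
qed

lemma basis_of_sum_in: "basis_of V n b \<Longrightarrow> (\<Sum>i<n. c i *\<^sub>R b i) \<in> V"
  using basis_of_subspace basis_of_in by (metis (no_types, lifting) lessThan_iff subspace_scale subspace_sum)

lemma basis_of_zero:
  assumes "basis_of V n b" "(\<Sum>i<n. c i *\<^sub>R b i) = 0" "i < n"
  shows "c i = 0"
proof -
  have b: "inj_on b {..<n}" "independent (b ` {..<n})" using assms(1) by (auto simp: basis_of_def)
  have "(\<Sum>w\<in>b ` {..<n}. c (the_inv_into {..<n} b w) *\<^sub>R w) = (\<Sum>i<n. c i *\<^sub>R b i)"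
    using b(1) by (simp add: sum.reindex the_inv_into_f_f)
  then have "c (the_inv_into {..<n} b (b i)) = 0"
    using independentD[OF b(2), of "b ` {..<n}" "\<lambda>w. c (the_inv_into {..<n} b w)" "b i"] assms by auto
  then show ?thesis using b(1) assms(3) by (simp add: the_inv_into_f_f)
qed

lemma basis_of_unique:
  assumes "basis_of V n b" "(\<Sum>i<n. c i *\<^sub>R b i) = (\<Sum>i<n. d i *\<^sub>R b i)" "i < n"
  shows "c i = d i"
  using basis_of_zero[OF assms(1), of "\<lambda>i. c i - d i" i] assms(2,3)
  by (simp add: scaleR_diff_left sum_subtractf)

section \<open>Smooth sections near a point\<close>

definition sec_near ::
  "('m::topological_space, 'b::euclidean_space) manifold \<Rightarrow> ('m, 'v::real_vector, 'z) vbundle_scheme \<Rightarrow>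
   'm \<Rightarrow> ('m \<Rightarrow> 'v) \<Rightarrow> bool" where
  "sec_near M E x s \<longleftrightarrow> (\<exists>W. open W \<and> x \<in> W \<and> smooth_section M E W s)"

locale vbun = smooth_mfd M
  for M :: "('m::{t2_space,second_countable_topology}, 'b::euclidean_space) manifold" +
  fixes E :: "('m, 'v::real_vector, 'z) vbundle_scheme"
  assumes vector_bundle: "vector_bundle M E"
begin

abbreviation "rk \<equiv> brank E"

lemma frame_cover: obtains U e where "(U, e) \<in> frames E" "x \<in> U"
proof -
  have "x \<in> (\<Union>(U, e)\<in>frames E. U)"
    using vector_bundle unfolding vector_bundle_def by simp
  then show thesis using that by auto
qed

lemma fiber_basis_exists: "\<exists>b. basis_of (fiber E x) rk b"
proof -
  obtain U e where "(U, e) \<in> frames E" "x \<in> U" using frame_cover .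
  then have "basis_of (fiber E x) rk (\<lambda>i. e i x)"
    using vector_bundle unfolding vector_bundle_def basis_of_def by fast
  then show ?thesis by (intro exI[of _ "\<lambda>i. e i x"])
qed

lemma fiber_subspace: "subspace (fiber E x)"
  using fiber_basis_exists basis_of_subspace by blast

context
  fixes U e
  assumes frame: "(U, e) \<in> frames E"
begin

lemma frame_open: "open U"
  using vector_bundle frame unfolding vector_bundle_def by fast

lemma frame_basis: "x \<in> U \<Longrightarrow> basis_of (fiber E x) rk (\<lambda>i. e i x)"
  using vector_bundle frame unfolding vector_bundle_def basis_of_def by fast

lemma frame_section: "i < rk \<Longrightarrow> smooth_section M E U (e i)"
  using vector_bundle frame unfolding vector_bundle_def by fast

lemma frame_eventually: "x \<in> U \<Longrightarrow> \<forall>\<^sub>F y in nhds x. y \<in> U"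
  using eventually_nhds_in_open frame_open by blast

text \<open>One frame decides smoothness of a section. Coefficients in another frame are obtained
  through the transition coefficients, which are smooth because frame sections are required to be
  smooth in every frame.\<close>

lemma sec_near_frame:
  assumes x: "x \<in> U"
  shows "sec_near M E x s \<longleftrightarrow>
    (\<exists>c. (\<forall>i<rk. smooth_near M x (c i)) \<and> (\<forall>\<^sub>F y in nhds x. s y = (\<Sum>i<rk. c i y *\<^sub>R e i y)))"
proof
  assume "sec_near M E x s"
  then obtain W where W: "open W" "x \<in> W" "smooth_section M E W s"
    unfolding sec_near_def by blast
  then obtain c where c: "\<forall>i<rk. smooth_fun M (U \<inter> W) (c i)"
    "\<forall>x\<in>U \<inter> W. s x = (\<Sum>i<rk. c i x *\<^sub>R e i x)"
    using frame unfolding smooth_section_def by fast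
  have o: "open (U \<inter> W)" using frame_open W by blast
  have "\<forall>\<^sub>F y in nhds x. y \<in> U \<inter> W" using o x W by (intro eventually_nhds_in_open) auto
  then have "\<forall>\<^sub>F y in nhds x. s y = (\<Sum>i<rk. c i y *\<^sub>R e i y)"
    by eventually_elim (use c in auto)
  moreover have "\<forall>i<rk. smooth_near M x (c i)"
    using c(1) smooth_fun_iff[OF o] x W by blast
  ultimately show "\<exists>c. (\<forall>i<rk. smooth_near M x (c i)) \<and>
      (\<forall>\<^sub>F y in nhds x. s y = (\<Sum>i<rk. c i y *\<^sub>R e i y))" by blast
next
  assume "\<exists>c. (\<forall>i<rk. smooth_near M x (c i)) \<and>
      (\<forall>\<^sub>F y in nhds x. s y = (\<Sum>i<rk. c i y *\<^sub>R e i y))"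
  then obtain c where c: "\<forall>i<rk. smooth_near M x (c i)"
    and s: "\<forall>\<^sub>F y in nhds x. s y = (\<Sum>i<rk. c i y *\<^sub>R e i y)" by blast
  have "\<forall>\<^sub>F y in nhds x. \<forall>i\<in>{..<rk}. smooth_near M y (c i)"
    using c by (intro eventually_ball_finite) (auto intro: smooth_near_eventually)
  with s frame_eventually[OF x] have "\<forall>\<^sub>F y in nhds x. y \<in> U \<and> (\<forall>i<rk. smooth_near M y (c i)) \<and>
      s y = (\<Sum>i<rk. c i y *\<^sub>R e i y)"
    by eventually_elim simp
  then obtain W where W: "open W" "x \<in> W" and WP: "\<And>y. y \<in> W \<Longrightarrow> y \<in> U"
    "\<And>y i. y \<in> W \<Longrightarrow> i < rk \<Longrightarrow> smooth_near M y (c i)"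
    "\<And>y. y \<in> W \<Longrightarrow> s y = (\<Sum>i<rk. c i y *\<^sub>R e i y)"
    unfolding eventually_nhds by blast
  have "smooth_section M E W s"
    unfolding smooth_section_def
  proof (intro conjI ballI, goal_cases)
    case (1 y)
    then show ?case using WP basis_of_sum_in[OF frame_basis] by metis
  next
    case (2 F)
    obtain U' e' where F: "F = (U', e')" by (cases F)
    have "\<exists>d. (\<forall>j<rk. smooth_fun M (U' \<inter> U) (d j)) \<and>
        (\<forall>y\<in>U' \<inter> U. e i y = (\<Sum>j<rk. d j y *\<^sub>R e' j y))" if "i < rk" for i
      using frame_section[OF that] 2 F unfolding smooth_section_def by fast
    then obtain d where d: "\<And>i j. i < rk \<Longrightarrow> j < rk \<Longrightarrow> smooth_fun M (U' \<inter> U) (d i j)"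
      "\<And>i y. i < rk \<Longrightarrow> y \<in> U' \<inter> U \<Longrightarrow> e i y = (\<Sum>j<rk. d i j y *\<^sub>R e' j y)"
      by metis
    have oU': "open U'" using vector_bundle 2 F unfolding vector_bundle_def by fast
    let ?c = "\<lambda>j y. \<Sum>i<rk. c i y * d i j y"
    have "smooth_fun M (U' \<inter> W) (?c j)" if "j < rk" for j
    proof -
      have "smooth_near M y (?c j)" if y: "y \<in> U' \<inter> W" for y
      proof (intro smooth_near_sum smooth_near_mult)
        fix i assume i: "i \<in> {..<rk}"
        have "open (U' \<inter> U)" using oU' frame_open by blast
        then have "\<forall>y\<in>U' \<inter> U. smooth_near M y (d i j)"
          using d(1)[OF _ \<open>j < rk\<close>, of i] smooth_fun_iff i by simp
        then show "smooth_near M y (d i j)" using y WP(1) by blast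
        show "smooth_near M y (c i)" using WP(2) y i by simp
      qed
      then show ?thesis using smooth_fun_iff[of "U' \<inter> W"] oU' W by blast
    qed
    moreover have "s y = (\<Sum>j<rk. ?c j y *\<^sub>R e' j y)" if y: "y \<in> U' \<inter> W" for y
    proof -
      have "s y = (\<Sum>i<rk. c i y *\<^sub>R (\<Sum>j<rk. d i j y *\<^sub>R e' j y))"
        using WP y d(2) by simp
      also have "\<dots> = (\<Sum>i<rk. \<Sum>j<rk. (c i y * d i j y) *\<^sub>R e' j y)"
        by (simp add: scaleR_sum_right)
      also have "\<dots> = (\<Sum>j<rk. ?c j y *\<^sub>R e' j y)"
        by (subst sum.swap) (simp add: scaleR_sum_left)
      finally show ?thesis .
    qed
    ultimately show ?case unfolding F prod.case by (intro exI[of _ ?c]) simp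
  qed
  then show "sec_near M E x s" unfolding sec_near_def using W by blast
qed

end

lemma sec_near_fiber: "sec_near M E x s \<Longrightarrow> s x \<in> fiber E x"
  unfolding sec_near_def smooth_section_def by blast

lemma smooth_section_iff:
  assumes W: "open W"
  shows "smooth_section M E W s \<longleftrightarrow> (\<forall>x\<in>W. sec_near M E x s)"
proof
  assume "smooth_section M E W s"
  then show "\<forall>x\<in>W. sec_near M E x s" using W unfolding sec_near_def by blast
next
  assume *: "\<forall>x\<in>W. sec_near M E x s"
  show "smooth_section M E W s"
    unfolding smooth_section_def
  proof (intro conjI ballI, goal_cases)
    case (1 x)
    then show ?case using * sec_near_fiber by blast
  next
    case (2 F)
    obtain U e where F: "F = (U, e)" "(U, e) \<in> frames E" using 2 by (cases F) auto
    have oUW: "open (U \<inter> W)" using frame_open[OF F(2)] W by blast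
    \<comment> \<open>Coefficients are chosen point by point. Linear independence identifies them
      near each point with smooth ones, so the choice is smooth after all.\<close>
    define c where "c i x = (SOME c. s x = (\<Sum>i<rk. c i *\<^sub>R e i x)) i" for i x
    have c: "s x = (\<Sum>i<rk. c i x *\<^sub>R e i x)" if "x \<in> U \<inter> W" for x
    proof -
      have "s x \<in> fiber E x" using that * sec_near_fiber by blast
      then have "\<exists>c. s x = (\<Sum>i<rk. c i *\<^sub>R e i x)"
        using basis_of_expand[OF frame_basis[OF F(2)], of x "s x"] that by blast
      then have "s x = (\<Sum>i<rk. (SOME c. s x = (\<Sum>i<rk. c i *\<^sub>R e i x)) i *\<^sub>R e i x)"
        by (rule someI_ex)
      then show ?thesis unfolding c_def .
    qed
    have "smooth_near M x (c i)" if x: "x \<in> U \<inter> W" and i: "i < rk" for i x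
    proof -
      obtain d where d: "\<forall>i<rk. smooth_near M x (d i)" "\<forall>\<^sub>F y in nhds x. s y = (\<Sum>i<rk. d i y *\<^sub>R e i y)"
        using * x sec_near_frame[OF F(2)] by blast
      have "\<forall>\<^sub>F y in nhds x. y \<in> U \<inter> W" using oUW x by (rule eventually_nhds_in_open)
      with d(2) have "\<forall>\<^sub>F y in nhds x. d i y = c i y"
      proof eventually_elim
        case (elim y)
        then have "(\<Sum>i<rk. d i y *\<^sub>R e i y) = (\<Sum>i<rk. c i y *\<^sub>R e i y)" using c[of y] by simp
        then show ?case using basis_of_unique[OF frame_basis[OF F(2)] _ i, of y "\<lambda>i. d i y" "\<lambda>i. c i y"] elim
          by blast
      qed
      then show ?thesis using d(1) i smooth_near_cong by blast
    qed
    then have "\<forall>i<rk. smooth_fun M (U \<inter> W) (c i)" using smooth_fun_iff[OF oUW] by blast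
    then show ?case unfolding F prod.case using c by (intro exI[of _ c]) simp
  qed
qed

lemma Sec_iff: "s \<in> Sec M E \<longleftrightarrow> (\<forall>x. sec_near M E x s)"
  by (simp add: smooth_section_iff)

lemma SecD: "s \<in> Sec M E \<Longrightarrow> sec_near M E x s"
  using Sec_iff by blast

lemma Sec_fiber: "s \<in> Sec M E \<Longrightarrow> s x \<in> fiber E x"
  using SecD sec_near_fiber by blast

lemma sec_near_eventually: "sec_near M E x s \<Longrightarrow> \<forall>\<^sub>F y in nhds x. sec_near M E y s"
  unfolding sec_near_def eventually_nhds by blast

lemma frame_sec_near: "(U, e) \<in> frames E \<Longrightarrow> x \<in> U \<Longrightarrow> i < rk \<Longrightarrow> sec_near M E x (e i)"
  unfolding sec_near_def using frame_section[of U e i] frame_open[of U e] by (intro exI[of _ U]) simp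

lemma sec_near_transform:
  assumes "sec_near M E x s" "\<forall>\<^sub>F y in nhds x. s y = t y"
  shows "sec_near M E x t"
proof -
  obtain U e where F: "(U, e) \<in> frames E" "x \<in> U" using frame_cover .
  then obtain c where c: "\<forall>i<rk. smooth_near M x (c i)" "\<forall>\<^sub>F y in nhds x. s y = (\<Sum>i<rk. c i y *\<^sub>R e i y)"
    using assms sec_near_frame by blast
  from assms(2) c(2) have "\<forall>\<^sub>F y in nhds x. t y = (\<Sum>i<rk. c i y *\<^sub>R e i y)"
    by eventually_elim simp
  then show ?thesis using c(1) sec_near_frame[OF F] by blast
qed

lemma sec_near_add:
  assumes "sec_near M E x s" "sec_near M E x t"
  shows "sec_near M E x (\<lambda>y. s y + t y)"
proof -
  obtain U e where F: "(U, e) \<in> frames E" "x \<in> U" using frame_cover .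
  obtain c where c: "\<forall>i<rk. smooth_near M x (c i)" "\<forall>\<^sub>F y in nhds x. s y = (\<Sum>i<rk. c i y *\<^sub>R e i y)"
    using assms sec_near_frame[OF F] by blast
  obtain d where d: "\<forall>i<rk. smooth_near M x (d i)" "\<forall>\<^sub>F y in nhds x. t y = (\<Sum>i<rk. d i y *\<^sub>R e i y)"
    using assms sec_near_frame[OF F] by blast
  from c(2) d(2) have "\<forall>\<^sub>F y in nhds x. s y + t y = (\<Sum>i<rk. (c i y + d i y) *\<^sub>R e i y)"
    by eventually_elim (simp add: scaleR_add_left sum.distrib)
  then show ?thesis
    unfolding sec_near_frame[OF F] using c(1) d(1)
    by (intro exI[of _ "\<lambda>i y. c i y + d i y"]) auto
qed

lemma sec_near_scale:
  assumes "smooth_near M x f" "sec_near M E x s"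
  shows "sec_near M E x (\<lambda>y. f y *\<^sub>R s y)"
proof -
  obtain U e where F: "(U, e) \<in> frames E" "x \<in> U" using frame_cover .
  obtain c where c: "\<forall>i<rk. smooth_near M x (c i)" "\<forall>\<^sub>F y in nhds x. s y = (\<Sum>i<rk. c i y *\<^sub>R e i y)"
    using assms sec_near_frame[OF F] by blast
  from c(2) have "\<forall>\<^sub>F y in nhds x. f y *\<^sub>R s y = (\<Sum>i<rk. (f y * c i y) *\<^sub>R e i y)"
    by eventually_elim (simp add: scaleR_sum_right)
  then show ?thesis
    unfolding sec_near_frame[OF F] using c(1) assms(1)
    by (intro exI[of _ "\<lambda>i y. f y * c i y"]) auto
qed

lemma sec_near_zero: "sec_near M E x (\<lambda>y. 0)"
proof -
  obtain U e where F: "(U, e) \<in> frames E" "x \<in> U" using frame_cover .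
  then show ?thesis unfolding sec_near_frame[OF F] by (intro exI[of _ "\<lambda>i y. 0"]) auto
qed

lemma sec_near_sum:
  "(\<And>i. i \<in> I \<Longrightarrow> sec_near M E x (s i)) \<Longrightarrow> sec_near M E x (\<lambda>y. \<Sum>i\<in>I. s i y)"
  by (induction I rule: infinite_finite_induct) (auto intro: sec_near_zero sec_near_add)

lemma Sec_add: "X \<in> Sec M E \<Longrightarrow> Y \<in> Sec M E \<Longrightarrow> (\<lambda>y. X y + Y y) \<in> Sec M E"
  unfolding Sec_iff by (blast intro: sec_near_add)

lemma Sec_scale: "smooth_fun M UNIV f \<Longrightarrow> X \<in> Sec M E \<Longrightarrow> (\<lambda>y. f y *\<^sub>R X y) \<in> Sec M E"
  unfolding Sec_iff smooth_fun_UNIV by (blast intro: sec_near_scale)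

lemma Sec_diff:
  assumes "X \<in> Sec M E" "Y \<in> Sec M E"
  shows "(\<lambda>y. X y - Y y) \<in> Sec M E"
proof -
  have "smooth_fun M UNIV (\<lambda>y. -1)" by (simp add: smooth_fun_UNIV)
  from Sec_add[OF assms(1) Sec_scale[OF this assms(2)]] show ?thesis by simp
qed

text \<open>A section defined near a point becomes global after multiplication by a bump function,
  without change of its germ. The axioms for the bracket concern global sections, so local
  computations with brackets go through this extension.\<close>

lemma Sec_extend:
  assumes "sec_near M E x s"
  obtains S where "S \<in> Sec M E" "\<forall>\<^sub>F y in nhds x. S y = s y"
proof -
  obtain W where W: "open W" "x \<in> W" "smooth_section M E W s"
    using assms unfolding sec_near_def by blast
  obtain \<beta> C where \<beta>: "\<And>y. smooth_near M y \<beta>" "closed C" "C \<subseteq> W" "\<And>y. y \<notin> C \<Longrightarrow> \<beta> y = 0"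
    "\<forall>\<^sub>F y in nhds x. \<beta> y = 1"
    using bump_function[OF W(1,2)] by metis
  define S where "S y = \<beta> y *\<^sub>R s y" for y
  have "sec_near M E y S" for y
  proof (cases "y \<in> W")
    case True
    then show ?thesis
      unfolding S_def[abs_def] using sec_near_scale[OF \<beta>(1)] W smooth_section_iff by blast
  next
    case False
    then have "\<forall>\<^sub>F z in nhds y. z \<in> - C" using \<beta> by (intro eventually_nhds_in_open) auto
    then have "\<forall>\<^sub>F z in nhds y. 0 = S z" by eventually_elim (simp add: S_def \<beta>)
    with sec_near_zero show ?thesis by (rule sec_near_transform)
  qed
  then have "S \<in> Sec M E" using Sec_iff by blast
  moreover from \<beta>(5) have "\<forall>\<^sub>F y in nhds x. S y = s y" by eventually_elim (simp add: S_def)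
  ultimately show thesis using that by blast
qed

lemma smooth_fun_extend:
  assumes "smooth_near M x f"
  obtains g where "smooth_fun M UNIV g" "\<forall>\<^sub>F y in nhds x. g y = f y"
proof -
  obtain W where W: "open W" "x \<in> W" "\<And>y. y \<in> W \<Longrightarrow> smooth_near M y f"
    using smooth_near_eventually[OF assms] unfolding eventually_nhds by blast
  obtain \<beta> C where \<beta>: "\<And>y. smooth_near M y \<beta>" "closed C" "C \<subseteq> W" "\<And>y. y \<notin> C \<Longrightarrow> \<beta> y = 0"
    "\<forall>\<^sub>F y in nhds x. \<beta> y = 1"
    using bump_function[OF W(1,2)] by metis
  have "smooth_near M y (\<lambda>y. \<beta> y * f y)" for y
  proof (cases "y \<in> W")
    case True
    then show ?thesis using smooth_near_mult \<beta>(1) W(3) by blast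
  next
    case False
    then have "\<forall>\<^sub>F z in nhds y. z \<in> - C" using \<beta> by (intro eventually_nhds_in_open) auto
    then have "\<forall>\<^sub>F z in nhds y. 0 = \<beta> z * f z" by eventually_elim (simp add: \<beta>)
    with smooth_near_const show ?thesis by (rule smooth_near_transform)
  qed
  then have "smooth_fun M UNIV (\<lambda>y. \<beta> y * f y)" using smooth_fun_UNIV by blast
  moreover from \<beta>(5) have "\<forall>\<^sub>F y in nhds x. \<beta> y * f y = f y" by eventually_elim simp
  ultimately show thesis by (rule that)
qed

lemma Sec_through:
  assumes "v \<in> fiber E x"
  obtains X where "X \<in> Sec M E" "X x = v"
proof -
  obtain U e where F: "(U, e) \<in> frames E" "x \<in> U" using frame_cover .
  obtain c where c: "v = (\<Sum>i<rk. c i *\<^sub>R e i x)"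
    using basis_of_expand[OF frame_basis[OF F] assms] .
  have "sec_near M E x (\<lambda>y. \<Sum>i<rk. c i *\<^sub>R e i y)"
    by (intro sec_near_sum sec_near_scale smooth_near_const frame_sec_near[OF F]) simp
  then obtain X where "X \<in> Sec M E" "\<forall>\<^sub>F y in nhds x. X y = (\<Sum>i<rk. c i *\<^sub>R e i y)"
    by (rule Sec_extend)
  then show thesis using that[of X] c eventually_nhds_x_imp_x by force
qed

lemma Sec_through_list:
  assumes "set vs \<subseteq> fiber E x"
  obtains Xs where "set Xs \<subseteq> Sec M E" "eval_at x Xs = vs"
proof -
  have "\<exists>Xs. set Xs \<subseteq> Sec M E \<and> eval_at x Xs = vs"
    using assms
  proof (induction vs)
    case (Cons v vs)
    then obtain Xs where Xs: "set Xs \<subseteq> Sec M E" "eval_at x Xs = vs" by auto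
    have "v \<in> fiber E x" using Cons.prems by simp
    then obtain X where "X \<in> Sec M E" "X x = v" by (rule Sec_through)
    with Xs have "set (X # Xs) \<subseteq> Sec M E \<and> eval_at x (X # Xs) = v # vs" by simp
    then show ?case ..
  qed (auto intro: exI[of _ "[]"])
  then show thesis using that by blast
qed

text \<open>Provides sections with which one can both form brackets and compute in a frame near
  \<open>x\<close>.\<close>

lemma frame_extend:
  assumes F: "(U, e) \<in> frames E" "x \<in> U"
  obtains Y where "\<forall>i<rk. Y i \<in> Sec M E" "\<forall>\<^sub>F y in nhds x. \<forall>i<rk. Y i y = e i y"
proof -
  have "\<exists>Y. Y \<in> Sec M E \<and> (\<forall>\<^sub>F y in nhds x. Y y = e i y)" if "i < rk" for i
    using Sec_extend[OF frame_sec_near[OF F that]] by blast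
  then obtain Y where Y: "\<And>i. i < rk \<Longrightarrow> Y i \<in> Sec M E"
    "\<And>i. i < rk \<Longrightarrow> \<forall>\<^sub>F y in nhds x. Y i y = e i y" by metis
  have "\<forall>\<^sub>F y in nhds x. \<forall>i\<in>{..<rk}. Y i y = e i y"
    using Y(2) by (intro eventually_ball_finite) auto
  then show thesis using that[of Y] Y(1) by (simp add: Ball_def)
qed

text \<open>A section vanishing at \<open>x\<close> is near \<open>x\<close> a combination of frame sections with coefficients
  vanishing at \<open>x\<close>; bump functions make this global.\<close>

lemma tensorial_vanish:
  fixes K :: "('m \<Rightarrow> 'v) \<Rightarrow> real"
  assumes add: "\<And>X Y. X \<in> Sec M E \<Longrightarrow> Y \<in> Sec M E \<Longrightarrow> K (\<lambda>y. X y + Y y) = K X + K Y"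
    and scale: "\<And>f X. smooth_fun M UNIV f \<Longrightarrow> X \<in> Sec M E \<Longrightarrow> K (\<lambda>y. f y *\<^sub>R X y) = f x * K X"
    and X: "X \<in> Sec M E" "X x = 0"
  shows "K X = 0"
proof -
  \<comment> \<open>Linearity over functions implies locality: \<open>Y\<close> equals
    \<open>1 - \<beta>\<close> times \<open>Y\<close>, and \<open>1 - \<beta>\<close> vanishes at
    \<open>x\<close>.\<close>
  have local: "K Y = 0" if Y: "Y \<in> Sec M E" "\<forall>\<^sub>F y in nhds x. Y y = 0" for Y
  proof -
    obtain W where W: "open W" "x \<in> W" "\<And>y. y \<in> W \<Longrightarrow> Y y = 0"
      using Y(2) unfolding eventually_nhds by blast
    obtain \<beta> C where \<beta>: "\<And>y. smooth_near M y \<beta>" "C \<subseteq> W" "\<And>y. y \<notin> C \<Longrightarrow> \<beta> y = 0"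
      "\<forall>\<^sub>F y in nhds x. \<beta> y = 1"
      using bump_function[OF W(1,2)] by metis
    have "smooth_fun M UNIV (\<lambda>y. 1 - \<beta> y)"
      using \<beta>(1) by (auto simp: smooth_fun_UNIV)
    moreover have "(\<lambda>y. (1 - \<beta> y) *\<^sub>R Y y) = Y"
    proof
      fix y show "(1 - \<beta> y) *\<^sub>R Y y = Y y"
        using W(3)[of y] \<beta>(2) \<beta>(3)[of y] by (cases "y \<in> C") auto
    qed
    ultimately have "K Y = (1 - \<beta> x) * K Y" using scale[of "\<lambda>y. 1 - \<beta> y" Y] Y(1) by simp
    then show ?thesis using eventually_nhds_x_imp_x[OF \<beta>(4)] by simp
  qed
  obtain U e where F: "(U, e) \<in> frames E" "x \<in> U" using frame_cover .
  obtain c where c: "\<forall>i<rk. smooth_near M x (c i)" "\<forall>\<^sub>F y in nhds x. X y = (\<Sum>i<rk. c i y *\<^sub>R e i y)"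
    using SecD[OF X(1)] sec_near_frame[OF F] by blast
  have c0: "c i x = 0" if "i < rk" for i
    using basis_of_zero[OF frame_basis[OF F], of "\<lambda>i. c i x" i] eventually_nhds_x_imp_x[OF c(2)] X(2) that
    by simp
  obtain Y where Y: "\<forall>i<rk. Y i \<in> Sec M E" "\<forall>\<^sub>F y in nhds x. \<forall>i<rk. Y i y = e i y"
    using frame_extend[OF F] .
  have "\<exists>g. smooth_fun M UNIV g \<and> (\<forall>\<^sub>F y in nhds x. g y = c i y)" if "i < rk" for i
    using smooth_fun_extend[of x "c i"] c(1) that by metis
  then obtain g where g: "\<And>i. i < rk \<Longrightarrow> smooth_fun M UNIV (g i)"
    "\<And>i. i < rk \<Longrightarrow> \<forall>\<^sub>F y in nhds x. g i y = c i y" by metis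
  have g': "\<forall>\<^sub>F y in nhds x. \<forall>i\<in>{..<rk}. g i y = c i y"
    using g(2) by (intro eventually_ball_finite) auto
  define Z where "Z y = (\<Sum>i<rk. g i y *\<^sub>R Y i y)" for y
  have Z: "(\<lambda>y. \<Sum>i\<in>I. g i y *\<^sub>R Y i y) \<in> Sec M E \<and> K (\<lambda>y. \<Sum>i\<in>I. g i y *\<^sub>R Y i y) = 0"
    if "I \<subseteq> {..<rk}" for I
    using finite_subset[OF that finite_lessThan] that
  proof (induction I rule: finite_induct)
    case empty
    have "(\<lambda>y. 0) \<in> Sec M E" using sec_near_zero Sec_iff by blast
    then show ?case using local[of "\<lambda>y. 0"] by simp
  next
    case (insert i I)
    have i: "i < rk" using insert by simp
    have "K (\<lambda>y. g i y *\<^sub>R Y i y) = 0"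
      using scale[OF g(1)[OF i], of "Y i"] Y(1) i eventually_nhds_x_imp_x[OF g(2)[OF i]] c0[OF i] by simp
    moreover have "(\<lambda>y. g i y *\<^sub>R Y i y) \<in> Sec M E" using Sec_scale g(1) Y(1) i by blast
    ultimately show ?case
      using insert add[of "\<lambda>y. g i y *\<^sub>R Y i y" "\<lambda>y. \<Sum>i\<in>I. g i y *\<^sub>R Y i y"]
        Sec_add[of "\<lambda>y. g i y *\<^sub>R Y i y" "\<lambda>y. \<Sum>i\<in>I. g i y *\<^sub>R Y i y"] by simp
  qed
  have Z1: "Z \<in> Sec M E" "K Z = 0" using Z[of "{..<rk}"] unfolding Z_def[abs_def] by auto
  have "\<forall>\<^sub>F y in nhds x. X y - Z y = 0"
    using c(2) Y(2) g' by eventually_elim (simp add: Z_def)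
  then have "K (\<lambda>y. X y - Z y) = 0" using local Sec_diff[OF X(1) Z1(1)] by blast
  then show ?thesis using add[OF Sec_diff[OF X(1) Z1(1)] Z1(1)] Z1(2) by simp
qed

end

section \<open>Alternating forms\<close>

lemma alt_forms_outside: "\<omega> \<in> alt_forms V k \<Longrightarrow> \<not> (length vs = k \<and> set vs \<subseteq> V) \<Longrightarrow> \<omega> vs = 0"
  unfolding alt_forms_def by blast

lemma alt_formsD:
  assumes "\<omega> \<in> alt_forms V k" "length vs = k" "set vs \<subseteq> V" "i < k" "u \<in> V"
  shows "w \<in> V \<Longrightarrow> \<omega> (vs[i := u + w]) = \<omega> (vs[i := u]) + \<omega> (vs[i := w])"
    and "\<omega> (vs[i := c *\<^sub>R u]) = c * \<omega> (vs[i := u])"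
  using assms unfolding alt_forms_def by auto

text \<open>Holds for arbitrary \<open>ps\<close> and \<open>qs\<close>: at a wrong length or with
  an entry outside \<open>V\<close> all three values are the default 0.\<close>

lemma alt_forms_add:
  assumes w: "\<omega> \<in> alt_forms V k" and uv: "u \<in> V" "v \<in> V" "u + v \<in> V"
  shows "\<omega> (ps @ (u + v) # qs) = \<omega> (ps @ u # qs) + \<omega> (ps @ v # qs)"
proof (cases "length (ps @ u # qs) = k \<and> set (ps @ u # qs) \<subseteq> V")
  case True
  then have l: "length (ps @ u # qs) = k" "set (ps @ u # qs) \<subseteq> V" by auto
  have i: "length ps < k" using l(1) by simp
  from alt_formsD(1)[OF w l i uv(1,2)] show ?thesis by (simp add: list_update_append)
next
  case False
  then show ?thesis
    using uv alt_forms_outside[OF w, of "ps @ u # qs"] alt_forms_outside[OF w, of "ps @ v # qs"]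
      alt_forms_outside[OF w, of "ps @ (u + v) # qs"] by auto
qed

lemma alt_forms_scale:
  assumes w: "\<omega> \<in> alt_forms V k" and u: "u \<in> V" "c *\<^sub>R u \<in> V"
  shows "\<omega> (ps @ (c *\<^sub>R u) # qs) = c * \<omega> (ps @ u # qs)"
proof (cases "length (ps @ u # qs) = k \<and> set (ps @ u # qs) \<subseteq> V")
  case True
  then have l: "length (ps @ u # qs) = k" "set (ps @ u # qs) \<subseteq> V" by auto
  have i: "length ps < k" using l(1) by simp
  from alt_formsD(2)[OF w l i u(1)] show ?thesis by (simp add: list_update_append)
next
  case False
  then show ?thesis
    using u alt_forms_outside[OF w, of "ps @ u # qs"]
      alt_forms_outside[OF w, of "ps @ (c *\<^sub>R u) # qs"] by auto
qed

lemma alt_forms_repeat: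
  assumes w: "\<omega> \<in> alt_forms V k" and d: "\<not> distinct vs"
  shows "\<omega> vs = 0"
proof (cases "length vs = k \<and> set vs \<subseteq> V")
  case True
  then show ?thesis
    using w d unfolding alt_forms_def distinct_conv_nth by auto
next
  case False
  then show ?thesis using alt_forms_outside[OF w] by blast
qed

lemma alt_forms_zero_arg: "\<omega> \<in> alt_forms V k \<Longrightarrow> subspace V \<Longrightarrow> \<omega> (ps @ 0 # qs) = 0"
  using alt_forms_scale[of \<omega> V k 0 0 ps qs] subspace_0 by auto

lemma alt_forms_sum:
  assumes "\<omega> \<in> alt_forms V k" "subspace V" "\<And>i. i \<in> I \<Longrightarrow> b i \<in> V"
  shows "\<omega> (ps @ (\<Sum>i\<in>I. c i *\<^sub>R b i) # qs) = (\<Sum>i\<in>I. c i * \<omega> (ps @ b i # qs))"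
  using assms(3)
proof (induction I rule: infinite_finite_induct)
  case (insert i I)
  have "(\<Sum>i\<in>I. c i *\<^sub>R b i) \<in> V" "c i *\<^sub>R b i \<in> V"
    using insert assms(2) by (auto intro!: subspace_sum subspace_scale)
  then show ?case
    using insert assms alt_forms_add[OF assms(1), of "c i *\<^sub>R b i" "\<Sum>i\<in>I. c i *\<^sub>R b i"]
      alt_forms_scale[OF assms(1), of "b i" "c i"] subspace_add[OF assms(2)] by simp
qed (use assms alt_forms_zero_arg in auto)

text \<open>Polarization of the vanishing on the repeated argument \<open>x + y\<close>; if one of
  the vectors is outside \<open>V\<close>, both sides are the default 0.\<close>

lemma alt_forms_swap:
  assumes w: "\<omega> \<in> alt_forms V k" and V: "subspace V"
  shows "\<omega> (ps @ x # y # qs) = - \<omega> (ps @ y # x # qs)"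
proof (cases "x \<in> V \<and> y \<in> V")
  case True
  then have xy: "x \<in> V" "y \<in> V" "x + y \<in> V" using V by (auto intro: subspace_add)
  have "0 = \<omega> (ps @ (x + y) # (x + y) # qs)"
    by (rule alt_forms_repeat[OF w, symmetric]) simp
  also have "\<dots> = \<omega> (ps @ x # (x + y) # qs) + \<omega> (ps @ y # (x + y) # qs)"
    by (rule alt_forms_add[OF w xy])
  also have "\<omega> (ps @ x # (x + y) # qs) = \<omega> (ps @ x # x # qs) + \<omega> (ps @ x # y # qs)"
    using alt_forms_add[OF w xy, of "ps @ [x]"] by simp
  also have "\<omega> (ps @ y # (x + y) # qs) = \<omega> (ps @ y # x # qs) + \<omega> (ps @ y # y # qs)"
    using alt_forms_add[OF w xy, of "ps @ [y]"] by simp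
  also have "\<omega> (ps @ x # x # qs) = 0"
    by (auto intro: alt_forms_repeat[OF w])
  also have "\<omega> (ps @ y # y # qs) = 0"
    by (auto intro: alt_forms_repeat[OF w])
  finally show ?thesis by simp
next
  case False
  then show ?thesis
    using alt_forms_outside[OF w, of "ps @ x # y # qs"] alt_forms_outside[OF w, of "ps @ y # x # qs"]
    by auto
qed

lemma alt_forms_move:
  assumes w: "\<omega> \<in> alt_forms V k" and V: "subspace V"
  shows "\<omega> (ps @ as @ x # bs) = (-1) ^ length as * \<omega> (ps @ x # as @ bs)"
proof (induction as arbitrary: ps)
  case (Cons a as)
  have "\<omega> (ps @ (a # as) @ x # bs) = (-1) ^ length as * \<omega> (ps @ a # x # as @ bs)"
    using Cons[of "ps @ [a]"] by simp
  then show ?case using alt_forms_swap[OF w V, of ps a x] by simp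
qed simp

text \<open>The constant is chosen before the space, the form and the vectors, so that one sign
  serves for all of them; this uniformity allows it to be applied pointwise to a whole field of
  forms. The prefix \<open>ps\<close> carries the induction.\<close>

lemma alt_forms_perm:
  assumes "mset I = mset J"
  shows "\<exists>c::real. \<forall>V k \<omega> (b :: 'a \<Rightarrow> 'v::real_vector) ps. subspace V \<longrightarrow> \<omega> \<in> alt_forms V k \<longrightarrow>
    \<omega> (map b (ps @ I)) = c * \<omega> (map b (ps @ J))"
  using assms
proof (induction I arbitrary: J)
  case Nil
  then show ?case by (intro exI[of _ 1]) simp
next
  case (Cons i I)
  then have "i \<in> set J" by (metis list.set_intros(1) mset_eq_setD)
  then obtain as bs where J: "J = as @ i # bs" by (meson split_list)
  then have "mset I = mset (as @ bs)" using Cons.prems by simp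
  then obtain c :: real where c: "\<And>V k \<omega> (b :: 'a \<Rightarrow> 'v) ps. subspace V \<Longrightarrow> \<omega> \<in> alt_forms V k \<Longrightarrow>
      \<omega> (map b (ps @ I)) = c * \<omega> (map b (ps @ as @ bs))" using Cons.IH by blast
  have "\<omega> (map b (ps @ i # I)) = (c * (-1) ^ length as) * \<omega> (map b (ps @ J))"
    if "subspace V" "\<omega> \<in> alt_forms V k" for V k \<omega> and b :: "'a \<Rightarrow> 'v" and ps
    using c[OF that, of b "ps @ [i]"] alt_forms_move[OF that(2,1), of "map b ps" "map b as" "b i" "map b bs"]
    by (simp add: J flip: power_add mult.assoc)
  then show ?case by (intro exI[of _ "c * (-1) ^ length as"]) simp
qed

text \<open>The constant is the sign of the permutation \<open>I\<close>, or 0 if an index repeats,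
  and depends on \<open>I\<close> alone; the components of a varying top form are therefore constant
  multiples of one function.\<close>

lemma alt_forms_top_const:
  assumes "length I = n" "set I \<subseteq> {..<n}"
  shows "\<exists>c::real. \<forall>V \<omega> (b :: nat \<Rightarrow> 'v::real_vector). subspace V \<longrightarrow> \<omega> \<in> alt_forms V n \<longrightarrow>
    \<omega> (map b I) = c * \<omega> (map b [0..<n])"
proof (cases "distinct I")
  case True
  then have "card (set I) = n" using assms(1) distinct_card by metis
  then have "set I = {..<n}" using assms(2) by (intro card_subset_eq) auto
  then have "mset I = mset [0..<n]"
    using True by (intro set_eq_iff_mset_eq_distinct[THEN iffD1]) (auto simp: atLeast0LessThan)
  from alt_forms_perm[OF this] obtain c :: real where
    "\<forall>V k \<omega> (b :: nat \<Rightarrow> 'v) ps. subspace V \<longrightarrow> \<omega> \<in> alt_forms V k \<longrightarrow>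
      \<omega> (map b (ps @ I)) = c * \<omega> (map b (ps @ [0..<n]))" by blast
  then show ?thesis by (intro exI[of _ c]) (metis append_Nil)
next
  case False
  then have "\<not> distinct (map b I)" for b :: "nat \<Rightarrow> 'v" by (auto simp: distinct_map)
  then show ?thesis by (intro exI[of _ 0]) (auto intro: alt_forms_repeat)
qed

text \<open>The arguments are expanded in the basis one at a time from the left; the list
  \<open>I\<close> records the basis vectors already inserted.\<close>

lemma alt_forms_eq_0:
  assumes b: "basis_of V n b" and w: "\<omega> \<in> alt_forms V k"
    and z: "\<And>I. length I = k \<Longrightarrow> set I \<subseteq> {..<n} \<Longrightarrow> \<omega> (map b I) = 0"
  shows "\<omega> = 0"
proof -
  have *: "\<omega> (map b I @ vs) = 0" if "set vs \<subseteq> V" "length I + length vs = k" "set I \<subseteq> {..<n}" for vs I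
    using that
  proof (induction vs arbitrary: I)
    case (Cons v vs)
    then have "v \<in> V" by simp
    then obtain c where c: "v = (\<Sum>i<n. c i *\<^sub>R b i)" by (rule basis_of_expand[OF b])
    have "\<omega> (map b I @ v # vs) = (\<Sum>i<n. c i * \<omega> (map b I @ b i # vs))"
      unfolding c using alt_forms_sum[OF w basis_of_subspace[OF b], of "{..<n}" b] basis_of_in[OF b] by simp
    also have "\<dots> = (\<Sum>i<n. c i * 0)"
    proof (intro sum.cong refl arg_cong2[where f = "(*)"])
      fix i assume "i \<in> {..<n}"
      then show "\<omega> (map b I @ b i # vs) = 0" using Cons.IH[of "I @ [i]"] Cons.prems by simp
    qed
    finally show ?case by simp
  qed (use z in simp)
  show ?thesis
  proof
    fix vs show "\<omega> vs = 0 vs"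
      using *[of vs "[]"] alt_forms_outside[OF w, of vs] by (auto simp: zero_fun_def)
  qed
qed

lemma alt_forms_scaleR: "\<omega> \<in> alt_forms V k \<Longrightarrow> c *\<^sub>R \<omega> \<in> alt_forms V k"
  unfolding alt_forms_def by (auto simp: algebra_simps)

lemma alt_forms_plus:
  "\<omega> \<in> alt_forms V k \<Longrightarrow> \<eta> \<in> alt_forms V k \<Longrightarrow> \<omega> + \<eta> \<in> alt_forms V k"
  unfolding alt_forms_def by (auto simp: algebra_simps)

lemma alt_forms_zero: "0 \<in> alt_forms V k"
  unfolding alt_forms_def by (auto simp: zero_fun_def)

text \<open>One-dimensionality of the space of top forms, cross-multiplied to avoid a division: the
  difference of the two sides vanishes on the basis in its standard order and hence on all lists of
  basis vectors.\<close>

lemma alt_forms_top_eq: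
  assumes b: "basis_of V n b" and w: "\<omega> \<in> alt_forms V n" and m: "\<mu> \<in> alt_forms V n"
  shows "\<mu> (map b [0..<n]) *\<^sub>R \<omega> = \<omega> (map b [0..<n]) *\<^sub>R \<mu>"
proof -
  let ?\<eta> = "\<mu> (map b [0..<n]) *\<^sub>R \<omega> + (- \<omega> (map b [0..<n])) *\<^sub>R \<mu>"
  have \<eta>: "?\<eta> \<in> alt_forms V n" using w m by (intro alt_forms_plus alt_forms_scaleR)
  have "?\<eta> = 0"
  proof (rule alt_forms_eq_0[OF b \<eta>])
    fix I assume "length I = n" "set I \<subseteq> {..<n}"
    then obtain c where "\<And>V \<omega> (b :: nat \<Rightarrow> 'a). subspace V \<Longrightarrow> \<omega> \<in> alt_forms V n \<Longrightarrow>
        \<omega> (map b I) = c * \<omega> (map b [0..<n])"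
      using alt_forms_top_const by metis
    from this[OF basis_of_subspace[OF b] \<eta>, of b] show "?\<eta> (map b I) = 0" by simp
  qed
  then show ?thesis by simp
qed

lemma alt_forms_top_eq_0:
  assumes b: "basis_of V n b" and w: "\<omega> \<in> alt_forms V n" and z: "\<omega> (map b [0..<n]) = 0"
  shows "\<omega> = 0"
proof (rule alt_forms_eq_0[OF b w])
  fix I assume "length I = n" "set I \<subseteq> {..<n}"
  then obtain c where "\<And>V \<omega> (b :: nat \<Rightarrow> 'a). subspace V \<Longrightarrow> \<omega> \<in> alt_forms V n \<Longrightarrow>
      \<omega> (map b I) = c * \<omega> (map b [0..<n])"
    using alt_forms_top_const by metis
  from this[OF basis_of_subspace[OF b] w, of b] show "\<omega> (map b I) = 0" using z by simp
qed

text \<open>The two forms are proportional, so the two by two determinant of their values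
  vanishes.\<close>

lemma alt_forms_top_cross:
  assumes b: "basis_of V n b" and w: "\<omega> \<in> alt_forms V n" and m: "\<mu> \<in> alt_forms V n"
  shows "\<mu> vs * \<omega> ws = \<mu> ws * \<omega> vs"
proof (cases "\<mu> (map b [0..<n]) = 0")
  case True
  then have "\<mu> = 0" by (rule alt_forms_top_eq_0[OF b m])
  then show ?thesis by (simp add: zero_fun_def)
next
  case False
  have "\<mu> (map b [0..<n]) * \<omega> us = \<omega> (map b [0..<n]) * \<mu> us" for us
    using alt_forms_top_eq[OF b w m] by (metis real_scaleR_def scaleR_fun_apply)
  then have "\<mu> (map b [0..<n]) * (\<mu> vs * \<omega> ws) = \<mu> (map b [0..<n]) * (\<mu> ws * \<omega> vs)"
    by (metis mult.left_commute mult.commute)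
  then show ?thesis using False by simp
qed

text \<open>Cramer's rule: in the expansion of the inserted vector every term except that of
  \<open>b i\<close> repeats a basis vector and vanishes.\<close>

lemma alt_forms_update_basis:
  assumes b: "basis_of V n b" and w: "\<omega> \<in> alt_forms V n" and i: "i < n"
  shows "\<omega> ((map b [0..<n])[i := \<Sum>j<n. c j *\<^sub>R b j]) = c i * \<omega> (map b [0..<n])"
proof -
  let ?ps = "map b [0..<i]" and ?qs = "map b [Suc i..<n]"
  have split: "[0..<n] = [0..<i] @ i # [Suc i..<n]"
    using i by (metis append_Cons append_Nil append_assoc le0 less_or_eq_imp_le upt_conv_Cons upt_add_eq_append less_imp_add_positive)
  have up: "(map b [0..<n])[i := v] = ?ps @ v # ?qs" for v
    unfolding split by (simp add: list_update_append)
  have "\<omega> ((map b [0..<n])[i := \<Sum>j<n. c j *\<^sub>R b j]) = (\<Sum>j<n. c j * \<omega> (?ps @ b j # ?qs))"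
    unfolding up using alt_forms_sum[OF w basis_of_subspace[OF b], of "{..<n}" b] basis_of_in[OF b] by simp
  also have "\<dots> = (\<Sum>j<n. if j = i then c i * \<omega> (map b [0..<n]) else 0)"
  proof (rule sum.cong)
    fix j assume j: "j \<in> {..<n}"
    show "c j * \<omega> (?ps @ b j # ?qs) = (if j = i then c i * \<omega> (map b [0..<n]) else 0)"
    proof (cases "j = i")
      case False
      then have "j \<in> {0..<i} \<union> {Suc i..<n}" using j by auto
      then have "b j \<in> set ?ps \<union> set ?qs" by auto
      then have "\<not> distinct (?ps @ b j # ?qs)" by auto
      then show ?thesis using alt_forms_repeat[OF w] False by simp
    qed (simp add: split)
  qed simp
  finally show ?thesis using i by simp
qed

text \<open>The Leibniz formula for the determinant in functionals \<open>g j\<close> dual to the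
  basis. They are extended to the ambient space because \<open>wedge\<close> is tested against forms
  on \<open>UNIV\<close>.\<close>

lemma ex_alt_form:
  assumes b: "basis_of V n b"
  obtains \<omega> where "\<omega> \<in> alt_forms UNIV n" "\<omega> (map b [0..<n]) = 1"
proof -
  have B: "inj_on b {..<n}" "independent (b ` {..<n})" using b by (auto simp: basis_of_def)
  have "\<exists>g. linear g \<and> (\<forall>v\<in>b ` {..<n}. g v = (if v = b j then 1 else 0 :: real))" for j
    using linear_independent_extend[OF B(2)] .
  then obtain g :: "nat \<Rightarrow> 'a \<Rightarrow> real" where g: "\<And>j. linear (g j)"
    "\<And>j. \<forall>v\<in>b ` {..<n}. g j v = (if v = b j then 1 else 0)"
    by metis
  have gb: "g j (b i) = (if i = j then 1 else 0)" if "i < n" "j < n" for i j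
    using g(2)[of j] that B(1) by (auto dest: inj_onD)
  let ?P = "{p. p permutes {..<n}}"
  define \<omega> where "\<omega> vs = (if length vs = n
    then \<Sum>p\<in>?P. of_int (sign p) * (\<Prod>i<n. g (p i) (vs ! i)) else 0)" for vs
  have upd: "\<omega> (vs[i := u]) = (\<Sum>p\<in>?P. of_int (sign p) * (g (p i) u * (\<Prod>l\<in>{..<n} - {i}. g (p l) (vs ! l))))"
    if "length vs = n" "i < n" for vs i u
  proof -
    have "(\<Prod>l<n. g (p l) (vs[i := u] ! l)) = g (p i) u * (\<Prod>l\<in>{..<n} - {i}. g (p l) (vs ! l))" for p
      using that by (subst prod.remove[of _ i]) (auto intro!: prod.cong)
    then show ?thesis using that by (simp add: \<omega>_def)
  qed
  have alt: "\<omega> vs = 0" if vs: "length vs = n" and ij: "i < n" "j < n" "i \<noteq> j" "vs ! i = vs ! j" for vs i j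
  proof -
    let ?t = "Transposition.transpose i j"
    have t: "?t permutes {..<n}" using ij by (auto intro: permutes_swap_id)
    \<comment> \<open>Replacing \<open>p\<close> by its composite with the transposition of
      \<open>i\<close> and \<open>j\<close> shows that the sum equals its own negative.\<close>
    have "(\<Sum>p\<in>?P. of_int (sign p) * (\<Prod>l<n. g (p l) (vs ! l))) =
        (\<Sum>p\<in>?P. of_int (sign (p \<circ> ?t)) * (\<Prod>l<n. g ((p \<circ> ?t) l) (vs ! l)))"
      by (rule sum.reindex_bij_witness[where i = "\<lambda>p. p \<circ> ?t" and j = "\<lambda>p. p \<circ> ?t"])
        (auto simp: comp_assoc intro: permutes_compose[OF t])
    also have "\<dots> = (\<Sum>p\<in>?P. - (of_int (sign p) * (\<Prod>l<n. g (p l) (vs ! l))))"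
    proof (rule sum.cong)
      fix p assume "p \<in> ?P"
      then have "permutation p" using permutation_permutes by auto
      then have "sign (p \<circ> ?t) = - sign p"
        using ij by (simp add: sign_compose permutation_swap_id sign_swap_id)
      moreover have "(\<Prod>l<n. g ((p \<circ> ?t) l) (vs ! l)) = (\<Prod>l<n. g (p l) (vs ! l))"
      proof -
        have "(\<Prod>l<n. g ((p \<circ> ?t) l) (vs ! l)) = (\<Prod>l<n. g ((p \<circ> ?t) (?t l)) (vs ! ?t l))"
          using prod.permute[OF t, of "\<lambda>l. g ((p \<circ> ?t) l) (vs ! l)"] by (simp add: o_def)
        also have "\<dots> = (\<Prod>l<n. g (p l) (vs ! l))"
          using ij by (intro prod.cong) (auto simp: Transposition.transpose_def)
        finally show ?thesis .
      qed
      ultimately show "of_int (sign (p \<circ> ?t)) * (\<Prod>l<n. g ((p \<circ> ?t) l) (vs ! l)) =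
          - (of_int (sign p) * (\<Prod>l<n. g (p l) (vs ! l)))" by simp
    qed simp
    finally show ?thesis using vs by (simp add: \<omega>_def sum_negf)
  qed
  have "\<omega> \<in> alt_forms UNIV n"
    unfolding alt_forms_def
  proof (intro CollectI conjI allI impI ballI)
    fix vs :: "'a list" assume "\<not> (length vs = n \<and> set vs \<subseteq> UNIV)"
    then show "\<omega> vs = 0" by (simp add: \<omega>_def)
  next
    fix vs :: "'a list" and i u w assume "length vs = n \<and> set vs \<subseteq> UNIV" and i: "i < n"
    then have vs: "length vs = n" by simp
    show "\<omega> (vs[i := u + w]) = \<omega> (vs[i := u]) + \<omega> (vs[i := w])"
      unfolding upd[OF vs i] by (simp add: linear_add[OF g(1)] ring_distribs sum.distrib)
  next
    fix vs :: "'a list" and i u c assume "length vs = n \<and> set vs \<subseteq> UNIV" and i: "i < n"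
    then have vs: "length vs = n" by simp
    show "\<omega> (vs[i := c *\<^sub>R u]) = c * \<omega> (vs[i := u])"
      unfolding upd[OF vs i] by (simp add: linear_scale[OF g(1)] sum_distrib_left mult_ac)
  next
    fix vs :: "'a list" and i j
    assume "length vs = n \<and> set vs \<subseteq> UNIV" "i < n" "j < n" "i \<noteq> j \<and> vs ! i = vs ! j"
    then show "\<omega> vs = 0" using alt by blast
  qed
  moreover have "\<omega> (map b [0..<n]) = 1"
  proof -
    have "(\<Prod>i<n. g (p i) (b i)) = (if p = id then 1 else 0)" if p: "p \<in> ?P" for p
    proof (cases "p = id")
      case True
      then show ?thesis using gb by simp
    next
      case False
      then obtain i where i: "p i \<noteq> i" by (metis eq_id_iff)
      then have "i \<in> {..<n}" using p permutes_not_in[of p "{..<n}"] by blast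
      moreover have "p i < n" using p calculation permutes_in_image[of p "{..<n}" i] by simp
      ultimately have "(\<Prod>i<n. g (p i) (b i)) = 0"
        using gb i by (intro prod_zero) (auto intro!: bexI[of _ i])
      then show ?thesis using False by simp
    qed
    then have "(\<Sum>p\<in>?P. of_int (sign p) * (\<Prod>i<n. g (p i) (b i))) =
        (\<Sum>p\<in>?P. if p = id then 1 else 0)"
      by (intro sum.cong) auto
    also have "\<dots> = 1" by (simp add: finite_permutations permutes_id)
    finally show ?thesis by (simp add: \<omega>_def)
  qed
  ultimately show thesis by (rule that)
qed

section \<open>Exterior powers and tensor products as evaluation functionals\<close>

lemma alt_forms_restrict:
  assumes "\<omega> \<in> alt_forms UNIV k" "subspace V"
  shows "(\<lambda>vs. if set vs \<subseteq> V then \<omega> vs else 0) \<in> alt_forms V k"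
proof -
  have "set (vs[i := u]) \<subseteq> V" if "set vs \<subseteq> V" "u \<in> V" for vs i u
    using that set_update_subset_insert[of vs i u] by blast
  moreover have "u + w \<in> V" "c *\<^sub>R u \<in> V" if "u \<in> V" "w \<in> V" for u w c
    using assms(2) that by (auto intro: subspace_add subspace_scale)
  ultimately show ?thesis
    using assms(1) unfolding alt_forms_def by auto
qed

text \<open>\<open>wedge\<close> evaluates ambient forms. Restricted to argument lists in
  \<open>V\<close>, an ambient form becomes a top form of \<open>V\<close>, to which
  \<open>alt_forms_top_cross\<close> applies.\<close>

lemma wedge_cross:
  assumes b: "basis_of V n b" and m: "\<mu> \<in> alt_forms V n"
    and vs: "length vs = n" "set vs \<subseteq> V" and ws: "length ws = n" "set ws \<subseteq> V"
  shows "\<mu> vs *\<^sub>R wedge ws = \<mu> ws *\<^sub>R wedge vs"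
proof
  fix \<omega>
  show "(\<mu> vs *\<^sub>R wedge ws) \<omega> = (\<mu> ws *\<^sub>R wedge vs) \<omega>"
  proof (cases "\<omega> \<in> alt_forms UNIV n")
    case True
    from alt_forms_top_cross[OF b alt_forms_restrict[OF True basis_of_subspace[OF b]] m, of vs ws]
    show ?thesis using True vs ws by (simp add: wedge_def)
  qed (use vs ws in \<open>simp add: wedge_def\<close>)
qed

lemma wedge_basis_nonzero:
  assumes b: "basis_of V n b"
  shows "wedge (map b [0..<n]) \<noteq> 0"
proof -
  obtain \<omega> where "\<omega> \<in> alt_forms UNIV n" "\<omega> (map b [0..<n]) = 1" using ex_alt_form[OF b] .
  then have "wedge (map b [0..<n]) \<omega> = 1" by (simp add: wedge_def)
  then show ?thesis by (metis zero_fun_def zero_neq_one)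
qed

text \<open>Normalized to pair to \<open>1\<close> with \<open>\<mu> \<noteq> 0\<close>. For \<open>n = 0\<close> there need not be arguments on which
  \<open>\<mu>\<close> itself takes the value \<open>1\<close>.\<close>

definition dual_vec :: "'v::real_vector set \<Rightarrow> nat \<Rightarrow> ('v list \<Rightarrow> real) \<Rightarrow> (('v list \<Rightarrow> real) \<Rightarrow> real)" where
  "dual_vec V n \<mu> = (let vs = SOME vs. length vs = n \<and> set vs \<subseteq> V \<and> \<mu> vs \<noteq> 0
     in inverse (\<mu> vs) *\<^sub>R wedge vs)"

text \<open>By \<open>wedge_cross\<close> the multivector
  \<open>inverse (\<mu> vs) *\<^sub>R wedge vs\<close> is the same for all lists in \<open>V\<close>
  with nonzero \<open>\<mu> vs\<close>, so the choice in \<open>dual_vec\<close> does not matter.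
  This duality turns top multivectors into numbers and their fields into functions.\<close>

lemma wedge_dual_vec:
  assumes b: "basis_of V n b" and m: "\<mu> \<in> alt_forms V n" "\<mu> \<noteq> 0"
    and ws: "length ws = n" "set ws \<subseteq> V"
  shows "wedge ws = \<mu> ws *\<^sub>R dual_vec V n \<mu>"
proof -
  define vs where "vs = (SOME vs. length vs = n \<and> set vs \<subseteq> V \<and> \<mu> vs \<noteq> 0)"
  obtain us where "\<mu> us \<noteq> 0" using m(2) by (auto simp: zero_fun_def fun_eq_iff)
  then have "\<exists>vs. length vs = n \<and> set vs \<subseteq> V \<and> \<mu> vs \<noteq> 0"
    using alt_forms_outside[OF m(1)] by blast
  then have vs: "length vs = n" "set vs \<subseteq> V" "\<mu> vs \<noteq> 0"
    unfolding vs_def by (metis (mono_tags, lifting) someI_ex)+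
  have "\<mu> vs *\<^sub>R wedge ws = \<mu> ws *\<^sub>R wedge vs" by (rule wedge_cross[OF b m(1) vs(1,2) ws])
  then have "inverse (\<mu> vs) *\<^sub>R (\<mu> vs *\<^sub>R wedge ws) = inverse (\<mu> vs) *\<^sub>R (\<mu> ws *\<^sub>R wedge vs)" by simp
  then show ?thesis
    using vs(3) unfolding dual_vec_def vs_def[symmetric] Let_def
    by (simp add: mult.commute)
qed

lemma dual_vec_nonzero:
  assumes b: "basis_of V n b" and m: "\<mu> \<in> alt_forms V n" "\<mu> \<noteq> 0"
  shows "dual_vec V n \<mu> \<noteq> 0"
proof -
  have "set (map b [0..<n]) \<subseteq> V" using basis_of_in[OF b] by auto
  then show ?thesis
    using wedge_dual_vec[OF b m, of "map b [0..<n]"] wedge_basis_nonzero[OF b] by auto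
qed

lemma dual_vec_span:
  assumes b: "basis_of V n b" and m: "\<mu> \<in> alt_forms V n" "\<mu> \<noteq> 0"
  shows "span {wedge vs | vs. length vs = n \<and> set vs \<subseteq> V} = range (\<lambda>c. c *\<^sub>R dual_vec V n \<mu>)"
proof (intro equalityI subsetI)
  fix a assume "a \<in> span {wedge vs | vs. length vs = n \<and> set vs \<subseteq> V}"
  moreover have "{wedge vs | vs. length vs = n \<and> set vs \<subseteq> V} \<subseteq> span {dual_vec V n \<mu>}"
    by (auto simp: wedge_dual_vec[OF b m] span_singleton)
  then have "span {wedge vs | vs. length vs = n \<and> set vs \<subseteq> V} \<subseteq> span {dual_vec V n \<mu>}"
    by (rule span_minimal) simp
  ultimately have "a \<in> span {dual_vec V n \<mu>}" by (rule set_mp[rotated])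
  then show "a \<in> range (\<lambda>c. c *\<^sub>R dual_vec V n \<mu>)" by (simp add: span_singleton)
next
  fix a assume "a \<in> range (\<lambda>c. c *\<^sub>R dual_vec V n \<mu>)"
  then obtain c where a: "a = c *\<^sub>R dual_vec V n \<mu>" by blast
  let ?vs = "map b [0..<n]"
  have vs: "length ?vs = n" "set ?vs \<subseteq> V" using basis_of_in[OF b] by auto
  have "\<mu> ?vs \<noteq> 0" using alt_forms_top_eq_0[OF b m(1)] m(2) by blast
  then have "a = (c / \<mu> ?vs) *\<^sub>R wedge ?vs"
    using wedge_dual_vec[OF b m vs] a by simp
  moreover have "wedge ?vs \<in> span {wedge vs | vs. length vs = n \<and> set vs \<subseteq> V}"
    using vs by (intro span_base CollectI exI[of _ ?vs]) simp
  ultimately show "a \<in> span {wedge vs | vs. length vs = n \<and> set vs \<subseteq> V}"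
    using span_scale by simp
qed

lemma linear_ex_nonzero:
  fixes v :: "'v::real_vector"
  assumes "v \<noteq> 0"
  obtains f :: "'v \<Rightarrow> real" where "linear f" "f v = 1"
proof -
  have "independent {v}" using assms by simp
  then have "\<exists>f. linear f \<and> (\<forall>x\<in>{v}. f x = (1::real))" by (rule linear_independent_extend)
  then show thesis using that by auto
qed

lemma tensor_scale: "(a *\<^sub>R v) \<otimes>\<^sub>t (b *\<^sub>R w) = (a * b) *\<^sub>R (v \<otimes>\<^sub>t w)"
proof
  fix \<beta> :: "'a \<Rightarrow> 'b \<Rightarrow> real"
  have "\<beta> (a *\<^sub>R v) (b *\<^sub>R w) = a * b * \<beta> v w" if "bilinear \<beta>"
    using that by (simp add: bilinear_lmul bilinear_rmul)
  then show "((a *\<^sub>R v) \<otimes>\<^sub>t (b *\<^sub>R w)) \<beta> = ((a * b) *\<^sub>R (v \<otimes>\<^sub>t w)) \<beta>" by (simp add: tensor_def)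
qed

text \<open>Tested against the bilinear form \<open>f x * g y\<close> built from functionals with
  \<open>f v = 1\<close> and \<open>g w = 1\<close>.\<close>

lemma tensor_nonzero:
  assumes "v \<noteq> 0" "w \<noteq> 0"
  shows "v \<otimes>\<^sub>t w \<noteq> 0"
proof -
  obtain f :: "'a \<Rightarrow> real" where f: "linear f" "f v = 1" using linear_ex_nonzero[OF assms(1)] .
  obtain g :: "'b \<Rightarrow> real" where g: "linear g" "g w = 1" using linear_ex_nonzero[OF assms(2)] .
  have "bilinear (\<lambda>x y. f x * g y)"
    unfolding bilinear_def linear_iff
    using f(1) g(1) by (simp add: linear_add linear_scale algebra_simps)
  then have "(v \<otimes>\<^sub>t w) (\<lambda>x y. f x * g y) = 1" using f g by (simp add: tensor_def)
  then show ?thesis by (metis zero_fun_def zero_neq_one)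
qed

text \<open>For two lines the pure tensors already form a line, so taking the span adds
  nothing.\<close>

lemma tensor_span:
  "span {v \<otimes>\<^sub>t w | v w. v \<in> range (\<lambda>c. c *\<^sub>R a) \<and> w \<in> range (\<lambda>c. c *\<^sub>R b)} =
    range (\<lambda>c. c *\<^sub>R (a \<otimes>\<^sub>t b))"
proof -
  have "{v \<otimes>\<^sub>t w | v w. v \<in> range (\<lambda>c. c *\<^sub>R a) \<and> w \<in> range (\<lambda>c. c *\<^sub>R b)} = range (\<lambda>c. c *\<^sub>R (a \<otimes>\<^sub>t b))"
  proof (intro equalityI subsetI)
    fix x assume "x \<in> range (\<lambda>c. c *\<^sub>R (a \<otimes>\<^sub>t b))"
    then obtain c where "x = c *\<^sub>R (a \<otimes>\<^sub>t b)" by blast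
    then have "x = (c *\<^sub>R a) \<otimes>\<^sub>t (1 *\<^sub>R b)" unfolding tensor_scale by simp
    then show "x \<in> {v \<otimes>\<^sub>t w | v w. v \<in> range (\<lambda>c. c *\<^sub>R a) \<and> w \<in> range (\<lambda>c. c *\<^sub>R b)}" by blast
  qed (auto simp: tensor_scale)
  also have "\<dots> = span {a \<otimes>\<^sub>t b}" by (simp add: span_singleton)
  finally show ?thesis by (metis span_singleton span_span)
qed

section \<open>Differential forms and the Koszul formula\<close>

context smooth_mfd
begin

context
  fixes x v
  assumes v: "v \<in> tangent_space M x"
begin

lemmas tangent_spaceD = v[unfolded tangent_space_def mem_Collect_eq]

lemmas tangent_not_smooth = tangent_spaceD[THEN conjunct1, rule_format]

lemmas tangent_scale = tangent_spaceD[THEN conjunct2, THEN conjunct2, rule_format]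

lemma tangent_add: "smooth_near M x f \<Longrightarrow> smooth_near M x g \<Longrightarrow> v (\<lambda>y. f y + g y) = v f + v g"
  using tangent_spaceD[THEN conjunct2, THEN conjunct1, THEN spec, THEN spec, of f g] by linarith

lemma tangent_mult:
  "smooth_near M x f \<Longrightarrow> smooth_near M x g \<Longrightarrow> v (\<lambda>y. f y * g y) = f x * v g + g x * v f"
  using tangent_spaceD[THEN conjunct2, THEN conjunct1, THEN spec, THEN spec, of f g] by linarith

text \<open>Valid for arbitrary functions: being smooth near \<open>x\<close> is itself a property
  of the germ, and on germs that are not smooth both values are the default 0.\<close>

lemma tangent_cong:
  assumes "\<forall>\<^sub>F y in nhds x. f y = g y"
  shows "v f = v g"
proof (cases "smooth_near M x f")
  case True
  then have "smooth_near M x g" using assms by (rule smooth_near_transform)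
  then show ?thesis
    using True assms tangent_spaceD[THEN conjunct2, THEN conjunct1, THEN spec, THEN spec, of f g] by linarith
next
  case False
  then have "\<not> smooth_near M x g" using smooth_near_cong_iff[OF assms] by simp
  then show ?thesis using False tangent_not_smooth by metis
qed

lemma tangent_const: "v (\<lambda>y. c) = 0"
proof -
  have "v (\<lambda>y. 1) = 0" using tangent_mult[of "\<lambda>y. 1" "\<lambda>y. 1"] by simp
  then show ?thesis using tangent_scale[of "\<lambda>y. 1" c] by simp
qed

lemma tangent_zero: "\<forall>\<^sub>F y in nhds x. f y = 0 \<Longrightarrow> v f = 0"
  using tangent_cong[of f "\<lambda>y. 0"] tangent_const by simp

lemma tangent_diff: "smooth_near M x f \<Longrightarrow> smooth_near M x g \<Longrightarrow> v (\<lambda>y. f y - g y) = v f - v g"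
  using tangent_add[of f "\<lambda>y. - 1 * g y"] tangent_scale[of g "- 1"] smooth_near_minus[of x g] by simp

lemma tangent_sum:
  "(\<And>i. i \<in> I \<Longrightarrow> smooth_near M x (f i)) \<Longrightarrow> v (\<lambda>y. \<Sum>i\<in>I. f i y) = (\<Sum>i\<in>I. v (f i))"
proof (induction I rule: infinite_finite_induct)
  case (insert i I)
  then show ?case using tangent_add[of "f i" "\<lambda>y. \<Sum>i\<in>I. f i y"] smooth_near_sum[of I x f] by simp
qed (simp_all add: tangent_const)

end

end

section \<open>Smooth forms near a point\<close>

definition form_near ::
  "('m::topological_space, 'b::euclidean_space) manifold \<Rightarrow> ('m, 'v::real_vector, 'z) vbundle_scheme \<Rightarrow>
   nat \<Rightarrow> 'm \<Rightarrow> ('m \<Rightarrow> 'v list \<Rightarrow> real) \<Rightarrow> bool" where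
  "form_near M E k x \<omega> \<longleftrightarrow> (\<exists>W. open W \<and> x \<in> W \<and> is_form M E k W \<omega>)"

context vbun
begin

text \<open>The arguments are expanded in the frame one at a time; the list \<open>I\<close> records
  the frame indices already inserted, until only the components assumed smooth are left.\<close>

lemma form_eval_aux:
  assumes F: "(U, e) \<in> frames E" "x \<in> U"
    and alt: "\<forall>\<^sub>F y in nhds x. \<omega> y \<in> alt_forms (fiber E y) k"
    and sm: "\<And>I. length I = k \<Longrightarrow> set I \<subseteq> {..<rk} \<Longrightarrow> smooth_near M x (\<lambda>y. \<omega> y (map (\<lambda>i. e i y) I))"
    and Xs: "\<And>X. X \<in> set Xs \<Longrightarrow> sec_near M E x X" "length I + length Xs = k" "set I \<subseteq> {..<rk}"
  shows "smooth_near M x (\<lambda>y. \<omega> y (map (\<lambda>i. e i y) I @ eval_at y Xs))"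
  using Xs
proof (induction Xs arbitrary: I)
  case Nil
  then show ?case using sm by simp
next
  case (Cons X Xs)
  have "sec_near M E x X" using Cons.prems(1)[of X] by simp
  then obtain c where c: "\<forall>i<rk. smooth_near M x (c i)" "\<forall>\<^sub>F y in nhds x. X y = (\<Sum>i<rk. c i y *\<^sub>R e i y)"
    using sec_near_frame[OF F] by blast
  have IH: "smooth_near M x (\<lambda>y. \<omega> y (map (\<lambda>i. e i y) (I @ [i]) @ eval_at y Xs))" if "i < rk" for i
    using Cons.IH[of "I @ [i]"] Cons.prems that by simp
  have "smooth_near M x (\<lambda>y. \<Sum>i<rk. c i y * \<omega> y (map (\<lambda>i. e i y) (I @ [i]) @ eval_at y Xs))"
    by (rule smooth_near_sum, rule smooth_near_mult) (use IH c in auto)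
  moreover have "\<forall>\<^sub>F y in nhds x. (\<Sum>i<rk. c i y * \<omega> y (map (\<lambda>i. e i y) (I @ [i]) @ eval_at y Xs)) =
      \<omega> y (map (\<lambda>i. e i y) I @ eval_at y (X # Xs))"
    using alt c(2) frame_eventually[OF F]
  proof eventually_elim
    case (elim y)
    have "\<omega> y (map (\<lambda>i. e i y) I @ (\<Sum>i<rk. c i y *\<^sub>R e i y) # eval_at y Xs) =
        (\<Sum>i<rk. c i y * \<omega> y (map (\<lambda>i. e i y) I @ e i y # eval_at y Xs))"
      by (rule alt_forms_sum[OF elim(1) fiber_subspace])
        (use basis_of_in[OF frame_basis[OF F(1) elim(3)]] in simp)
    then show ?case using elim(2) by simp
  qed
  ultimately show ?case by (rule smooth_near_transform)
qed

text \<open>Components in another frame are values of the form on smooth sections, so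
  \<open>form_eval_aux\<close> covers them. There are finitely many index lists, which allows one
  neighbourhood for all components.\<close>

lemma form_near_frame:
  assumes F: "(U, e) \<in> frames E" "x \<in> U"
  shows "form_near M E k x \<omega> \<longleftrightarrow> (\<forall>\<^sub>F y in nhds x. \<omega> y \<in> alt_forms (fiber E y) k) \<and>
    (\<forall>I. length I = k \<longrightarrow> set I \<subseteq> {..<rk} \<longrightarrow> smooth_near M x (\<lambda>y. \<omega> y (map (\<lambda>i. e i y) I)))"
proof
  assume "form_near M E k x \<omega>"
  then obtain W where W: "open W" "x \<in> W" "is_form M E k W \<omega>" unfolding form_near_def by blast
  have o: "open (U \<inter> W)" "x \<in> U \<inter> W" using frame_open[OF F(1)] W F(2) by auto
  have "\<forall>\<^sub>F y in nhds x. y \<in> W" using W by (intro eventually_nhds_in_open)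
  then have "\<forall>\<^sub>F y in nhds x. \<omega> y \<in> alt_forms (fiber E y) k"
    by eventually_elim (use W(3) in \<open>simp add: is_form_def\<close>)
  moreover have "smooth_near M x (\<lambda>y. \<omega> y (map (\<lambda>i. e i y) I))"
    if "length I = k" "set I \<subseteq> {..<rk}" for I
  proof -
    have "smooth_fun M (U \<inter> W) (\<lambda>y. \<omega> y (map (\<lambda>i. e i y) I))"
      using W(3) F(1) that unfolding is_form_def by fast
    then show ?thesis using smooth_fun_iff[OF o(1)] o(2) by blast
  qed
  ultimately show "(\<forall>\<^sub>F y in nhds x. \<omega> y \<in> alt_forms (fiber E y) k) \<and>
    (\<forall>I. length I = k \<longrightarrow> set I \<subseteq> {..<rk} \<longrightarrow> smooth_near M x (\<lambda>y. \<omega> y (map (\<lambda>i. e i y) I)))"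
    by simp
next
  assume A: "(\<forall>\<^sub>F y in nhds x. \<omega> y \<in> alt_forms (fiber E y) k) \<and>
    (\<forall>I. length I = k \<longrightarrow> set I \<subseteq> {..<rk} \<longrightarrow> smooth_near M x (\<lambda>y. \<omega> y (map (\<lambda>i. e i y) I)))"
  let ?I = "{I. set I \<subseteq> {..<rk} \<and> length I = k}"
  have "finite ?I" by (rule finite_lists_length_eq) simp
  then have "\<forall>\<^sub>F y in nhds x. \<forall>I\<in>?I. smooth_near M y (\<lambda>y. \<omega> y (map (\<lambda>i. e i y) I))"
    using A by (intro eventually_ball_finite) (auto intro: smooth_near_eventually)
  with conjunct1[OF A] frame_eventually[OF F]
  have "\<forall>\<^sub>F y in nhds x. \<omega> y \<in> alt_forms (fiber E y) k \<and> y \<in> U \<and>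
      (\<forall>I\<in>?I. smooth_near M y (\<lambda>y. \<omega> y (map (\<lambda>i. e i y) I)))"
    by eventually_elim simp
  then obtain W where W: "open W" "x \<in> W" and WP: "\<And>y. y \<in> W \<Longrightarrow> \<omega> y \<in> alt_forms (fiber E y) k"
    "\<And>y. y \<in> W \<Longrightarrow> y \<in> U"
    "\<And>y I. y \<in> W \<Longrightarrow> I \<in> ?I \<Longrightarrow> smooth_near M y (\<lambda>y. \<omega> y (map (\<lambda>i. e i y) I))"
    unfolding eventually_nhds by blast
  have "is_form M E k W \<omega>"
    unfolding is_form_def
  proof (intro conjI ballI, goal_cases)
    case (1 y)
    then show ?case using WP(1) by blast
  next
    case (2 F')
    obtain U' e' where F': "F' = (U', e')" "(U', e') \<in> frames E" using 2 by (cases F') auto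
    have "smooth_fun M (U' \<inter> W) (\<lambda>y. \<omega> y (map (\<lambda>i. e' i y) I))"
      if I: "length I = k" "set I \<subseteq> {..<rk}" for I
    proof -
      have "smooth_near M y (\<lambda>y. \<omega> y (map (\<lambda>i. e' i y) I))" if y: "y \<in> U' \<inter> W" for y
      proof -
        have "\<forall>\<^sub>F z in nhds y. z \<in> W" using W y by (intro eventually_nhds_in_open) auto
        then have ev: "\<forall>\<^sub>F z in nhds y. \<omega> z \<in> alt_forms (fiber E z) k"
          by eventually_elim (rule WP(1))
        have "smooth_near M y (\<lambda>z. \<omega> z (map (\<lambda>i. e i z) [] @ eval_at z (map e' I)))"
        proof (rule form_eval_aux[OF F(1) _ ev])
          show "y \<in> U" using WP(2) y by blast
          fix J assume "length J = k" "set J \<subseteq> {..<rk}"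
          then show "smooth_near M y (\<lambda>y. \<omega> y (map (\<lambda>i. e i y) J))" using WP(3)[of y J] y by simp
        next
          fix X assume "X \<in> set (map e' I)"
          then obtain i where i: "i \<in> set I" "X = e' i" by auto
          then have "i < rk" using I(2) by blast
          then show "sec_near M E y X" unfolding i(2) using frame_sec_near[OF F'(2), of y i] y by simp
        qed (use I in simp_all)
        then show ?thesis by (simp add: comp_def)
      qed
      then show ?thesis using smooth_fun_iff[of "U' \<inter> W"] frame_open[OF F'(2)] W by blast
    qed
    then show ?case unfolding F'(1) prod.case by simp
  qed
  then show "form_near M E k x \<omega>" unfolding form_near_def using W by blast
qed

lemma form_near_alt:
  assumes "form_near M E k x \<omega>"
  shows "\<forall>\<^sub>F y in nhds x. \<omega> y \<in> alt_forms (fiber E y) k"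
proof -
  obtain U e where F: "(U, e) \<in> frames E" "x \<in> U" using frame_cover .
  show ?thesis using assms unfolding form_near_frame[OF F] ..
qed

lemma form_near_alt_at: "form_near M E k x \<omega> \<Longrightarrow> \<omega> x \<in> alt_forms (fiber E x) k"
  using form_near_alt eventually_nhds_x_imp_x by fast

lemma form_near_eventually: "form_near M E k x \<omega> \<Longrightarrow> \<forall>\<^sub>F y in nhds x. form_near M E k y \<omega>"
  unfolding form_near_def eventually_nhds by blast

lemma form_near_eval:
  assumes w: "form_near M E k x \<omega>" and Xs: "\<And>X. X \<in> set Xs \<Longrightarrow> sec_near M E x X"
  shows "smooth_near M x (\<lambda>y. \<omega> y (eval_at y Xs))"
proof (cases "length Xs = k")
  case True
  obtain U e where F: "(U, e) \<in> frames E" "x \<in> U" using frame_cover .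
  have "smooth_near M x (\<lambda>y. \<omega> y (map (\<lambda>i. e i y) [] @ eval_at y Xs))"
  proof (rule form_eval_aux[OF F form_near_alt[OF w]])
    fix J assume "length J = k" "set J \<subseteq> {..<rk}"
    then show "smooth_near M x (\<lambda>y. \<omega> y (map (\<lambda>i. e i y) J))"
      using w unfolding form_near_frame[OF F] by simp
  qed (use Xs True in simp_all)
  then show ?thesis by simp
next
  case False
  from form_near_alt[OF w] have "\<forall>\<^sub>F y in nhds x. 0 = \<omega> y (eval_at y Xs)"
    by eventually_elim (use False alt_forms_outside in fastforce)
  with smooth_near_const show ?thesis by (rule smooth_near_transform)
qed

lemma is_form_iff:
  assumes W: "open W"
  shows "is_form M E k W \<omega> \<longleftrightarrow> (\<forall>x\<in>W. form_near M E k x \<omega>)"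
proof
  assume "is_form M E k W \<omega>"
  then show "\<forall>x\<in>W. form_near M E k x \<omega>" using W unfolding form_near_def by blast
next
  assume *: "\<forall>x\<in>W. form_near M E k x \<omega>"
  show "is_form M E k W \<omega>"
    unfolding is_form_def
  proof (intro conjI ballI, goal_cases)
    case (1 x)
    then show ?case using * form_near_alt_at by blast
  next
    case (2 F)
    obtain U e where F: "F = (U, e)" "(U, e) \<in> frames E" using 2 by (cases F) auto
    have "smooth_fun M (U \<inter> W) (\<lambda>y. \<omega> y (map (\<lambda>i. e i y) I))"
      if I: "length I = k" "set I \<subseteq> {..<rk}" for I
      using * form_near_frame[OF F(2)] I smooth_fun_iff[of "U \<inter> W"] W frame_open[OF F(2)] by blast
    then show ?case unfolding F prod.case by simp
  qed
qed

text \<open>By \<open>alt_forms_top_const\<close> all components of a top form in a frame are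
  constant multiples of one, so a single function has to be tested.\<close>

lemma top_form_near_frame:
  assumes F: "(U, e) \<in> frames E" "x \<in> U"
  shows "form_near M E rk x \<omega> \<longleftrightarrow> (\<forall>\<^sub>F y in nhds x. \<omega> y \<in> alt_forms (fiber E y) rk) \<and>
    smooth_near M x (\<lambda>y. \<omega> y (map (\<lambda>i. e i y) [0..<rk]))"
proof
  assume "form_near M E rk x \<omega>"
  then show "(\<forall>\<^sub>F y in nhds x. \<omega> y \<in> alt_forms (fiber E y) rk) \<and>
    smooth_near M x (\<lambda>y. \<omega> y (map (\<lambda>i. e i y) [0..<rk]))"
    unfolding form_near_frame[OF F] by (auto simp: atLeast0LessThan)
next
  assume A: "(\<forall>\<^sub>F y in nhds x. \<omega> y \<in> alt_forms (fiber E y) rk) \<and>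
    smooth_near M x (\<lambda>y. \<omega> y (map (\<lambda>i. e i y) [0..<rk]))"
  have "smooth_near M x (\<lambda>y. \<omega> y (map (\<lambda>i. e i y) I))" if I: "length I = rk" "set I \<subseteq> {..<rk}" for I
  proof -
    obtain c where c: "\<And>V \<omega> (b :: nat \<Rightarrow> 'v). subspace V \<Longrightarrow> \<omega> \<in> alt_forms V rk \<Longrightarrow>
        \<omega> (map b I) = c * \<omega> (map b [0..<rk])"
      using alt_forms_top_const[OF I] by metis
    have "smooth_near M x (\<lambda>y. c * \<omega> y (map (\<lambda>i. e i y) [0..<rk]))"
      using A by (intro smooth_near_mult smooth_near_const) simp
    moreover from conjunct1[OF A] have "\<forall>\<^sub>F y in nhds x.
        c * \<omega> y (map (\<lambda>i. e i y) [0..<rk]) = \<omega> y (map (\<lambda>i. e i y) I)"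
      by eventually_elim (rule c[OF fiber_subspace, symmetric])
    ultimately show ?thesis by (rule smooth_near_transform)
  qed
  then show "form_near M E rk x \<omega>" unfolding form_near_frame[OF F] using A by simp
qed

lemma form_near_scale:
  assumes "smooth_near M x f" "form_near M E k x \<omega>"
  shows "form_near M E k x (\<lambda>y. f y *\<^sub>R \<omega> y)"
proof -
  obtain U e where F: "(U, e) \<in> frames E" "x \<in> U" using frame_cover .
  from form_near_alt[OF assms(2)] have "\<forall>\<^sub>F y in nhds x. f y *\<^sub>R \<omega> y \<in> alt_forms (fiber E y) k"
    by eventually_elim (rule alt_forms_scaleR)
  then show ?thesis
    using assms unfolding form_near_frame[OF F] by (auto intro: smooth_near_mult)
qed

text \<open>In degree 0 the truncated \<open>k - 1\<close> is again 0, and the statement remains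
  true: \<open>\<omega>\<close> is fed a list of length at least 1 and gives the default value
  0.\<close>

lemma form_near_contract:
  assumes w: "form_near M E k x \<omega>" and X: "sec_near M E x X"
  shows "form_near M E (k - 1) x (contract X \<omega>)"
proof -
  obtain U e where F: "(U, e) \<in> frames E" "x \<in> U" using frame_cover .
  have "\<forall>\<^sub>F y in nhds x. contract X \<omega> y \<in> alt_forms (fiber E y) (k - 1)"
    using form_near_alt[OF w] sec_near_eventually[OF X]
  proof eventually_elim
    case (elim y)
    have X: "X y \<in> fiber E y" using elim(2) by (rule sec_near_fiber)
    show ?case
      unfolding alt_forms_def
    proof (intro CollectI conjI allI impI ballI)
      fix vs assume "\<not> (length vs = k - 1 \<and> set vs \<subseteq> fiber E y)"
      then show "contract X \<omega> y vs = 0"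
        unfolding contract_def by (intro alt_forms_outside[OF elim(1)]) auto
    next
      fix vs i u v assume A: "length vs = k - 1 \<and> set vs \<subseteq> fiber E y" "i < k - 1"
        "u \<in> fiber E y" "v \<in> fiber E y"
      show "contract X \<omega> y (vs[i := u + v]) = contract X \<omega> y (vs[i := u]) + contract X \<omega> y (vs[i := v])"
        using alt_formsD(1)[OF elim(1), of "X y # vs" "Suc i" u v] A X by (simp add: contract_def)
    next
      fix vs i u c assume A: "length vs = k - 1 \<and> set vs \<subseteq> fiber E y" "i < k - 1" "u \<in> fiber E y"
      show "contract X \<omega> y (vs[i := c *\<^sub>R u]) = c * contract X \<omega> y (vs[i := u])"
        using alt_formsD(2)[OF elim(1), of "X y # vs" "Suc i" u c] A X by (simp add: contract_def)
    next
      fix vs i j assume "length vs = k - 1 \<and> set vs \<subseteq> fiber E y" "i < k - 1" "j < k - 1"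
        "i \<noteq> j \<and> vs ! i = vs ! j"
      then have "\<not> distinct vs" by (auto simp: distinct_conv_nth)
      then have "\<not> distinct (X y # vs)" by simp
      then show "contract X \<omega> y vs = 0"
        unfolding contract_def by (rule alt_forms_repeat[OF elim(1)])
    qed
  qed
  moreover have "smooth_near M x (\<lambda>y. contract X \<omega> y (map (\<lambda>i. e i y) I))"
    if "set I \<subseteq> {..<rk}" for I
  proof -
    have "smooth_near M x (\<lambda>y. \<omega> y (eval_at y (X # map e I)))"
      using X that frame_sec_near[OF F] by (intro form_near_eval[OF w]) auto
    then show ?thesis by (simp add: contract_def comp_def)
  qed
  ultimately show ?thesis unfolding form_near_frame[OF F] by blast
qed

end

section \<open>Tensoriality of the Koszul formula\<close>

lemma drop_nth_append:
  "i < length ps \<Longrightarrow> drop_nth i (ps @ qs) = drop_nth i ps @ qs"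
  "drop_nth (length ps) (ps @ X # qs) = ps @ qs"
  "i > length ps \<Longrightarrow> drop_nth i (ps @ X # qs) = ps @ X # drop_nth (i - Suc (length ps)) qs"
  by (auto simp: drop_nth_def Suc_diff_le take_Cons' split: nat_diff_split)

lemma length_drop_nth: "i < length xs \<Longrightarrow> length (drop_nth i xs) = length xs - 1"
  by (simp add: drop_nth_def)

lemma set_drop_nth: "set (drop_nth i xs) \<subseteq> set xs"
  unfolding drop_nth_def using set_take_subset[of i xs] set_drop_subset[of "Suc i" xs] by auto

text \<open>Deleting another entry keeps the slot of \<open>X\<close>: the surroundings
  \<open>A\<close> and \<open>B\<close> do not depend on \<open>X\<close>, so the deletion can be
  described for all \<open>X\<close> at once. The length of \<open>A\<close> tells whether the slot
  has moved, which accounts for the signs in the Koszul formula.\<close>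

lemma drop_nth_slot:
  assumes "i \<noteq> length ps" "i < length (ps @ X # qs)"
  shows "\<exists>A B. (\<forall>X. drop_nth i (ps @ X # qs) = A @ X # B) \<and> set A \<subseteq> set ps \<and> set B \<subseteq> set qs \<and>
    length A = (if i < length ps then length ps - 1 else length ps) \<and>
    (i < length ps \<longrightarrow> drop_nth i (ps @ qs) = A @ B)"
proof (cases "i < length ps")
  case True
  then show ?thesis
    using set_drop_nth[of i ps]
    by (intro exI[of _ "drop_nth i ps"] exI[of _ qs]) (simp add: drop_nth_append length_drop_nth)
next
  case False
  then show ?thesis
    using set_drop_nth[of "i - Suc (length ps)" qs] assms
    by (intro exI[of _ ps] exI[of _ "drop_nth (i - Suc (length ps)) qs"]) (simp add: drop_nth_append)
qed

locale algd = smooth_mfd M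
  for M :: "('m::{t2_space,second_countable_topology}, 'b::euclidean_space) manifold" +
  fixes E :: "('m, 'v::real_vector) algebroid"
  assumes lie_algebroid: "lie_algebroid M E"
begin

sublocale vbun M E
  using lie_algebroid by unfold_locales (simp add: lie_algebroid_def)

lemma anchor_tangent: "v \<in> fiber E x \<Longrightarrow> anchor E x v \<in> tangent_space M x"
  using lie_algebroid unfolding lie_algebroid_def by blast

lemma anchor_add: "v \<in> fiber E x \<Longrightarrow> w \<in> fiber E x \<Longrightarrow> anchor E x (v + w) f = anchor E x v f + anchor E x w f"
  using lie_algebroid unfolding lie_algebroid_def by (simp add: plus_fun_def)

lemma anchor_scale: "v \<in> fiber E x \<Longrightarrow> anchor E x (c *\<^sub>R v) f = c * anchor E x v f"
  using lie_algebroid unfolding lie_algebroid_def by simp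

lemma anchor_zero: "anchor E x 0 f = 0"
  using anchor_scale[of 0 x 0 f] subspace_0[OF fiber_subspace] by simp

lemma anchor_Sec: "X \<in> Sec M E \<Longrightarrow> (\<lambda>x. anchor E x (X x)) \<in> Sec M (tangent_algebroid M)"
  using lie_algebroid unfolding lie_algebroid_def by blast

lemma Sec_tangent: "X \<in> Sec M E \<Longrightarrow> anchor E x (X x) \<in> tangent_space M x"
  using anchor_tangent Sec_fiber by blast

context
  fixes X Y
  assumes XY: "X \<in> Sec M E" "Y \<in> Sec M E"
begin

lemma bracket_Sec: "bracket E X Y \<in> Sec M E"
  using lie_algebroid XY unfolding lie_algebroid_def by blast

lemma bracket_skew: "bracket E Y X x = - bracket E X Y x"
proof -
  have "bracket E Y X = - bracket E X Y"
    using lie_algebroid XY unfolding lie_algebroid_def by blast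
  then show ?thesis by simp
qed

lemma bracket_add:
  assumes "Z \<in> Sec M E"
  shows "bracket E X (\<lambda>y. Y y + Z y) x = bracket E X Y x + bracket E X Z x"
proof -
  have "bracket E X (Y + Z) = bracket E X Y + bracket E X Z"
    using lie_algebroid XY assms unfolding lie_algebroid_def by blast
  then show ?thesis by (simp add: plus_fun_def)
qed

lemma bracket_mult:
  assumes "smooth_fun M UNIV f"
  shows "bracket E X (\<lambda>y. f y *\<^sub>R Y y) x = f x *\<^sub>R bracket E X Y x + anchor E x (X x) f *\<^sub>R Y x"
proof -
  have "bracket E X (\<lambda>y. f y *\<^sub>R Y y) = (\<lambda>x. f x *\<^sub>R bracket E X Y x + anchor E x (X x) f *\<^sub>R Y x)"
    using lie_algebroid XY assms unfolding lie_algebroid_def by blast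
  then show ?thesis by simp
qed

lemma bracket_jacobi:
  assumes "Z \<in> Sec M E"
  shows "bracket E X (bracket E Y Z) x = bracket E (bracket E X Y) Z x + bracket E Y (bracket E X Z) x"
proof -
  have "bracket E X (bracket E Y Z) = bracket E (bracket E X Y) Z + bracket E Y (bracket E X Z)"
    using lie_algebroid XY assms unfolding lie_algebroid_def by blast
  then show ?thesis by simp
qed

lemma anchor_bracket:
  "(\<lambda>x. anchor E x (bracket E X Y x)) =
    bracket (tangent_algebroid M) (\<lambda>x. anchor E x (X x)) (\<lambda>x. anchor E x (Y x))"
  using lie_algebroid XY unfolding lie_algebroid_def by blast

lemma anchor_bracket_apply:
  assumes "smooth_near M x f"
  shows "anchor E x (bracket E X Y x) f =
    anchor E x (X x) (\<lambda>y. anchor E y (Y y) f) - anchor E x (Y x) (\<lambda>y. anchor E y (X y) f)"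
  using fun_cong[OF fun_cong[OF anchor_bracket, of x], of f] assms
  by (simp add: tangent_algebroid_def)

end

lemma bracket_mult_left:
  assumes "X \<in> Sec M E" "Y \<in> Sec M E" "smooth_fun M UNIV f"
  shows "bracket E (\<lambda>y. f y *\<^sub>R Y y) X x = f x *\<^sub>R bracket E Y X x - anchor E x (X x) f *\<^sub>R Y x"
  using bracket_skew[OF assms(1) Sec_scale[OF assms(3,2)], of x] bracket_mult[OF assms, of x]
    bracket_skew[OF assms(1,2), of x] by simp

lemma bracket_add_left:
  assumes "X \<in> Sec M E" "Y \<in> Sec M E" "Z \<in> Sec M E"
  shows "bracket E (\<lambda>y. Y y + Z y) X x = bracket E Y X x + bracket E Z X x"
  using bracket_skew[OF assms(1) Sec_add[OF assms(2,3)], of x] bracket_add[OF assms, of x]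
    bracket_skew[OF assms(1,2), of x] bracket_skew[OF assms(1,3), of x] by simp

lemma form_near_eval_Sec:
  "form_near M E k x \<omega> \<Longrightarrow> set Xs \<subseteq> Sec M E \<Longrightarrow> smooth_near M x (\<lambda>y. \<omega> y (eval_at y Xs))"
  by (rule form_near_eval) (use SecD in blast)+

lemma eval_at_fiber: "set Xs \<subseteq> Sec M E \<Longrightarrow> set (eval_at x Xs) \<subseteq> fiber E x"
  using Sec_fiber by fastforce

context
  fixes k x \<omega>
  assumes w: "form_near M E k x \<omega>"
begin

text \<open>The terms in which the function \<open>f\<close> is differentiated cancel: by the Leibniz rule each of
  them occurs once in the first and once in the second sum of the Koszul formula.\<close>

lemma koszul_linear:
  assumes f: "smooth_fun M UNIV f" and X: "X \<in> Sec M E" and Y: "Y \<in> Sec M E"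
    and ps: "set ps \<subseteq> Sec M E" and qs: "set qs \<subseteq> Sec M E"
  shows "koszul E \<omega> (ps @ (\<lambda>y. f y *\<^sub>R X y + Y y) # qs) x =
    f x * koszul E \<omega> (ps @ X # qs) x + koszul E \<omega> (ps @ Y # qs) x"
proof -
  let ?p = "length ps"
  let ?L = "\<lambda>X. ps @ X # qs"
  let ?Z = "\<lambda>y. f y *\<^sub>R X y + Y y"
  let ?m = "length (ps @ X # qs)"
  have fx: "smooth_near M y f" for y using f smooth_fun_UNIV by blast
  have fX: "(\<lambda>y. f y *\<^sub>R X y) \<in> Sec M E" by (rule Sec_scale[OF f X])
  have alt: "\<omega> x \<in> alt_forms (fiber E x) k" by (rule form_near_alt_at[OF w])
  define t1 where "t1 X i = (-1) ^ i * anchor E x ((?L X ! i) x) (\<lambda>y. \<omega> y (eval_at y (drop_nth i (?L X))))"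
    for X i
  define t2 where "t2 X j i = (-1) ^ (i + j) *
    \<omega> x (eval_at x (bracket E (?L X ! i) (?L X ! j) # drop_nth i (drop_nth j (?L X))))" for X j i
  \<comment> \<open>The unwanted term of index \<open>i\<close>, in which the section of that index
    differentiates \<open>f\<close>. In the slot itself \<open>f\<close> is a mere factor, hence the
    value 0 at \<open>?p\<close>.\<close>
  define c where "c i = (if i = ?p then 0 else
    (-1) ^ i * anchor E x ((?L X ! i) x) f * \<omega> x (eval_at x (drop_nth i (?L X))))" for i
  have K: "koszul E \<omega> (?L W) x = (\<Sum>i<?m. t1 W i) + (\<Sum>j<?m. \<Sum>i<j. t2 W j i)" for W
    unfolding koszul_def t1_def t2_def by simp
  have LS: "?L X ! i \<in> Sec M E" if "i < ?m" for i
  proof -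
    have "?L X ! i \<in> set (?L X)" using that by (intro nth_mem) simp
    then show ?thesis using X ps qs by auto
  qed
  have Lne: "?L W ! i = ?L X ! i" if "i \<noteq> ?p" for i W
    using that by (auto simp: nth_append nth_Cons')
  have lin: "\<omega> y (us @ (r *\<^sub>R u + u') # us') = r * \<omega> y (us @ u # us') + \<omega> y (us @ u' # us')"
    if "\<omega> y \<in> alt_forms (fiber E y) k" "u \<in> fiber E y" "u' \<in> fiber E y" for y us us' r u u'
  proof -
    have ru: "r *\<^sub>R u \<in> fiber E y" using subspace_scale[OF fiber_subspace that(2)] .
    show ?thesis
      using alt_forms_add[OF that(1) ru that(3) subspace_add[OF fiber_subspace ru that(3)]]
        alt_forms_scale[OF that(1,2) ru] by simp
  qed
  have slot: "\<omega> y (eval_at y (A @ ?Z # B)) = f y * \<omega> y (eval_at y (A @ X # B)) + \<omega> y (eval_at y (A @ Y # B))"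
    if "\<omega> y \<in> alt_forms (fiber E y) k" for y A B
    using lin[OF that Sec_fiber[OF X] Sec_fiber[OF Y], of "eval_at y A" "f y" "eval_at y B"] by simp
  have 1: "t1 ?Z i = f x * t1 X i + t1 Y i + c i" if i: "i < ?m" for i
  proof (cases "i = ?p")
    case True
    then show ?thesis
      using anchor_add[OF Sec_fiber[OF fX] Sec_fiber[OF Y]] anchor_scale[OF Sec_fiber[OF X]]
      by (simp add: t1_def c_def drop_nth_append algebra_simps)
  next
    case False
    obtain A B where AB: "\<And>X. drop_nth i (ps @ X # qs) = A @ X # B" "set A \<subseteq> set ps" "set B \<subseteq> set qs"
      using drop_nth_slot[OF False i] by blast
    have S: "set (A @ X # B) \<subseteq> Sec M E" "set (A @ Y # B) \<subseteq> Sec M E" using AB ps qs X Y by auto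
    note sm = form_near_eval_Sec[OF w S(1)] form_near_eval_Sec[OF w S(2)]
    let ?v = "anchor E x ((?L X ! i) x)"
    have v: "?v \<in> tangent_space M x" using Sec_tangent LS[OF i] by blast
    have "?v (\<lambda>y. \<omega> y (eval_at y (A @ ?Z # B))) =
        ?v (\<lambda>y. f y * \<omega> y (eval_at y (A @ X # B)) + \<omega> y (eval_at y (A @ Y # B)))"
      by (intro tangent_cong[OF v] eventually_mono[OF form_near_alt[OF w]]) (rule slot)
    also have "\<dots> = ?v (\<lambda>y. f y * \<omega> y (eval_at y (A @ X # B))) + ?v (\<lambda>y. \<omega> y (eval_at y (A @ Y # B)))"
      by (rule tangent_add[OF v smooth_near_mult[OF fx sm(1)] sm(2)])
    also have "?v (\<lambda>y. f y * \<omega> y (eval_at y (A @ X # B))) =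
        f x * ?v (\<lambda>y. \<omega> y (eval_at y (A @ X # B))) + \<omega> x (eval_at x (A @ X # B)) * ?v f"
      by (rule tangent_mult[OF v fx sm(1)])
    finally show ?thesis
      unfolding t1_def c_def AB(1) Lne[OF False, of Y] Lne[OF False, of ?Z] using False
      by (simp add: algebra_simps)
  qed
  \<comment> \<open>A pair of indices produces an unwanted term only if it contains
    \<open>?p\<close>: the Leibniz rule for the bracket returns a multiple of \<open>X\<close>, and
    moving \<open>X\<close> from the front back to its slot gives the sign of
    \<open>c\<close>.\<close>
  have 2: "t2 ?Z j i = f x * t2 X j i + t2 Y j i - (if j = ?p then c i else if i = ?p then c j else 0)"
    if j: "j < ?m" and i: "i < j" for i j
  proof -
    have im: "i < ?m" using i j by simp
    have br: "\<omega> x ((f x *\<^sub>R u + a *\<^sub>R X x + u') # us) = f x * \<omega> x (u # us) + a * \<omega> x (X x # us) + \<omega> x (u' # us)"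
      if "u \<in> fiber E x" "u' \<in> fiber E x" for u a u' us
      using lin[OF alt that(1) subspace_add[OF fiber_subspace subspace_scale[OF fiber_subspace Sec_fiber[OF X]] that(2)],
          of "[]" "f x" a us] lin[OF alt Sec_fiber[OF X] that(2), of "[]" a us]
      by (simp add: add.assoc)
    have sq: "(-1 :: real) ^ n * (-1) ^ n = 1" for n by (simp flip: power_mult_distrib)
    consider "j = ?p" | "i = ?p" | "j \<noteq> ?p" "i \<noteq> ?p" by blast
    then show ?thesis
    proof cases
      case 1
      then have ip: "i \<noteq> ?p" "i < ?p" using i by simp_all
      obtain A B where AB: "\<And>X. drop_nth i (ps @ X # qs) = A @ X # B"
        "length A = (if i < length ps then length ps - 1 else length ps)"
        "i < length ps \<Longrightarrow> drop_nth i (ps @ qs) = A @ B"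
        using drop_nth_slot[OF ip(1) im] by blast
      let ?V = "?L X ! i"
      let ?R = "eval_at x (A @ B)"
      have R: "drop_nth i (drop_nth ?p (ps @ X # qs)) = A @ B" for X
        using AB(3)[OF ip(2)] by (simp add: drop_nth_append)
      have b: "bracket E ?V ?Z x = f x *\<^sub>R bracket E ?V X x + anchor E x (?V x) f *\<^sub>R X x + bracket E ?V Y x"
        using bracket_add[OF LS[OF im] fX Y, of x] bracket_mult[OF LS[OF im] X f, of x] by simp
      have "\<omega> x (bracket E ?V ?Z x # ?R) = f x * \<omega> x (bracket E ?V X x # ?R) +
          anchor E x (?V x) f * \<omega> x (X x # ?R) + \<omega> x (bracket E ?V Y x # ?R)"
        unfolding b by (rule br; rule Sec_fiber; rule bracket_Sec[OF LS[OF im]]; fact)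
      moreover have "\<omega> x (eval_at x (A @ X # B)) = (-1) ^ (?p - 1) * \<omega> x (X x # ?R)"
        using alt_forms_move[OF alt fiber_subspace, of "[]" "eval_at x A" "X x" "eval_at x B"] AB(2) ip by simp
      moreover have "(-1 :: real) ^ (i + ?p) = - ((-1) ^ i * (-1) ^ (?p - 1))"
        using ip(2) by (cases ?p) (simp_all add: power_add)
      ultimately show ?thesis
        unfolding t2_def c_def 1 Lne[OF ip(1), of Y] Lne[OF ip(1), of ?Z] R AB(1) using ip(1) sq[of "?p - 1"]
        by (simp add: ring_distribs)
    next
      case 2
      then have jp: "j \<noteq> ?p" using i by simp
      obtain A B where AB: "\<And>X. drop_nth j (ps @ X # qs) = A @ X # B"
        "length A = (if j < length ps then length ps - 1 else length ps)"
        using drop_nth_slot[OF jp j] by blast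
      have lA: "?p = length A" using AB(2) 2 i by simp
      let ?V = "?L X ! j"
      let ?R = "eval_at x (A @ B)"
      have R: "drop_nth ?p (A @ X # B) = A @ B" for X
        unfolding lA by (simp add: drop_nth_append)
      have b: "bracket E ?Z ?V x = f x *\<^sub>R bracket E X ?V x + (- anchor E x (?V x) f) *\<^sub>R X x + bracket E Y ?V x"
        using bracket_add_left[OF LS[OF j] fX Y, of x] bracket_mult_left[OF LS[OF j] X f, of x] by simp
      have "\<omega> x (bracket E ?Z ?V x # ?R) = f x * \<omega> x (bracket E X ?V x # ?R) +
          (- anchor E x (?V x) f) * \<omega> x (X x # ?R) + \<omega> x (bracket E Y ?V x # ?R)"
        unfolding b by (rule br; rule Sec_fiber; rule bracket_Sec[OF _ LS[OF j]]; fact)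
      moreover have "\<omega> x (eval_at x (A @ X # B)) = (-1) ^ ?p * \<omega> x (X x # ?R)"
        using alt_forms_move[OF alt fiber_subspace, of "[]" "eval_at x A" "X x" "eval_at x B"] lA by simp
      moreover have "(-1 :: real) ^ (?p + j) = (-1) ^ j * (-1) ^ ?p"
        by (simp add: power_add)
      ultimately show ?thesis
        unfolding t2_def c_def 2 Lne[OF jp, of Y] Lne[OF jp, of ?Z] R AB(1) using jp sq[of ?p]
        by (simp add: R ring_distribs)
    next
      case 3
      obtain A B where AB: "\<And>X. drop_nth j (ps @ X # qs) = A @ X # B"
        "length A = (if j < length ps then length ps - 1 else length ps)"
        using drop_nth_slot[OF 3(1) j] by blast
      have iA: "i \<noteq> length A" "i < length (A @ X # B)"
        using AB(2) 3 i j length_drop_nth[OF j] unfolding AB(1) by (auto split: if_splits)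
      obtain A' B' where AB': "\<And>X. drop_nth i (A @ X # B) = A' @ X # B'"
        using drop_nth_slot[OF iA] by blast
      let ?b = "bracket E (?L X ! i) (?L X ! j)"
      show ?thesis
        unfolding t2_def AB(1) AB' Lne[OF 3(1), of Y] Lne[OF 3(1), of ?Z] Lne[OF 3(2), of Y] Lne[OF 3(2), of ?Z]
        using slot[OF alt, of "?b # A'" B'] 3 by (simp add: algebra_simps)
    qed
  qed
  have s1: "(\<Sum>i<?m. t1 ?Z i) = f x * (\<Sum>i<?m. t1 X i) + (\<Sum>i<?m. t1 Y i) + (\<Sum>i<?m. c i)"
    unfolding sum_distrib_left sum.distrib[symmetric] by (rule sum.cong) (use 1 in auto)
  have s2: "(\<Sum>j<?m. \<Sum>i<j. t2 ?Z j i) = f x * (\<Sum>j<?m. \<Sum>i<j. t2 X j i) + (\<Sum>j<?m. \<Sum>i<j. t2 Y j i) -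
      (\<Sum>j<?m. \<Sum>i<j. if j = ?p then c i else if i = ?p then c j else 0)"
    unfolding sum_distrib_left sum.distrib[symmetric] sum_subtractf[symmetric]
    by (intro sum.cong refl) (use 2 in auto)
  \<comment> \<open>Each index other than \<open>?p\<close> forms exactly one pair with
    \<open>?p\<close>, so the pairs together contribute the full sum of \<open>c\<close>, which
    cancels the one from the first sum.\<close>
  have "(\<Sum>i<j. if j = ?p then c i else if i = ?p then c j else 0) =
      (if j = ?p then (\<Sum>i<?p. c i) else if ?p < j then c j else 0)" for j
    by (cases "j = ?p") auto
  then have "(\<Sum>j<?m. \<Sum>i<j. if j = ?p then c i else if i = ?p then c j else 0) =
      (\<Sum>j<?m. if j = ?p then (\<Sum>i<?p. c i) else if ?p < j then c j else 0)" by simp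
  also have "\<dots> = (\<Sum>i<?p. c i) + (\<Sum>j\<in>{..<?m} - {?p}. if ?p < j then c j else 0)"
    by (subst sum.remove[of _ ?p]) auto
  also have "(\<Sum>j\<in>{..<?m} - {?p}. if ?p < j then c j else 0) = (\<Sum>j\<in>{Suc ?p..<?m}. c j)"
    by (rule sum.mono_neutral_cong_right) auto
  also have "(\<Sum>i<?p. c i) = (\<Sum>i<Suc ?p. c i)" by (simp add: c_def)
  also have "(\<Sum>i<Suc ?p. c i) + (\<Sum>j\<in>{Suc ?p..<?m}. c j) = sum c ({..<Suc ?p} \<union> {Suc ?p..<?m})"
    by (rule sum.union_disjoint[symmetric]) auto
  also have "{..<Suc ?p} \<union> {Suc ?p..<?m} = {..<?m}" by auto
  finally show ?thesis unfolding K s1 s2 by (simp add: algebra_simps)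
qed

lemma koszul_zero:
  assumes "set ps \<subseteq> Sec M E" "set qs \<subseteq> Sec M E"
  shows "koszul E \<omega> (ps @ (\<lambda>y. 0) # qs) x = 0"
proof -
  have "smooth_fun M UNIV (\<lambda>y. 1)" "(\<lambda>y. 0) \<in> Sec M E"
    using sec_near_zero Sec_iff by (auto simp: smooth_fun_UNIV)
  from koszul_linear[OF this this(2) assms] show ?thesis by simp
qed

lemma koszul_add:
  assumes "X \<in> Sec M E" "Y \<in> Sec M E" "set ps \<subseteq> Sec M E" "set qs \<subseteq> Sec M E"
  shows "koszul E \<omega> (ps @ (\<lambda>y. X y + Y y) # qs) x =
    koszul E \<omega> (ps @ X # qs) x + koszul E \<omega> (ps @ Y # qs) x"
proof -
  have "smooth_fun M UNIV (\<lambda>y. 1)" by (simp add: smooth_fun_UNIV)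
  from koszul_linear[OF this assms] show ?thesis by simp
qed

lemma koszul_scale:
  assumes "smooth_fun M UNIV f" "X \<in> Sec M E" "set ps \<subseteq> Sec M E" "set qs \<subseteq> Sec M E"
  shows "koszul E \<omega> (ps @ (\<lambda>y. f y *\<^sub>R X y) # qs) x = f x * koszul E \<omega> (ps @ X # qs) x"
proof -
  have "(\<lambda>y. 0) \<in> Sec M E" using sec_near_zero Sec_iff by auto
  from koszul_linear[OF assms(1,2) this assms(3,4)] show ?thesis using koszul_zero[OF assms(3,4)] by simp
qed

lemma koszul_vanish:
  assumes "X \<in> Sec M E" "X x = 0" "set ps \<subseteq> Sec M E" "set qs \<subseteq> Sec M E"
  shows "koszul E \<omega> (ps @ X # qs) x = 0"
  by (rule tensorial_vanish[where x = x and X = X])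
    (use assms koszul_add koszul_scale in auto)

text \<open>Arguments are exchanged one at a time: the difference of two sections with equal value
  at \<open>x\<close> vanishes there, and \<open>koszul_vanish\<close> applies in that slot. The
  prefix \<open>ps\<close> takes up the arguments already exchanged.\<close>

lemma koszul_cong:
  assumes "set Xs \<subseteq> Sec M E" "set Ys \<subseteq> Sec M E" "set ps \<subseteq> Sec M E" "eval_at x Xs = eval_at x Ys"
  shows "koszul E \<omega> (ps @ Xs) x = koszul E \<omega> (ps @ Ys) x"
  using assms
proof (induction Xs arbitrary: Ys ps)
  case (Cons X Xs)
  then obtain Y Ys' where Y: "Ys = Y # Ys'" "X x = Y x" "eval_at x Xs = eval_at x Ys'"
    by (cases Ys) auto
  have S: "X \<in> Sec M E" "Y \<in> Sec M E" "set Xs \<subseteq> Sec M E" "set Ys' \<subseteq> Sec M E"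
    using Cons.prems Y by auto
  have "koszul E \<omega> (ps @ X # Xs) x =
      koszul E \<omega> (ps @ (\<lambda>y. X y - Y y) # Xs) x + koszul E \<omega> (ps @ Y # Xs) x"
    using koszul_add[OF Sec_diff[OF S(1,2)] S(2) Cons.prems(3) S(3)] by simp
  also have "koszul E \<omega> (ps @ (\<lambda>y. X y - Y y) # Xs) x = 0"
    using Y(2) by (intro koszul_vanish Sec_diff S Cons.prems(3)) simp
  also have "koszul E \<omega> (ps @ Y # Xs) x = koszul E \<omega> (ps @ Y # Ys') x"
    using Cons.IH[of Ys' "ps @ [Y]"] S Cons.prems(3) Y(3) by simp
  finally show ?case by (simp add: Y(1))
qed simp

text \<open>Independence of the extending sections, from \<open>koszul_cong\<close>, is what gives
  the description in \<open>ext_d\<close> a value.\<close>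

lemma ext_d_eval:
  assumes Xs: "set Xs \<subseteq> Sec M E"
  shows "ext_d M E \<omega> x (eval_at x Xs) = koszul E \<omega> Xs x"
proof -
  have "(THE c. \<exists>Ys. set Ys \<subseteq> Sec M E \<and> eval_at x Ys = eval_at x Xs \<and> c = koszul E \<omega> Ys x) =
      koszul E \<omega> Xs x"
  proof (rule the_equality)
    show "\<exists>Ys. set Ys \<subseteq> Sec M E \<and> eval_at x Ys = eval_at x Xs \<and> koszul E \<omega> Xs x = koszul E \<omega> Ys x"
      using Xs by blast
    fix c assume "\<exists>Ys. set Ys \<subseteq> Sec M E \<and> eval_at x Ys = eval_at x Xs \<and> c = koszul E \<omega> Ys x"
    then obtain Ys where "set Ys \<subseteq> Sec M E" "eval_at x Ys = eval_at x Xs" "c = koszul E \<omega> Ys x" by blast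
    then show "c = koszul E \<omega> Xs x" using koszul_cong[of Ys Xs "[]"] Xs by simp
  qed
  then show ?thesis using eval_at_fiber[OF Xs, of x] by (simp add: ext_d_def)
qed

text \<open>The first sum evaluates the form on lists with one entry removed, and the second removes
  two entries and adds a bracket; both have the wrong length, and the form has its default value
  0.\<close>

lemma koszul_length:
  assumes Xs: "set Xs \<subseteq> Sec M E" and l: "length Xs \<noteq> k + 1"
  shows "koszul E \<omega> Xs x = 0"
proof -
  have "anchor E x ((Xs ! i) x) (\<lambda>y. \<omega> y (eval_at y (drop_nth i Xs))) = 0" if i: "i < length Xs" for i
  proof (rule tangent_zero[where v = "anchor E x ((Xs ! i) x)"])
    show "anchor E x ((Xs ! i) x) \<in> tangent_space M x" using Sec_tangent Xs i nth_mem by blast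
    have "length (drop_nth i Xs) \<noteq> k" using l i by (simp add: length_drop_nth)
    then show "\<forall>\<^sub>F y in nhds x. \<omega> y (eval_at y (drop_nth i Xs)) = 0"
      using form_near_alt[OF w] by (elim eventually_mono) (simp add: alt_forms_outside)
  qed
  moreover have "\<omega> x (eval_at x (bracket E (Xs ! i) (Xs ! j) # drop_nth i (drop_nth j Xs))) = 0"
    if "j < length Xs" "i < j" for i j
  proof (rule alt_forms_outside[OF form_near_alt_at[OF w]])
    have "Suc (length Xs - 2) \<noteq> k" using l that by linarith
    moreover have "length (drop_nth i (drop_nth j Xs)) = length Xs - 2"
      using that by (simp add: length_drop_nth)
    ultimately show "\<not> (length (eval_at x (bracket E (Xs ! i) (Xs ! j) # drop_nth i (drop_nth j Xs))) = k \<and>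
        set (eval_at x (bracket E (Xs ! i) (Xs ! j) # drop_nth i (drop_nth j Xs))) \<subseteq> fiber E x)"
      by simp
  qed
  ultimately show ?thesis unfolding koszul_def by simp
qed

section \<open>Cartan's formula for the Lie derivative\<close>

lemma lie_form_eval_koszul:
  assumes X: "X \<in> Sec M E" and Ys: "set Ys \<subseteq> Sec M E"
  shows "lie_form M E X \<omega> x (eval_at x Ys) = koszul E (contract X \<omega>) Ys x + koszul E \<omega> (X # Ys) x"
proof -
  note c = form_near_contract[OF w SecD[OF X]]
  have "set (X # Ys) \<subseteq> Sec M E" using X Ys by simp
  from ext_d_eval[OF this] algd.ext_d_eval[OF algd_axioms c Ys]
  show ?thesis by (simp add: lie_form_def contract_def)
qed

text \<open>In the Koszul sum of \<open>X # Ys\<close> the terms in which \<open>X\<close>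
  differentiates or is bracketed give the right-hand side; the remaining ones are those of the
  contraction with opposite sign and cancel.\<close>

lemma lie_form_eval:
  assumes X: "X \<in> Sec M E" and Ys: "set Ys \<subseteq> Sec M E"
  shows "lie_form M E X \<omega> x (eval_at x Ys) = anchor E x (X x) (\<lambda>y. \<omega> y (eval_at y Ys)) -
    (\<Sum>i<length Ys. \<omega> x (eval_at x (Ys[i := bracket E X (Ys ! i)])))"
proof -
  let ?m = "length Ys"
  let ?a = "\<lambda>i. anchor E x ((Ys ! i) x) (\<lambda>y. \<omega> y (X y # eval_at y (drop_nth i Ys)))"
  let ?b = "\<lambda>i j. \<omega> x (X x # bracket E (Ys ! i) (Ys ! j) x # eval_at x (drop_nth i (drop_nth j Ys)))"
  have alt: "\<omega> x \<in> alt_forms (fiber E x) k" by (rule form_near_alt_at[OF w])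
  have D: "drop_nth (Suc i) (X # Ys) = X # drop_nth i Ys" "drop_nth 0 (X # Ys) = Ys" for i
    by (simp_all add: drop_nth_def)
  have D2: "drop_nth (Suc i) (X # Zs) = X # drop_nth i Zs" "drop_nth 0 (X # Zs) = Zs"
    for i and Zs :: "('m \<Rightarrow> 'v) list"
    by (simp_all add: drop_nth_def)
  have k1: "koszul E (contract X \<omega>) Ys x = (\<Sum>i<?m. (-1) ^ i * ?a i) + (\<Sum>j<?m. \<Sum>i<j. (-1) ^ (i + j) * ?b i j)"
    by (simp add: koszul_def contract_def)
  have "(\<Sum>i<Suc ?m. (-1) ^ i * anchor E x (((X # Ys) ! i) x) (\<lambda>y. \<omega> y (eval_at y (drop_nth i (X # Ys))))) =
      anchor E x (X x) (\<lambda>y. \<omega> y (eval_at y Ys)) - (\<Sum>i<?m. (-1) ^ i * ?a i)"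
    by (subst sum.lessThan_Suc_shift) (simp add: D sum_negf)
  moreover have "(\<Sum>j<Suc ?m. \<Sum>i<j. (-1) ^ (i + j) * \<omega> x (eval_at x (bracket E ((X # Ys) ! i) ((X # Ys) ! j) #
      drop_nth i (drop_nth j (X # Ys))))) =
      - (\<Sum>i<?m. \<omega> x (eval_at x (Ys[i := bracket E X (Ys ! i)]))) -
      (\<Sum>j<?m. \<Sum>i<j. (-1) ^ (i + j) * ?b i j)"
  proof -
    have inner: "(\<Sum>i<Suc j. (-1) ^ (i + Suc j) * \<omega> x (eval_at x (bracket E ((X # Ys) ! i) (Ys ! j) #
        drop_nth i (X # drop_nth j Ys)))) =
        - \<omega> x (eval_at x (Ys[j := bracket E X (Ys ! j)])) - (\<Sum>i<j. (-1) ^ (i + j) * ?b i j)"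
      if j: "j < ?m" for j
    proof -
      have sp: "Ys[j := bracket E X (Ys ! j)] = take j Ys @ bracket E X (Ys ! j) # drop (Suc j) Ys"
        using j by (rule upd_conv_take_nth_drop)
      have "\<omega> x (eval_at x (Ys[j := bracket E X (Ys ! j)])) =
          (-1) ^ j * \<omega> x (bracket E X (Ys ! j) x # eval_at x (drop_nth j Ys))"
        unfolding sp drop_nth_def
        using alt_forms_move[OF alt fiber_subspace, of "[]" "eval_at x (take j Ys)"] j by simp
      \<comment> \<open>Both indices are shifted by one, which preserves the parity of their sum;
        the sign change comes from moving \<open>X\<close> back in front of the bracket.\<close>
      moreover have "\<omega> x (bracket E (Ys ! i) (Ys ! j) x # X x # eval_at x (drop_nth i (drop_nth j Ys))) =
          - ?b i j" for i
        by (rule alt_forms_swap[OF alt fiber_subspace, of "[]", unfolded append_Nil])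
      ultimately show ?thesis
        by (subst sum.lessThan_Suc_shift) (simp add: D2 sum_negf)
    qed
    have "(\<Sum>j<Suc ?m. \<Sum>i<j. (-1) ^ (i + j) * \<omega> x (eval_at x (bracket E ((X # Ys) ! i) ((X # Ys) ! j) #
        drop_nth i (drop_nth j (X # Ys))))) =
        (\<Sum>j<?m. \<Sum>i<Suc j. (-1) ^ (i + Suc j) * \<omega> x (eval_at x (bracket E ((X # Ys) ! i) (Ys ! j) #
        drop_nth i (X # drop_nth j Ys))))"
      by (subst sum.lessThan_Suc_shift) (simp only: D nth_Cons_Suc lessThan_0 sum.empty add_0)
    also have "\<dots> = (\<Sum>j<?m. - \<omega> x (eval_at x (Ys[j := bracket E X (Ys ! j)])) -
        (\<Sum>i<j. (-1) ^ (i + j) * ?b i j))"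
      by (rule sum.cong) (use inner in auto)
    finally show ?thesis by (simp add: sum_subtractf sum_negf)
  qed
  ultimately have k2: "koszul E \<omega> (X # Ys) x =
      (anchor E x (X x) (\<lambda>y. \<omega> y (eval_at y Ys)) - (\<Sum>i<?m. (-1) ^ i * ?a i)) +
      (- (\<Sum>i<?m. \<omega> x (eval_at x (Ys[i := bracket E X (Ys ! i)]))) -
      (\<Sum>j<?m. \<Sum>i<j. (-1) ^ (i + j) * ?b i j))"
    unfolding koszul_def by (simp only: length_Cons)
  show ?thesis
    unfolding lie_form_eval_koszul[OF X Ys] k1 k2 by simp
qed

text \<open>Additivity and homogeneity are inherited from the tensorial Koszul sums; the alternating
  property is read off from \<open>lie_form_eval\<close>.\<close>

lemma lie_form_alt:
  assumes X: "X \<in> Sec M E"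
  shows "lie_form M E X \<omega> x \<in> alt_forms (fiber E x) k"
proof -
  note c = form_near_contract[OF w SecD[OF X]]
  have alt: "\<omega> x \<in> alt_forms (fiber E x) k" by (rule form_near_alt_at[OF w])
  show ?thesis
    unfolding alt_forms_def
  proof (intro CollectI conjI allI impI ballI)
    fix vs assume A: "\<not> (length vs = k \<and> set vs \<subseteq> fiber E x)"
    show "lie_form M E X \<omega> x vs = 0"
    proof (cases "set vs \<subseteq> fiber E x")
      case True
      then obtain Ys where Ys: "set Ys \<subseteq> Sec M E" "eval_at x Ys = vs" by (rule Sec_through_list)
      have "length Ys \<noteq> k" using A True Ys(2) by auto
      then have "koszul E \<omega> (X # Ys) x = 0" using X Ys by (intro koszul_length) auto
      moreover have "koszul E (contract X \<omega>) Ys x = 0"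
      proof (cases "k = 0")
        case False
        then show ?thesis
          using algd.koszul_length[OF algd_axioms c Ys(1)] \<open>length Ys \<noteq> k\<close> by simp
      next
        case True
        have "\<forall>\<^sub>F y in nhds x. contract X \<omega> y = 0"
          using form_near_alt[OF w]
          by eventually_elim (auto simp: contract_def True zero_fun_def intro: alt_forms_outside)
        \<comment> \<open>A form vanishing near \<open>x\<close> counts as a form of every degree.
          In degree \<open>length Ys\<close> the list \<open>Ys\<close> has the wrong length for its
          differential, and \<open>koszul_length\<close> gives 0.\<close>
        then have "form_near M E (length Ys) x (contract X \<omega>)"
        proof -
          assume *: "\<forall>\<^sub>F y in nhds x. contract X \<omega> y = 0"
          obtain U e where F: "(U, e) \<in> frames E" "x \<in> U" using frame_cover .
          have "\<forall>\<^sub>F y in nhds x. contract X \<omega> y \<in> alt_forms (fiber E y) (length Ys)"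
            using * by eventually_elim (simp add: alt_forms_zero)
          moreover have "smooth_near M x (\<lambda>y. contract X \<omega> y (map (\<lambda>i. e i y) I))" for I
          proof -
            have "\<forall>\<^sub>F y in nhds x. 0 = contract X \<omega> y (map (\<lambda>i. e i y) I)"
              using * by eventually_elim simp
            with smooth_near_const show ?thesis by (rule smooth_near_transform)
          qed
          ultimately show ?thesis unfolding form_near_frame[OF F] by blast
        qed
        then show ?thesis using algd.koszul_length[OF algd_axioms _ Ys(1)] by simp
      qed
      ultimately show ?thesis using lie_form_eval_koszul[OF X Ys(1)] Ys(2) by simp
    next
      case False
      then show ?thesis by (simp add: lie_form_def ext_d_def contract_def)
    qed
  next
    fix vs i u v assume A: "length vs = k \<and> set vs \<subseteq> fiber E x" "i < k" "u \<in> fiber E x" "v \<in> fiber E x"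
    obtain ps where ps: "set ps \<subseteq> Sec M E" "eval_at x ps = take i vs"
      using A set_take_subset[of i vs] by (metis Sec_through_list subset_trans)
    obtain qs where qs: "set qs \<subseteq> Sec M E" "eval_at x qs = drop (Suc i) vs"
      using A set_drop_subset[of "Suc i" vs] by (metis Sec_through_list subset_trans)
    obtain P where P: "P \<in> Sec M E" "P x = u" using A(3) by (rule Sec_through)
    obtain Q where Q: "Q \<in> Sec M E" "Q x = v" using A(4) by (rule Sec_through)
    have ev: "eval_at x (ps @ Z # qs) = vs[i := Z x]" for Z
      using A ps qs by (simp add: upd_conv_take_nth_drop)
    have L: "lie_form M E X \<omega> x (vs[i := Z x]) =
        koszul E (contract X \<omega>) (ps @ Z # qs) x + koszul E \<omega> ((X # ps) @ Z # qs) x" if "Z \<in> Sec M E" for Z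
      unfolding ev[symmetric] using lie_form_eval_koszul[OF X, of "ps @ Z # qs"] that ps qs by simp
    have Xps: "set (X # ps) \<subseteq> Sec M E" using X ps by simp
    show "lie_form M E X \<omega> x (vs[i := u + v]) = lie_form M E X \<omega> x (vs[i := u]) + lie_form M E X \<omega> x (vs[i := v])"
      using L[OF P(1)] L[OF Q(1)] L[OF Sec_add[OF P(1) Q(1)]] P(2) Q(2)
        algd.koszul_add[OF algd_axioms c P(1) Q(1) ps(1) qs(1)] koszul_add[OF P(1) Q(1) Xps qs(1)]
      by simp
  next
    fix vs i u r assume A: "length vs = k \<and> set vs \<subseteq> fiber E x" "i < k" "u \<in> fiber E x"
    obtain ps where ps: "set ps \<subseteq> Sec M E" "eval_at x ps = take i vs"
      using A set_take_subset[of i vs] by (metis Sec_through_list subset_trans)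
    obtain qs where qs: "set qs \<subseteq> Sec M E" "eval_at x qs = drop (Suc i) vs"
      using A set_drop_subset[of "Suc i" vs] by (metis Sec_through_list subset_trans)
    obtain P where P: "P \<in> Sec M E" "P x = u" using A(3) by (rule Sec_through)
    have ev: "eval_at x (ps @ Z # qs) = vs[i := Z x]" for Z
      using A ps qs by (simp add: upd_conv_take_nth_drop)
    have L: "lie_form M E X \<omega> x (vs[i := Z x]) =
        koszul E (contract X \<omega>) (ps @ Z # qs) x + koszul E \<omega> ((X # ps) @ Z # qs) x" if "Z \<in> Sec M E" for Z
      unfolding ev[symmetric] using lie_form_eval_koszul[OF X, of "ps @ Z # qs"] that ps qs by simp
    have Xps: "set (X # ps) \<subseteq> Sec M E" using X ps by simp
    have r: "smooth_fun M UNIV (\<lambda>y. r)" by (simp add: smooth_fun_UNIV)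
    show "lie_form M E X \<omega> x (vs[i := r *\<^sub>R u]) = r * lie_form M E X \<omega> x (vs[i := u])"
      using L[OF P(1)] L[OF Sec_scale[OF r P(1)]] P(2)
        algd.koszul_scale[OF algd_axioms c r P(1) ps(1) qs(1)] koszul_scale[OF r P(1) Xps qs(1)]
      by (simp add: ring_distribs)
  next
    fix vs i j assume A: "length vs = k \<and> set vs \<subseteq> fiber E x" "i < k" "j < k" "i \<noteq> j \<and> vs ! i = vs ! j"
    have "\<forall>v\<in>fiber E x. \<exists>Y. Y \<in> Sec M E \<and> Y x = v" using Sec_through by blast
    \<comment> \<open>The extension is a function of the vector, so that equal vectors receive the
      same section.\<close>
    then obtain S where S: "\<And>v. v \<in> fiber E x \<Longrightarrow> S v \<in> Sec M E \<and> S v x = v" by metis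
    define Ys where "Ys = map S vs"
    have Ys: "set Ys \<subseteq> Sec M E" "eval_at x Ys = vs" "length Ys = k" "Ys ! i = Ys ! j"
    proof -
      show "set Ys \<subseteq> Sec M E" using S A unfolding Ys_def by auto
      show "eval_at x Ys = vs"
        unfolding Ys_def map_map comp_def by (rule map_idI) (use S A in auto)
      show "length Ys = k" "Ys ! i = Ys ! j" using A by (simp_all add: Ys_def)
    qed
    have "\<not> distinct Ys" using A Ys by (auto simp: distinct_conv_nth)
    then have nd: "\<not> distinct (eval_at y Ys)" for y by (auto simp: distinct_map)
    have "anchor E x (X x) (\<lambda>y. \<omega> y (eval_at y Ys)) = 0"
      using form_near_alt[OF w]
      by (intro tangent_zero[OF Sec_tangent[OF X]]) (elim eventually_mono, rule alt_forms_repeat[OF _ nd])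
    moreover have "(\<Sum>l<length Ys. \<omega> x (eval_at x (Ys[l := bracket E X (Ys ! l)]))) = 0"
    proof -
      \<comment> \<open>Polarization: expanding the value with \<open>?b + ?v\<close> in both slots
        shows that the two surviving terms of the sum are negatives of each other.\<close>
      let ?b = "bracket E X (Ys ! i) x" and ?v = "vs ! i"
      have f: "?b \<in> fiber E x" "?v \<in> fiber E x" "?b + ?v \<in> fiber E x"
        using Sec_fiber bracket_Sec[OF X] Ys A nth_mem subspace_add[OF fiber_subspace]
        by (metis (no_types, lifting) subsetD)+
      have up: "set (vs[l := u]) \<subseteq> fiber E x" if "u \<in> fiber E x" for l u
        using A that set_update_subset_insert[of vs l u] by blast
      have l: "length (vs[l := u]) = k" for l u using A by simp
      have nd2: "\<not> distinct (vs[i := c, j := c])" for c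
        using A nth_eq_iff_index_eq[of "vs[i := c, j := c]" i j] by (auto simp: nth_list_update)
      have "\<omega> x (vs[i := ?b + ?v, j := ?b + ?v]) = 0"
        by (rule alt_forms_repeat[OF alt nd2])
      moreover have "\<omega> x (vs[i := ?b, j := ?b]) = 0"
        by (rule alt_forms_repeat[OF alt nd2])
      moreover have "\<omega> x (vs[i := ?v, j := ?v]) = 0"
        by (rule alt_forms_repeat[OF alt nd2])
      moreover have "\<omega> x (vs[i := ?b + ?v, j := ?b + ?v]) =
          \<omega> x (vs[i := ?b + ?v, j := ?b]) + \<omega> x (vs[i := ?b + ?v, j := ?v])"
        using alt_formsD(1)[OF alt l up[OF f(3)] A(3) f(1,2)] .
      moreover have "\<omega> x (vs[i := ?b + ?v, j := u]) = \<omega> x (vs[i := ?b, j := u]) + \<omega> x (vs[i := ?v, j := u])"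
        if "u \<in> fiber E x" for u
        using alt_formsD(1)[OF alt l up[OF that] A(2) f(1,2), of j] A(4)
        by (simp add: list_update_swap)
      ultimately have "\<omega> x (vs[i := ?b, j := ?v]) + \<omega> x (vs[i := ?v, j := ?b]) = 0"
        using f by simp
      moreover have "vs[j := ?v] = vs" "vs[i := ?v] = vs" using A by (metis list_update_id)+
      ultimately have z: "\<omega> x (vs[i := ?b]) + \<omega> x (vs[j := ?b]) = 0"
        using A(4) by (metis list_update_swap)
      have "(\<Sum>l<k. \<omega> x (eval_at x (Ys[l := bracket E X (Ys ! l)]))) =
          (\<Sum>l\<in>{i, j}. \<omega> x (eval_at x (Ys[l := bracket E X (Ys ! l)])))"
      proof (rule sum.mono_neutral_right)
        show "\<forall>l\<in>{..<k} - {i, j}. \<omega> x (eval_at x (Ys[l := bracket E X (Ys ! l)])) = 0"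
        proof
          fix l assume "l \<in> {..<k} - {i, j}"
          then have "\<not> distinct (eval_at x (Ys[l := bracket E X (Ys ! l)]))"
            using A Ys nth_eq_iff_index_eq[of "eval_at x (Ys[l := bracket E X (Ys ! l)])" i j]
            by (auto simp: nth_list_update)
          then show "\<omega> x (eval_at x (Ys[l := bracket E X (Ys ! l)])) = 0"
            by (rule alt_forms_repeat[OF alt])
        qed
      qed (use A in auto)
      also have "\<dots> = \<omega> x (vs[i := ?b]) + \<omega> x (vs[j := ?b])"
        using A(4) Ys(4) by (simp add: map_update Ys(2))
      finally show ?thesis using z Ys(3) by simp
    qed
    ultimately show "lie_form M E X \<omega> x vs = 0"
      using lie_form_eval[OF X Ys(1)] Ys(2) by simp
  qed
qed

end

end

section \<open>The tangent bundle as a Lie algebroid\<close>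

lemma sum_fun_apply: "(\<Sum>i\<in>I. g i) z = (\<Sum>i\<in>I. g i z)"
  by (induction I rule: infinite_finite_induct) auto

lemma basis_ofI:
  assumes "subspace V" "\<And>i. i < n \<Longrightarrow> b i \<in> V" "\<And>v. v \<in> V \<Longrightarrow> \<exists>c. v = (\<Sum>i<n. c i *\<^sub>R b i)"
    and zero: "\<And>c i. (\<Sum>i<n. c i *\<^sub>R b i) = 0 \<Longrightarrow> i < n \<Longrightarrow> c i = 0"
  shows "basis_of V n b"
  unfolding basis_of_def
proof (intro conjI)
  show inj: "inj_on b {..<n}"
  proof (rule inj_onI, rule ccontr)
    fix i j assume ij: "i \<in> {..<n}" "j \<in> {..<n}" "b i = b j" "i \<noteq> j"
    define c where "c k = (if k = i then 1 else if k = j then -1 else 0 :: real)" for k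
    have "(\<Sum>k<n. c k *\<^sub>R b k) = (\<Sum>k\<in>{i, j}. c k *\<^sub>R b k)"
      using ij by (intro sum.mono_neutral_right) (auto simp: c_def)
    also have "\<dots> = 0" using ij by (simp add: c_def)
    finally show False using zero[of c i] ij by (simp add: c_def)
  qed
  show "independent (b ` {..<n})"
  proof
    assume "dependent (b ` {..<n})"
    then obtain u where u: "\<exists>v\<in>b ` {..<n}. u v \<noteq> 0" "(\<Sum>v\<in>b ` {..<n}. u v *\<^sub>R v) = 0"
      by (auto simp: dependent_finite)
    then have "(\<Sum>i<n. u (b i) *\<^sub>R b i) = 0" using inj by (simp add: sum.reindex)
    then show False using zero[of "\<lambda>i. u (b i)"] u(1) by auto
  qed
  show "span (b ` {..<n}) = V"
  proof
    show "span (b ` {..<n}) \<subseteq> V" using assms(1,2) by (intro span_minimal) auto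
    show "V \<subseteq> span (b ` {..<n})"
    proof
      fix v assume "v \<in> V"
      then obtain c where "v = (\<Sum>i<n. c i *\<^sub>R b i)" using assms(3) by blast
      then show "v \<in> span (b ` {..<n})" by (simp only:) (intro span_sum span_scale span_base imageI)
    qed
  qed
qed

context smooth_mfd
begin

lemma tangent_subspace: "subspace (tangent_space M x)"
proof (rule subspaceI)
  show "0 \<in> tangent_space M x" unfolding tangent_space_def by simp
next
  fix v w assume v: "v \<in> tangent_space M x" and w: "w \<in> tangent_space M x"
  show "v + w \<in> tangent_space M x"
    unfolding tangent_space_def mem_Collect_eq
  proof (intro conjI allI impI, goal_cases)
    case 1 then show ?case using tangent_not_smooth[OF v] tangent_not_smooth[OF w] by simp
  next
    case 2 then show ?case using tangent_cong[OF v] tangent_cong[OF w] by (metis plus_fun_apply)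
  next
    case 3 then show ?case using tangent_add[OF v] tangent_add[OF w] by simp
  next
    case 4 then show ?case using tangent_mult[OF v] tangent_mult[OF w] by (simp add: algebra_simps)
  next
    case 5 then show ?case using tangent_scale[OF v] tangent_scale[OF w] by (simp add: algebra_simps)
  qed
next
  fix r :: real and v assume v: "v \<in> tangent_space M x"
  show "r *\<^sub>R v \<in> tangent_space M x"
    unfolding tangent_space_def mem_Collect_eq
  proof (intro conjI allI impI, goal_cases)
    case 1 then show ?case using tangent_not_smooth[OF v] by simp
  next
    case 2 then show ?case using tangent_cong[OF v] by (metis scaleR_fun_apply)
  next
    case 3 then show ?case using tangent_add[OF v] by (simp add: algebra_simps)
  next
    case 4 then show ?case using tangent_mult[OF v] by (simp add: algebra_simps)
  next
    case 5 then show ?case using tangent_scale[OF v] by simp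
  qed
qed

lemma model_Basis: "set (model M) \<subseteq> Basis" "distinct (model M)"
  using smooth_manifold unfolding smooth_manifold_def by simp_all

lemma model_space_inner:
  assumes "z \<in> model_space" "b \<in> Basis" "b \<notin> set (model M)"
  shows "z \<bullet> b = 0"
proof -
  have "subspace {z. z \<bullet> b = 0}" by (rule subspaceI) (auto simp: inner_add_left)
  moreover have "set (model M) \<subseteq> {z. z \<bullet> b = 0}"
    using assms(2,3) model_Basis(1) by (auto simp: inner_Basis)
  ultimately show ?thesis using assms(1) span_minimal by blast
qed

section \<open>Coordinate vectors as a basis of the tangent space\<close>

context
  fixes U \<phi> x
  assumes chart: "(U, \<phi>) \<in> charts M" and x: "x \<in> U"
begin

text \<open>The line through \<open>\<phi> x\<close> in a model direction stays in the model space
  and hence, for small \<open>t\<close>, in the chart image. There \<open>f\<close> is given by the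
  ambient representative \<open>F\<close>, whose derivative \<open>D\<close> is applied to
  \<open>b\<close>.\<close>

lemma coord_vec_eqI:
  assumes f: "smooth_near M x f" and b: "b \<in> set (model M)"
    and D: "(F has_derivative D) (at (\<phi> x))" and ev: "\<forall>\<^sub>F y in nhds x. f y = F (\<phi> y)"
  shows "coord_vec M U \<phi> b x f = D b"
proof -
  obtain Q where Q: "open Q" "x \<in> Q" "\<And>y. y \<in> Q \<Longrightarrow> f y = F (\<phi> y)"
    using ev unfolding eventually_nhds by blast
  obtain N where N: "open N" "\<phi> ` (U \<inter> Q) = model_space \<inter> N"
    using chart_image[OF chart Q(1)] .
  let ?g = "\<lambda>t. \<phi> x + t *\<^sub>R b"
  have "linear D" using D by (rule has_derivative_linear)
  then have "((\<lambda>t. F (?g t)) has_derivative (\<lambda>t. t * D b)) (at 0)"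
  proof -
    assume l: "linear D"
    have "(?g has_derivative (\<lambda>t. t *\<^sub>R b)) (at 0)"
      by (auto intro!: derivative_eq_intros)
    then have "((\<lambda>t. F (?g t)) has_derivative (\<lambda>t. D (t *\<^sub>R b))) (at 0)"
      by (rule has_derivative_compose) (use D in simp)
    then show ?thesis by (simp add: linear_scale[OF l])
  qed
  then have F': "((\<lambda>t. F (?g t)) has_real_derivative D b) (at 0)"
    unfolding has_field_derivative_def by (rule has_derivative_eq_rhs) (simp add: fun_eq_iff)
  have oN: "open (?g -` N)"
    by (intro open_vimage N(1) continuous_intros)
  have "((\<lambda>t. f (inv_into U \<phi> (?g t))) has_real_derivative D b) (at 0)"
  proof (rule has_field_derivative_transform_within_open[OF F' oN])
    show "0 \<in> ?g -` N" using N(2) x Q(2) by auto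
    fix t assume t: "t \<in> ?g -` N"
    have "?g t \<in> model_space"
      using chart_in_model[OF chart x] span_base[OF b] by (intro span_add span_scale)
    then have "?g t \<in> \<phi> ` (U \<inter> Q)" using t N(2) by blast
    then obtain y where "y \<in> U" "y \<in> Q" "?g t = \<phi> y" by blast
    then show "F (?g t) = f (inv_into U \<phi> (?g t))" using Q(3) chart_inv[OF chart] by simp
  qed
  then show ?thesis using f by (simp add: coord_vec_def DERIV_imp_deriv)
qed

lemma coord_vec_coord:
  "b \<in> set (model M) \<Longrightarrow> coord_vec M U \<phi> b x (\<lambda>y. \<phi> y \<bullet> b') = b \<bullet> b'"
  by (rule coord_vec_eqI[OF chart_coord_smooth[OF chart x], where F = "\<lambda>z. z \<bullet> b'"])
    (auto intro!: derivative_eq_intros)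

lemma smooth_near_rep:
  assumes "smooth_near M x f"
  obtains r F where "r > 0" "Cinf (ball (\<phi> x) r) F" "\<forall>\<^sub>F y in nhds x. f y = F (\<phi> y)"
    "(F has_derivative frechet_derivative F (at (\<phi> x))) (at (\<phi> x))"
proof -
  obtain r F where r: "r > 0" "Cinf (ball (\<phi> x) r) F" "\<forall>\<^sub>F y in nhds x. f y = F (\<phi> y)"
    using assms smooth_near_chart[OF chart x] by blast
  then show thesis using that Cinf_has_derivative[OF r(2), of "\<phi> x"] by simp
qed

lemma coord_vec_tangent:
  assumes b: "b \<in> set (model M)"
  shows "coord_vec M U \<phi> b x \<in> tangent_space M x"
  unfolding tangent_space_def mem_Collect_eq
proof (intro conjI allI impI, goal_cases)
  case 1 then show ?case by (simp add: coord_vec_def)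
next
  case (2 f g)
  then have "smooth_near M x f" by simp
  then obtain r F where "r > 0" "Cinf (ball (\<phi> x) r) F" and F: "\<forall>\<^sub>F y in nhds x. f y = F (\<phi> y)"
    "(F has_derivative frechet_derivative F (at (\<phi> x))) (at (\<phi> x))"
    by (rule smooth_near_rep)
  have "\<forall>\<^sub>F y in nhds x. g y = F (\<phi> y)" using F(1) 2(2) by eventually_elim simp
  then show ?case using coord_vec_eqI[OF _ b F(2)] F(1) 2(1) by simp
next
  case (3 f g)
  obtain r F where "r > 0" "Cinf (ball (\<phi> x) r) F" and F: "\<forall>\<^sub>F y in nhds x. f y = F (\<phi> y)"
    "(F has_derivative frechet_derivative F (at (\<phi> x))) (at (\<phi> x))"
    by (rule smooth_near_rep[OF conjunct1[OF 3]])
  obtain s G where "s > 0" "Cinf (ball (\<phi> x) s) G" and G: "\<forall>\<^sub>F y in nhds x. g y = G (\<phi> y)"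
    "(G has_derivative frechet_derivative G (at (\<phi> x))) (at (\<phi> x))"
    by (rule smooth_near_rep[OF conjunct2[OF 3]])
  have "\<forall>\<^sub>F y in nhds x. f y + g y = F (\<phi> y) + G (\<phi> y)"
    using F(1) G(1) by eventually_elim simp
  from coord_vec_eqI[OF _ b has_derivative_add[OF F(2) G(2)] this]
  show ?case using coord_vec_eqI[OF _ b F(2,1)] coord_vec_eqI[OF _ b G(2,1)] 3 smooth_near_add by simp
next
  case (4 f g)
  obtain r F where "r > 0" "Cinf (ball (\<phi> x) r) F" and F: "\<forall>\<^sub>F y in nhds x. f y = F (\<phi> y)"
    "(F has_derivative frechet_derivative F (at (\<phi> x))) (at (\<phi> x))"
    by (rule smooth_near_rep[OF conjunct1[OF 4]])
  obtain s G where "s > 0" "Cinf (ball (\<phi> x) s) G" and G: "\<forall>\<^sub>F y in nhds x. g y = G (\<phi> y)"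
    "(G has_derivative frechet_derivative G (at (\<phi> x))) (at (\<phi> x))"
    by (rule smooth_near_rep[OF conjunct2[OF 4]])
  have "\<forall>\<^sub>F y in nhds x. f y * g y = F (\<phi> y) * G (\<phi> y)"
    using F(1) G(1) by eventually_elim simp
  from coord_vec_eqI[OF _ b has_derivative_mult[OF F(2) G(2)] this]
  show ?case
    using coord_vec_eqI[OF _ b F(2,1)] coord_vec_eqI[OF _ b G(2,1)] 4 smooth_near_mult
      eventually_nhds_x_imp_x[OF F(1)] eventually_nhds_x_imp_x[OF G(1)] by simp
next
  case (5 c f)
  obtain r F where "r > 0" "Cinf (ball (\<phi> x) r) F" and F: "\<forall>\<^sub>F y in nhds x. f y = F (\<phi> y)"
    "(F has_derivative frechet_derivative F (at (\<phi> x))) (at (\<phi> x))"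
    by (rule smooth_near_rep[OF 5])
  have "\<forall>\<^sub>F y in nhds x. c * f y = c * F (\<phi> y)"
    using F(1) by eventually_elim simp
  from coord_vec_eqI[OF _ b has_derivative_mult_right[OF F(2), of c] this]
  show ?case using coord_vec_eqI[OF _ b F(2,1)] 5 smooth_near_mult[OF smooth_near_const] by simp
qed

text \<open>Hadamard's lemma applied to a representative: \<open>v\<close> annihilates the constant,
  and the factors \<open>\<phi> y \<bullet> b - \<phi> x \<bullet> b\<close> vanish at
  \<open>x\<close>, so the Leibniz rule leaves only the partial derivatives at
  \<open>x\<close>.\<close>

lemma tangent_expand_Basis:
  assumes v: "v \<in> tangent_space M x" and f: "smooth_near M x f"
  shows "v f = (\<Sum>b\<in>set (model M). v (\<lambda>y. \<phi> y \<bullet> b) * coord_vec M U \<phi> b x f)"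
proof -
  obtain r F where F: "r > 0" "Cinf (ball (\<phi> x) r) F" "\<forall>\<^sub>F y in nhds x. f y = F (\<phi> y)"
    "(F has_derivative frechet_derivative F (at (\<phi> x))) (at (\<phi> x))"
    using smooth_near_rep[OF f] .
  obtain G where G: "\<And>b. Cinf (ball (\<phi> x) r) (G b)"
    "\<And>z. z \<in> ball (\<phi> x) r \<Longrightarrow> F z = F (\<phi> x) + (\<Sum>b\<in>Basis. ((z - \<phi> x) \<bullet> b) * G b z)"
    "\<And>b. G b (\<phi> x) = frechet_derivative F (at (\<phi> x)) b"
    using Hadamard[OF F(2)] by metis
  have sG: "smooth_near M x (\<lambda>y. G b (\<phi> y))" for b
    unfolding smooth_near_chart[OF chart x] using F(1) G(1)
    by (intro exI[of _ r] conjI exI[of _ "G b"]) auto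
  have sc: "smooth_near M x (\<lambda>y. \<phi> y \<bullet> b - \<phi> x \<bullet> b)" for b
    by (intro smooth_near_diff chart_coord_smooth[OF chart x] smooth_near_const)
  have "\<forall>\<^sub>F y in nhds x. \<phi> y \<in> ball (\<phi> x) r"
    by (rule chart_eventually[OF chart x]) (use F(1) in auto)
  then have "\<forall>\<^sub>F y in nhds x. f y = F (\<phi> x) + (\<Sum>b\<in>Basis. (\<phi> y \<bullet> b - \<phi> x \<bullet> b) * G b (\<phi> y))"
    using F(3) by eventually_elim (simp add: G(2) inner_diff_left)
  then have "v f = v (\<lambda>y. F (\<phi> x) + (\<Sum>b\<in>Basis. (\<phi> y \<bullet> b - \<phi> x \<bullet> b) * G b (\<phi> y)))"
    by (rule tangent_cong[OF v])
  also have "\<dots> = v (\<lambda>y. F (\<phi> x)) + v (\<lambda>y. \<Sum>b\<in>Basis. (\<phi> y \<bullet> b - \<phi> x \<bullet> b) * G b (\<phi> y))"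
    by (intro tangent_add[OF v] smooth_near_const smooth_near_sum smooth_near_mult sc sG)
  also have "\<dots> = (\<Sum>b\<in>Basis. v (\<lambda>y. (\<phi> y \<bullet> b - \<phi> x \<bullet> b) * G b (\<phi> y)))"
    unfolding tangent_const[OF v] by (subst tangent_sum[OF v]) (auto intro: smooth_near_mult sc sG)
  also have "\<dots> = (\<Sum>b\<in>Basis. v (\<lambda>y. \<phi> y \<bullet> b) * G b (\<phi> x))"
  proof (rule sum.cong)
    fix b
    have "v (\<lambda>y. (\<phi> y \<bullet> b - \<phi> x \<bullet> b) * G b (\<phi> y)) = G b (\<phi> x) * v (\<lambda>y. \<phi> y \<bullet> b - \<phi> x \<bullet> b)"
      using tangent_mult[OF v sc sG, of b b] by simp
    also have "v (\<lambda>y. \<phi> y \<bullet> b - \<phi> x \<bullet> b) = v (\<lambda>y. \<phi> y \<bullet> b)"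
      using tangent_diff[OF v chart_coord_smooth[OF chart x] smooth_near_const, of b "\<phi> x \<bullet> b"]
        tangent_const[OF v] by simp
    finally show "v (\<lambda>y. (\<phi> y \<bullet> b - \<phi> x \<bullet> b) * G b (\<phi> y)) = v (\<lambda>y. \<phi> y \<bullet> b) * G b (\<phi> x)" by simp
  qed simp
  \<comment> \<open>Coordinates in directions outside the model vanish identically on the chart
    domain, so \<open>v\<close> annihilates them.\<close>
  also have "\<dots> = (\<Sum>b\<in>set (model M). v (\<lambda>y. \<phi> y \<bullet> b) * G b (\<phi> x))"
  proof (rule sum.mono_neutral_right)
    show "\<forall>b\<in>Basis - set (model M). v (\<lambda>y. \<phi> y \<bullet> b) * G b (\<phi> x) = 0"
    proof
      fix b assume b: "b \<in> Basis - set (model M)"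
      have "\<forall>\<^sub>F y in nhds x. y \<in> U" by (rule eventually_nhds_in_open[OF chart_open[OF chart] x])
      then have "\<forall>\<^sub>F y in nhds x. \<phi> y \<bullet> b = 0"
        by eventually_elim (use b chart_in_model[OF chart] model_space_inner in blast)
      then show "v (\<lambda>y. \<phi> y \<bullet> b) * G b (\<phi> x) = 0" using tangent_zero[OF v] by simp
    qed
  qed (use model_Basis in auto)
  also have "\<dots> = (\<Sum>b\<in>set (model M). v (\<lambda>y. \<phi> y \<bullet> b) * coord_vec M U \<phi> b x f)"
    by (rule sum.cong) (simp_all add: coord_vec_eqI[OF f _ F(4,3)] G(3))
  finally show ?thesis .
qed

lemma tangent_expand:
  assumes v: "v \<in> tangent_space M x"
  shows "v = (\<Sum>i<length (model M). v (\<lambda>y. \<phi> y \<bullet> model M ! i) *\<^sub>R coord_vec M U \<phi> (model M ! i) x)"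
proof
  fix f
  have *: "(\<Sum>b\<in>set (model M). g b) = (\<Sum>i<length (model M). g (model M ! i))" for g :: "'b \<Rightarrow> real"
    using sum.reindex_bij_betw[OF bij_betw_nth[OF model_Basis(2) refl refl], of g] by simp
  show "v f = (\<Sum>i<length (model M). v (\<lambda>y. \<phi> y \<bullet> model M ! i) *\<^sub>R coord_vec M U \<phi> (model M ! i) x) f"
  proof (cases "smooth_near M x f")
    case True
    then show ?thesis using tangent_expand_Basis[OF v True] * by (simp add: sum_fun_apply)
  next
    case False
    then show ?thesis by (simp add: sum_fun_apply tangent_not_smooth[OF v False] coord_vec_def)
  qed
qed

text \<open>Spanning is \<open>tangent_expand\<close>; independence is tested on the coordinate
  functions, to which the coordinate vectors are dual.\<close>

lemma coord_vec_basis: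
  "basis_of (tangent_space M x) (length (model M)) (\<lambda>i. coord_vec M U \<phi> (model M ! i) x)"
proof (rule basis_ofI)
  show "subspace (tangent_space M x)" by (rule tangent_subspace)
  show "coord_vec M U \<phi> (model M ! i) x \<in> tangent_space M x" if "i < length (model M)" for i
    using that by (intro coord_vec_tangent) simp
  show "\<exists>c. v = (\<Sum>i<length (model M). c i *\<^sub>R coord_vec M U \<phi> (model M ! i) x)"
    if "v \<in> tangent_space M x" for v
    by (rule exI, rule tangent_expand[OF that])
  fix c :: "nat \<Rightarrow> real" and j
  assume z: "(\<Sum>i<length (model M). c i *\<^sub>R coord_vec M U \<phi> (model M ! i) x) = 0" and j: "j < length (model M)"
  have "0 = (\<Sum>i<length (model M). c i *\<^sub>R coord_vec M U \<phi> (model M ! i) x) (\<lambda>y. \<phi> y \<bullet> model M ! j)"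
    unfolding z by simp
  also have "\<dots> = (\<Sum>i<length (model M). c i * (model M ! i \<bullet> model M ! j))"
    by (simp add: sum_fun_apply coord_vec_coord)
  also have "\<dots> = (\<Sum>i<length (model M). if i = j then c i else 0)"
  proof (rule sum.cong)
    fix i assume "i \<in> {..<length (model M)}"
    then have "model M ! i \<bullet> model M ! j = (if i = j then 1 else 0)"
      using model_Basis j by (metis inner_Basis lessThan_iff nth_eq_iff_index_eq nth_mem subsetD)
    then show "c i * (model M ! i \<bullet> model M ! j) = (if i = j then c i else 0)" by simp
  qed simp
  finally show "c j = 0" using j by simp
qed

end

text \<open>One smooth representative \<open>F\<close> serves at all nearby points, so the
  derivative in direction \<open>b\<close> is represented by a partial derivative of
  \<open>F\<close>.\<close>

lemma coord_vec_smooth: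
  assumes chart: "(U, \<phi>) \<in> charts M" and x: "x \<in> U" and b: "b \<in> set (model M)" and f: "smooth_near M x f"
  shows "smooth_near M x (\<lambda>y. coord_vec M U \<phi> b y f)"
proof -
  obtain r F where F: "r > 0" "Cinf (ball (\<phi> x) r) F" "\<forall>\<^sub>F y in nhds x. f y = F (\<phi> y)"
    using smooth_near_rep[OF chart x f] by metis
  have "\<forall>\<^sub>F y in nhds x. \<phi> y \<in> ball (\<phi> x) r"
    by (rule chart_eventually[OF chart x]) (use F(1) in auto)
  moreover have "\<forall>\<^sub>F y in nhds x. y \<in> U" by (rule eventually_nhds_in_open[OF chart_open[OF chart] x])
  moreover have "\<forall>\<^sub>F y in nhds x. \<forall>\<^sub>F z in nhds y. f z = F (\<phi> z)"
    using F(3) by (simp add: eventually_eventually)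
  moreover have "\<forall>\<^sub>F y in nhds x. smooth_near M y f" by (rule smooth_near_eventually[OF f])
  ultimately have "\<forall>\<^sub>F y in nhds x. coord_vec M U \<phi> b y f = frechet_derivative F (at (\<phi> y)) b"
  proof eventually_elim
    case (elim y)
    show ?case
      by (rule coord_vec_eqI[OF chart elim(2,4) b Cinf_has_derivative[OF F(2) elim(1)] elim(3)])
  qed
  then show ?thesis
    unfolding smooth_near_chart[OF chart x] using F(1) Cinf_derivative[OF F(2), of b]
    by (intro exI[of _ r] conjI exI[of _ "\<lambda>z. frechet_derivative F (at z) b"]) auto
qed

lemma tangent_bundle: "vector_bundle M (tangent_algebroid M)"
  unfolding vector_bundle_def
proof (intro conjI)
  have "\<exists>U \<phi>. (U, \<phi>) \<in> charts M \<and> x \<in> U" for x using chart_cover by metis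
  then show "(\<Union>(U, e)\<in>frames (tangent_algebroid M). U) = UNIV"
    unfolding tangent_algebroid_def by fastforce
  show "\<forall>(U, e)\<in>frames (tangent_algebroid M). open U \<and> (\<forall>x\<in>U.
      inj_on (\<lambda>i. e i x) {..<brank (tangent_algebroid M)} \<and>
      independent ((\<lambda>i. e i x) ` {..<brank (tangent_algebroid M)}) \<and>
      span ((\<lambda>i. e i x) ` {..<brank (tangent_algebroid M)}) = fiber (tangent_algebroid M) x)"
    using coord_vec_basis chart_open unfolding tangent_algebroid_def basis_of_def by auto
  show "\<forall>(U, e)\<in>frames (tangent_algebroid M). \<forall>i<brank (tangent_algebroid M).
      smooth_section M (tangent_algebroid M) U (e i)"
  proof (intro ballI, goal_cases)
    case (1 G)
    then obtain U \<phi> where G: "G = (U, \<lambda>i. coord_vec M U \<phi> (model M ! i))" and chart: "(U, \<phi>) \<in> charts M"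
      by (auto simp: tangent_algebroid_def)
    have "smooth_section M (tangent_algebroid M) U (coord_vec M U \<phi> (model M ! i))"
      if i: "i < length (model M)" for i
      unfolding smooth_section_def
    proof (intro conjI ballI, goal_cases)
      case (1 x)
      then show ?case using coord_vec_tangent[OF chart] i by (simp add: tangent_algebroid_def)
    next
      case (2 H)
      then obtain V \<psi> where H: "H = (V, \<lambda>i. coord_vec M V \<psi> (model M ! i))" and chart': "(V, \<psi>) \<in> charts M"
        by (auto simp: tangent_algebroid_def)
      \<comment> \<open>The entries of the Jacobian matrix of the change of charts: derivatives of
        the new coordinates along the old coordinate vectors.\<close>
      let ?c = "\<lambda>j y. coord_vec M U \<phi> (model M ! i) y (\<lambda>z. \<psi> z \<bullet> model M ! j)"
      have "smooth_near M y (?c j)" if "y \<in> V \<inter> U" for y j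
        using that i by (intro coord_vec_smooth[OF chart] chart_coord_smooth[OF chart']) auto
      then have "smooth_fun M (V \<inter> U) (?c j)" for j
        using smooth_fun_iff[of "V \<inter> U"] chart_open[OF chart] chart_open[OF chart'] by blast
      moreover have "coord_vec M U \<phi> (model M ! i) y = (\<Sum>j<length (model M). ?c j y *\<^sub>R coord_vec M V \<psi> (model M ! j) y)"
        if "y \<in> V \<inter> U" for y
        using that i by (intro tangent_expand[OF chart' _ coord_vec_tangent[OF chart]]) auto
      ultimately show ?case
        unfolding H prod.case by (intro exI[of _ ?c]) (simp add: tangent_algebroid_def)
    qed
    then show ?case unfolding G prod.case by (simp add: tangent_algebroid_def)
  qed
qed

end

sublocale smooth_mfd \<subseteq> TM: vbun M "tangent_algebroid M"
  by unfold_locales (rule tangent_bundle)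

context smooth_mfd
begin

lemma tangent_fiber: "fiber (tangent_algebroid M) x = tangent_space M x"
  by (simp add: tangent_algebroid_def)

lemma vector_field_smooth:
  assumes X: "sec_near M (tangent_algebroid M) x X" and f: "smooth_near M x f"
  shows "smooth_near M x (\<lambda>y. X y f)"
proof -
  obtain U \<phi> where c: "(U, \<phi>) \<in> charts M" "x \<in> U" using chart_cover .
  have F: "(U, \<lambda>i. coord_vec M U \<phi> (model M ! i)) \<in> frames (tangent_algebroid M)"
    using c by (auto simp: tangent_algebroid_def)
  have rk: "brank (tangent_algebroid M) = length (model M)" by (simp add: tangent_algebroid_def)
  obtain d where d: "\<forall>i<length (model M). smooth_near M x (d i)"
    "\<forall>\<^sub>F y in nhds x. X y = (\<Sum>i<length (model M). d i y *\<^sub>R coord_vec M U \<phi> (model M ! i) y)"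
    using X unfolding TM.sec_near_frame[OF F c(2)] rk by blast
  have "smooth_near M x (\<lambda>y. \<Sum>i<length (model M). d i y * coord_vec M U \<phi> (model M ! i) y f)"
    using d(1) by (intro smooth_near_sum smooth_near_mult coord_vec_smooth[OF c _ f]) auto
  moreover from d(2) have "\<forall>\<^sub>F y in nhds x.
      (\<Sum>i<length (model M). d i y * coord_vec M U \<phi> (model M ! i) y f) = X y f"
    by eventually_elim (simp add: sum_fun_apply)
  ultimately show ?thesis by (rule smooth_near_transform)
qed

text \<open>The coefficients of \<open>X\<close> in a chart are its values on the coordinate
  functions, to which the smoothness assumption applies.\<close>

lemma vector_fieldI:
  assumes X: "\<forall>\<^sub>F y in nhds x. X y \<in> tangent_space M y"
    and sm: "\<And>f. smooth_near M x f \<Longrightarrow> smooth_near M x (\<lambda>y. X y f)"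
  shows "sec_near M (tangent_algebroid M) x X"
proof -
  obtain U \<phi> where c: "(U, \<phi>) \<in> charts M" "x \<in> U" using chart_cover .
  have F: "(U, \<lambda>i. coord_vec M U \<phi> (model M ! i)) \<in> frames (tangent_algebroid M)"
    using c by (auto simp: tangent_algebroid_def)
  have rk: "brank (tangent_algebroid M) = length (model M)" by (simp add: tangent_algebroid_def)
  have "\<forall>\<^sub>F y in nhds x. y \<in> U" by (rule eventually_nhds_in_open[OF chart_open[OF c(1)] c(2)])
  with X have "\<forall>\<^sub>F y in nhds x. X y =
      (\<Sum>i<length (model M). X y (\<lambda>y. \<phi> y \<bullet> model M ! i) *\<^sub>R coord_vec M U \<phi> (model M ! i) y)"
    by eventually_elim (rule tangent_expand[OF c(1)])
  moreover have "smooth_near M x (\<lambda>y. X y (\<lambda>y. \<phi> y \<bullet> model M ! i))" for i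
    by (rule sm[OF chart_coord_smooth[OF c]])
  ultimately show ?thesis
    unfolding TM.sec_near_frame[OF F c(2)] rk
    by (intro exI[of _ "\<lambda>i y. X y (\<lambda>y. \<phi> y \<bullet> model M ! i)"]) simp
qed

lemma Sec_tangentD:
  assumes "X \<in> Sec M (tangent_algebroid M)"
  shows "X x \<in> tangent_space M x" "smooth_near M x f \<Longrightarrow> smooth_near M x (\<lambda>y. X y f)"
  using TM.Sec_fiber[OF assms] vector_field_smooth[OF TM.SecD[OF assms]] by (simp_all add: tangent_fiber)

lemma bracket_tangent:
  "bracket (tangent_algebroid M) X Y x f =
    (if smooth_near M x f then X x (\<lambda>y. Y y f) - Y x (\<lambda>y. X y f) else 0)"
  by (simp add: tangent_algebroid_def)

section \<open>The commutator of vector fields\<close>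

context
  fixes X Y
  assumes X: "X \<in> Sec M (tangent_algebroid M)" and Y: "Y \<in> Sec M (tangent_algebroid M)"
begin

text \<open>Exchanging \<open>X\<close> and \<open>Y\<close> exchanges the two mixed products of
  first derivatives, so they cancel in the commutator, which is therefore a derivation.\<close>

lemma vf_mult:
  assumes f: "smooth_near M x f" and g: "smooth_near M x g"
  shows "X x (\<lambda>y. Y y (\<lambda>z. f z * g z)) =
    f x * X x (\<lambda>y. Y y g) + Y x g * X x f + (g x * X x (\<lambda>y. Y y f) + Y x f * X x g)"
proof -
  have "\<forall>\<^sub>F y in nhds x. Y y (\<lambda>z. f z * g z) = f y * Y y g + g y * Y y f"
    using smooth_near_eventually[OF f] smooth_near_eventually[OF g]
    by eventually_elim (rule tangent_mult[OF Sec_tangentD(1)[OF Y]])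
  from tangent_cong[OF Sec_tangentD(1)[OF X] this] show ?thesis
    using f g Sec_tangentD(2)[OF Y f] Sec_tangentD(2)[OF Y g]
    by (simp only: tangent_add[OF Sec_tangentD(1)[OF X]] tangent_mult[OF Sec_tangentD(1)[OF X]] smooth_near_mult)
qed

lemma vf_add:
  assumes f: "smooth_near M x f" and g: "smooth_near M x g"
  shows "X x (\<lambda>y. Y y (\<lambda>z. f z + g z)) = X x (\<lambda>y. Y y f) + X x (\<lambda>y. Y y g)"
proof -
  have "\<forall>\<^sub>F y in nhds x. Y y (\<lambda>z. f z + g z) = Y y f + Y y g"
    using smooth_near_eventually[OF f] smooth_near_eventually[OF g]
    by eventually_elim (rule tangent_add[OF Sec_tangentD(1)[OF Y]])
  from tangent_cong[OF Sec_tangentD(1)[OF X] this] show ?thesis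
    using Sec_tangentD(2)[OF Y f] Sec_tangentD(2)[OF Y g] by (simp only: tangent_add[OF Sec_tangentD(1)[OF X]])
qed

lemma vf_scale:
  assumes f: "smooth_near M x f"
  shows "X x (\<lambda>y. Y y (\<lambda>z. c * f z)) = c * X x (\<lambda>y. Y y f)"
proof -
  have "\<forall>\<^sub>F y in nhds x. Y y (\<lambda>z. c * f z) = c * Y y f"
    using smooth_near_eventually[OF f] by eventually_elim (rule tangent_scale[OF Sec_tangentD(1)[OF Y]])
  from tangent_cong[OF Sec_tangentD(1)[OF X] this] show ?thesis
    using Sec_tangentD(2)[OF Y f] by (simp only: tangent_scale[OF Sec_tangentD(1)[OF X]])
qed

lemma vf_cong:
  assumes "\<forall>\<^sub>F y in nhds x. f y = g y"
  shows "X x (\<lambda>y. Y y f) = X x (\<lambda>y. Y y g)"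
proof (rule tangent_cong[OF Sec_tangentD(1)[OF X]])
  have "\<forall>\<^sub>F y in nhds x. \<forall>\<^sub>F z in nhds y. f z = g z"
    using assms by (simp add: eventually_eventually)
  then show "\<forall>\<^sub>F y in nhds x. Y y f = Y y g" by eventually_elim (rule tangent_cong[OF Sec_tangentD(1)[OF Y]])
qed

end

lemma bracket_tangent_Sec:
  assumes X: "X \<in> Sec M (tangent_algebroid M)" and Y: "Y \<in> Sec M (tangent_algebroid M)"
  shows "bracket (tangent_algebroid M) X Y \<in> Sec M (tangent_algebroid M)"
proof -
  have "bracket (tangent_algebroid M) X Y x \<in> tangent_space M x" for x
    unfolding tangent_space_def mem_Collect_eq
  proof (intro conjI allI impI, goal_cases)
    case 1 then show ?case by (simp add: bracket_tangent)
  next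
    case 2 then show ?case using vf_cong[OF X Y] vf_cong[OF Y X] by (simp add: bracket_tangent)
  next
    case (3 f g)
    then have "smooth_near M x (\<lambda>y. f y + g y)" by (intro smooth_near_add) simp_all
    then show ?case
      using 3 vf_add[OF X Y, of x f g] vf_add[OF Y X, of x f g] by (simp add: bracket_tangent)
  next
    case (4 f g)
    then have "smooth_near M x (\<lambda>y. f y * g y)" by (intro smooth_near_mult) simp_all
    then show ?case
      using 4 vf_mult[OF X Y, of x f g] vf_mult[OF Y X, of x f g]
      by (simp add: bracket_tangent algebra_simps)
  next
    case (5 c f)
    then have "smooth_near M x (\<lambda>y. c * f y)" by (intro smooth_near_mult smooth_near_const)
    then show ?case
      using 5 vf_scale[OF X Y, of x f c] vf_scale[OF Y X, of x f c]
      by (simp add: bracket_tangent algebra_simps)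
  qed
  moreover have "smooth_near M x (\<lambda>y. bracket (tangent_algebroid M) X Y y f)" if f: "smooth_near M x f" for x f
  proof -
    have "smooth_near M x (\<lambda>y. X y (\<lambda>z. Y z f) - Y y (\<lambda>z. X z f))"
      using f by (intro smooth_near_diff Sec_tangentD[OF X] Sec_tangentD[OF Y])
    moreover have "\<forall>\<^sub>F y in nhds x. X y (\<lambda>z. Y z f) - Y y (\<lambda>z. X z f) = bracket (tangent_algebroid M) X Y y f"
      using smooth_near_eventually[OF f] by eventually_elim (simp add: bracket_tangent)
    ultimately show ?thesis by (rule smooth_near_transform)
  qed
  ultimately show ?thesis unfolding TM.Sec_iff by (intro allI vector_fieldI always_eventually) auto
qed

lemma bracket_tangent_ev:
  assumes "smooth_near M x f" "X \<in> Sec M (tangent_algebroid M)"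
    "Y \<in> Sec M (tangent_algebroid M)" "Z \<in> Sec M (tangent_algebroid M)"
  shows "X x (\<lambda>y. bracket (tangent_algebroid M) Y Z y f) =
    X x (\<lambda>y. Y y (\<lambda>z. Z z f)) - X x (\<lambda>y. Z y (\<lambda>z. Y z f))"
proof -
  note X = Sec_tangentD[OF assms(2)] and Y = Sec_tangentD[OF assms(3)] and Z = Sec_tangentD[OF assms(4)]
  have "\<forall>\<^sub>F y in nhds x. bracket (tangent_algebroid M) Y Z y f = Y y (\<lambda>z. Z z f) - Z y (\<lambda>z. Y z f)"
    using smooth_near_eventually[OF assms(1)] by eventually_elim (simp add: bracket_tangent)
  then have "X x (\<lambda>y. bracket (tangent_algebroid M) Y Z y f) =
      X x (\<lambda>y. Y y (\<lambda>z. Z z f) - Z y (\<lambda>z. Y z f))" by (rule tangent_cong[OF X(1)])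
  also have "\<dots> = X x (\<lambda>y. Y y (\<lambda>z. Z z f)) - X x (\<lambda>y. Z y (\<lambda>z. Y z f))"
    by (intro tangent_diff[OF X(1)] Y(2) Z(2) assms(1))
  finally show ?thesis .
qed

text \<open>Makes the results on forms and, later, on divergences available for the tangent bundle,
  where the anchor is the identity.\<close>

lemma tangent_lie_algebroid: "lie_algebroid M (tangent_algebroid M)"
  unfolding lie_algebroid_def
proof (intro conjI allI ballI impI)
  have anchor: "anchor (tangent_algebroid M) = (\<lambda>x v. v)" by (simp add: tangent_algebroid_def)
  show "vector_bundle M (tangent_algebroid M)" by (rule tangent_bundle)
  show "anchor (tangent_algebroid M) x v \<in> tangent_space M x"
    if "v \<in> fiber (tangent_algebroid M) x" for x v using that by (simp add: tangent_algebroid_def)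
  show "anchor (tangent_algebroid M) x (v + w) =
    anchor (tangent_algebroid M) x v + anchor (tangent_algebroid M) x w" for x v w
    by (simp add: anchor)
  show "anchor (tangent_algebroid M) x (c *\<^sub>R v) = c *\<^sub>R anchor (tangent_algebroid M) x v" for x v c
    by (simp add: anchor)
  show "(\<lambda>x. anchor (tangent_algebroid M) x (X x)) \<in> Sec M (tangent_algebroid M)"
    if "X \<in> Sec M (tangent_algebroid M)" for X using that by (simp add: anchor)
  fix X Y assume X: "X \<in> Sec M (tangent_algebroid M)" and Y: "Y \<in> Sec M (tangent_algebroid M)"
  show "bracket (tangent_algebroid M) X Y \<in> Sec M (tangent_algebroid M)" by (rule bracket_tangent_Sec[OF X Y])
  show "bracket (tangent_algebroid M) Y X = - bracket (tangent_algebroid M) X Y"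
    by (intro ext) (simp add: bracket_tangent)
  show "(\<lambda>x. anchor (tangent_algebroid M) x (bracket (tangent_algebroid M) X Y x)) =
    bracket (tangent_algebroid M) (\<lambda>x. anchor (tangent_algebroid M) x (X x))
      (\<lambda>x. anchor (tangent_algebroid M) x (Y x))" by (simp add: anchor)
  note Xt = Sec_tangentD[OF X] and Yt = Sec_tangentD[OF Y]
  {
    fix Z assume Z: "Z \<in> Sec M (tangent_algebroid M)"
    note Zt = Sec_tangentD[OF Z]
    have "bracket (tangent_algebroid M) X (Y + Z) x f =
        (bracket (tangent_algebroid M) X Y + bracket (tangent_algebroid M) X Z) x f" for x f
      using tangent_add[OF Xt(1) Yt(2) Zt(2), of x f f]
      by (simp add: bracket_tangent)
    then show "bracket (tangent_algebroid M) X (Y + Z) =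
        bracket (tangent_algebroid M) X Y + bracket (tangent_algebroid M) X Z" by blast
    have "bracket (tangent_algebroid M) X (bracket (tangent_algebroid M) Y Z) x f =
        (bracket (tangent_algebroid M) (bracket (tangent_algebroid M) X Y) Z +
        bracket (tangent_algebroid M) Y (bracket (tangent_algebroid M) X Z)) x f" for x f
    proof (cases "smooth_near M x f")
      case True
      then show ?thesis
        using bracket_tangent_ev[OF True X Y Z] bracket_tangent_ev[OF True Z X Y] bracket_tangent_ev[OF True Y X Z]
          Xt(2)[OF True] Yt(2)[OF True] Zt(2)[OF True]
        by (simp add: bracket_tangent[where f = f] bracket_tangent[where f = "\<lambda>y. X y f"]
            bracket_tangent[where f = "\<lambda>y. Y y f"] bracket_tangent[where f = "\<lambda>y. Z y f"])
    qed (simp add: bracket_tangent)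
    then show "bracket (tangent_algebroid M) X (bracket (tangent_algebroid M) Y Z) =
        bracket (tangent_algebroid M) (bracket (tangent_algebroid M) X Y) Z +
        bracket (tangent_algebroid M) Y (bracket (tangent_algebroid M) X Z)" by blast
  }
  show "bracket (tangent_algebroid M) X (c *\<^sub>R Y) = c *\<^sub>R bracket (tangent_algebroid M) X Y" for c
  proof (intro ext)
    fix x f
    show "bracket (tangent_algebroid M) X (c *\<^sub>R Y) x f = (c *\<^sub>R bracket (tangent_algebroid M) X Y) x f"
      using tangent_scale[OF Xt(1) Yt(2), of x f c] by (simp add: bracket_tangent algebra_simps)
  qed
  show "bracket (tangent_algebroid M) X (\<lambda>x. f x *\<^sub>R Y x) =
      (\<lambda>x. f x *\<^sub>R bracket (tangent_algebroid M) X Y x + anchor (tangent_algebroid M) x (X x) f *\<^sub>R Y x)"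
    if f: "smooth_fun M UNIV f" for f
  proof (intro ext)
    fix x g
    have fx: "smooth_near M x f" using f smooth_fun_UNIV by blast
    show "bracket (tangent_algebroid M) X (\<lambda>x. f x *\<^sub>R Y x) x g =
      (f x *\<^sub>R bracket (tangent_algebroid M) X Y x + anchor (tangent_algebroid M) x (X x) f *\<^sub>R Y x) g"
      using tangent_mult[OF Xt(1) fx Yt(2), of g] tangent_not_smooth[OF Yt(1), of x g]
      by (simp add: bracket_tangent anchor algebra_simps)
  qed
qed

end

sublocale smooth_mfd \<subseteq> TM: algd M "tangent_algebroid M"
  by unfold_locales (rule tangent_lie_algebroid)

context algd
begin

lemma anchor_smooth:
  assumes "X \<in> Sec M E" "smooth_near M x f"
  shows "smooth_near M x (\<lambda>y. anchor E y (X y) f)"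
  using Sec_tangentD(2)[OF anchor_Sec[OF assms(1)] assms(2)] .

end

section \<open>Divergences\<close>

context vbun
begin

text \<open>The form is required to be nonzero at \<open>x\<close> alone; by continuity of its
  component in a frame it then has no zeros near \<open>x\<close>.\<close>

definition vol_near :: "'m \<Rightarrow> ('m \<Rightarrow> 'v list \<Rightarrow> real) \<Rightarrow> bool" where
  "vol_near x \<mu> \<longleftrightarrow> form_near M E rk x \<mu> \<and> \<mu> x \<noteq> 0"

lemma vol_near_form: "vol_near x \<mu> \<Longrightarrow> form_near M E rk x \<mu>"
  by (simp add: vol_near_def)

lemma frame_form_smooth:
  assumes F: "(U, e) \<in> frames E" "x \<in> U" and w: "form_near M E rk x \<omega>"
  shows "smooth_near M x (\<lambda>y. \<omega> y (map (\<lambda>i. e i y) [0..<rk]))"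
  using w unfolding top_form_near_frame[OF F] by simp

lemma top_form_frame_nonzero:
  assumes F: "(U, e) \<in> frames E" "x \<in> U" and w: "\<omega> \<in> alt_forms (fiber E x) rk" "\<omega> \<noteq> 0"
  shows "\<omega> (map (\<lambda>i. e i x) [0..<rk]) \<noteq> 0"
  using alt_forms_top_eq_0[OF frame_basis[OF F] w(1)] w(2) by blast

lemma vol_near_frame:
  assumes F: "(U, e) \<in> frames E" "x \<in> U" and m: "vol_near x \<mu>"
  shows "\<mu> x (map (\<lambda>i. e i x) [0..<rk]) \<noteq> 0"
  using m form_near_alt_at[OF vol_near_form[OF m]] top_form_frame_nonzero[OF F]
  by (simp add: vol_near_def)

lemma vol_near_eventually:
  assumes m: "vol_near x \<mu>"
  shows "\<forall>\<^sub>F y in nhds x. vol_near y \<mu>"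
proof -
  obtain U e where F: "(U, e) \<in> frames E" "x \<in> U" using frame_cover .
  have "\<forall>\<^sub>F y in nhds x. \<mu> y (map (\<lambda>i. e i y) [0..<rk]) \<noteq> 0"
    by (rule smooth_near_eventually_nonzero[OF frame_form_smooth[OF F vol_near_form[OF m]] vol_near_frame[OF F m]])
  with form_near_eventually[OF vol_near_form[OF m]] show ?thesis
    by eventually_elim (auto simp: vol_near_def)
qed

lemma top_ratio:
  assumes m: "vol_near x \<mu>" and w: "form_near M E rk x \<omega>"
  obtains f where "smooth_near M x f" "\<forall>\<^sub>F y in nhds x. \<omega> y = f y *\<^sub>R \<mu> y"
proof -
  obtain U e where F: "(U, e) \<in> frames E" "x \<in> U" using frame_cover .
  let ?f = "\<lambda>y. \<omega> y (map (\<lambda>i. e i y) [0..<rk]) / \<mu> y (map (\<lambda>i. e i y) [0..<rk])"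
  have "smooth_near M x ?f"
    by (intro smooth_near_divide frame_form_smooth[OF F] w vol_near_form[OF m] vol_near_frame[OF F m])
  moreover have "\<forall>\<^sub>F y in nhds x. \<omega> y = ?f y *\<^sub>R \<mu> y"
    using vol_near_eventually[OF m] form_near_alt[OF w] frame_eventually[OF F]
  proof eventually_elim
    case (elim y)
    note n = vol_near_frame[OF F(1) elim(3,1)]
    have "\<mu> y (map (\<lambda>i. e i y) [0..<rk]) *\<^sub>R \<omega> y = \<omega> y (map (\<lambda>i. e i y) [0..<rk]) *\<^sub>R \<mu> y"
      by (rule alt_forms_top_eq[OF frame_basis[OF F(1) elim(3)] elim(2) form_near_alt_at[OF vol_near_form[OF elim(1)]]])
    then have "inverse (\<mu> y (map (\<lambda>i. e i y) [0..<rk])) *\<^sub>R (\<mu> y (map (\<lambda>i. e i y) [0..<rk]) *\<^sub>R \<omega> y) =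
        inverse (\<mu> y (map (\<lambda>i. e i y) [0..<rk])) *\<^sub>R (\<omega> y (map (\<lambda>i. e i y) [0..<rk]) *\<^sub>R \<mu> y)" by simp
    then show ?case using n by (simp add: divide_inverse mult.commute)
  qed
  ultimately show thesis by (rule that)
qed

text \<open>Supplies test sections: an identity multiplied by the value of \<open>\<mu>\<close> on
  them can be divided by it. This includes rank 0, where the list is empty.\<close>

lemma vol_near_args:
  assumes m: "vol_near x \<mu>"
  obtains Ys where "set Ys \<subseteq> Sec M E" "length Ys = rk" "\<mu> x (eval_at x Ys) \<noteq> 0"
proof -
  have alt: "\<mu> x \<in> alt_forms (fiber E x) rk" by (rule form_near_alt_at[OF vol_near_form[OF m]])
  obtain vs where "\<mu> x vs \<noteq> 0" using m by (auto simp: vol_near_def fun_eq_iff)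
  then have vs: "length vs = rk" "set vs \<subseteq> fiber E x" "\<mu> x vs \<noteq> 0"
    using alt_forms_outside[OF alt, of vs] by auto
  obtain Ys where Ys: "set Ys \<subseteq> Sec M E" "eval_at x Ys = vs" using Sec_through_list[OF vs(2)] .
  then have "length Ys = rk" using vs(1) by auto
  then show thesis using that[OF Ys(1)] Ys(2) vs(3) by simp
qed

lemma frame_form:
  assumes F: "(U, e) \<in> frames E" "x \<in> U"
  obtains \<omega> where "\<omega> \<in> alt_forms (fiber E x) rk" "\<omega> (map (\<lambda>i. e i x) [0..<rk]) = 1"
proof -
  obtain \<omega> where w: "\<omega> \<in> alt_forms UNIV rk" "\<omega> (map (\<lambda>i. e i x) [0..<rk]) = 1"
    using ex_alt_form[OF frame_basis[OF F]] .
  have "set (map (\<lambda>i. e i x) [0..<rk]) \<subseteq> fiber E x" using basis_of_in[OF frame_basis[OF F]] by auto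
  then show thesis
    using that[OF alt_forms_restrict[OF w(1) fiber_subspace]] w(2) by simp
qed

lemma frame_vol:
  assumes F: "(U, e) \<in> frames E"
  obtains \<mu> where "\<forall>x\<in>U. vol_near x \<mu> \<and> \<mu> x (map (\<lambda>i. e i x) [0..<rk]) = 1"
proof -
  define \<mu> where "\<mu> x = (SOME \<omega>. \<omega> \<in> alt_forms (fiber E x) rk \<and> \<omega> (map (\<lambda>i. e i x) [0..<rk]) = 1)" for x
  have \<mu>: "\<mu> x \<in> alt_forms (fiber E x) rk \<and> \<mu> x (map (\<lambda>i. e i x) [0..<rk]) = 1" if "x \<in> U" for x
  proof -
    have "\<exists>\<omega>. \<omega> \<in> alt_forms (fiber E x) rk \<and> \<omega> (map (\<lambda>i. e i x) [0..<rk]) = 1"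
      using frame_form[OF F that] by metis
    then show ?thesis unfolding \<mu>_def by (rule someI_ex)
  qed
  have "vol_near x \<mu>" if x: "x \<in> U" for x
  proof -
    from frame_eventually[OF F x] have "\<forall>\<^sub>F y in nhds x. \<mu> y \<in> alt_forms (fiber E y) rk"
      by eventually_elim (use \<mu> in blast)
    moreover from frame_eventually[OF F x]
    have "\<forall>\<^sub>F y in nhds x. 1 = \<mu> y (map (\<lambda>i. e i y) [0..<rk])"
      by eventually_elim (use \<mu> in simp)
    with smooth_near_const have "smooth_near M x (\<lambda>y. \<mu> y (map (\<lambda>i. e i y) [0..<rk]))"
      by (rule smooth_near_transform)
    moreover have "\<mu> x \<noteq> 0" using \<mu>[OF x] by auto
    ultimately show ?thesis unfolding vol_near_def top_form_near_frame[OF F x] by simp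
  qed
  then show thesis using that[of \<mu>] \<mu> by blast
qed

lemma local_rep_vol: "local_rep M E m U \<mu> \<Longrightarrow> x \<in> U \<Longrightarrow> vol_near x \<mu>"
  unfolding local_rep_def vol_near_def using is_form_iff by blast

text \<open>A global section of \<open>|Vol|\<close> is the unit sphere of a fibrewise norm on top forms, glued from
  the norms given by local frames.\<close>

lemma vol_section_exists: obtains m where "vol_section M E m"
proof -
  have "\<exists>F. F \<in> frames E \<and> x \<in> fst F" for x
  proof -
    obtain U e where "(U, e) \<in> frames E" "x \<in> U" using frame_cover .
    then show ?thesis by (intro exI[of _ "(U, e)"]) simp
  qed
  then obtain Fr where Fr: "\<And>x. Fr x \<in> frames E" "\<And>x. x \<in> fst (Fr x)" by metis
  define A where "A x = fst (Fr x)" for x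
  define fr where "fr x = snd (Fr x)" for x
  have Afr: "(A x, fr x) \<in> frames E" for x using Fr(1) by (simp add: A_def fr_def)
  have A: "open (A x)" "x \<in> A x" for x using frame_open[OF Afr] Fr(2) by (auto simp: A_def)
  obtain \<psi> :: "nat \<Rightarrow> 'm \<Rightarrow> real" and c :: "nat \<Rightarrow> 'm" where
    sm: "\<And>n y. smooth_near M y (\<psi> n)" and pos: "\<And>n y. 0 \<le> \<psi> n y"
    and off: "\<And>n y. y \<notin> A (c n) \<Longrightarrow> \<forall>\<^sub>F z in nhds y. \<psi> n z = 0"
    and on: "\<And>n y. \<psi> n y \<noteq> 0 \<Longrightarrow> y \<in> A (c n)"
    and lf: "\<And>x. \<exists>k. \<forall>\<^sub>F y in nhds x. \<forall>n\<ge>k. \<psi> n y = 0" and ex: "\<And>x. \<exists>n. \<psi> n x > 0"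
    using locally_finite_bumps[OF A] by blast
  let ?fr = "\<lambda>n x. map (\<lambda>i. fr (c n) i x) [0..<rk]"
  \<comment> \<open>Absolute values make the contributions of differently oriented frames add up
    instead of cancelling.\<close>
  define r where "r x \<omega> = (\<Sum>n | \<psi> n x \<noteq> 0. \<psi> n x * \<bar>\<omega> (?fr n x)\<bar>)" for x and \<omega> :: "'v list \<Rightarrow> real"
  have fin: "finite {n. \<psi> n x \<noteq> 0}" for x
  proof -
    obtain k where k: "\<forall>\<^sub>F y in nhds x. \<forall>n\<ge>k. \<psi> n y = 0" using lf by blast
    have "\<forall>n\<ge>k. \<psi> n x = 0" using eventually_nhds_x_imp_x[OF k] .
    then have "{n. \<psi> n x \<noteq> 0} \<subseteq> {..<k}" by (auto simp: not_le)
    then show ?thesis by (rule finite_subset) simp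
  qed
  have r_scale: "r x (t *\<^sub>R \<omega>) = \<bar>t\<bar> * r x \<omega>" for x t \<omega>
    by (simp add: r_def abs_mult sum_distrib_left mult_ac)
  have r_pos: "r x \<omega> > 0" if w: "\<omega> \<in> alt_forms (fiber E x) rk" "\<omega> \<noteq> 0" for x \<omega>
  proof -
    obtain n where n: "\<psi> n x > 0" using ex by blast
    then have "x \<in> A (c n)" using on[of n x] by simp
    then have "\<omega> (?fr n x) \<noteq> 0" using top_form_frame_nonzero[OF Afr _ w] by blast
    then have "0 < \<psi> n x * \<bar>\<omega> (?fr n x)\<bar>" using n by simp
    also have "\<dots> \<le> r x \<omega>"
      unfolding r_def using n pos by (intro member_le_sum fin) auto
    finally show ?thesis .
  qed
  define m where "m x = {\<omega> \<in> alt_forms (fiber E x) rk. r x \<omega> = 1}" for x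
  have "\<exists>U \<mu>. x \<in> U \<and> local_rep M E m U \<mu>" for x
  proof -
    obtain U e where F: "(U, e) \<in> frames E" "x \<in> U" using frame_cover .
    obtain \<omega> where \<omega>: "\<forall>x\<in>U. vol_near x \<omega> \<and> \<omega> x (map (\<lambda>i. e i x) [0..<rk]) = 1" using frame_vol[OF F(1)] .
    define s where "s y = r y (\<omega> y)" for y
    have alt: "\<omega> y \<in> alt_forms (fiber E y) rk" "\<omega> y \<noteq> 0" if "y \<in> U" for y
      using \<omega> that form_near_alt_at by (auto simp: vol_near_def)
    have s0: "s y > 0" if "y \<in> U" for y unfolding s_def using r_pos alt that by blast
    have ss: "smooth_near M y s" if y: "y \<in> U" for y
    proof -
      obtain k where k: "\<forall>\<^sub>F z in nhds y. \<forall>n\<ge>k. \<psi> n z = 0" using lf by blast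
      \<comment> \<open>On the domain of the frame the component has no zeros near \<open>y\<close>,
        so its absolute value is smooth; at other points the weight vanishes near
        \<open>y\<close>.\<close>
      have "smooth_near M y (\<lambda>z. \<psi> n z * \<bar>\<omega> z (?fr n z)\<bar>)" for n
      proof (cases "y \<in> A (c n)")
        case True
        have v: "vol_near y \<omega>" using \<omega> y by blast
        show ?thesis
          by (intro smooth_near_mult sm smooth_near_abs frame_form_smooth[OF Afr True vol_near_form[OF v]]
              vol_near_frame[OF Afr True v])
      next
        case False
        from off[OF False] have "\<forall>\<^sub>F z in nhds y. 0 = \<psi> n z * \<bar>\<omega> z (?fr n z)\<bar>"
          by eventually_elim simp
        with smooth_near_const show ?thesis by (rule smooth_near_transform)
      qed
      then have "smooth_near M y (\<lambda>z. \<Sum>n<k. \<psi> n z * \<bar>\<omega> z (?fr n z)\<bar>)" by (intro smooth_near_sum)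
      moreover from k have "\<forall>\<^sub>F z in nhds y. (\<Sum>n<k. \<psi> n z * \<bar>\<omega> z (?fr n z)\<bar>) = s z"
      proof eventually_elim
        case (elim z)
        then have "{n. \<psi> n z \<noteq> 0} \<subseteq> {..<k}" by (auto simp: not_le)
        then show ?case unfolding s_def r_def by (intro sum.mono_neutral_right) auto
      qed
      ultimately show ?thesis by (rule smooth_near_transform)
    qed
    \<comment> \<open>Normalized to norm 1; in a line the only other vector of norm 1 is the
      negative, which is what \<open>local_rep\<close> asks for.\<close>
    define \<mu> where "\<mu> y = inverse (s y) *\<^sub>R \<omega> y" for y
    have "form_near M E rk y \<mu>" if y: "y \<in> U" for y
      unfolding \<mu>_def[abs_def] using y \<omega> s0[OF y] ss[OF y]
      by (intro form_near_scale smooth_near_inverse vol_near_form) auto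
    then have "is_form M E rk U \<mu>" using is_form_iff[OF frame_open[OF F(1)]] by blast
    moreover have "\<mu> y \<noteq> 0 \<and> m y = {\<mu> y, - \<mu> y}" if y: "y \<in> U" for y
    proof
      show "\<mu> y \<noteq> 0" using alt(2)[OF y] s0[OF y] by (simp add: \<mu>_def)
      have mu: "\<mu> y \<in> alt_forms (fiber E y) rk" "r y (\<mu> y) = 1"
        using alt[OF y] s0[OF y] alt_forms_scaleR unfolding \<mu>_def r_scale by (auto simp: s_def)
      have "- \<mu> y = (-1) *\<^sub>R \<mu> y" by simp
      then have mu': "- \<mu> y \<in> alt_forms (fiber E y) rk" "r y (- \<mu> y) = 1"
        using alt_forms_scaleR[OF mu(1), of "-1"] r_scale[of y "-1" "\<mu> y"] mu(2) by simp_all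
      show "m y = {\<mu> y, - \<mu> y}"
      proof
        show "{\<mu> y, - \<mu> y} \<subseteq> m y" using mu mu' by (simp add: m_def)
        show "m y \<subseteq> {\<mu> y, - \<mu> y}"
        proof
          fix \<eta> assume "\<eta> \<in> m y"
          then have \<eta>: "\<eta> \<in> alt_forms (fiber E y) rk" "r y \<eta> = 1" by (simp_all add: m_def)
          have "\<omega> y (map (\<lambda>i. e i y) [0..<rk]) *\<^sub>R \<eta> = \<eta> (map (\<lambda>i. e i y) [0..<rk]) *\<^sub>R \<omega> y"
            by (rule alt_forms_top_eq[OF frame_basis[OF F(1) y] \<eta>(1) alt(1)[OF y]])
          then obtain t where t: "\<eta> = t *\<^sub>R \<omega> y" using \<omega> y by (metis scaleR_one)
          then have "\<bar>t\<bar> * s y = 1" using \<eta>(2) r_scale by (simp add: s_def)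
          then have "\<bar>t\<bar> = inverse (s y)" using s0[OF y] by (simp add: field_simps)
          then have "t = inverse (s y) \<or> t = - inverse (s y)" by linarith
          then show "\<eta> \<in> {\<mu> y, - \<mu> y}" unfolding t \<mu>_def by auto
        qed
      qed
    qed
    ultimately have "local_rep M E m U \<mu>" unfolding local_rep_def using frame_open[OF F(1)] by blast
    then show ?thesis using F(2) by blast
  qed
  then show thesis using that unfolding vol_section_def by blast
qed

end

section \<open>Divergence with respect to a local volume form\<close>

definition div_coeff ::
  "('m::topological_space, 'b::euclidean_space) manifold \<Rightarrow> ('m, 'v::real_vector) algebroid \<Rightarrow>
   ('m \<Rightarrow> 'v list \<Rightarrow> real) \<Rightarrow> ('m \<Rightarrow> 'v) \<Rightarrow> 'm \<Rightarrow> real" where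
  "div_coeff M E \<mu> X x = (SOME c. lie_form M E X \<mu> x = c *\<^sub>R \<mu> x)"

context algd
begin

lemma anchor_sum:
  "(\<And>i. i \<in> I \<Longrightarrow> v i \<in> fiber E x) \<Longrightarrow>
    anchor E x (\<Sum>i\<in>I. c i *\<^sub>R v i) f = (\<Sum>i\<in>I. c i * anchor E x (v i) f)"
proof (induction I rule: infinite_finite_induct)
  case (insert i I)
  then have "(\<Sum>i\<in>I. c i *\<^sub>R v i) \<in> fiber E x" "c i *\<^sub>R v i \<in> fiber E x"
    by (auto intro!: subspace_sum[OF fiber_subspace] subspace_scale[OF fiber_subspace])
  then show ?case using insert by (simp add: anchor_add anchor_scale)
qed (simp_all add: anchor_zero)

lemma lie_form_div:
  assumes m: "vol_near x \<mu>" and X: "X \<in> Sec M E"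
  shows "lie_form M E X \<mu> x = div_coeff M E \<mu> X x *\<^sub>R \<mu> x"
proof -
  obtain U e where F: "(U, e) \<in> frames E" "x \<in> U" using frame_cover .
  let ?e = "map (\<lambda>i. e i x) [0..<rk]"
  have "\<mu> x ?e *\<^sub>R lie_form M E X \<mu> x = lie_form M E X \<mu> x ?e *\<^sub>R \<mu> x"
    by (rule alt_forms_top_eq[OF frame_basis[OF F] lie_form_alt[OF vol_near_form[OF m] X]
        form_near_alt_at[OF vol_near_form[OF m]]])
  then have "inverse (\<mu> x ?e) *\<^sub>R (\<mu> x ?e *\<^sub>R lie_form M E X \<mu> x) =
      inverse (\<mu> x ?e) *\<^sub>R (lie_form M E X \<mu> x ?e *\<^sub>R \<mu> x)" by simp
  then have "\<exists>c. lie_form M E X \<mu> x = c *\<^sub>R \<mu> x"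
    using vol_near_frame[OF F m] by (intro exI[of _ "inverse (\<mu> x ?e) * lie_form M E X \<mu> x ?e"]) simp
  then show ?thesis unfolding div_coeff_def by (rule someI_ex)
qed

lemma div_coeff_unique:
  assumes m: "vol_near x \<mu>" and X: "X \<in> Sec M E" and c: "lie_form M E X \<mu> x = c *\<^sub>R \<mu> x"
  shows "div_coeff M E \<mu> X x = c"
  using lie_form_div[OF m X] c m by (simp add: vol_near_def)

text \<open>The formula for the Lie derivative, solved for the derivative of a component of
  \<open>\<mu>\<close>; in this form the divergence enters most later computations.\<close>

lemma div_formula:
  assumes m: "vol_near x \<mu>" and X: "X \<in> Sec M E" and Ys: "set Ys \<subseteq> Sec M E"
  shows "anchor E x (X x) (\<lambda>y. \<mu> y (eval_at y Ys)) = div_coeff M E \<mu> X x * \<mu> x (eval_at x Ys) +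
    (\<Sum>i<length Ys. \<mu> x (eval_at x (Ys[i := bracket E X (Ys ! i)])))"
  using lie_form_eval[OF vol_near_form[OF m] X Ys] lie_form_div[OF m X] by simp

text \<open>The Leibniz rule for the Lie derivative of f \<mu>. The factor may vanish, so that the
  rule also serves for arbitrary sections of the bundle of top forms.\<close>

lemma lie_form_top:
  assumes m: "vol_near x \<mu>" and X: "X \<in> Sec M E" and f: "smooth_near M x f"
    and w: "\<forall>\<^sub>F y in nhds x. \<omega> y = f y *\<^sub>R \<mu> y"
  shows "lie_form M E X \<omega> x = (anchor E x (X x) f + f x * div_coeff M E \<mu> X x) *\<^sub>R \<mu> x"
proof
  fix vs
  have wn: "form_near M E rk x \<omega>"
  proof -
    obtain U e where F: "(U, e) \<in> frames E" "x \<in> U" using frame_cover .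
    have "\<forall>\<^sub>F y in nhds x. \<omega> y \<in> alt_forms (fiber E y) rk"
      using w form_near_alt[OF vol_near_form[OF m]] by eventually_elim (simp add: alt_forms_scaleR)
    moreover have "smooth_near M x (\<lambda>y. f y * \<mu> y (map (\<lambda>i. e i y) [0..<rk]))"
      by (intro smooth_near_mult f frame_form_smooth[OF F vol_near_form[OF m]])
    then have "smooth_near M x (\<lambda>y. \<omega> y (map (\<lambda>i. e i y) [0..<rk]))"
      by (rule smooth_near_transform) (use w in \<open>eventually_elim, simp\<close>)
    ultimately show ?thesis unfolding top_form_near_frame[OF F] by simp
  qed
  show "lie_form M E X \<omega> x vs = ((anchor E x (X x) f + f x * div_coeff M E \<mu> X x) *\<^sub>R \<mu> x) vs"
  proof (cases "length vs = rk \<and> set vs \<subseteq> fiber E x")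
    case True
    then obtain Ys where Ys: "set Ys \<subseteq> Sec M E" "eval_at x Ys = vs" using Sec_through_list by metis
    have wx: "\<omega> x us = f x * \<mu> x us" for us using eventually_nhds_x_imp_x[OF w] by simp
    have "anchor E x (X x) (\<lambda>y. \<omega> y (eval_at y Ys)) = anchor E x (X x) (\<lambda>y. f y * \<mu> y (eval_at y Ys))"
      by (rule tangent_cong[OF Sec_tangent[OF X]]) (use w in \<open>eventually_elim, simp\<close>)
    also have "\<dots> = f x * anchor E x (X x) (\<lambda>y. \<mu> y (eval_at y Ys)) + \<mu> x vs * anchor E x (X x) f"
      unfolding Ys(2)[symmetric]
      by (rule tangent_mult[OF Sec_tangent[OF X] f form_near_eval_Sec[OF vol_near_form[OF m] Ys(1)]])
    finally show ?thesis
      using lie_form_eval[OF wn X Ys(1)] div_formula[OF m X Ys(1)] Ys(2)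
      by (simp add: wx sum_distrib_left algebra_simps)
  next
    case False
    then show ?thesis
      using alt_forms_outside[OF lie_form_alt[OF wn X] False]
        alt_forms_outside[OF form_near_alt_at[OF vol_near_form[OF m]] False] by simp
  qed
qed

text \<open>The Leibniz rule divided by \<open>f\<close>; the correction is the derivative of ln
  |f|, the source of the potentials by which classes are compared.\<close>

lemma div_coeff_scale:
  assumes m: "vol_near x \<mu>" and m': "vol_near x \<mu>'" and X: "X \<in> Sec M E" and f: "smooth_near M x f"
    and w: "\<forall>\<^sub>F y in nhds x. \<mu>' y = f y *\<^sub>R \<mu> y"
  shows "f x \<noteq> 0" "div_coeff M E \<mu>' X x = div_coeff M E \<mu> X x + anchor E x (X x) f / f x"
proof -
  have wx: "\<mu>' x = f x *\<^sub>R \<mu> x" using eventually_nhds_x_imp_x[OF w] .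
  then show f0: "f x \<noteq> 0" using m' by (auto simp: vol_near_def)
  show "div_coeff M E \<mu>' X x = div_coeff M E \<mu> X x + anchor E x (X x) f / f x"
  proof (rule div_coeff_unique[OF m' X])
    have "anchor E x (X x) f + f x * div_coeff M E \<mu> X x =
        (div_coeff M E \<mu> X x + anchor E x (X x) f / f x) * f x"
      using f0 by (simp add: field_simps)
    then show "lie_form M E X \<mu>' x = (div_coeff M E \<mu> X x + anchor E x (X x) f / f x) *\<^sub>R \<mu>' x"
      unfolding lie_form_top[OF m X f w] wx scaleR_scaleR by simp
  qed
qed

text \<open>Near \<open>x\<close> the ratio \<open>f\<close> of the forms takes only the values 1
  and -1. Its square is constant, so by the Leibniz rule 2 f times the derivative of
  \<open>f\<close> is 0, and the correction in \<open>div_coeff_scale\<close> vanishes.\<close>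

lemma div_coeff_pm:
  assumes m: "vol_near x \<mu>" and m': "vol_near x \<mu>'" and X: "X \<in> Sec M E"
    and w: "\<forall>\<^sub>F y in nhds x. \<mu>' y = \<mu> y \<or> \<mu>' y = - \<mu> y"
  shows "div_coeff M E \<mu>' X x = div_coeff M E \<mu> X x"
proof -
  obtain f where f: "smooth_near M x f" "\<forall>\<^sub>F y in nhds x. \<mu>' y = f y *\<^sub>R \<mu> y"
    using top_ratio[OF m vol_near_form[OF m']] .
  have "\<forall>\<^sub>F y in nhds x. f y * f y = 1"
    using f(2) w vol_near_eventually[OF m]
  proof eventually_elim
    case (elim y)
    have "\<mu> y \<noteq> 0" using elim(3) by (simp add: vol_near_def)
    have "f y *\<^sub>R \<mu> y = 1 *\<^sub>R \<mu> y \<or> f y *\<^sub>R \<mu> y = (-1) *\<^sub>R \<mu> y" using elim by simp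
    then have "f y = 1 \<or> f y = -1" using \<open>\<mu> y \<noteq> 0\<close> by (metis scaleR_right_imp_eq)
    then show ?case by auto
  qed
  then have "anchor E x (X x) (\<lambda>y. f y * f y) = anchor E x (X x) (\<lambda>y. 1)"
    by (rule tangent_cong[OF Sec_tangent[OF X]])
  then have "2 * (f x * anchor E x (X x) f) = 0"
    using tangent_mult[OF Sec_tangent[OF X] f(1) f(1)] tangent_const[OF Sec_tangent[OF X], where c = 1] by simp
  then show ?thesis using div_coeff_scale[OF m m' X f] by simp
qed

text \<open>On test sections where \<open>\<mu>\<close> does not vanish, \<open>div_formula\<close>
  exhibits the divergence as a quotient of smooth functions.\<close>

lemma div_coeff_smooth:
  assumes m: "vol_near x \<mu>" and X: "X \<in> Sec M E"
  shows "smooth_near M x (div_coeff M E \<mu> X)"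
proof -
  obtain Ys where Ys: "set Ys \<subseteq> Sec M E" "length Ys = rk" "\<mu> x (eval_at x Ys) \<noteq> 0" using vol_near_args[OF m] .
  let ?N = "\<lambda>y. anchor E y (X y) (\<lambda>z. \<mu> z (eval_at z Ys)) -
    (\<Sum>i<length Ys. \<mu> y (eval_at y (Ys[i := bracket E X (Ys ! i)])))"
  note ev = form_near_eval_Sec[OF vol_near_form[OF m]]
  have up: "set (Ys[i := bracket E X (Ys ! i)]) \<subseteq> Sec M E" if "i < length Ys" for i
  proof -
    have "bracket E X (Ys ! i) \<in> Sec M E" using bracket_Sec[OF X] Ys(1) that nth_mem by blast
    then show ?thesis using Ys(1) set_update_subset_insert[of Ys i] by blast
  qed
  have "smooth_near M x (\<lambda>y. ?N y / \<mu> y (eval_at y Ys))"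
    by (intro smooth_near_divide smooth_near_diff smooth_near_sum anchor_smooth[OF X] ev Ys up) simp
  moreover have "\<forall>\<^sub>F y in nhds x. ?N y / \<mu> y (eval_at y Ys) = div_coeff M E \<mu> X y"
    using vol_near_eventually[OF m] smooth_near_eventually_nonzero[OF ev[OF Ys(1)] Ys(3)]
  proof eventually_elim
    case (elim y)
    then show ?case using div_formula[OF elim(1) X Ys(1)] by simp
  qed
  ultimately show ?thesis by (rule smooth_near_transform)
qed

lemma div_coeff_add:
  assumes m: "vol_near x \<mu>" and X: "X \<in> Sec M E" and Y: "Y \<in> Sec M E"
  shows "div_coeff M E \<mu> (\<lambda>y. X y + Y y) x = div_coeff M E \<mu> X x + div_coeff M E \<mu> Y x"
proof -
  obtain Zs where Zs: "set Zs \<subseteq> Sec M E" "length Zs = rk" "\<mu> x (eval_at x Zs) \<noteq> 0" using vol_near_args[OF m] .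
  have alt: "\<mu> x \<in> alt_forms (fiber E x) rk" by (rule form_near_alt_at[OF vol_near_form[OF m]])
  have "\<mu> x (eval_at x (Zs[i := bracket E (\<lambda>y. X y + Y y) (Zs ! i)])) =
      \<mu> x (eval_at x (Zs[i := bracket E X (Zs ! i)])) + \<mu> x (eval_at x (Zs[i := bracket E Y (Zs ! i)]))"
    if i: "i < length Zs" for i
  proof -
    have Z: "Zs ! i \<in> Sec M E" using Zs(1) i nth_mem by blast
    have f: "bracket E X (Zs ! i) x \<in> fiber E x" "bracket E Y (Zs ! i) x \<in> fiber E x"
      using Sec_fiber bracket_Sec X Y Z by blast+
    show ?thesis
      unfolding map_update bracket_add_left[OF Z X Y]
      by (rule alt_formsD(1)[OF alt _ eval_at_fiber[OF Zs(1)] _ f]) (use i Zs(2) in simp_all)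
  qed
  then have "(\<Sum>i<length Zs. \<mu> x (eval_at x (Zs[i := bracket E (\<lambda>y. X y + Y y) (Zs ! i)]))) =
      (\<Sum>i<length Zs. \<mu> x (eval_at x (Zs[i := bracket E X (Zs ! i)]))) +
      (\<Sum>i<length Zs. \<mu> x (eval_at x (Zs[i := bracket E Y (Zs ! i)])))"
    by (simp add: sum.distrib)
  then have "div_coeff M E \<mu> (\<lambda>y. X y + Y y) x * \<mu> x (eval_at x Zs) =
      (div_coeff M E \<mu> X x + div_coeff M E \<mu> Y x) * \<mu> x (eval_at x Zs)"
    using div_formula[OF m X Zs(1)] div_formula[OF m Y Zs(1)] div_formula[OF m Sec_add[OF X Y] Zs(1)]
      anchor_add[OF Sec_fiber[OF X] Sec_fiber[OF Y], of x "\<lambda>y. \<mu> y (eval_at y Zs)"]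
    by (simp add: algebra_simps)
  then show ?thesis using Zs(3) by simp
qed

text \<open>In slot \<open>i\<close> the bracket of \<open>f\<close> times \<open>X\<close> with a
  frame section contributes minus the derivative of \<open>f\<close> along \<open>e i\<close> times
  the value of \<open>\<mu>\<close> with \<open>X\<close> inserted. By
  \<open>alt_forms_update_basis\<close> this insertion gives the coefficient \<open>u i\<close> of
  \<open>X\<close>, and the sum over the slots is the derivative of \<open>f\<close> along
  \<open>X\<close>.\<close>

lemma div_coeff_mult:
  assumes m: "vol_near x \<mu>" and X: "X \<in> Sec M E" and f: "smooth_fun M UNIV f"
  shows "div_coeff M E \<mu> (\<lambda>y. f y *\<^sub>R X y) x = f x * div_coeff M E \<mu> X x + anchor E x (X x) f"
proof -
  obtain U e where F: "(U, e) \<in> frames E" "x \<in> U" using frame_cover .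
  let ?e = "\<lambda>i. e i x"
  obtain Y where Y: "\<forall>i<rk. Y i \<in> Sec M E" "\<forall>\<^sub>F y in nhds x. \<forall>i<rk. Y i y = e i y"
    using frame_extend[OF F] .
  have Yx: "Y i x = e i x" if "i < rk" for i using eventually_nhds_x_imp_x[OF Y(2)] that by blast
  let ?Z = "map Y [0..<rk]"
  have Z: "set ?Z \<subseteq> Sec M E" using Y(1) by auto
  have ev: "eval_at x ?Z = map ?e [0..<rk]" using Yx by simp
  have alt: "\<mu> x \<in> alt_forms (fiber E x) rk" by (rule form_near_alt_at[OF vol_near_form[OF m]])
  obtain u where u: "X x = (\<Sum>j<rk. u j *\<^sub>R e j x)"
    using basis_of_expand[OF frame_basis[OF F] Sec_fiber[OF X]] .
  have upX: "\<mu> x ((map ?e [0..<rk])[i := X x]) = u i * \<mu> x (map ?e [0..<rk])" if "i < rk" for i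
    unfolding u by (rule alt_forms_update_basis[OF frame_basis[OF F] alt that])
  have step: "\<mu> x (eval_at x (?Z[i := bracket E (\<lambda>y. f y *\<^sub>R X y) (?Z ! i)])) =
      f x * \<mu> x (eval_at x (?Z[i := bracket E X (?Z ! i)])) -
      u i * anchor E x (e i x) f * \<mu> x (map ?e [0..<rk])" if i: "i < rk" for i
  proof -
    have Yi: "Y i \<in> Sec M E" using Y(1) i by blast
    have b: "bracket E X (Y i) x \<in> fiber E x" using Sec_fiber bracket_Sec X Yi by blast
    have up: "set ((map ?e [0..<rk])[i := v]) \<subseteq> fiber E x" if "v \<in> fiber E x" for v
      using that set_update_subset_insert[of "map ?e [0..<rk]" i v] basis_of_in[OF frame_basis[OF F]] by fastforce
    have se: "set (map ?e [0..<rk]) \<subseteq> fiber E x" using basis_of_in[OF frame_basis[OF F]] by auto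
    have sc: "f x *\<^sub>R bracket E X (Y i) x \<in> fiber E x" "(- anchor E x (e i x) f) *\<^sub>R X x \<in> fiber E x"
      using b Sec_fiber[OF X] subspace_scale[OF fiber_subspace] by blast+
    have "bracket E (\<lambda>y. f y *\<^sub>R X y) (Y i) x =
        f x *\<^sub>R bracket E X (Y i) x + (- anchor E x (e i x) f) *\<^sub>R X x"
      using bracket_mult_left[OF Yi X f, of x] Yx[OF i] by simp
    then have "\<mu> x (eval_at x (?Z[i := bracket E (\<lambda>y. f y *\<^sub>R X y) (?Z ! i)])) =
        \<mu> x ((map ?e [0..<rk])[i := f x *\<^sub>R bracket E X (Y i) x + (- anchor E x (e i x) f) *\<^sub>R X x])"
      using i unfolding map_update ev by simp
    also have "\<dots> = \<mu> x ((map ?e [0..<rk])[i := f x *\<^sub>R bracket E X (Y i) x]) +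
        \<mu> x ((map ?e [0..<rk])[i := (- anchor E x (e i x) f) *\<^sub>R X x])"
      by (rule alt_formsD(1)[OF alt _ se i sc]) simp
    also have "\<mu> x ((map ?e [0..<rk])[i := f x *\<^sub>R bracket E X (Y i) x]) =
        f x * \<mu> x ((map ?e [0..<rk])[i := bracket E X (Y i) x])"
      by (rule alt_formsD(2)[OF alt _ se i b]) simp
    also have "\<mu> x ((map ?e [0..<rk])[i := (- anchor E x (e i x) f) *\<^sub>R X x]) =
        (- anchor E x (e i x) f) * \<mu> x ((map ?e [0..<rk])[i := X x])"
      by (rule alt_formsD(2)[OF alt _ se i Sec_fiber[OF X]]) simp
    finally show ?thesis using i unfolding map_update ev upX[OF i] by simp
  qed
  have "anchor E x (X x) f = (\<Sum>i<rk. u i * anchor E x (e i x) f)"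
    unfolding u by (rule anchor_sum) (use basis_of_in[OF frame_basis[OF F]] in simp)
  then have S: "(\<Sum>i<rk. \<mu> x (eval_at x (?Z[i := bracket E (\<lambda>y. f y *\<^sub>R X y) (?Z ! i)]))) =
      f x * (\<Sum>i<rk. \<mu> x (eval_at x (?Z[i := bracket E X (?Z ! i)]))) -
      anchor E x (X x) f * \<mu> x (map ?e [0..<rk])"
  proof -
    assume a: "anchor E x (X x) f = (\<Sum>i<rk. u i * anchor E x (e i x) f)"
    have "(\<Sum>i<rk. \<mu> x (eval_at x (?Z[i := bracket E (\<lambda>y. f y *\<^sub>R X y) (?Z ! i)]))) =
        (\<Sum>i<rk. f x * \<mu> x (eval_at x (?Z[i := bracket E X (?Z ! i)])) -
          u i * anchor E x (e i x) f * \<mu> x (map ?e [0..<rk]))"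
      by (rule sum.cong) (simp_all only: step lessThan_iff)
    then show ?thesis unfolding a sum_subtractf sum_distrib_left sum_distrib_right .
  qed
  have l: "length ?Z = rk" by simp
  have "anchor E x (f x *\<^sub>R X x) (\<lambda>y. \<mu> y (eval_at y ?Z)) = f x * anchor E x (X x) (\<lambda>y. \<mu> y (eval_at y ?Z))"
    by (rule anchor_scale[OF Sec_fiber[OF X]])
  then have "div_coeff M E \<mu> (\<lambda>y. f y *\<^sub>R X y) x * \<mu> x (map ?e [0..<rk]) =
      (f x * div_coeff M E \<mu> X x + anchor E x (X x) f) * \<mu> x (map ?e [0..<rk])"
    using div_formula[OF m X Z] div_formula[OF m Sec_scale[OF f X] Z]
    unfolding l S ev by (simp add: algebra_simps)
  then show ?thesis using vol_near_frame[OF F m] by simp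
qed

text \<open>Applying the divergence formula twice expresses \<open>[\<rho> X, \<rho> Y]\<close> of a component of \<open>\<mu>\<close>; the terms
  with brackets in two different slots are symmetric in \<open>X\<close> and \<open>Y\<close>.\<close>

lemma div_coeff_bracket:
  assumes m: "vol_near x \<mu>" and X: "X \<in> Sec M E" and Y: "Y \<in> Sec M E"
  shows "div_coeff M E \<mu> (bracket E X Y) x =
    anchor E x (X x) (div_coeff M E \<mu> Y) - anchor E x (Y x) (div_coeff M E \<mu> X)"
proof -
  obtain Zs where Zs: "set Zs \<subseteq> Sec M E" "length Zs = rk" "\<mu> x (eval_at x Zs) \<noteq> 0" using vol_near_args[OF m] .
  have alt: "\<mu> x \<in> alt_forms (fiber E x) rk" by (rule form_near_alt_at[OF vol_near_form[OF m]])
  define h where "h Zs y = \<mu> y (eval_at y Zs)" for Zs y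
  define up where "up X i Zs = Zs[i := bracket E X (Zs ! i)]" for X i and Zs :: "('m \<Rightarrow> 'v) list"
  have ZS: "Zs ! i \<in> Sec M E" if "i < rk" for i
  proof -
    have "Zs ! i \<in> set Zs" using that Zs(2) by simp
    then show ?thesis using Zs(1) by blast
  qed
  have upS: "set (up X i Ws) \<subseteq> Sec M E" if "X \<in> Sec M E" "set Ws \<subseteq> Sec M E" "i < length Ws" for X i Ws
  proof -
    have "bracket E X (Ws ! i) \<in> Sec M E" using bracket_Sec that nth_mem by blast
    then show ?thesis unfolding up_def using that(2) set_update_subset_insert[of Ws i] by blast
  qed
  have lup: "length (up X i Ws) = length Ws" for X i Ws by (simp add: up_def)
  have hs: "smooth_near M x (h Ws)" if "set Ws \<subseteq> Sec M E" for Ws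
    unfolding h_def[abs_def] by (rule form_near_eval_Sec[OF vol_near_form[OF m] that])
  have df: "anchor E y (X y) (h Ws) = div_coeff M E \<mu> X y * h Ws y + (\<Sum>i<rk. h (up X i Ws) y)"
    if "vol_near y \<mu>" "X \<in> Sec M E" "set Ws \<subseteq> Sec M E" "length Ws = rk" for X y Ws
    using div_formula[OF that(1-3)] that(4) by (simp add: h_def[abs_def] up_def)
  have two: "anchor E x (X x) (\<lambda>y. anchor E y (Y y) (h Zs)) =
      anchor E x (X x) (div_coeff M E \<mu> Y) * h Zs x +
      div_coeff M E \<mu> Y x * (div_coeff M E \<mu> X x * h Zs x) +
      div_coeff M E \<mu> Y x * (\<Sum>i<rk. h (up X i Zs) x) + div_coeff M E \<mu> X x * (\<Sum>i<rk. h (up Y i Zs) x) +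
      (\<Sum>i<rk. \<Sum>j<rk. h (up X j (up Y i Zs)) x)"
    if X: "X \<in> Sec M E" and Y: "Y \<in> Sec M E" for X Y
  proof -
    have v: "anchor E x (X x) \<in> tangent_space M x" by (rule Sec_tangent[OF X])
    have S: "set (up Y i Zs) \<subseteq> Sec M E" if "i < rk" for i using upS[OF Y Zs(1)] that Zs(2) by simp
    have "anchor E x (X x) (\<lambda>y. anchor E y (Y y) (h Zs)) =
        anchor E x (X x) (\<lambda>y. div_coeff M E \<mu> Y y * h Zs y + (\<Sum>i<rk. h (up Y i Zs) y))"
      by (rule tangent_cong[OF v], rule eventually_mono[OF vol_near_eventually[OF m]])
        (rule df[OF _ Y Zs(1,2)])
    also have "\<dots> = anchor E x (X x) (\<lambda>y. div_coeff M E \<mu> Y y * h Zs y) +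
        anchor E x (X x) (\<lambda>y. \<Sum>i<rk. h (up Y i Zs) y)"
      by (intro tangent_add[OF v] smooth_near_mult smooth_near_sum div_coeff_smooth[OF m Y] hs Zs(1) S) simp
    also have "anchor E x (X x) (\<lambda>y. div_coeff M E \<mu> Y y * h Zs y) =
        div_coeff M E \<mu> Y x * anchor E x (X x) (h Zs) + h Zs x * anchor E x (X x) (div_coeff M E \<mu> Y)"
      by (rule tangent_mult[OF v div_coeff_smooth[OF m Y] hs[OF Zs(1)]])
    also have "anchor E x (X x) (\<lambda>y. \<Sum>i<rk. h (up Y i Zs) y) = (\<Sum>i<rk. anchor E x (X x) (h (up Y i Zs)))"
      by (rule tangent_sum[OF v]) (use S hs in simp)
    also have "\<dots> = (\<Sum>i<rk. div_coeff M E \<mu> X x * h (up Y i Zs) x + (\<Sum>j<rk. h (up X j (up Y i Zs)) x))"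
      by (rule sum.cong) (use df[OF m X S] lup Zs(2) in simp_all)
    finally show ?thesis
      unfolding df[OF m X Zs(1,2)] by (simp add: sum.distrib sum_distrib_left algebra_simps)
  qed
  have cross: "h (up X j (up Y i Zs)) x = h (up Y i (up X j Zs)) x" if "i \<noteq> j" for i j
    using that by (simp add: up_def list_update_swap)
  \<comment> \<open>For equal slots the Jacobi identity turns the difference of iterated brackets
    into the bracket with \<open>bracket E X Y\<close>.\<close>
  have jac: "h (up X i (up Y i Zs)) x - h (up Y i (up X i Zs)) x = h (up (bracket E X Y) i Zs) x"
    if i: "i < rk" for i
  proof -
    note Z = ZS[OF i]
    let ?b = "bracket E (bracket E X Y) (Zs ! i) x" and ?c = "bracket E Y (bracket E X (Zs ! i)) x"
    have f: "?b \<in> fiber E x" "?c \<in> fiber E x"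
      using Sec_fiber bracket_Sec X Y Z by blast+
    have "\<mu> x ((eval_at x Zs)[i := ?b + ?c]) = \<mu> x ((eval_at x Zs)[i := ?b]) + \<mu> x ((eval_at x Zs)[i := ?c])"
      by (rule alt_formsD(1)[OF alt _ eval_at_fiber[OF Zs(1)] i f]) (simp add: Zs(2))
    then show ?thesis
      using i Zs(2) bracket_jacobi[OF X Y Z, of x] by (simp add: h_def up_def map_update)
  qed
  have "(\<Sum>i<rk. \<Sum>j<rk. h (up X j (up Y i Zs)) x) - (\<Sum>i<rk. \<Sum>j<rk. h (up Y j (up X i Zs)) x) =
      (\<Sum>i<rk. \<Sum>j<rk. h (up X j (up Y i Zs)) x) - (\<Sum>i<rk. \<Sum>j<rk. h (up Y i (up X j Zs)) x)"
    by (subst (2) sum.swap) simp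
  also have "\<dots> = (\<Sum>i<rk. \<Sum>j<rk. if j = i then h (up (bracket E X Y) i Zs) x else 0)"
    unfolding sum_subtractf[symmetric]
    by (intro sum.cong refl) (use cross jac in auto)
  also have "\<dots> = (\<Sum>i<rk. h (up (bracket E X Y) i Zs) x)" by simp
  finally have dd: "(\<Sum>i<rk. \<Sum>j<rk. h (up X j (up Y i Zs)) x) - (\<Sum>i<rk. \<Sum>j<rk. h (up Y j (up X i Zs)) x) =
      (\<Sum>i<rk. h (up (bracket E X Y) i Zs) x)" .
  have "div_coeff M E \<mu> (bracket E X Y) x * h Zs x + (\<Sum>i<rk. h (up (bracket E X Y) i Zs) x) =
      anchor E x (X x) (\<lambda>y. anchor E y (Y y) (h Zs)) - anchor E x (Y x) (\<lambda>y. anchor E y (X y) (h Zs))"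
    using df[OF m bracket_Sec[OF X Y] Zs(1,2)] anchor_bracket_apply[OF X Y hs[OF Zs(1)]] by simp
  then have "div_coeff M E \<mu> (bracket E X Y) x * h Zs x =
      (anchor E x (X x) (div_coeff M E \<mu> Y) - anchor E x (Y x) (div_coeff M E \<mu> X)) * h Zs x"
    unfolding two[OF X Y] two[OF Y X] dd[symmetric] by (simp add: algebra_simps)
  then show ?thesis using Zs(3) by (simp add: h_def)
qed

text \<open>Representatives of one density agree up to sign on overlaps, and by
  \<open>div_coeff_pm\<close> the sign has no effect, so the local divergences fit together to the
  unique function described by \<open>divergence\<close>.\<close>

lemma divergence_eq:
  assumes m: "vol_section M E m" and X: "X \<in> Sec M E" and r: "local_rep M E m U \<mu>" "x \<in> U"
  shows "divergence M E m X x = div_coeff M E \<mu> X x"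
proof -
  have "\<forall>x. \<exists>U \<mu>. x \<in> U \<and> local_rep M E m U \<mu>" using m unfolding vol_section_def .
  then obtain U' \<mu>' where r': "\<And>x. x \<in> U' x" "\<And>x. local_rep M E m (U' x) (\<mu>' x)" by metis
  have same: "div_coeff M E \<mu>1 X y = div_coeff M E \<mu>2 X y"
    if r1: "local_rep M E m U1 \<mu>1" "y \<in> U1" and r2: "local_rep M E m U2 \<mu>2" "y \<in> U2" for U1 U2 \<mu>1 \<mu>2 y
  proof (rule div_coeff_pm[OF local_rep_vol[OF r2] local_rep_vol[OF r1] X])
    have "open (U1 \<inter> U2)" using r1 r2 unfolding local_rep_def by blast
    then have "\<forall>\<^sub>F z in nhds y. z \<in> U1 \<inter> U2" using r1(2) r2(2) by (intro eventually_nhds_in_open) auto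
    then show "\<forall>\<^sub>F z in nhds y. \<mu>1 z = \<mu>2 z \<or> \<mu>1 z = - \<mu>2 z"
    proof eventually_elim
      case (elim z)
      then have "{\<mu>1 z, - \<mu>1 z} = {\<mu>2 z, - \<mu>2 z}"
        using r1(1) r2(1) unfolding local_rep_def by (metis IntD1 IntD2)
      then show ?case by (metis insertCI insertE singletonD)
    qed
  qed
  define f where "f y = div_coeff M E (\<mu>' y) X y" for y
  have f: "lie_form M E X \<mu> y = f y *\<^sub>R \<mu> y" if "local_rep M E m U \<mu>" "y \<in> U" for U \<mu> y
    using lie_form_div[OF local_rep_vol[OF that] X] same[OF that r'(2) r'(1)] by (simp add: f_def)
  have "divergence M E m X = f"
    unfolding divergence_def
  proof (rule the_equality)
    show "\<forall>U \<mu>. local_rep M E m U \<mu> \<longrightarrow> (\<forall>x\<in>U. lie_form M E X \<mu> x = f x *\<^sub>R \<mu> x)" using f by blast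
    fix g assume g: "\<forall>U \<mu>. local_rep M E m U \<mu> \<longrightarrow> (\<forall>x\<in>U. lie_form M E X \<mu> x = g x *\<^sub>R \<mu> x)"
    show "g = f"
    proof
      fix y
      have "lie_form M E X (\<mu>' y) y = g y *\<^sub>R \<mu>' y y" using g r' by blast
      then show "g y = f y"
        using div_coeff_unique[OF local_rep_vol[OF r'(2)[of y] r'(1)[of y]] X, of "g y"] by (simp add: f_def)
    qed
  qed
  then show ?thesis using same[OF r r'(2) r'(1)] by (simp add: f_def)
qed

end

section \<open>Line bundles and their representations\<close>

text \<open>Records the rank and the open cover by frames; fibres and transition functions are
  handled by \<open>line_gen\<close>, which avoids verifying \<open>vector_bundle\<close> for
  exterior and tensor products.\<close>

definition line_bundle :: "('m::topological_space, 'v::real_vector, 'z) vbundle_scheme \<Rightarrow> bool" where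
  "line_bundle B \<longleftrightarrow> brank B = 1 \<and> (\<forall>x. \<exists>F\<in>frames B. x \<in> fst F) \<and> (\<forall>F\<in>frames B. open (fst F))"

text \<open>A local generator compared with every frame at \<open>x\<close>: smoothness of a section
  near \<open>x\<close> then amounts to smoothness of its coefficient with respect to
  \<open>g\<close>, and computations can leave the frames aside.\<close>

definition line_gen ::
  "('m::topological_space, 'b::euclidean_space) manifold \<Rightarrow> ('m, 'v::real_vector, 'z) vbundle_scheme \<Rightarrow>
   'm \<Rightarrow> ('m \<Rightarrow> 'v) \<Rightarrow> bool" where
  "line_gen M B x g \<longleftrightarrow>
     (\<forall>\<^sub>F y in nhds x. g y \<noteq> 0 \<and> fiber B y = range (\<lambda>c. c *\<^sub>R g y)) \<and>
     (\<forall>F\<in>frames B. x \<in> fst F \<longrightarrow>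
        (\<exists>r. smooth_near M x r \<and> r x \<noteq> 0 \<and> (\<forall>\<^sub>F y in nhds x. snd F 0 y = r y *\<^sub>R g y)))"

lemma line_bundle_tensor:
  assumes "line_bundle B" "line_bundle C"
  shows "line_bundle (tensor_bundle B C)"
  unfolding line_bundle_def
proof (intro conjI allI ballI)
  show "brank (tensor_bundle B C) = 1" using assms by (simp add: line_bundle_def tensor_bundle_def)
  fix x
  obtain U e where 1: "(U, e) \<in> frames B" "x \<in> U" using assms(1) unfolding line_bundle_def by force
  obtain V f where 2: "(V, f) \<in> frames C" "x \<in> V" using assms(2) unfolding line_bundle_def by force
  let ?F = "(U \<inter> V, \<lambda>i x. e (i div brank C) x \<otimes>\<^sub>t f (i mod brank C) x)"
  have "?F \<in> frames (tensor_bundle B C)" using 1 2 by (auto simp: tensor_bundle_def)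
  then show "\<exists>F\<in>frames (tensor_bundle B C). x \<in> fst F" using 1 2 by (intro bexI[of _ ?F]) simp_all
next
  fix F assume "F \<in> frames (tensor_bundle B C)"
  then obtain U e V f where "(U, e) \<in> frames B" "(V, f) \<in> frames C" "fst F = U \<inter> V"
    by (auto simp: tensor_bundle_def)
  then show "open (fst F)" using assms unfolding line_bundle_def by (metis fst_conv open_Int)
qed

context smooth_mfd
begin

lemma line_gen_tensor:
  assumes B: "line_bundle B" and C: "line_bundle C" and g: "line_gen M B x g" and h: "line_gen M C x h"
  shows "line_gen M (tensor_bundle B C) x (\<lambda>y. g y \<otimes>\<^sub>t h y)"
  unfolding line_gen_def
proof (intro conjI ballI impI)
  have "\<forall>\<^sub>F y in nhds x. g y \<noteq> 0 \<and> fiber B y = range (\<lambda>c. c *\<^sub>R g y)"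
    "\<forall>\<^sub>F y in nhds x. h y \<noteq> 0 \<and> fiber C y = range (\<lambda>c. c *\<^sub>R h y)"
    using g h by (simp_all add: line_gen_def)
  then show "\<forall>\<^sub>F y in nhds x. g y \<otimes>\<^sub>t h y \<noteq> 0 \<and>
      fiber (tensor_bundle B C) y = range (\<lambda>c. c *\<^sub>R (g y \<otimes>\<^sub>t h y))"
    by eventually_elim (simp add: tensor_nonzero tensor_bundle_def tensor_span)
next
  fix F assume F: "F \<in> frames (tensor_bundle B C)" "x \<in> fst F"
  then obtain U e V f where UV: "(U, e) \<in> frames B" "(V, f) \<in> frames C"
    and FF: "F = (U \<inter> V, \<lambda>i x. e (i div brank C) x \<otimes>\<^sub>t f (i mod brank C) x)"
    by (auto simp: tensor_bundle_def)
  have x: "x \<in> U" "x \<in> V" using F(2) FF by auto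
  obtain r where r: "smooth_near M x r" "r x \<noteq> 0" "\<forall>\<^sub>F y in nhds x. e 0 y = r y *\<^sub>R g y"
    using g UV(1) x(1) unfolding line_gen_def by fastforce
  obtain s where s: "smooth_near M x s" "s x \<noteq> 0" "\<forall>\<^sub>F y in nhds x. f 0 y = s y *\<^sub>R h y"
    using h UV(2) x(2) unfolding line_gen_def by fastforce
  have "\<forall>\<^sub>F y in nhds x. snd F 0 y = (r y * s y) *\<^sub>R (g y \<otimes>\<^sub>t h y)"
    using r(3) s(3) by eventually_elim (simp add: FF tensor_scale)
  then show "\<exists>t. smooth_near M x t \<and> t x \<noteq> 0 \<and> (\<forall>\<^sub>F y in nhds x. snd F 0 y = t y *\<^sub>R (g y \<otimes>\<^sub>t h y))"
    using r s by (intro exI[of _ "\<lambda>y. r y * s y"]) auto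
qed

lemma line_section_coeff:
  assumes B: "line_bundle B" and V: "open V" and s: "smooth_section M B V s" and x: "x \<in> V"
    and g: "line_gen M B x g"
  obtains p where "smooth_near M x p" "\<forall>\<^sub>F y in nhds x. s y = p y *\<^sub>R g y"
proof -
  obtain U e where F: "(U, e) \<in> frames B" "x \<in> U" using B unfolding line_bundle_def by force
  have oU: "open U" using B F unfolding line_bundle_def by force
  have n: "brank B = 1" using B by (simp add: line_bundle_def)
  obtain r where r: "smooth_near M x r" "\<forall>\<^sub>F y in nhds x. e 0 y = r y *\<^sub>R g y"
    using g F unfolding line_gen_def by fastforce
  have "\<exists>c. (\<forall>i<brank B. smooth_fun M (U \<inter> V) (c i)) \<and> (\<forall>x\<in>U \<inter> V. s x = (\<Sum>i<brank B. c i x *\<^sub>R e i x))"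
    using s F(1) unfolding smooth_section_def by fast
  then obtain c where c: "smooth_fun M (U \<inter> V) (c 0)" "\<And>y. y \<in> U \<inter> V \<Longrightarrow> s y = c (0::nat) y *\<^sub>R e 0 y"
    unfolding n by auto
  have "smooth_near M x (c 0)" using c(1) smooth_fun_iff[of "U \<inter> V"] oU V F(2) x by blast
  then have "smooth_near M x (\<lambda>y. c 0 y * r y)" using r(1) by (rule smooth_near_mult)
  moreover have "\<forall>\<^sub>F y in nhds x. y \<in> U \<inter> V" using oU V F(2) x by (intro eventually_nhds_in_open) auto
  then have "\<forall>\<^sub>F y in nhds x. s y = (c 0 y * r y) *\<^sub>R g y"
    using r(2) by eventually_elim (simp add: c(2))
  ultimately show thesis by (rule that)
qed

text \<open>Generator and coefficient may be chosen anew at each point, as is needed for sections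
  glued from generators with varying signs. Coefficients in a frame are chosen point by point and
  identified near \<open>x\<close> with the smooth quotient of \<open>p x\<close> by the frame
  coefficient \<open>r\<close>.\<close>

lemma line_sectionI:
  assumes B: "line_bundle B" and V: "open V" and g: "\<And>x. x \<in> V \<Longrightarrow> line_gen M B x (g x)"
    and p: "\<And>x. x \<in> V \<Longrightarrow> smooth_near M x (p x)"
    and s: "\<And>x. x \<in> V \<Longrightarrow> \<forall>\<^sub>F y in nhds x. s y = p x y *\<^sub>R g x y"
  shows "smooth_section M B V s"
  unfolding smooth_section_def
proof (intro conjI ballI, goal_cases)
  case (1 x)
  have "\<forall>\<^sub>F y in nhds x. g x y \<noteq> 0 \<and> fiber B y = range (\<lambda>c. c *\<^sub>R g x y)"
    using g[OF 1] by (simp add: line_gen_def)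
  from eventually_nhds_x_imp_x[OF this] eventually_nhds_x_imp_x[OF s[OF 1]] show ?case by simp
next
  case (2 F)
  obtain U e where F: "F = (U, e)" "(U, e) \<in> frames B" using 2 by (cases F) auto
  have oU: "open U" using B F unfolding line_bundle_def by force
  have n: "brank B = 1" using B by (simp add: line_bundle_def)
  have oUV: "open (U \<inter> V)" using oU V by blast
  define c where "c y = (SOME c. s y = c *\<^sub>R e 0 y)" for y
  have key: "smooth_near M x c \<and> s x = c x *\<^sub>R e 0 x" if x: "x \<in> U \<inter> V" for x
  proof -
    obtain r where r: "smooth_near M x r" "r x \<noteq> 0" "\<forall>\<^sub>F y in nhds x. e 0 y = r y *\<^sub>R g x y"
      using g[of x] F(2) x unfolding line_gen_def by fastforce
    have gn: "\<forall>\<^sub>F y in nhds x. g x y \<noteq> 0 \<and> fiber B y = range (\<lambda>c. c *\<^sub>R g x y)"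
      using g[of x] x by (simp add: line_gen_def)
    have sx: "\<forall>\<^sub>F y in nhds x. s y = p x y *\<^sub>R g x y" "smooth_near M x (p x)" using s p x by blast+
    have ev: "\<forall>\<^sub>F y in nhds x. p x y / r y = c y \<and> s y = c y *\<^sub>R e 0 y"
      using r(3) gn sx(1) smooth_near_eventually_nonzero[OF r(1,2)]
    proof eventually_elim
      case (elim y)
      have *: "s y = (p x y / r y) *\<^sub>R e 0 y" using elim by simp
      then have "s y = c y *\<^sub>R e 0 y" unfolding c_def by (rule someI)
      moreover have "e 0 y \<noteq> 0" using elim by simp
      ultimately show ?case using * by simp
    qed
    from ev have "\<forall>\<^sub>F y in nhds x. p x y / r y = c y" by eventually_elim simp
    with smooth_near_divide[OF sx(2) r(1,2)] have "smooth_near M x c" by (rule smooth_near_transform)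
    then show ?thesis using eventually_nhds_x_imp_x[OF ev] by simp
  qed
  then have "smooth_fun M (U \<inter> V) c" using smooth_fun_iff[OF oUV] by blast
  then show ?case unfolding F(1) prod.case n using key by (intro exI[of _ "\<lambda>i. c"]) simp
qed

end

section \<open>Generators of the bundles of top multivectors and top forms\<close>

context vbun
begin

abbreviation dual_sec :: "('m \<Rightarrow> 'v list \<Rightarrow> real) \<Rightarrow> 'm \<Rightarrow> ('v list \<Rightarrow> real) \<Rightarrow> real" where
  "dual_sec \<mu> y \<equiv> dual_vec (fiber E y) rk (\<mu> y)"

context
  fixes y \<mu>
  assumes m: "vol_near y \<mu>"
begin

lemma vol_near_alt: "\<mu> y \<in> alt_forms (fiber E y) rk" "\<mu> y \<noteq> 0"
  using m form_near_alt_at by (auto simp: vol_near_def)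

lemma wedge_dual_sec: "length ws = rk \<Longrightarrow> set ws \<subseteq> fiber E y \<Longrightarrow> wedge ws = \<mu> y ws *\<^sub>R dual_sec \<mu> y"
  using fiber_basis_exists[of y] wedge_dual_vec[OF _ vol_near_alt] by blast

lemma dual_sec_nonzero: "dual_sec \<mu> y \<noteq> 0"
  using fiber_basis_exists[of y] dual_vec_nonzero[OF _ vol_near_alt] by blast

lemma dual_sec_span:
  "span {wedge vs | vs. length vs = rk \<and> set vs \<subseteq> fiber E y} = range (\<lambda>c. c *\<^sub>R dual_sec \<mu> y)"
  using fiber_basis_exists[of y] dual_vec_span[OF _ vol_near_alt] by blast

lemma top_forms_range: "alt_forms (fiber E y) rk = range (\<lambda>c. c *\<^sub>R \<mu> y)"
proof
  show "range (\<lambda>c. c *\<^sub>R \<mu> y) \<subseteq> alt_forms (fiber E y) rk" using vol_near_alt(1) alt_forms_scaleR by blast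
  show "alt_forms (fiber E y) rk \<subseteq> range (\<lambda>c. c *\<^sub>R \<mu> y)"
  proof
    fix \<omega> assume w: "\<omega> \<in> alt_forms (fiber E y) rk"
    obtain b where b: "basis_of (fiber E y) rk b" using fiber_basis_exists by blast
    let ?b = "map b [0..<rk]"
    have "\<mu> y ?b \<noteq> 0" using alt_forms_top_eq_0[OF b vol_near_alt(1)] vol_near_alt(2) by blast
    moreover have "inverse (\<mu> y ?b) *\<^sub>R (\<mu> y ?b *\<^sub>R \<omega>) = inverse (\<mu> y ?b) *\<^sub>R (\<omega> ?b *\<^sub>R \<mu> y)"
      using alt_forms_top_eq[OF b w vol_near_alt(1)] by simp
    ultimately have "\<omega> = (inverse (\<mu> y ?b) * \<omega> ?b) *\<^sub>R \<mu> y" by simp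
    then show "\<omega> \<in> range (\<lambda>c. c *\<^sub>R \<mu> y)" by blast
  qed
qed

end

lemma line_bundle_multi: "line_bundle (top_multivector_bundle E)"
  unfolding line_bundle_def
proof (intro conjI allI ballI)
  show "brank (top_multivector_bundle E) = 1" by (simp add: top_multivector_bundle_def)
  fix x
  obtain U e where F: "(U, e) \<in> frames E" "x \<in> U" using frame_cover .
  then show "\<exists>F\<in>frames (top_multivector_bundle E). x \<in> fst F"
    by (intro bexI[of _ "(U, \<lambda>_ x. wedge (map (\<lambda>i. e i x) [0..<rk]))"])
      (auto simp: top_multivector_bundle_def)
next
  fix F assume "F \<in> frames (top_multivector_bundle E)"
  then show "open (fst F)" using frame_open by (auto simp: top_multivector_bundle_def)
qed

lemma line_gen_multi:
  assumes m: "vol_near x \<mu>"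
  shows "line_gen M (top_multivector_bundle E) x (dual_sec \<mu>)"
  unfolding line_gen_def
proof (intro conjI ballI impI)
  show "\<forall>\<^sub>F y in nhds x. dual_sec \<mu> y \<noteq> 0 \<and>
      fiber (top_multivector_bundle E) y = range (\<lambda>c. c *\<^sub>R dual_sec \<mu> y)"
    using vol_near_eventually[OF m]
    by eventually_elim (simp add: dual_sec_nonzero top_multivector_bundle_def dual_sec_span)
  fix F assume F: "F \<in> frames (top_multivector_bundle E)" "x \<in> fst F"
  then obtain U e where UF: "(U, e) \<in> frames E" "x \<in> U"
    and FF: "F = (U, \<lambda>_ x. wedge (map (\<lambda>i. e i x) [0..<rk]))"
    by (auto simp: top_multivector_bundle_def)
  \<comment> \<open>By duality the wedge of a frame is the value of \<open>\<mu>\<close> on it times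
    the dual section.\<close>
  let ?r = "\<lambda>y. \<mu> y (map (\<lambda>i. e i y) [0..<rk])"
  have "\<forall>\<^sub>F y in nhds x. snd F 0 y = ?r y *\<^sub>R dual_sec \<mu> y"
    using vol_near_eventually[OF m] frame_eventually[OF UF]
  proof eventually_elim
    case (elim y)
    show ?case
      unfolding FF snd_conv by (rule wedge_dual_sec[OF elim(1)])
        (use basis_of_in[OF frame_basis[OF UF(1) elim(2)]] in auto)
  qed
  then show "\<exists>r. smooth_near M x r \<and> r x \<noteq> 0 \<and> (\<forall>\<^sub>F y in nhds x. snd F 0 y = r y *\<^sub>R dual_sec \<mu> y)"
    using frame_form_smooth[OF UF vol_near_form[OF m]] vol_near_frame[OF UF m]
    by (intro exI[of _ ?r]) simp
qed

lemma line_bundle_form: "line_bundle (top_form_bundle E)"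
  unfolding line_bundle_def
proof (intro conjI allI ballI)
  show "brank (top_form_bundle E) = 1" by (simp add: top_form_bundle_def)
  fix x
  obtain U e where F: "(U, e) \<in> frames E" "x \<in> U" using frame_cover .
  obtain \<mu> where \<mu>: "\<forall>x\<in>U. vol_near x \<mu> \<and> \<mu> x (map (\<lambda>i. e i x) [0..<rk]) = 1" using frame_vol[OF F(1)] .
  have "(U, \<lambda>_. \<mu>) \<in> frames (top_form_bundle E)"
    unfolding top_form_bundle_def vbundle.select_convs
    using F(1) \<mu> vol_near_alt(1)
    by (intro CollectI exI[of _ U] exI[of _ \<mu>] conjI refl exI[of _ e] ballI) auto
  then show "\<exists>F\<in>frames (top_form_bundle E). x \<in> fst F"
    using F(2) by (intro bexI[of _ "(U, \<lambda>_. \<mu>)"]) simp_all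
next
  fix F assume "F \<in> frames (top_form_bundle E)"
  then show "open (fst F)" using frame_open by (auto simp: top_form_bundle_def)
qed

lemma line_gen_form:
  assumes m: "vol_near x \<mu>"
  shows "line_gen M (top_form_bundle E) x \<mu>"
  unfolding line_gen_def
proof (intro conjI ballI impI)
  show "\<forall>\<^sub>F y in nhds x. \<mu> y \<noteq> 0 \<and> fiber (top_form_bundle E) y = range (\<lambda>c. c *\<^sub>R \<mu> y)"
    using vol_near_eventually[OF m]
    by eventually_elim (simp add: vol_near_alt(2) top_form_bundle_def top_forms_range)
  fix F assume F: "F \<in> frames (top_form_bundle E)" "x \<in> fst F"
  then obtain U e \<nu> where UF: "(U, e) \<in> frames E" "x \<in> U" and FF: "F = (U, \<lambda>_. \<nu>)"
    and \<nu>: "\<And>y. y \<in> U \<Longrightarrow> \<nu> y \<in> alt_forms (fiber E y) rk"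
    "\<And>y. y \<in> U \<Longrightarrow> \<nu> y (map (\<lambda>i. e i y) [0..<rk]) = 1"
    by (auto simp: top_form_bundle_def)
  \<comment> \<open>A frame of the bundle of top forms takes the value 1 on the frame
    \<open>e\<close>, so its coefficient with respect to \<open>\<mu>\<close> is the inverse of the
    value of \<open>\<mu>\<close>.\<close>
  let ?r = "\<lambda>y. inverse (\<mu> y (map (\<lambda>i. e i y) [0..<rk]))"
  have "\<forall>\<^sub>F y in nhds x. snd F 0 y = ?r y *\<^sub>R \<mu> y"
    using vol_near_eventually[OF m] frame_eventually[OF UF]
  proof eventually_elim
    case (elim y)
    have "\<mu> y (map (\<lambda>i. e i y) [0..<rk]) *\<^sub>R \<nu> y = 1 *\<^sub>R \<mu> y"
      using alt_forms_top_eq[OF frame_basis[OF UF(1) elim(2)] \<nu>(1)[OF elim(2)] vol_near_alt(1)[OF elim(1)]]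
        \<nu>(2)[OF elim(2)] by simp
    then have "?r y *\<^sub>R (\<mu> y (map (\<lambda>i. e i y) [0..<rk]) *\<^sub>R \<nu> y) = ?r y *\<^sub>R \<mu> y" by simp
    then show ?case using vol_near_frame[OF UF(1) elim(2,1)] by (simp add: FF)
  qed
  then show "\<exists>r. smooth_near M x r \<and> r x \<noteq> 0 \<and> (\<forall>\<^sub>F y in nhds x. snd F 0 y = r y *\<^sub>R \<mu> y)"
    using smooth_near_inverse[OF frame_form_smooth[OF UF vol_near_form[OF m]] vol_near_frame[OF UF m]]
      vol_near_frame[OF UF m] by (intro exI[of _ ?r]) simp
qed

end

section \<open>The representation on the Evens-Lu-Weinstein bundle\<close>

context algd
begin

abbreviation elw_gen :: "('m \<Rightarrow> 'v list \<Rightarrow> real) \<Rightarrow> ('m \<Rightarrow> 'm tvec list \<Rightarrow> real) \<Rightarrow> 'm \<Rightarrow> ('m, 'v) elw_fib" where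
  "elw_gen \<mu> \<nu> y \<equiv> dual_sec \<mu> y \<otimes>\<^sub>t \<nu> y"

abbreviation "anchor_sec X \<equiv> (\<lambda>y. anchor E y (X y))"

definition elw_coeff :: "('m \<Rightarrow> 'v list \<Rightarrow> real) \<Rightarrow> ('m \<Rightarrow> 'm tvec list \<Rightarrow> real) \<Rightarrow> ('m \<Rightarrow> 'v) \<Rightarrow> 'm \<Rightarrow> real" where
  "elw_coeff \<mu> \<nu> X y =
    div_coeff M (tangent_algebroid M) \<nu> (anchor_sec X) y - div_coeff M E \<mu> X y"

lemma elw_line_bundle: "line_bundle (elw_bundle M E)"
  unfolding elw_bundle_def by (intro line_bundle_tensor line_bundle_multi TM.line_bundle_form)

lemma elw_line_gen:
  "vol_near x \<mu> \<Longrightarrow> TM.vol_near x \<nu> \<Longrightarrow> line_gen M (elw_bundle M E) x (elw_gen \<mu> \<nu>)"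
  unfolding elw_bundle_def
  by (intro line_gen_tensor line_bundle_multi TM.line_bundle_form line_gen_multi TM.line_gen_form)

lemma elw_gen_nonzero: "vol_near x \<mu> \<Longrightarrow> TM.vol_near x \<nu> \<Longrightarrow> elw_gen \<mu> \<nu> x \<noteq> 0"
  by (intro tensor_nonzero dual_sec_nonzero TM.vol_near_alt(2))

text \<open>Pairing with \<open>\<mu>\<close> replaces each term by the function
  \<open>f y * \<mu> y (eval_at y Ys)\<close>, whose derivative is given by
  \<open>div_formula\<close>. The result depends on the list \<open>T\<close> only through the sum
  \<open>h\<close>, which is what makes \<open>lie_multi\<close> well defined.\<close>

lemma lie_multi_terms:
  assumes m: "vol_near x \<mu>" and X: "X \<in> Sec M E"
    and T: "\<And>f Ys. (f, Ys) \<in> set T \<Longrightarrow> smooth_near M x f \<and> length Ys = rk \<and> set Ys \<subseteq> Sec M E"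
  defines "h \<equiv> \<lambda>y. \<Sum>(f, Ys)\<leftarrow>T. f y * \<mu> y (eval_at y Ys)"
  shows "smooth_near M x h"
    and "(\<Sum>(f, Ys)\<leftarrow>T. anchor E x (X x) f *\<^sub>R wedge (eval_at x Ys) +
            f x *\<^sub>R (\<Sum>i<rk. wedge (eval_at x (Ys[i := bracket E X (Ys ! i)])))) =
      (anchor E x (X x) h - h x * div_coeff M E \<mu> X x) *\<^sub>R dual_sec \<mu> x"
proof -
  have v: "anchor E x (X x) \<in> tangent_space M x" by (rule Sec_tangent[OF X])
  have "smooth_near M x (\<lambda>y. \<Sum>(f, Ys)\<leftarrow>T. f y * \<mu> y (eval_at y Ys)) \<and>
    (\<Sum>(f, Ys)\<leftarrow>T. anchor E x (X x) f *\<^sub>R wedge (eval_at x Ys) +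
            f x *\<^sub>R (\<Sum>i<rk. wedge (eval_at x (Ys[i := bracket E X (Ys ! i)])))) =
      (anchor E x (X x) (\<lambda>y. \<Sum>(f, Ys)\<leftarrow>T. f y * \<mu> y (eval_at y Ys)) -
        (\<Sum>(f, Ys)\<leftarrow>T. f x * \<mu> x (eval_at x Ys)) * div_coeff M E \<mu> X x) *\<^sub>R dual_sec \<mu> x"
    using T
  proof (induction T)
    case Nil
    then show ?case by (simp add: tangent_const[OF v])
  next
    case (Cons t T)
    obtain f Ys where t: "t = (f, Ys)" by (cases t)
    have f: "smooth_near M x f" and Ys: "length Ys = rk" "set Ys \<subseteq> Sec M E"
      using Cons.prems[of f Ys] t by auto
    let ?h = "\<lambda>y. \<Sum>(f, Ys)\<leftarrow>T. f y * \<mu> y (eval_at y Ys)"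
    have P: "smooth_near M x f \<and> length Ys = rk \<and> set Ys \<subseteq> Sec M E" if "(f, Ys) \<in> set T" for f Ys
      by (rule Cons.prems) (use that in simp)
    have IH: "smooth_near M x ?h" using Cons.IH[OF P] by blast
    have IH2: "(\<Sum>(f, Ys)\<leftarrow>T. anchor E x (X x) f *\<^sub>R wedge (eval_at x Ys) +
            f x *\<^sub>R (\<Sum>i<rk. wedge (eval_at x (Ys[i := bracket E X (Ys ! i)])))) =
        (anchor E x (X x) ?h - ?h x * div_coeff M E \<mu> X x) *\<^sub>R dual_sec \<mu> x"
      using Cons.IH[OF P] by blast
    have mY: "smooth_near M x (\<lambda>y. \<mu> y (eval_at y Ys))"
      by (rule form_near_eval_Sec[OF vol_near_form[OF m] Ys(2)])
    have fm: "smooth_near M x (\<lambda>y. f y * \<mu> y (eval_at y Ys))" using f mY by (rule smooth_near_mult)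
    have w: "wedge (eval_at x Ys) = \<mu> x (eval_at x Ys) *\<^sub>R dual_sec \<mu> x"
      using eval_at_fiber[OF Ys(2)] Ys(1) by (intro wedge_dual_sec[OF m]) simp_all
    have "wedge (eval_at x (Ys[i := bracket E X (Ys ! i)])) =
        \<mu> x (eval_at x (Ys[i := bracket E X (Ys ! i)])) *\<^sub>R dual_sec \<mu> x" if "i < rk" for i
    proof (rule wedge_dual_sec[OF m])
      have "Ys ! i \<in> set Ys" using that Ys(1) by simp
      then have "bracket E X (Ys ! i) \<in> Sec M E" using bracket_Sec[OF X] Ys(2) by blast
      then have "set (Ys[i := bracket E X (Ys ! i)]) \<subseteq> Sec M E"
        using Ys(2) set_update_subset_insert[of Ys i] by blast
      then show "set (eval_at x (Ys[i := bracket E X (Ys ! i)])) \<subseteq> fiber E x" by (rule eval_at_fiber)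
    qed (use Ys(1) in simp)
    then have "(\<Sum>i<rk. wedge (eval_at x (Ys[i := bracket E X (Ys ! i)]))) =
        (\<Sum>i<rk. \<mu> x (eval_at x (Ys[i := bracket E X (Ys ! i)]))) *\<^sub>R dual_sec \<mu> x"
      by (simp add: scaleR_sum_left)
    also have "(\<Sum>i<rk. \<mu> x (eval_at x (Ys[i := bracket E X (Ys ! i)]))) =
        anchor E x (X x) (\<lambda>y. \<mu> y (eval_at y Ys)) - div_coeff M E \<mu> X x * \<mu> x (eval_at x Ys)"
      using div_formula[OF m X Ys(2)] Ys(1) by simp
    finally have s: "(\<Sum>i<rk. wedge (eval_at x (Ys[i := bracket E X (Ys ! i)]))) =
        (anchor E x (X x) (\<lambda>y. \<mu> y (eval_at y Ys)) - div_coeff M E \<mu> X x * \<mu> x (eval_at x Ys)) *\<^sub>R dual_sec \<mu> x" .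
    have "anchor E x (X x) (\<lambda>y. f y * \<mu> y (eval_at y Ys) + ?h y) =
        f x * anchor E x (X x) (\<lambda>y. \<mu> y (eval_at y Ys)) + \<mu> x (eval_at x Ys) * anchor E x (X x) f +
        anchor E x (X x) ?h"
      using tangent_add[OF v fm IH] tangent_mult[OF v f mY] by simp
    then have l: "anchor E x (X x) f * \<mu> x (eval_at x Ys) +
        f x * (anchor E x (X x) (\<lambda>y. \<mu> y (eval_at y Ys)) - div_coeff M E \<mu> X x * \<mu> x (eval_at x Ys)) +
        (anchor E x (X x) ?h - ?h x * div_coeff M E \<mu> X x) =
        anchor E x (X x) (\<lambda>y. f y * \<mu> y (eval_at y Ys) + ?h y) -
        (f x * \<mu> x (eval_at x Ys) + ?h x) * div_coeff M E \<mu> X x"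
      by (simp add: algebra_simps)
    show ?case
      unfolding t list.map sum_list.Cons prod.case IH2 w s scaleR_scaleR
        scaleR_add_left[symmetric] l
      using smooth_near_add[OF fm IH] by simp
  qed
  then show "smooth_near M x h"
    and "(\<Sum>(f, Ys)\<leftarrow>T. anchor E x (X x) f *\<^sub>R wedge (eval_at x Ys) +
            f x *\<^sub>R (\<Sum>i<rk. wedge (eval_at x (Ys[i := bracket E X (Ys ! i)])))) =
      (anchor E x (X x) h - h x * div_coeff M E \<mu> X x) *\<^sub>R dual_sec \<mu> x"
    unfolding h_def by simp_all
qed

text \<open>Two decompositions of the same \<open>a\<close> have the same coefficient with respect
  to \<open>dual_sec \<mu>\<close> near \<open>x\<close>, so \<open>lie_multi_terms\<close> gives
  them the same value. A decomposition exists: a multiple of the wedge of an extended frame.\<close>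

lemma lie_multi_dual:
  assumes m: "vol_near x \<mu>" and X: "X \<in> Sec M E" and h: "smooth_near M x h"
    and a: "\<forall>\<^sub>F y in nhds x. a y = h y *\<^sub>R dual_sec \<mu> y"
  shows "lie_multi M E rk X a x = (anchor E x (X x) h - h x * div_coeff M E \<mu> X x) *\<^sub>R dual_sec \<mu> x"
proof -
  define terms where "terms T = (\<Sum>(f, Ys)\<leftarrow>T. anchor E x (X x) f *\<^sub>R wedge (eval_at x Ys) +
    f x *\<^sub>R (\<Sum>i<rk. wedge (eval_at x (Ys[i := bracket E X (Ys ! i)]))))" for T
  have key: "terms T = (anchor E x (X x) h - h x * div_coeff M E \<mu> X x) *\<^sub>R dual_sec \<mu> x"
    if V: "open V" "x \<in> V" and T: "\<forall>(f, Ys)\<in>set T. smooth_fun M V f \<and> length Ys = rk \<and> set Ys \<subseteq> Sec M E"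
      and aV: "\<forall>y\<in>V. a y = (\<Sum>(f, Ys)\<leftarrow>T. f y *\<^sub>R wedge (eval_at y Ys))" for V T
  proof -
    let ?h = "\<lambda>y. \<Sum>(f, Ys)\<leftarrow>T. f y * \<mu> y (eval_at y Ys)"
    have T': "smooth_near M x f \<and> length Ys = rk \<and> set Ys \<subseteq> Sec M E" if "(f, Ys) \<in> set T" for f Ys
      using T that smooth_fun_iff[OF V(1)] V(2) by fastforce
    have "\<forall>\<^sub>F y in nhds x. y \<in> V" using V by (intro eventually_nhds_in_open)
    then have "\<forall>\<^sub>F y in nhds x. ?h y = h y"
      using a vol_near_eventually[OF m]
    proof eventually_elim
      case (elim y)
      have "(\<Sum>(f, Ys)\<leftarrow>T. f y *\<^sub>R wedge (eval_at y Ys)) = ?h y *\<^sub>R dual_sec \<mu> y"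
        using T'
      proof (induction T)
        case (Cons t T)
        obtain f Ys where t: "t = (f, Ys)" by (cases t)
        have Ys: "length Ys = rk" "set Ys \<subseteq> Sec M E" using Cons.prems[of f Ys] t by auto
        have P: "smooth_near M x f \<and> length Ys = rk \<and> set Ys \<subseteq> Sec M E" if "(f, Ys) \<in> set T" for f Ys
          by (rule Cons.prems) (use that in simp)
        have w: "wedge (eval_at y Ys) = \<mu> y (eval_at y Ys) *\<^sub>R dual_sec \<mu> y"
          using eval_at_fiber[OF Ys(2)] Ys(1) by (intro wedge_dual_sec[OF elim(3)]) simp_all
        have IH: "(\<Sum>(f, Ys)\<leftarrow>T. f y *\<^sub>R wedge (eval_at y Ys)) =
            (\<Sum>(f, Ys)\<leftarrow>T. f y * \<mu> y (eval_at y Ys)) *\<^sub>R dual_sec \<mu> y"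
          by (rule Cons.IH, rule P)
        show ?case
          unfolding t list.map sum_list.Cons prod.case w IH scaleR_scaleR scaleR_add_left ..
      qed simp
      moreover have "h y *\<^sub>R dual_sec \<mu> y = (\<Sum>(f, Ys)\<leftarrow>T. f y *\<^sub>R wedge (eval_at y Ys))"
        using aV elim(1,2) by metis
      ultimately have "?h y *\<^sub>R dual_sec \<mu> y = h y *\<^sub>R dual_sec \<mu> y" by (simp only:)
      then show ?case by (rule scaleR_right_imp_eq[OF dual_sec_nonzero[OF elim(3)]])
    qed
    note eq = this
    have "anchor E x (X x) ?h = anchor E x (X x) h" by (rule tangent_cong[OF Sec_tangent[OF X] eq])
    moreover have "?h x = h x" using eventually_nhds_x_imp_x[OF eq] .
    ultimately show ?thesis using lie_multi_terms(2)[OF m X T'] by (simp add: terms_def)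
  qed
  obtain U e where F: "(U, e) \<in> frames E" "x \<in> U" using frame_cover .
  obtain Y where Y: "\<forall>i<rk. Y i \<in> Sec M E" "\<forall>\<^sub>F y in nhds x. \<forall>i<rk. Y i y = e i y"
    using frame_extend[OF F] .
  let ?Z = "map Y [0..<rk]"
  \<comment> \<open>Divides by the value of \<open>\<mu>\<close> on the frame, since the wedge of
    the frame is that value times \<open>dual_sec \<mu>\<close>.\<close>
  let ?c = "\<lambda>y. h y / \<mu> y (map (\<lambda>i. e i y) [0..<rk])"
  have Z: "set ?Z \<subseteq> Sec M E" using Y(1) by auto
  have c: "smooth_near M x ?c"
    by (intro smooth_near_divide h frame_form_smooth[OF F vol_near_form[OF m]] vol_near_frame[OF F m])
  have "\<forall>\<^sub>F y in nhds x. smooth_near M y ?c \<and> a y = ?c y *\<^sub>R wedge (eval_at y ?Z)"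
    using smooth_near_eventually[OF c] a Y(2) vol_near_eventually[OF m] frame_eventually[OF F]
  proof eventually_elim
    case (elim y)
    have e: "eval_at y ?Z = map (\<lambda>i. e i y) [0..<rk]" using elim(3) by simp
    have "wedge (eval_at y ?Z) = \<mu> y (eval_at y ?Z) *\<^sub>R dual_sec \<mu> y"
      using eval_at_fiber[OF Z] by (intro wedge_dual_sec[OF elim(4)]) simp_all
    then show ?case unfolding e using elim(1,2) vol_near_frame[OF F(1) elim(5,4)] by simp
  qed
  then obtain V where V: "open V" "x \<in> V" "\<And>y. y \<in> V \<Longrightarrow> smooth_near M y ?c"
    "\<And>y. y \<in> V \<Longrightarrow> a y = ?c y *\<^sub>R wedge (eval_at y ?Z)"
    unfolding eventually_nhds by blast
  have T: "\<forall>(f, Ys)\<in>set [(?c, ?Z)]. smooth_fun M V f \<and> length Ys = rk \<and> set Ys \<subseteq> Sec M E"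
    using V(3) smooth_fun_iff[OF V(1)] Z by simp
  have aV: "\<forall>y\<in>V. a y = (\<Sum>(f, Ys)\<leftarrow>[(?c, ?Z)]. f y *\<^sub>R wedge (eval_at y Ys))"
    using V(4) by simp
  show ?thesis
    unfolding lie_multi_def terms_def[symmetric]
  proof (rule the_equality)
    show "\<exists>V T. open V \<and> x \<in> V \<and> (\<forall>(f, Ys)\<in>set T. smooth_fun M V f \<and> length Ys = rk \<and> set Ys \<subseteq> Sec M E) \<and>
      (\<forall>y\<in>V. a y = (\<Sum>(f, Ys)\<leftarrow>T. f y *\<^sub>R wedge (eval_at y Ys))) \<and>
      (anchor E x (X x) h - h x * div_coeff M E \<mu> X x) *\<^sub>R dual_sec \<mu> x = terms T"
      using V(1,2) T aV key[OF V(1,2) T aV] by (intro exI[of _ V] exI[of _ "[(?c, ?Z)]"]) simp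
    fix w assume "\<exists>V T. open V \<and> x \<in> V \<and> (\<forall>(f, Ys)\<in>set T. smooth_fun M V f \<and> length Ys = rk \<and> set Ys \<subseteq> Sec M E) \<and>
      (\<forall>y\<in>V. a y = (\<Sum>(f, Ys)\<leftarrow>T. f y *\<^sub>R wedge (eval_at y Ys))) \<and> w = terms T"
    then obtain V T where "open V" "x \<in> V" "\<forall>(f, Ys)\<in>set T. smooth_fun M V f \<and> length Ys = rk \<and> set Ys \<subseteq> Sec M E"
      "\<forall>y\<in>V. a y = (\<Sum>(f, Ys)\<leftarrow>T. f y *\<^sub>R wedge (eval_at y Ys))" "w = terms T" by blast
    then show "w = (anchor E x (X x) h - h x * div_coeff M E \<mu> X x) *\<^sub>R dual_sec \<mu> x" using key by simp
  qed
qed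

lemma anchor_TM [simp]: "anchor (tangent_algebroid M) x v = v"
  by (simp add: tangent_algebroid_def)

text \<open>A factorization of \<open>s\<close> into \<open>a\<close> and \<open>\<eta>\<close> with
  coefficients \<open>h\<close> and \<open>k\<close> has \<open>q = h * k\<close> near
  \<open>x\<close>. The Leibniz rule assembles the derivatives of \<open>h\<close> and
  \<open>k\<close> into that of \<open>q\<close>, so the value does not depend on the
  factorization.\<close>

lemma elw_rep_gen:
  assumes m: "vol_near x \<mu>" and n: "TM.vol_near x \<nu>" and X: "X \<in> Sec M E" and q: "smooth_near M x q"
    and s: "\<forall>\<^sub>F y in nhds x. s y = q y *\<^sub>R elw_gen \<mu> \<nu> y"
  shows "elw_rep M E X s x = (anchor E x (X x) q + q x * elw_coeff \<mu> \<nu> X x) *\<^sub>R elw_gen \<mu> \<nu> x"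
proof -
  let ?TM = "tangent_algebroid M"
  let ?d1 = "div_coeff M E \<mu> X x" and ?d2 = "div_coeff M ?TM \<nu> (anchor_sec X) x"
  have v: "anchor E x (X x) \<in> tangent_space M x" by (rule Sec_tangent[OF X])
  note aX = anchor_Sec[OF X]
  define val where "val a \<eta> = lie_multi M E rk X a x \<otimes>\<^sub>t \<eta> x + a x \<otimes>\<^sub>t lie_form M ?TM (anchor_sec X) \<eta> x" for a \<eta>
  have key: "val a \<eta> = (anchor E x (X x) q + q x * elw_coeff \<mu> \<nu> X x) *\<^sub>R elw_gen \<mu> \<nu> x"
    if V: "open V" "x \<in> V" and a: "smooth_section M (top_multivector_bundle E) V a"
      and e: "smooth_section M (top_form_bundle ?TM) V \<eta>" and sV: "\<forall>y\<in>V. s y = a y \<otimes>\<^sub>t \<eta> y" for V a \<eta>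
  proof -
    obtain h where h: "smooth_near M x h" "\<forall>\<^sub>F y in nhds x. a y = h y *\<^sub>R dual_sec \<mu> y"
      by (rule line_section_coeff[OF line_bundle_multi V(1) a V(2) line_gen_multi[OF m]])
    obtain k where k: "smooth_near M x k" "\<forall>\<^sub>F y in nhds x. \<eta> y = k y *\<^sub>R \<nu> y"
      by (rule line_section_coeff[OF TM.line_bundle_form V(1) e V(2) TM.line_gen_form[OF n]])
    have "\<forall>\<^sub>F y in nhds x. y \<in> V" using V by (intro eventually_nhds_in_open)
    then have ev: "\<forall>\<^sub>F y in nhds x. q y = h y * k y"
      using h(2) k(2) s vol_near_eventually[OF m] TM.vol_near_eventually[OF n]
    proof eventually_elim
      case (elim y)
      have "q y *\<^sub>R elw_gen \<mu> \<nu> y = a y \<otimes>\<^sub>t \<eta> y" using sV elim(1,4) by metis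
      also have "\<dots> = (h y * k y) *\<^sub>R elw_gen \<mu> \<nu> y" unfolding elim(2,3) by (rule tensor_scale)
      finally show ?case by (rule scaleR_right_imp_eq[OF elw_gen_nonzero[OF elim(5,6)]])
    qed
    have ax: "a x = h x *\<^sub>R dual_sec \<mu> x" and ex: "\<eta> x = k x *\<^sub>R \<nu> x" and qx: "q x = h x * k x"
      using eventually_nhds_x_imp_x[OF h(2)] eventually_nhds_x_imp_x[OF k(2)] eventually_nhds_x_imp_x[OF ev] .
    have lq: "anchor E x (X x) q = h x * anchor E x (X x) k + k x * anchor E x (X x) h"
      using tangent_cong[OF v ev] tangent_mult[OF v h(1) k(1)] by simp
    have l1: "lie_multi M E rk X a x = (anchor E x (X x) h - h x * ?d1) *\<^sub>R dual_sec \<mu> x"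
      by (rule lie_multi_dual[OF m X h])
    have l2: "lie_form M ?TM (anchor_sec X) \<eta> x = (anchor E x (X x) k + k x * ?d2) *\<^sub>R \<nu> x"
      using TM.lie_form_top[OF n aX k] by simp
    show ?thesis
      unfolding val_def l1 l2 ax ex tensor_scale scaleR_add_left[symmetric]
      by (rule arg_cong[where f = "\<lambda>c. c *\<^sub>R elw_gen \<mu> \<nu> x"]) (simp add: lq qx elw_coeff_def algebra_simps)
  qed
  have "\<forall>\<^sub>F y in nhds x. s y = q y *\<^sub>R elw_gen \<mu> \<nu> y \<and> smooth_near M y q \<and> vol_near y \<mu> \<and> TM.vol_near y \<nu>"
    using s smooth_near_eventually[OF q] vol_near_eventually[OF m] TM.vol_near_eventually[OF n]
    by eventually_elim simp
  then obtain V where V: "open V" "x \<in> V" "\<And>y. y \<in> V \<Longrightarrow> s y = q y *\<^sub>R elw_gen \<mu> \<nu> y"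
    "\<And>y. y \<in> V \<Longrightarrow> smooth_near M y q" "\<And>y. y \<in> V \<Longrightarrow> vol_near y \<mu>" "\<And>y. y \<in> V \<Longrightarrow> TM.vol_near y \<nu>"
    unfolding eventually_nhds by blast
  let ?a = "\<lambda>y. q y *\<^sub>R dual_sec \<mu> y"
  have a: "smooth_section M (top_multivector_bundle E) V ?a"
    by (rule line_sectionI[OF line_bundle_multi V(1), where g = "\<lambda>_. dual_sec \<mu>" and p = "\<lambda>_. q"])
      (simp_all add: line_gen_multi V)
  have e: "smooth_section M (top_form_bundle ?TM) V \<nu>"
    by (rule line_sectionI[OF TM.line_bundle_form V(1), where g = "\<lambda>_. \<nu>" and p = "\<lambda>_ _. 1"])
      (simp_all add: TM.line_gen_form V smooth_near_const)
  have sV: "\<forall>y\<in>V. s y = ?a y \<otimes>\<^sub>t \<nu> y"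
  proof
    fix y assume "y \<in> V"
    then show "s y = ?a y \<otimes>\<^sub>t \<nu> y" using V(3) tensor_scale[of "q y" "dual_sec \<mu> y" 1 "\<nu> y"] by simp
  qed
  show ?thesis
    unfolding elw_rep_def val_def[symmetric]
  proof (rule the_equality)
    show "\<exists>V a \<eta>. open V \<and> x \<in> V \<and> smooth_section M (top_multivector_bundle E) V a \<and>
      smooth_section M (top_form_bundle ?TM) V \<eta> \<and> (\<forall>y\<in>V. s y = a y \<otimes>\<^sub>t \<eta> y) \<and>
      (anchor E x (X x) q + q x * elw_coeff \<mu> \<nu> X x) *\<^sub>R elw_gen \<mu> \<nu> x = val a \<eta>"
      using V(1,2) a e sV key[OF V(1,2) a e sV] by (intro exI[of _ V] exI[of _ ?a] exI[of _ \<nu>]) simp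
    fix w assume "\<exists>V a \<eta>. open V \<and> x \<in> V \<and> smooth_section M (top_multivector_bundle E) V a \<and>
      smooth_section M (top_form_bundle ?TM) V \<eta> \<and> (\<forall>y\<in>V. s y = a y \<otimes>\<^sub>t \<eta> y) \<and> w = val a \<eta>"
    then obtain V a \<eta> where "open V" "x \<in> V" "smooth_section M (top_multivector_bundle E) V a"
      "smooth_section M (top_form_bundle ?TM) V \<eta>" "\<forall>y\<in>V. s y = a y \<otimes>\<^sub>t \<eta> y" "w = val a \<eta>" by blast
    then show "w = (anchor E x (X x) q + q x * elw_coeff \<mu> \<nu> X x) *\<^sub>R elw_gen \<mu> \<nu> x" using key by simp
  qed
qed

text \<open>The argument of \<open>elw_rep_gen\<close> one level up; the factor 2 comes from the
  action on both copies of the generator.\<close>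

lemma elw_rep2_gen:
  assumes m: "vol_near x \<mu>" and n: "TM.vol_near x \<nu>" and X: "X \<in> Sec M E" and q: "smooth_near M x q"
    and s: "\<forall>\<^sub>F y in nhds x. s y = q y *\<^sub>R (elw_gen \<mu> \<nu> y \<otimes>\<^sub>t elw_gen \<mu> \<nu> y)"
  shows "elw_rep2 M E X s x =
    (anchor E x (X x) q + 2 * q x * elw_coeff \<mu> \<nu> X x) *\<^sub>R (elw_gen \<mu> \<nu> x \<otimes>\<^sub>t elw_gen \<mu> \<nu> x)"
proof -
  let ?g = "elw_gen \<mu> \<nu>"
  have v: "anchor E x (X x) \<in> tangent_space M x" by (rule Sec_tangent[OF X])
  define val where "val t u = elw_rep M E X t x \<otimes>\<^sub>t u x + t x \<otimes>\<^sub>t elw_rep M E X u x" for t u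
  have key: "val t u = (anchor E x (X x) q + 2 * q x * elw_coeff \<mu> \<nu> X x) *\<^sub>R (?g x \<otimes>\<^sub>t ?g x)"
    if V: "open V" "x \<in> V" and t: "smooth_section M (elw_bundle M E) V t"
      and u: "smooth_section M (elw_bundle M E) V u" and sV: "\<forall>y\<in>V. s y = t y \<otimes>\<^sub>t u y" for V t u
  proof -
    obtain h where h: "smooth_near M x h" "\<forall>\<^sub>F y in nhds x. t y = h y *\<^sub>R ?g y"
      by (rule line_section_coeff[OF elw_line_bundle V(1) t V(2) elw_line_gen[OF m n]])
    obtain k where k: "smooth_near M x k" "\<forall>\<^sub>F y in nhds x. u y = k y *\<^sub>R ?g y"
      by (rule line_section_coeff[OF elw_line_bundle V(1) u V(2) elw_line_gen[OF m n]])
    have "\<forall>\<^sub>F y in nhds x. y \<in> V" using V by (intro eventually_nhds_in_open)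
    then have ev: "\<forall>\<^sub>F y in nhds x. q y = h y * k y"
      using h(2) k(2) s vol_near_eventually[OF m] TM.vol_near_eventually[OF n]
    proof eventually_elim
      case (elim y)
      have "q y *\<^sub>R (?g y \<otimes>\<^sub>t ?g y) = t y \<otimes>\<^sub>t u y" using sV elim(1,4) by metis
      also have "\<dots> = (h y * k y) *\<^sub>R (?g y \<otimes>\<^sub>t ?g y)" unfolding elim(2,3) by (rule tensor_scale)
      finally show ?case
        by (rule scaleR_right_imp_eq[OF tensor_nonzero[OF elw_gen_nonzero[OF elim(5,6)] elw_gen_nonzero[OF elim(5,6)]]])
    qed
    have tx: "t x = h x *\<^sub>R ?g x" and ux: "u x = k x *\<^sub>R ?g x" and qx: "q x = h x * k x"
      using eventually_nhds_x_imp_x[OF h(2)] eventually_nhds_x_imp_x[OF k(2)] eventually_nhds_x_imp_x[OF ev] .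
    have lq: "anchor E x (X x) q = h x * anchor E x (X x) k + k x * anchor E x (X x) h"
      using tangent_cong[OF v ev] tangent_mult[OF v h(1) k(1)] by simp
    show ?thesis
      unfolding val_def elw_rep_gen[OF m n X h] elw_rep_gen[OF m n X k] tx ux tensor_scale
        scaleR_add_left[symmetric]
      by (rule arg_cong[where f = "\<lambda>c. c *\<^sub>R (?g x \<otimes>\<^sub>t ?g x)"]) (simp add: lq qx algebra_simps)
  qed
  have "\<forall>\<^sub>F y in nhds x. s y = q y *\<^sub>R (?g y \<otimes>\<^sub>t ?g y) \<and> smooth_near M y q \<and> vol_near y \<mu> \<and> TM.vol_near y \<nu>"
    using s smooth_near_eventually[OF q] vol_near_eventually[OF m] TM.vol_near_eventually[OF n]
    by eventually_elim simp
  then obtain V where V: "open V" "x \<in> V" "\<And>y. y \<in> V \<Longrightarrow> s y = q y *\<^sub>R (?g y \<otimes>\<^sub>t ?g y)"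
    "\<And>y. y \<in> V \<Longrightarrow> smooth_near M y q" "\<And>y. y \<in> V \<Longrightarrow> vol_near y \<mu>" "\<And>y. y \<in> V \<Longrightarrow> TM.vol_near y \<nu>"
    unfolding eventually_nhds by blast
  let ?t = "\<lambda>y. q y *\<^sub>R ?g y"
  have t: "smooth_section M (elw_bundle M E) V ?t"
    by (rule line_sectionI[OF elw_line_bundle V(1), where g = "\<lambda>_. ?g" and p = "\<lambda>_. q"])
      (simp_all add: elw_line_gen V)
  have u: "smooth_section M (elw_bundle M E) V ?g"
    by (rule line_sectionI[OF elw_line_bundle V(1), where g = "\<lambda>_. ?g" and p = "\<lambda>_ _. 1"])
      (simp_all add: elw_line_gen V smooth_near_const)
  have sV: "\<forall>y\<in>V. s y = ?t y \<otimes>\<^sub>t ?g y"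
  proof
    fix y assume "y \<in> V"
    then show "s y = ?t y \<otimes>\<^sub>t ?g y" using V(3) tensor_scale[of "q y" "?g y" 1 "?g y"] by simp
  qed
  show ?thesis
    unfolding elw_rep2_def val_def[symmetric]
  proof (rule the_equality)
    show "\<exists>V t u. open V \<and> x \<in> V \<and> smooth_section M (elw_bundle M E) V t \<and>
      smooth_section M (elw_bundle M E) V u \<and> (\<forall>y\<in>V. s y = t y \<otimes>\<^sub>t u y) \<and>
      (anchor E x (X x) q + 2 * q x * elw_coeff \<mu> \<nu> X x) *\<^sub>R (?g x \<otimes>\<^sub>t ?g x) = val t u"
      using V(1,2) t u sV key[OF V(1,2) t u sV] by (intro exI[of _ V] exI[of _ ?t] exI[of _ ?g]) simp
    fix w assume "\<exists>V t u. open V \<and> x \<in> V \<and> smooth_section M (elw_bundle M E) V t \<and>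
      smooth_section M (elw_bundle M E) V u \<and> (\<forall>y\<in>V. s y = t y \<otimes>\<^sub>t u y) \<and> w = val t u"
    then obtain V t u where "open V" "x \<in> V" "smooth_section M (elw_bundle M E) V t"
      "smooth_section M (elw_bundle M E) V u" "\<forall>y\<in>V. s y = t y \<otimes>\<^sub>t u y" "w = val t u" by blast
    then show "w = (anchor E x (X x) q + 2 * q x * elw_coeff \<mu> \<nu> X x) *\<^sub>R (?g x \<otimes>\<^sub>t ?g x)" using key by simp
  qed
qed

end

section \<open>Modular classes\<close>

lemma ln_abs_derivative:
  assumes "(t::real) \<noteq> 0"
  shows "((\<lambda>t. ln \<bar>t\<bar>) has_real_derivative inverse t) (at t)"
proof (cases "t > 0")
  case True
  then show ?thesis
    by (intro has_field_derivative_transform_within_open[OF DERIV_ln open_greaterThan[of 0]]) auto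
next
  case False
  then have "((\<lambda>t. ln (- t)) has_real_derivative inverse (- t) * (- 1)) (at t)"
    using assms by (auto intro!: derivative_eq_intros simp: inverse_eq_divide)
  then have "((\<lambda>t. ln (- t)) has_real_derivative inverse t) (at t)" using assms by simp
  then show ?thesis
    by (rule has_field_derivative_transform_within_open[OF _ open_lessThan[of 0]]) (use False assms in auto)
qed

context smooth_mfd
begin

text \<open>Derivations obey the Leibniz rule by definition, but no chain rule. The latter is proved
  for coordinate vectors, where it is calculus, and transferred by the expansion of \<open>v\<close>
  in them.\<close>

lemma tangent_ln_abs:
  assumes v: "v \<in> tangent_space M x" and f: "smooth_near M x f" and f0: "f x \<noteq> 0"
  shows "v (\<lambda>y. ln \<bar>f y\<bar>) = v f / f x"
proof -
  obtain U \<phi> where c: "(U, \<phi>) \<in> charts M" "x \<in> U" using chart_cover .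
  obtain r F where "r > 0" "Cinf (ball (\<phi> x) r) F" and F: "\<forall>\<^sub>F y in nhds x. f y = F (\<phi> y)"
    "(F has_derivative frechet_derivative F (at (\<phi> x))) (at (\<phi> x))"
    by (rule smooth_near_rep[OF c f])
  let ?D = "frechet_derivative F (at (\<phi> x))"
  have Fx: "F (\<phi> x) = f x" using eventually_nhds_x_imp_x[OF F(1)] by simp
  have "((\<lambda>z. ln \<bar>F z\<bar>) has_derivative (\<lambda>w. inverse (f x) * ?D w)) (at (\<phi> x))"
    using has_derivative_compose[OF F(2), of "\<lambda>t. ln \<bar>t\<bar>" "(*) (inverse (f x))"] ln_abs_derivative[OF f0]
    by (simp add: has_field_derivative_def Fx)
  moreover have "\<forall>\<^sub>F y in nhds x. ln \<bar>f y\<bar> = ln \<bar>F (\<phi> y)\<bar>" using F(1) by eventually_elim simp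
  ultimately have "coord_vec M U \<phi> b x (\<lambda>y. ln \<bar>f y\<bar>) = inverse (f x) * coord_vec M U \<phi> b x f"
    if "b \<in> set (model M)" for b
    using coord_vec_eqI[OF c smooth_near_ln_abs[OF f f0] that, of "\<lambda>z. ln \<bar>F z\<bar>" "\<lambda>w. inverse (f x) * ?D w"]
      coord_vec_eqI[OF c f that F(2,1)] by simp
  then show ?thesis
    unfolding tangent_expand_Basis[OF c v smooth_near_ln_abs[OF f f0]] tangent_expand_Basis[OF c v f]
    by (simp add: sum_distrib_left divide_inverse mult_ac)
qed

text \<open>The diagonal function mapping \<open>y\<close> to \<open>f y y\<close> need not be
  continuous, since its sign may depend on a choice made at \<open>y\<close>. Its absolute value
  agrees near \<open>x\<close> with that of the single function \<open>f x\<close>, which is smooth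
  and nonzero there.\<close>

lemma glue_ln_abs:
  assumes sm: "\<And>x. smooth_near M x (f x)" and nz: "\<And>x. f x x \<noteq> 0"
    and eq: "\<And>x. \<forall>\<^sub>F y in nhds x. \<bar>f y y\<bar> = \<bar>f x y\<bar>"
  defines "h \<equiv> \<lambda>y. ln \<bar>f y y\<bar>"
  shows "smooth_fun M UNIV h" and "v \<in> tangent_space M x \<Longrightarrow> v h = v (f x) / f x x"
proof -
  have ev: "\<forall>\<^sub>F y in nhds x. ln \<bar>f x y\<bar> = h y" for x
    using eq[of x] by eventually_elim (simp add: h_def)
  have "smooth_near M x h" for x
    using smooth_near_ln_abs[OF sm nz, of x] ev[of x] by (rule smooth_near_transform)
  then show "smooth_fun M UNIV h" using smooth_fun_UNIV by blast
  assume v: "v \<in> tangent_space M x"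
  then have "v h = v (\<lambda>y. ln \<bar>f x y\<bar>)" using tangent_cong[OF v ev] by simp
  then show "v h = v (f x) / f x x" using tangent_ln_abs[OF v sm nz] by simp
qed

end

context vbun
begin

lemma dual_sec_uminus:
  assumes m: "vol_near y \<mu>" and n: "vol_near y \<nu>" and eq: "\<nu> y = - \<mu> y"
  shows "dual_sec \<nu> y = - dual_sec \<mu> y"
proof -
  obtain vs where "\<mu> y vs \<noteq> 0" using vol_near_alt(2)[OF m] by (auto simp: fun_eq_iff)
  moreover then have "length vs = rk" "set vs \<subseteq> fiber E y"
    using alt_forms_outside[OF vol_near_alt(1)[OF m], of vs] by auto
  then have "\<mu> y vs *\<^sub>R dual_sec \<mu> y = \<nu> y vs *\<^sub>R dual_sec \<nu> y"
    using wedge_dual_sec[OF m] wedge_dual_sec[OF n] by metis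
  ultimately have "\<mu> y vs *\<^sub>R dual_sec \<nu> y = \<mu> y vs *\<^sub>R (- dual_sec \<mu> y)" by (simp add: eq)
  then show ?thesis using \<open>\<mu> y vs \<noteq> 0\<close> by (metis scaleR_left_imp_eq)
qed

lemma local_rep_pm:
  assumes "local_rep M E m U \<mu>" "local_rep M E m V \<nu>" "y \<in> U" "y \<in> V"
  shows "\<nu> y = \<mu> y \<or> \<nu> y = - \<mu> y"
proof -
  have "{\<nu> y, - \<nu> y} = {\<mu> y, - \<mu> y}" using assms unfolding local_rep_def by metis
  then show ?thesis by blast
qed

lemma local_rep_eventually:
  "local_rep M E m U \<mu> \<Longrightarrow> x \<in> U \<Longrightarrow> \<forall>\<^sub>F y in nhds x. y \<in> U"
  unfolding local_rep_def by (blast intro: eventually_nhds_in_open)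

end

context algd
begin

lemma divergence_ratio:
  assumes m: "vol_section M E m" and m': "vol_section M E m'"
  obtains h where "smooth_fun M UNIV h"
    "\<And>X x. X \<in> Sec M E \<Longrightarrow> divergence M E m' X x = divergence M E m X x + anchor E x (X x) h"
proof -
  obtain U \<mu> where r: "\<And>x. x \<in> U x" "\<And>x. local_rep M E m (U x) (\<mu> x)"
    using m unfolding vol_section_def by metis
  obtain U' \<mu>' where r': "\<And>x. x \<in> U' x" "\<And>x. local_rep M E m' (U' x) (\<mu>' x)"
    using m' unfolding vol_section_def by metis
  note v = local_rep_vol[OF r(2)] and v' = local_rep_vol[OF r'(2)]
  have "\<exists>f. smooth_near M x f \<and> (\<forall>\<^sub>F y in nhds x. \<mu>' x y = f y *\<^sub>R \<mu> x y)" for x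
    using top_ratio[OF v[OF r(1)] vol_near_form[OF v'[OF r'(1)]]] by metis
  then obtain f where f: "\<And>x. smooth_near M x (f x)" "\<And>x. \<forall>\<^sub>F y in nhds x. \<mu>' x y = f x y *\<^sub>R \<mu> x y"
    by metis
  have f0: "f x x \<noteq> 0" for x
    using eventually_nhds_x_imp_x[OF f(2)[of x]] vol_near_alt(2)[OF v'[OF r'(1)[of x]]] by auto
  have eq: "\<forall>\<^sub>F y in nhds x. \<bar>f y y\<bar> = \<bar>f x y\<bar>" for x
    using f(2)[of x] local_rep_eventually[OF r(2,1), of x] local_rep_eventually[OF r'(2,1), of x]
  proof eventually_elim
    case (elim y)
    have e: "\<mu>' y y = f y y *\<^sub>R \<mu> y y" using eventually_nhds_x_imp_x[OF f(2)] .
    have n: "\<mu> x y \<noteq> 0" using vol_near_alt(2)[OF v[OF elim(2)]] .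
    have "\<mu> y y = 1 *\<^sub>R \<mu> x y \<or> \<mu> y y = (-1) *\<^sub>R \<mu> x y"
      using local_rep_pm[OF r(2) r(2) elim(2) r(1)] by simp
    then obtain s where s: "\<mu> y y = s *\<^sub>R \<mu> x y" "\<bar>s\<bar> = 1" by (metis abs_1 abs_minus)
    have "\<mu>' y y = 1 *\<^sub>R \<mu>' x y \<or> \<mu>' y y = (-1) *\<^sub>R \<mu>' x y"
      using local_rep_pm[OF r'(2) r'(2) elim(3) r'(1)] by simp
    then obtain t where t: "\<mu>' y y = t *\<^sub>R \<mu>' x y" "\<bar>t\<bar> = 1" by (metis abs_1 abs_minus)
    have "(t * f x y) *\<^sub>R \<mu> x y = (f y y * s) *\<^sub>R \<mu> x y"
      using e unfolding s(1) t(1) elim(1) scaleR_scaleR .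
    then have "t * f x y = f y y * s" by (rule scaleR_right_imp_eq[OF n])
    then have "\<bar>t\<bar> * \<bar>f x y\<bar> = \<bar>f y y\<bar> * \<bar>s\<bar>" by (simp flip: abs_mult)
    then show ?case using s t by simp
  qed
  note glue = glue_ln_abs[of f, OF f(1) f0 eq]
  show thesis
  proof (rule that[OF glue(1)])
    fix X x assume X: "X \<in> Sec M E"
    show "divergence M E m' X x = divergence M E m X x + anchor E x (X x) (\<lambda>y. ln \<bar>f y y\<bar>)"
      unfolding divergence_eq[OF m X r(2,1)] divergence_eq[OF m' X r'(2,1)] glue(2)[OF Sec_tangent[OF X]]
      by (rule div_coeff_scale(2)[OF v[OF r(1)] v'[OF r'(1)] X f])
  qed
qed

section \<open>From differences of divergences to a 1-form\<close>

lemma elw_coeff_add: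
  assumes m: "vol_near x \<mu>" and n: "TM.vol_near x \<nu>" and X: "X \<in> Sec M E" and Y: "Y \<in> Sec M E"
  shows "elw_coeff \<mu> \<nu> (\<lambda>y. X y + Y y) x = elw_coeff \<mu> \<nu> X x + elw_coeff \<mu> \<nu> Y x"
proof -
  have "anchor_sec (\<lambda>y. X y + Y y) = (\<lambda>y. anchor_sec X y + anchor_sec Y y)"
    by (intro ext) (simp add: anchor_add[OF Sec_fiber[OF X] Sec_fiber[OF Y]])
  then show ?thesis
    unfolding elw_coeff_def
    using div_coeff_add[OF m X Y] TM.div_coeff_add[OF n anchor_Sec[OF X] anchor_Sec[OF Y]] by simp
qed

lemma elw_coeff_mult:
  assumes m: "vol_near x \<mu>" and n: "TM.vol_near x \<nu>" and X: "X \<in> Sec M E" and f: "smooth_fun M UNIV f"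
  shows "elw_coeff \<mu> \<nu> (\<lambda>y. f y *\<^sub>R X y) x = f x * elw_coeff \<mu> \<nu> X x"
proof -
  have "anchor_sec (\<lambda>y. f y *\<^sub>R X y) = (\<lambda>y. f y *\<^sub>R anchor_sec X y)"
    by (intro ext) (simp add: anchor_scale[OF Sec_fiber[OF X]])
  then show ?thesis
    unfolding elw_coeff_def
    using div_coeff_mult[OF m X f] TM.div_coeff_mult[OF n anchor_Sec[OF X] f] by (simp add: algebra_simps)
qed

lemma elw_coeff_smooth:
  assumes m: "vol_near x \<mu>" and n: "TM.vol_near x \<nu>" and X: "X \<in> Sec M E"
  shows "smooth_near M x (elw_coeff \<mu> \<nu> X)"
  unfolding elw_coeff_def[abs_def]
  by (intro smooth_near_diff div_coeff_smooth[OF m X] TM.div_coeff_smooth[OF n anchor_Sec[OF X]])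

lemma elw_coeff_bracket:
  assumes m: "vol_near x \<mu>" and n: "TM.vol_near x \<nu>" and X: "X \<in> Sec M E" and Y: "Y \<in> Sec M E"
  shows "elw_coeff \<mu> \<nu> (bracket E X Y) x =
    anchor E x (X x) (elw_coeff \<mu> \<nu> Y) - anchor E x (Y x) (elw_coeff \<mu> \<nu> X)"
proof -
  have d: "anchor E x (Z x) (elw_coeff \<mu> \<nu> W) =
      anchor E x (Z x) (div_coeff M (tangent_algebroid M) \<nu> (anchor_sec W)) - anchor E x (Z x) (div_coeff M E \<mu> W)"
    if "Z \<in> Sec M E" "W \<in> Sec M E" for Z W
    unfolding elw_coeff_def[abs_def]
    by (intro tangent_diff[OF Sec_tangent[OF that(1)]] div_coeff_smooth[OF m] TM.div_coeff_smooth[OF n]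
        anchor_Sec that)
  show ?thesis
    unfolding d[OF X Y] d[OF Y X] elw_coeff_def anchor_bracket[OF X Y]
    using div_coeff_bracket[OF m X Y] TM.div_coeff_bracket[OF n anchor_Sec[OF X] anchor_Sec[OF Y]] by simp
qed

text \<open>The value on a vector is taken from some global section through it;
  \<open>one_form_tensorial\<close> shows that for tensorial \<open>K\<close> all such sections
  agree.\<close>

definition one_form :: "(('m \<Rightarrow> 'v) \<Rightarrow> 'm \<Rightarrow> real) \<Rightarrow> 'm \<Rightarrow> 'v list \<Rightarrow> real" where
  "one_form K x vs = (if length vs = 1 \<and> set vs \<subseteq> fiber E x
     then K (SOME X. X \<in> Sec M E \<and> X x = hd vs) x else 0)"

lemma one_form_tensorial:
  assumes add: "\<And>x X Y. X \<in> Sec M E \<Longrightarrow> Y \<in> Sec M E \<Longrightarrow> K (\<lambda>y. X y + Y y) x = K X x + K Y x"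
    and mult: "\<And>x f X. smooth_fun M UNIV f \<Longrightarrow> X \<in> Sec M E \<Longrightarrow> K (\<lambda>y. f y *\<^sub>R X y) x = f x * K X x"
    and sm: "\<And>x X. X \<in> Sec M E \<Longrightarrow> smooth_near M x (K X)"
  shows "X \<in> Sec M E \<Longrightarrow> one_form K x [X x] = K X x" and "is_form M E 1 UNIV (one_form K)"
proof -
  have cong: "K X x = K Y x" if "X \<in> Sec M E" "Y \<in> Sec M E" "X x = Y x" for X Y x
  proof -
    have "K (\<lambda>y. X y - Y y) x = 0"
      by (rule tensorial_vanish[where K = "\<lambda>X. K X x" and x = x])
        (use add mult Sec_diff that in auto)
    then show ?thesis using add[OF Sec_diff[OF that(1,2)] that(2), of x] by simp
  qed
  show ev: "one_form K x [X x] = K X x" if X: "X \<in> Sec M E" for X x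
  proof -
    have "\<exists>Y. Y \<in> Sec M E \<and> Y x = X x" using X by blast
    then have "(SOME Y. Y \<in> Sec M E \<and> Y x = X x) \<in> Sec M E \<and> (SOME Y. Y \<in> Sec M E \<and> Y x = X x) x = X x"
      by (rule someI_ex)
    then show ?thesis using cong[OF _ X] Sec_fiber[OF X] by (simp add: one_form_def)
  qed
  have alt: "one_form K x \<in> alt_forms (fiber E x) 1" for x
    unfolding alt_forms_def
  proof (intro CollectI conjI allI impI ballI)
    fix vs assume "\<not> (length vs = 1 \<and> set vs \<subseteq> fiber E x)"
    then show "one_form K x vs = 0" unfolding one_form_def by (rule if_not_P)
  next
    fix vs :: "'v list" and i :: nat and u w
    assume A: "length vs = 1 \<and> set vs \<subseteq> fiber E x" "i < 1" "u \<in> fiber E x" "w \<in> fiber E x"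
    then have up: "vs[i := z] = [z]" for z by (cases vs) auto
    obtain X Y where XY: "X \<in> Sec M E" "X x = u" "Y \<in> Sec M E" "Y x = w"
      using Sec_through A(3,4) by metis
    show "one_form K x (vs[i := u + w]) = one_form K x (vs[i := u]) + one_form K x (vs[i := w])"
      using ev[OF XY(1), of x] ev[OF XY(3), of x] ev[OF Sec_add[OF XY(1,3)], of x] add[OF XY(1,3), of x] XY(2,4)
      unfolding up by simp
  next
    fix vs :: "'v list" and i :: nat and u c
    assume A: "length vs = 1 \<and> set vs \<subseteq> fiber E x" "i < 1" "u \<in> fiber E x"
    then have up: "vs[i := z] = [z]" for z by (cases vs) auto
    obtain X where X: "X \<in> Sec M E" "X x = u" using Sec_through A(3) by metis
    have c: "smooth_fun M UNIV (\<lambda>y. c)" by (simp add: smooth_fun_UNIV)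
    show "one_form K x (vs[i := c *\<^sub>R u]) = c * one_form K x (vs[i := u])"
      using ev[OF X(1), of x] ev[OF Sec_scale[OF c X(1)], of x] mult[OF c X(1), of x] X(2)
      unfolding up by simp
  qed auto
  have "form_near M E 1 x (one_form K)" for x
  proof -
    obtain U e where F: "(U, e) \<in> frames E" "x \<in> U" using frame_cover .
    obtain Y where Y: "\<forall>i<rk. Y i \<in> Sec M E" "\<forall>\<^sub>F y in nhds x. \<forall>i<rk. Y i y = e i y"
      using frame_extend[OF F] .
    have "smooth_near M x (\<lambda>y. one_form K y (map (\<lambda>i. e i y) I))" if "length I = 1" "set I \<subseteq> {..<rk}" for I
    proof -
      obtain i where i: "I = [i]" "i < rk" using \<open>length I = 1\<close> \<open>set I \<subseteq> {..<rk}\<close> by (cases I) auto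
      have Yi: "Y i \<in> Sec M E" using Y(1) i(2) by blast
      from Y(2) have "\<forall>\<^sub>F y in nhds x. K (Y i) y = one_form K y (map (\<lambda>i. e i y) I)"
      proof eventually_elim
        case (elim y)
        then have "e i y = Y i y" using i(2) by simp
        then show ?case using ev[OF Yi, of y] by (simp add: i(1))
      qed
      with sm[OF Yi] show ?thesis by (rule smooth_near_transform)
    qed
    then show ?thesis unfolding form_near_frame[OF F] using alt by simp
  qed
  then show "is_form M E 1 UNIV (one_form K)" using is_form_iff[OF open_UNIV] by blast
qed

section \<open>Closed and exact 1-forms\<close>

lemma closed_1_form:
  assumes w: "is_form M E 1 UNIV \<phi>"
    and c: "\<And>x X Y. X \<in> Sec M E \<Longrightarrow> Y \<in> Sec M E \<Longrightarrow> \<phi> x [bracket E X Y x] =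
      anchor E x (X x) (\<lambda>y. \<phi> y [Y y]) - anchor E x (Y x) (\<lambda>y. \<phi> y [X y])"
  shows "\<phi> \<in> closed_forms M E 1"
proof -
  have wn: "form_near M E 1 x \<phi>" for x using w is_form_iff[OF open_UNIV] by blast
  have "ext_d M E \<phi> x vs = 0" for x vs
  proof (cases "set vs \<subseteq> fiber E x")
    case True
    then obtain Xs where Xs: "set Xs \<subseteq> Sec M E" "eval_at x Xs = vs" by (rule Sec_through_list)
    have "koszul E \<phi> Xs x = 0"
    proof (cases "length Xs = 2")
      case True
      then obtain X Y where XY: "Xs = [X, Y]" by (auto simp: length_Suc_conv numeral_2_eq_2)
      then have "X \<in> Sec M E" "Y \<in> Sec M E" using Xs(1) by auto
      from c[OF this, of x] show ?thesis
        by (simp add: XY koszul_def drop_nth_def lessThan_Suc numeral_2_eq_2)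
    next
      case False
      then show ?thesis using koszul_length[OF wn Xs(1)] by simp
    qed
    then show ?thesis using ext_d_eval[OF wn[of x] Xs(1)] Xs(2) by simp
  qed (simp add: ext_d_def)
  then have "ext_d M E \<phi> = 0" by (intro ext) simp
  then show ?thesis using w by (simp add: closed_forms_def)
qed

lemma closed_1_formD:
  assumes w: "\<phi> \<in> closed_forms M E 1" and X: "X \<in> Sec M E" and Y: "Y \<in> Sec M E"
  shows "\<phi> x [bracket E X Y x] = anchor E x (X x) (\<lambda>y. \<phi> y [Y y]) - anchor E x (Y x) (\<lambda>y. \<phi> y [X y])"
proof -
  have wn: "form_near M E 1 x \<phi>" using w is_form_iff[OF open_UNIV] unfolding closed_forms_def by blast
  have "ext_d M E \<phi> x (eval_at x [X, Y]) = 0" using w by (simp add: closed_forms_def)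
  then have "koszul E \<phi> [X, Y] x = 0" using ext_d_eval[OF wn, of "[X, Y]"] X Y by simp
  then show ?thesis by (simp add: koszul_def drop_nth_def lessThan_Suc numeral_2_eq_2)
qed

lemma is_form_0_smooth: "is_form M E 0 UNIV \<eta> \<Longrightarrow> smooth_near M x (\<lambda>y. \<eta> y [])"
  using form_near_eval[of 0 x \<eta> "[]"] is_form_iff[OF open_UNIV] by simp

lemma ext_d_0_form:
  assumes w: "is_form M E 0 UNIV \<eta>"
  shows "ext_d M E \<eta> x vs = (if length vs = 1 \<and> set vs \<subseteq> fiber E x
    then anchor E x (hd vs) (\<lambda>y. \<eta> y []) else 0)"
proof (cases "set vs \<subseteq> fiber E x")
  case True
  then obtain Xs where Xs: "set Xs \<subseteq> Sec M E" "eval_at x Xs = vs" by (rule Sec_through_list)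
  have wn: "form_near M E 0 x \<eta>" using w is_form_iff[OF open_UNIV] by blast
  show ?thesis
  proof (cases "length vs = 1")
    case 1: True
    then obtain X where X: "Xs = [X]" using Xs(2) by (auto simp: length_Suc_conv)
    have "koszul E \<eta> Xs x = anchor E x (hd vs) (\<lambda>y. \<eta> y [])"
      using Xs(2) by (auto simp: X koszul_def drop_nth_def)
    then show ?thesis using ext_d_eval[OF wn Xs(1)] Xs(2) 1 True by simp
  next
    case False
    then show ?thesis using koszul_length[OF wn Xs(1)] ext_d_eval[OF wn Xs(1)] Xs(2) by auto
  qed
qed (simp add: ext_d_def)

definition zero_form :: "('m \<Rightarrow> real) \<Rightarrow> 'm \<Rightarrow> 'v list \<Rightarrow> real" where
  "zero_form h x vs = (if vs = [] then h x else 0)"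

lemma is_form_zero_form:
  assumes "smooth_fun M UNIV h"
  shows "is_form M E 0 UNIV (zero_form h)"
proof -
  have "form_near M E 0 x (zero_form h)" for x
  proof -
    obtain U e where F: "(U, e) \<in> frames E" "x \<in> U" using frame_cover .
    have "zero_form h y \<in> alt_forms (fiber E y) 0" for y
      unfolding alt_forms_def zero_form_def by auto
    then show ?thesis
      unfolding form_near_frame[OF F] using assms smooth_fun_UNIV by (simp add: zero_form_def)
  qed
  then show ?thesis using is_form_iff[OF open_UNIV] by blast
qed

text \<open>The differential of a 0-form sees only its value on the empty list, so primitives may be
  taken to be functions.\<close>

lemma exact_1_form_iff:
  "\<alpha> \<in> exact_forms M E 1 \<longleftrightarrow> (\<exists>h. smooth_fun M UNIV h \<and> \<alpha> = ext_d M E (zero_form h))"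
proof
  assume "\<alpha> \<in> exact_forms M E 1"
  then obtain \<eta> where \<eta>: "is_form M E 0 UNIV \<eta>" "\<alpha> = ext_d M E \<eta>" by auto
  have h: "smooth_fun M UNIV (\<lambda>y. \<eta> y [])" using is_form_0_smooth[OF \<eta>(1)] smooth_fun_UNIV by blast
  have "ext_d M E \<eta> = ext_d M E (zero_form (\<lambda>y. \<eta> y []))"
    by (intro ext) (simp add: ext_d_0_form[OF \<eta>(1)] ext_d_0_form[OF is_form_zero_form[OF h]] zero_form_def)
  then show "\<exists>h. smooth_fun M UNIV h \<and> \<alpha> = ext_d M E (zero_form h)"
    using h \<eta>(2) by (intro exI[of _ "\<lambda>y. \<eta> y []"]) simp
next
  assume "\<exists>h. smooth_fun M UNIV h \<and> \<alpha> = ext_d M E (zero_form h)"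
  then show "\<alpha> \<in> exact_forms M E 1" using is_form_zero_form by auto
qed

lemma ext_d_zero_form_add:
  assumes h: "smooth_fun M UNIV h" and k: "smooth_fun M UNIV k"
  shows "ext_d M E (zero_form (\<lambda>y. h y + k y)) = ext_d M E (zero_form h) + ext_d M E (zero_form k)"
proof -
  have sm: "smooth_near M x h" "smooth_near M x k" for x using h k smooth_fun_UNIV by blast+
  have hk: "smooth_fun M UNIV (\<lambda>y. h y + k y)" using smooth_near_add[OF sm] smooth_fun_UNIV by blast
  have "anchor E x v (\<lambda>y. h y + k y) = anchor E x v h + anchor E x v k" if "v \<in> fiber E x" for x v
    by (rule tangent_add[OF anchor_tangent[OF that] sm])
  moreover have "hd vs \<in> fiber E x" if "length vs = 1" "set vs \<subseteq> fiber E x" for vs x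
    using that by (cases vs) auto
  ultimately show ?thesis
    by (intro ext) (simp add: ext_d_0_form is_form_zero_form h k hk zero_form_def)
qed

text \<open>The criterion by which all choices are compared. It derives closedness of \<phi>' from
  that of \<phi>, since the definitions of both classes ask their representatives only to be smooth
  forms; the bracket identity for the differential of \<open>h\<close> is the compatibility of the
  anchor with brackets.\<close>

lemma coh_class_1_eq:
  assumes w: "\<phi> \<in> closed_forms M E 1" and w': "is_form M E 1 UNIV \<phi>'" and h: "smooth_fun M UNIV h"
    and eq: "\<And>x X. X \<in> Sec M E \<Longrightarrow> \<phi>' x [X x] = \<phi> x [X x] + anchor E x (X x) h"
  shows "coh_class M E 1 \<phi>' = coh_class M E 1 \<phi>"
proof -
  have wf: "is_form M E 1 UNIV \<phi>" using w by (simp add: closed_forms_def)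
  have wn: "form_near M E 1 x \<phi>" for x using wf is_form_iff[OF open_UNIV] by blast
  have wn': "form_near M E 1 x \<phi>'" for x using w' is_form_iff[OF open_UNIV] by blast
  have hx: "smooth_near M x h" for x using h smooth_fun_UNIV by blast
  have s\<phi>: "smooth_near M x (\<lambda>y. \<phi> y [X y])" if "X \<in> Sec M E" for X x
    using form_near_eval_Sec[OF wn, of "[X]"] that by simp
  have c': "\<phi>' \<in> closed_forms M E 1"
  proof (rule closed_1_form[OF w'])
    fix x X Y assume X: "X \<in> Sec M E" and Y: "Y \<in> Sec M E"
    have e: "(\<lambda>y. \<phi>' y [Z y]) = (\<lambda>y. \<phi> y [Z y] + anchor E y (Z y) h)" if "Z \<in> Sec M E" for Z
      using eq[OF that] by auto
    have "anchor E x (Z x) (\<lambda>y. \<phi>' y [W y]) =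
        anchor E x (Z x) (\<lambda>y. \<phi> y [W y]) + anchor E x (Z x) (\<lambda>y. anchor E y (W y) h)"
      if "Z \<in> Sec M E" "W \<in> Sec M E" for Z W
      unfolding e[OF that(2)]
      by (rule tangent_add[OF Sec_tangent[OF that(1)] s\<phi>[OF that(2)] anchor_smooth[OF that(2) hx]])
    then show "\<phi>' x [bracket E X Y x] =
      anchor E x (X x) (\<lambda>y. \<phi>' y [Y y]) - anchor E x (Y x) (\<lambda>y. \<phi>' y [X y])"
      using eq[OF bracket_Sec[OF X Y], of x] closed_1_formD[OF w X Y, of x]
        anchor_bracket_apply[OF X Y hx, of x] X Y by simp
  qed
  have d: "\<phi>' = \<phi> + ext_d M E (zero_form h)"
  proof (intro ext)
    fix x vs
    show "\<phi>' x vs = (\<phi> + ext_d M E (zero_form h)) x vs"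
    proof (cases "length vs = 1 \<and> set vs \<subseteq> fiber E x")
      case True
      then obtain v where v: "vs = [v]" "v \<in> fiber E x" by (cases vs) auto
      obtain X where "X \<in> Sec M E" "X x = v" using Sec_through[OF v(2)] .
      then show ?thesis
        using eq[of X x] v by (simp add: ext_d_0_form[OF is_form_zero_form[OF h]] zero_form_def)
    next
      case False
      then show ?thesis
        unfolding plus_fun_apply ext_d_0_form[OF is_form_zero_form[OF h]] if_not_P[OF False]
        using alt_forms_outside[OF form_near_alt_at[OF wn] False] alt_forms_outside[OF form_near_alt_at[OF wn'] False]
        by simp
    qed
  qed
  have nh: "smooth_fun M UNIV (\<lambda>y. - h y)" using smooth_near_minus[OF hx] smooth_fun_UNIV by blast
  have z: "ext_d M E (zero_form h) + ext_d M E (zero_form (\<lambda>y. - h y)) = 0"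
  proof -
    have z0: "smooth_fun M UNIV (\<lambda>y. 0)" by (simp add: smooth_fun_UNIV)
    have "ext_d M E (zero_form (\<lambda>y. h y + - h y)) = 0"
    proof (intro ext)
      fix x and vs :: "'v list"
      have "anchor E x (hd vs) (\<lambda>y. 0) = 0" if "length vs = 1" "set vs \<subseteq> fiber E x"
        using that by (cases vs) (auto intro: tangent_const anchor_tangent)
      then show "ext_d M E (zero_form (\<lambda>y. h y + - h y)) x vs = 0 x vs"
        by (simp add: ext_d_0_form[OF is_form_zero_form[OF z0]] zero_form_def)
    qed
    then show ?thesis using ext_d_zero_form_add[OF h nh] by simp
  qed
  \<comment> \<open>Classes are sets of closed forms, so their equality means that subtracting
    either representative gives an exact form for the same \<beta>.\<close>
  have "\<beta> - \<phi>' \<in> exact_forms M E 1 \<longleftrightarrow> \<beta> - \<phi> \<in> exact_forms M E 1" for \<beta>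
  proof
    assume "\<beta> - \<phi>' \<in> exact_forms M E 1"
    then obtain k where k: "smooth_fun M UNIV k" "\<beta> - \<phi>' = ext_d M E (zero_form k)"
      using exact_1_form_iff by blast
    have "smooth_fun M UNIV (\<lambda>y. k y + h y)"
      using k(1) h smooth_near_add unfolding smooth_fun_UNIV by blast
    moreover have "\<beta> - \<phi> = ext_d M E (zero_form (\<lambda>y. k y + h y))"
      unfolding ext_d_zero_form_add[OF k(1) h] k(2)[symmetric] d by simp
    ultimately show "\<beta> - \<phi> \<in> exact_forms M E 1" unfolding exact_1_form_iff by (intro exI conjI)
  next
    assume "\<beta> - \<phi> \<in> exact_forms M E 1"
    then obtain k where k: "smooth_fun M UNIV k" "\<beta> - \<phi> = ext_d M E (zero_form k)"
      using exact_1_form_iff by blast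
    have "smooth_fun M UNIV (\<lambda>y. k y + - h y)"
      using k(1) nh smooth_near_add unfolding smooth_fun_UNIV by blast
    moreover have "\<beta> - \<phi>' = ext_d M E (zero_form (\<lambda>y. k y + - h y))"
    proof -
      have "ext_d M E (zero_form (\<lambda>y. - h y)) = - ext_d M E (zero_form h)"
        using z by (metis add.commute eq_neg_iff_add_eq_0)
      then show ?thesis unfolding ext_d_zero_form_add[OF k(1) nh] k(2)[symmetric] d by simp
    qed
    ultimately show "\<beta> - \<phi>' \<in> exact_forms M E 1" unfolding exact_1_form_iff by (intro exI conjI)
  qed
  then show ?thesis
    unfolding coh_class_def cohomologous_def using w c' by auto
qed

lemma coh_class_in_cohomology: "\<phi> \<in> closed_forms M E 1 \<Longrightarrow> coh_class M E 1 \<phi> \<in> cohomology M E 1"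
  unfolding cohomology_def coh_class_def by (rule quotientI)

end

section \<open>The modular 1-form and the two classes\<close>

locale elw_volumes = algd M E
  for M :: "('m::{t2_space,second_countable_topology}, 'b::euclidean_space) manifold"
    and E :: "('m, 'v::real_vector) algebroid" +
  fixes m m' U \<mu> U' \<nu>
  assumes vol: "vol_section M E m" and vol': "vol_section M (tangent_algebroid M) m'"
    and rep: "\<And>x. x \<in> U x" "\<And>x. local_rep M E m (U x) (\<mu> x)"
    and rep': "\<And>x. x \<in> U' x" "\<And>x. local_rep M (tangent_algebroid M) m' (U' x) (\<nu> x)"
begin

lemmas rep_vol = local_rep_vol[OF rep(2)] and rep_vol' = TM.local_rep_vol[OF rep'(2)]

definition modular_coeff :: "('m \<Rightarrow> 'v) \<Rightarrow> 'm \<Rightarrow> real" where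
  "modular_coeff X x = divergence M (tangent_algebroid M) m' (anchor_sec X) x - divergence M E m X x"

lemma modular_coeff_eq:
  assumes X: "X \<in> Sec M E" and y: "y \<in> U x" "y \<in> U' x"
  shows "modular_coeff X y = elw_coeff (\<mu> x) (\<nu> x) X y"
  unfolding modular_coeff_def elw_coeff_def
  using divergence_eq[OF vol X rep(2) y(1)] TM.divergence_eq[OF vol' anchor_Sec[OF X] rep'(2) y(2)] by simp

lemma modular_coeff_eventually:
  assumes X: "X \<in> Sec M E"
  shows "\<forall>\<^sub>F y in nhds x. modular_coeff X y = elw_coeff (\<mu> x) (\<nu> x) X y"
  using local_rep_eventually[OF rep(2,1)] TM.local_rep_eventually[OF rep'(2,1)]
  by eventually_elim (rule modular_coeff_eq[OF X])

abbreviation "mod_form \<equiv> one_form modular_coeff"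

lemma mod_form:
  shows "X \<in> Sec M E \<Longrightarrow> mod_form x [X x] = modular_coeff X x" and "is_form M E 1 UNIV mod_form"
proof -
  have add: "modular_coeff (\<lambda>y. X y + Y y) x = modular_coeff X x + modular_coeff Y x"
    if "X \<in> Sec M E" "Y \<in> Sec M E" for X Y x
    using modular_coeff_eq[OF _ rep(1) rep'(1)] Sec_add that elw_coeff_add[OF rep_vol[OF rep(1)] rep_vol'[OF rep'(1)]] by simp
  have mult: "modular_coeff (\<lambda>y. f y *\<^sub>R X y) x = f x * modular_coeff X x"
    if "smooth_fun M UNIV f" "X \<in> Sec M E" for f X x
    using modular_coeff_eq[OF _ rep(1) rep'(1)] Sec_scale that elw_coeff_mult[OF rep_vol[OF rep(1)] rep_vol'[OF rep'(1)]] by simp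
  have sm: "smooth_near M x (modular_coeff X)" if X: "X \<in> Sec M E" for X x
  proof -
    have "\<forall>\<^sub>F y in nhds x. elw_coeff (\<mu> x) (\<nu> x) X y = modular_coeff X y"
      using modular_coeff_eventually[OF X] by eventually_elim simp
    with elw_coeff_smooth[OF rep_vol[OF rep(1)] rep_vol'[OF rep'(1)] X] show ?thesis by (rule smooth_near_transform)
  qed
  show "X \<in> Sec M E \<Longrightarrow> mod_form x [X x] = modular_coeff X x" "is_form M E 1 UNIV mod_form"
    using one_form_tensorial[of modular_coeff, OF add mult sm] by blast+
qed

lemma mod_form_closed: "mod_form \<in> closed_forms M E 1"
proof (rule closed_1_form[OF mod_form(2)])
  fix x X Y assume X: "X \<in> Sec M E" and Y: "Y \<in> Sec M E"
  have "anchor E x (Z x) (\<lambda>y. mod_form y [W y]) = anchor E x (Z x) (elw_coeff (\<mu> x) (\<nu> x) W)"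
    if "Z \<in> Sec M E" "W \<in> Sec M E" for Z W
    unfolding mod_form(1)[OF that(2)]
    by (rule tangent_cong[OF Sec_tangent[OF that(1)] modular_coeff_eventually[OF that(2)]])
  then show "mod_form x [bracket E X Y x] =
      anchor E x (X x) (\<lambda>y. mod_form y [Y y]) - anchor E x (Y x) (\<lambda>y. mod_form y [X y])"
    using mod_form(1)[OF bracket_Sec[OF X Y]] modular_coeff_eq[OF bracket_Sec[OF X Y] rep(1) rep'(1)]
      elw_coeff_bracket[OF rep_vol[OF rep(1)] rep_vol'[OF rep'(1)] X Y] X Y by simp
qed

abbreviation "gen x y \<equiv> elw_gen (\<mu> x) (\<nu> x) y"

lemma gen_nonzero: "y \<in> U x \<Longrightarrow> y \<in> U' x \<Longrightarrow> gen x y \<noteq> 0"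
  by (rule elw_gen_nonzero[OF rep_vol rep_vol'])

text \<open>Each point \<open>y\<close> carries representatives of its own; passing from them to
  those chosen at \<open>x\<close> changes each of the two factors of the generator by a
  sign.\<close>

lemma gen_pm:
  assumes "y \<in> U x" "y \<in> U' x"
  obtains c where "gen y y = c *\<^sub>R gen x y" "\<bar>c\<bar> = 1"
proof -
  have "dual_sec (\<mu> y) y = dual_sec (\<mu> x) y \<or> dual_sec (\<mu> y) y = - dual_sec (\<mu> x) y"
    using local_rep_pm[OF rep(2) rep(2) assms(1) rep(1)] dual_sec_uminus[OF rep_vol[OF assms(1)] rep_vol[OF rep(1)]] by metis
  then have "dual_sec (\<mu> y) y = 1 *\<^sub>R dual_sec (\<mu> x) y \<or> dual_sec (\<mu> y) y = (-1) *\<^sub>R dual_sec (\<mu> x) y" by simp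
  then obtain s where s: "dual_sec (\<mu> y) y = s *\<^sub>R dual_sec (\<mu> x) y" "\<bar>s\<bar> = 1" by (metis abs_1 abs_minus)
  have "\<nu> y y = 1 *\<^sub>R \<nu> x y \<or> \<nu> y y = (-1) *\<^sub>R \<nu> x y"
    using TM.local_rep_pm[OF rep'(2) rep'(2) assms(2) rep'(1)] by simp
  then obtain t where t: "\<nu> y y = t *\<^sub>R \<nu> x y" "\<bar>t\<bar> = 1" by (metis abs_1 abs_minus)
  have "gen y y = (s * t) *\<^sub>R gen x y" unfolding s(1) t(1) by (rule tensor_scale)
  moreover have "\<bar>s * t\<bar> = 1" using s t by (simp add: abs_mult)
  ultimately show thesis by (rule that)
qed

lemma gen_line_gen: "line_gen M (elw_bundle M E) x (gen x)"
  by (rule elw_line_gen[OF rep_vol[OF rep(1)] rep_vol'[OF rep'(1)]])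

abbreviation "L2 \<equiv> tensor_bundle (elw_bundle M E) (elw_bundle M E)"

lemma L2_line_bundle: "line_bundle L2"
  by (intro line_bundle_tensor elw_line_bundle)

lemma gen2_line_gen: "line_gen M L2 x (\<lambda>y. gen x y \<otimes>\<^sub>t gen x y)"
  by (intro line_gen_tensor elw_line_bundle gen_line_gen)

lemma global_L2_section:
  obtains s where "s \<in> Sec M L2" "\<And>x. s x \<noteq> 0"
    "\<And>X x. X \<in> Sec M E \<Longrightarrow> elw_rep2 M E X s x = (2 * mod_form x [X x]) *\<^sub>R s x"
proof -
  define s where "s y = gen y y \<otimes>\<^sub>t gen y y" for y
  \<comment> \<open>The diagonal choice \<open>gen y y\<close> may change sign from point to point;
    in the square the sign cancels, so near \<open>x\<close> the section is the square of the single
    generator \<open>gen x\<close>.\<close>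
  have ev: "\<forall>\<^sub>F y in nhds x. s y = 1 *\<^sub>R (gen x y \<otimes>\<^sub>t gen x y)" for x
    using local_rep_eventually[OF rep(2,1), of x] TM.local_rep_eventually[OF rep'(2,1), of x]
  proof eventually_elim
    case (elim y)
    obtain c where c: "gen y y = c *\<^sub>R gen x y" "\<bar>c\<bar> = 1" using gen_pm[OF elim] .
    have "c * c = 1" using c(2) by (metis abs_mult_self_eq mult_1)
    then show ?case unfolding s_def c(1) tensor_scale by simp
  qed
  show thesis
  proof (rule that)
    show "s \<in> Sec M L2"
      by (rule CollectI, rule line_sectionI[OF L2_line_bundle open_UNIV gen2_line_gen smooth_near_const ev])
    show "s x \<noteq> 0" for x
      unfolding s_def by (intro tensor_nonzero gen_nonzero rep rep')
    fix X x assume X: "X \<in> Sec M E"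
    show "elw_rep2 M E X s x = (2 * mod_form x [X x]) *\<^sub>R s x"
    proof -
      have sx: "s x = gen x x \<otimes>\<^sub>t gen x x" by (simp add: s_def)
      show ?thesis
        unfolding elw_rep2_gen[OF rep_vol[OF rep(1)] rep_vol'[OF rep'(1)] X smooth_near_const ev] sx
          tangent_const[OF Sec_tangent[OF X]] mod_form(1)[OF X] modular_coeff_eq[OF X rep(1) rep'(1)]
        by simp
    qed
  qed
qed

lemma L_section_class:
  assumes s: "s \<in> Sec M (elw_bundle M E)" "\<And>x. s x \<noteq> 0" and w: "is_form M E 1 UNIV \<phi>"
    and rp: "\<And>X x. X \<in> Sec M E \<Longrightarrow> elw_rep M E X s x = \<phi> x [X x] *\<^sub>R s x"
  shows "coh_class M E 1 \<phi> = coh_class M E 1 mod_form"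
proof -
  have sU: "smooth_section M (elw_bundle M E) UNIV s" using s(1) by simp
  have "\<exists>p. smooth_near M x p \<and> (\<forall>\<^sub>F y in nhds x. s y = p y *\<^sub>R gen x y)" for x
  proof -
    obtain p where "smooth_near M x p" "\<forall>\<^sub>F y in nhds x. s y = p y *\<^sub>R gen x y"
      by (rule line_section_coeff[OF elw_line_bundle open_UNIV sU UNIV_I gen_line_gen])
    then show ?thesis by (intro exI[of _ p] conjI)
  qed
  then have "\<exists>p. \<forall>x. smooth_near M x (p x) \<and> (\<forall>\<^sub>F y in nhds x. s y = p x y *\<^sub>R gen x y)"
    by (intro choice allI)
  then obtain p where p: "\<And>x. smooth_near M x (p x)" "\<And>x. \<forall>\<^sub>F y in nhds x. s y = p x y *\<^sub>R gen x y"
    by blast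
  have px: "s x = p x x *\<^sub>R gen x x" for x using eventually_nhds_x_imp_x[OF p(2)] .
  have p0: "p x x \<noteq> 0" for x using px[of x] s(2)[of x] by auto
  have eq: "\<forall>\<^sub>F y in nhds x. \<bar>p y y\<bar> = \<bar>p x y\<bar>" for x
    using local_rep_eventually[OF rep(2,1), of x] TM.local_rep_eventually[OF rep'(2,1), of x] p(2)[of x]
  proof eventually_elim
    case (elim y)
    obtain c where c: "gen y y = c *\<^sub>R gen x y" "\<bar>c\<bar> = 1" using gen_pm[OF elim(1,2)] .
    have "p x y *\<^sub>R gen x y = (p y y * c) *\<^sub>R gen x y" using px[of y] elim(3) unfolding c(1) by simp
    then have "p x y = p y y * c" by (rule scaleR_right_imp_eq[OF gen_nonzero[OF elim(1,2)]])
    then show ?case using c(2) by (simp add: abs_mult)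
  qed
  note glue = glue_ln_abs[of p, OF p(1) p0 eq]
  show ?thesis
  proof (rule coh_class_1_eq[OF mod_form_closed w glue(1)])
    fix x X assume X: "X \<in> Sec M E"
    have "(\<phi> x [X x] * p x x) *\<^sub>R gen x x =
        (anchor E x (X x) (p x) + p x x * elw_coeff (\<mu> x) (\<nu> x) X x) *\<^sub>R gen x x"
      using elw_rep_gen[OF rep_vol[OF rep(1)] rep_vol'[OF rep'(1)] X p(1,2), of x] rp[OF X, of x] px[of x] by simp
    then have "\<phi> x [X x] * p x x = anchor E x (X x) (p x) + p x x * elw_coeff (\<mu> x) (\<nu> x) X x"
      by (rule scaleR_right_imp_eq[OF gen_nonzero[OF rep(1) rep'(1)]])
    then show "\<phi> x [X x] = mod_form x [X x] + anchor E x (X x) (\<lambda>y. ln \<bar>p y y\<bar>)"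
      unfolding glue(2)[OF Sec_tangent[OF X]] mod_form(1)[OF X] modular_coeff_eq[OF X rep(1) rep'(1)]
      using p0[of x] by (simp add: field_simps)
  qed
qed

lemma L2_section_class:
  assumes s: "s \<in> Sec M L2" "\<And>x. s x \<noteq> 0" and w: "is_form M E 1 UNIV \<phi>"
    and rp: "\<And>X x. X \<in> Sec M E \<Longrightarrow> elw_rep2 M E X s x = (2 * \<phi> x [X x]) *\<^sub>R s x"
  shows "coh_class M E 1 \<phi> = coh_class M E 1 mod_form"
proof -
  have sU: "smooth_section M L2 UNIV s" using s(1) by simp
  let ?g = "\<lambda>x y. gen x y \<otimes>\<^sub>t gen x y"
  have gn: "?g x y \<noteq> 0" if "y \<in> U x" "y \<in> U' x" for x y
    by (intro tensor_nonzero gen_nonzero that)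
  have "\<exists>p. smooth_near M x p \<and> (\<forall>\<^sub>F y in nhds x. s y = p y *\<^sub>R ?g x y)" for x
  proof -
    obtain p where "smooth_near M x p" "\<forall>\<^sub>F y in nhds x. s y = p y *\<^sub>R ?g x y"
      by (rule line_section_coeff[OF L2_line_bundle open_UNIV sU UNIV_I gen2_line_gen])
    then show ?thesis by (intro exI[of _ p] conjI)
  qed
  then have "\<exists>p. \<forall>x. smooth_near M x (p x) \<and> (\<forall>\<^sub>F y in nhds x. s y = p x y *\<^sub>R ?g x y)"
    by (intro choice allI)
  then obtain p where p: "\<And>x. smooth_near M x (p x)" "\<And>x. \<forall>\<^sub>F y in nhds x. s y = p x y *\<^sub>R ?g x y"
    by blast
  have px: "s x = p x x *\<^sub>R ?g x x" for x using eventually_nhds_x_imp_x[OF p(2)] .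
  have p0: "p x x \<noteq> 0" for x using px[of x] s(2)[of x] by auto
  have eq: "\<forall>\<^sub>F y in nhds x. \<bar>p y y\<bar> = \<bar>p x y\<bar>" for x
    using local_rep_eventually[OF rep(2,1), of x] TM.local_rep_eventually[OF rep'(2,1), of x] p(2)[of x]
  proof eventually_elim
    case (elim y)
    obtain c where c: "gen y y = c *\<^sub>R gen x y" "\<bar>c\<bar> = 1" using gen_pm[OF elim(1,2)] .
    have "c * c = 1" using c(2) by (metis abs_mult_self_eq mult_1)
    then have "p x y *\<^sub>R ?g x y = p y y *\<^sub>R ?g x y"
      using px[of y] elim(3) unfolding c(1) tensor_scale by simp
    then have "p x y = p y y" by (rule scaleR_right_imp_eq[OF gn[OF elim(1,2)]])
    then show ?case by simp
  qed
  note glue = glue_ln_abs[of p, OF p(1) p0 eq]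
  \<comment> \<open>The action on \<open>L2\<close> determines twice the 1-form, hence half the
    logarithm.\<close>
  have sh: "smooth_fun M UNIV (\<lambda>y. 1 / 2 * ln \<bar>p y y\<bar>)"
    using glue(1) smooth_near_mult[OF smooth_near_const] unfolding smooth_fun_UNIV by blast
  show ?thesis
  proof (rule coh_class_1_eq[OF mod_form_closed w sh])
    fix x X assume X: "X \<in> Sec M E"
    have "(2 * \<phi> x [X x] * p x x) *\<^sub>R ?g x x =
        (anchor E x (X x) (p x) + 2 * p x x * elw_coeff (\<mu> x) (\<nu> x) X x) *\<^sub>R ?g x x"
      using elw_rep2_gen[OF rep_vol[OF rep(1)] rep_vol'[OF rep'(1)] X p(1,2), of x] rp[OF X, of x] px[of x] by simp
    then have "2 * \<phi> x [X x] * p x x = anchor E x (X x) (p x) + 2 * p x x * elw_coeff (\<mu> x) (\<nu> x) X x"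
      by (rule scaleR_right_imp_eq[OF gn[OF rep(1) rep'(1)]])
    moreover have hl: "anchor E x (X x) (\<lambda>y. 1 / 2 * ln \<bar>p y y\<bar>) = 1 / 2 * (anchor E x (X x) (p x) / p x x)"
      using tangent_scale[OF Sec_tangent[OF X], of x "\<lambda>y. ln \<bar>p y y\<bar>" "1 / 2"] glue(1)
        glue(2)[OF Sec_tangent[OF X], of x] unfolding smooth_fun_UNIV by simp
    ultimately show "\<phi> x [X x] = mod_form x [X x] + anchor E x (X x) (\<lambda>y. 1 / 2 * ln \<bar>p y y\<bar>)"
      unfolding mod_form(1)[OF X] modular_coeff_eq[OF X rep(1) rep'(1)] hl
      using p0[of x] by (simp add: field_simps)
  qed
qed

lemma divergence_class:
  assumes n: "vol_section M E n" and n': "vol_section M (tangent_algebroid M) n'" and w: "is_form M E 1 UNIV \<phi>"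
    and rp: "\<And>X x. X \<in> Sec M E \<Longrightarrow>
      divergence M (tangent_algebroid M) n' (anchor_sec X) x - divergence M E n X x = \<phi> x [X x]"
  shows "coh_class M E 1 \<phi> = coh_class M E 1 mod_form"
proof -
  obtain h where h: "smooth_fun M UNIV h"
    "\<And>X x. X \<in> Sec M E \<Longrightarrow> divergence M E n X x = divergence M E m X x + anchor E x (X x) h"
    using divergence_ratio[OF vol n] by blast
  obtain k where k: "smooth_fun M UNIV k"
    "\<And>X x. X \<in> Sec M (tangent_algebroid M) \<Longrightarrow> divergence M (tangent_algebroid M) n' X x =
      divergence M (tangent_algebroid M) m' X x + anchor (tangent_algebroid M) x (X x) k"
    using TM.divergence_ratio[OF vol' n'] by blast
  have sm: "smooth_near M x h" "smooth_near M x k" for x using h(1) k(1) smooth_fun_UNIV by blast+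
  have kh: "smooth_fun M UNIV (\<lambda>y. k y - h y)"
    using smooth_near_diff[OF sm(2,1)] smooth_fun_UNIV by blast
  show ?thesis
  proof (rule coh_class_1_eq[OF mod_form_closed w kh])
    fix x X assume X: "X \<in> Sec M E"
    have "anchor E x (X x) (\<lambda>y. k y - h y) = anchor E x (X x) k - anchor E x (X x) h"
      by (rule tangent_diff[OF Sec_tangent[OF X] sm(2,1)])
    then show "\<phi> x [X x] = mod_form x [X x] + anchor E x (X x) (\<lambda>y. k y - h y)"
      using rp[OF X, of x] h(2)[OF X, of x] k(2)[OF anchor_Sec[OF X], of x]
      by (simp add: mod_form(1)[OF X] modular_coeff_def)
  qed
qed

lemma modular_class_eq:
  "modular_class M E (tangent_algebroid M) (anchor E) = coh_class M E 1 mod_form"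
  unfolding modular_class_def
proof (rule the_equality)
  show "\<exists>\<delta>1\<in>Div0 M E. \<exists>\<delta>2\<in>Div0 M (tangent_algebroid M). \<exists>\<phi>. is_form M E 1 UNIV \<phi> \<and>
    (\<forall>X\<in>Sec M E. \<forall>x. \<delta>2 (\<lambda>y. anchor E y (X y)) x - \<delta>1 X x = \<phi> x [X x]) \<and>
    coh_class M E 1 mod_form = coh_class M E 1 \<phi>"
  proof (intro bexI exI conjI ballI allI)
    show "divergence M E m \<in> Div0 M E" "divergence M (tangent_algebroid M) m' \<in> Div0 M (tangent_algebroid M)"
      using vol vol' by (simp_all add: Div0_def)
    show "is_form M E 1 UNIV mod_form" by (rule mod_form(2))
    show "divergence M (tangent_algebroid M) m' (anchor_sec X) x - divergence M E m X x = mod_form x [X x]"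
      if "X \<in> Sec M E" for X x
      using mod_form(1)[OF that] by (simp add: modular_coeff_def)
  qed simp
  fix c
  assume "\<exists>\<delta>1\<in>Div0 M E. \<exists>\<delta>2\<in>Div0 M (tangent_algebroid M). \<exists>\<phi>. is_form M E 1 UNIV \<phi> \<and>
    (\<forall>X\<in>Sec M E. \<forall>x. \<delta>2 (\<lambda>y. anchor E y (X y)) x - \<delta>1 X x = \<phi> x [X x]) \<and> c = coh_class M E 1 \<phi>"
  then obtain n n' \<phi> where "vol_section M E n" "vol_section M (tangent_algebroid M) n'" "is_form M E 1 UNIV \<phi>"
    "\<forall>X\<in>Sec M E. \<forall>x. divergence M (tangent_algebroid M) n' (anchor_sec X) x - divergence M E n X x = \<phi> x [X x]"
    "c = coh_class M E 1 \<phi>" unfolding Div0_def by blast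
  then show "c = coh_class M E 1 mod_form" using divergence_class by simp
qed

lemma elw_class_eq: "elw_class M E = coh_class M E 1 mod_form"
  unfolding elw_class_def
proof (rule the_equality)
  \<comment> \<open>Existence goes through the square of the bundle, which always has a nowhere
    vanishing section. The bundle itself may have none, so its sections appear in the uniqueness
    part alone.\<close>
  obtain s where "s \<in> Sec M L2" "\<And>x. s x \<noteq> 0"
    "\<And>X x. X \<in> Sec M E \<Longrightarrow> elw_rep2 M E X s x = (2 * mod_form x [X x]) *\<^sub>R s x"
    using global_L2_section by blast
  then have "\<exists>s\<in>Sec M L2. (\<forall>x. s x \<noteq> 0) \<and>
      (\<forall>X\<in>Sec M E. \<forall>x. elw_rep2 M E X s x = (2 * mod_form x [X x]) *\<^sub>R s x)" by blast
  then show "\<exists>\<phi>. is_form M E 1 UNIV \<phi> \<and> coh_class M E 1 mod_form = coh_class M E 1 \<phi> \<and>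
     ((\<exists>s\<in>Sec M (elw_bundle M E). (\<forall>x. s x \<noteq> 0) \<and>
         (\<forall>X\<in>Sec M E. \<forall>x. elw_rep M E X s x = \<phi> x [X x] *\<^sub>R s x)) \<or>
      (\<exists>s\<in>Sec M L2. (\<forall>x. s x \<noteq> 0) \<and>
         (\<forall>X\<in>Sec M E. \<forall>x. elw_rep2 M E X s x = (2 * \<phi> x [X x]) *\<^sub>R s x)))"
    using mod_form(2) by (intro exI[of _ mod_form]) simp
  fix c
  assume "\<exists>\<phi>. is_form M E 1 UNIV \<phi> \<and> c = coh_class M E 1 \<phi> \<and>
     ((\<exists>s\<in>Sec M (elw_bundle M E). (\<forall>x. s x \<noteq> 0) \<and>
         (\<forall>X\<in>Sec M E. \<forall>x. elw_rep M E X s x = \<phi> x [X x] *\<^sub>R s x)) \<or>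
      (\<exists>s\<in>Sec M L2. (\<forall>x. s x \<noteq> 0) \<and>
         (\<forall>X\<in>Sec M E. \<forall>x. elw_rep2 M E X s x = (2 * \<phi> x [X x]) *\<^sub>R s x)))"
  then obtain \<phi> where w: "is_form M E 1 UNIV \<phi>" and c: "c = coh_class M E 1 \<phi>" and
    d: "(\<exists>s\<in>Sec M (elw_bundle M E). (\<forall>x. s x \<noteq> 0) \<and>
         (\<forall>X\<in>Sec M E. \<forall>x. elw_rep M E X s x = \<phi> x [X x] *\<^sub>R s x)) \<or>
      (\<exists>s\<in>Sec M L2. (\<forall>x. s x \<noteq> 0) \<and>
         (\<forall>X\<in>Sec M E. \<forall>x. elw_rep2 M E X s x = (2 * \<phi> x [X x]) *\<^sub>R s x))" by blast
  from d show "c = coh_class M E 1 mod_form"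
  proof (elim disjE bexE conjE)
    fix s assume "s \<in> Sec M (elw_bundle M E)" "\<forall>x. s x \<noteq> 0"
      "\<forall>X\<in>Sec M E. \<forall>x. elw_rep M E X s x = \<phi> x [X x] *\<^sub>R s x"
    then show ?thesis unfolding c by (intro L_section_class[OF _ _ w]) blast+
  next
    fix s assume "s \<in> Sec M L2" "\<forall>x. s x \<noteq> 0"
      "\<forall>X\<in>Sec M E. \<forall>x. elw_rep2 M E X s x = (2 * \<phi> x [X x]) *\<^sub>R s x"
    then show ?thesis unfolding c by (intro L2_section_class[OF _ _ w]) blast+
  qed
qed

end

theorem theorem4p4:
  fixes M :: "('m::{t2_space,second_countable_topology}, 'b::euclidean_space) manifold"
    and E :: "('m, 'v::real_vector) algebroid"
  assumes "smooth_manifold M"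
    and "lie_algebroid M E"
  shows "modular_class M E (tangent_algebroid M) (anchor E) \<in> cohomology M E 1 \<and>
    elw_class M E \<in> cohomology M E 1 \<and>
    modular_class M E (tangent_algebroid M) (anchor E) = elw_class M E"
proof -
  interpret algd M E using assms by unfold_locales
  obtain m where m: "vol_section M E m" using vol_section_exists .
  obtain m' where m': "vol_section M (tangent_algebroid M) m'" using TM.vol_section_exists .
  obtain U \<mu> where r: "\<And>x. x \<in> U x" "\<And>x. local_rep M E m (U x) (\<mu> x)"
    using m unfolding vol_section_def by metis
  obtain U' \<nu> where r': "\<And>x. x \<in> U' x" "\<And>x. local_rep M (tangent_algebroid M) m' (U' x) (\<nu> x)"
    using m' unfolding vol_section_def by metis
  interpret elw_volumes M E m m' U \<mu> U' \<nu>
    using m m' r r' by unfold_locales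
  show ?thesis
    unfolding modular_class_eq elw_class_eq using coh_class_in_cohomology[OF mod_form_closed] by simp
qed

end
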